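(* Let $d\ge2$ and let $\rho$ be an admissible single-site measure on $\mathbb R$. The set $$\Xi=\{\beta\ge0:\Psi^0_\beta\ne\Psi^1_\beta\}$$ is at most countable, where $\Psi^0_\beta$ and $\Psi^1_\beta$ are the free and wired infinite-volume random cluster measures on $\mathbb Z^d$ at inverse temperature $\beta$.
   Context: Notation: $\mathbb R^+=[0,\infty)$. For $x,y\in\mathbb Z^d$, $x\sim y$ means $\|x-y\|_1=1$. For $\Lambda\subset\mathbb Z^d$: $\partial^{\mathrm{ext}}\Lambda=\{y\notin\Lambda:\exists x\in\Lambda,\ x\sim y\}$, $\overline\Lambda=\Lambda\cup\partial^{\mathrm{ext}}\Lambda$, $E(\Lambda)=\{xy:x,y\in\Lambda,\ x\sim y\}$, $\overline E(\Lambda)=\{xy:x\in\Lambda,\ y\in\mathbb Z^d,\ x\sim y\}$. Admissible measure: a Borel measure $\rho$ on $\mathbb R$ with (i) $\rho(A)=\rho(-A)$ for all Borel $A$; (ii) $\int e^{au^2}d\rho(u)<\infty$ for every $a>0$; (iii) $\rho(\mathbb R\setminus\{0\})>0$. In the densities below for nonnegative fields $\mathsf a$, $d\rho(\mathsf a_x)$ denotes $\rho$ restricted to $\mathbb R^+$. Plus measure: for finite $\Lambda$, $\nu^\eta_{\Lambda,\beta}$ is the probability measure on $\mathbb R^{\overline\Lambda}$ proportional to $\exp(\beta\sum_{xy\in\overline E(\Lambda)}\tau_x\tau_y)\prod_{x\in\Lambda}d\rho(\tau_x)\prod_{x\in\partial^{\mathrm{ext}}\Lambda}\delta_{\eta_x}(d\tau_x)$.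 A regular Gibbs measure at $\beta$ is a probability measure on $\mathbb R^{\mathbb Z^d}$ satisfying the DLR equations for the kernels $\nu^\eta_{\Lambda,\beta}$ and whose marginal on each finite $\Lambda$ has density with respect to $\prod_{x\in\Lambda}d\rho(\tau_x)$ bounded by $\prod_{x\in\Lambda}e^{a\tau_x^2+b}$ for some constants $a>0,b\in\mathbb R$ independent of $\Lambda$. $\nu^+_\beta$ is the regular Gibbs measure stochastically dominating all others (it exists). The measure $\zeta$: for every $\beta_0\ge0$ it is known that there is a measure $\zeta=\zeta(\rho,\beta_0)$ supported on $\mathbb R^+$ with $\int e^{At^2}d\zeta(t)<\infty$ for all $A>0$ such that, for all $\beta\le\beta_0$, the probability measures $\nu^\zeta_{\Lambda,\beta}$ on $\mathbb R^{\overline\Lambda}$ proportional to $\exp(\beta\sum_{xy\in\overline E(\Lambda)}\tau_x\tau_y)\prod_{x\in\Lambda}d\rho(\tau_x)\prod_{x\in\partial^{\mathrm{ext}}\Lambda}d\zeta(\tau_x)$ converge weakly to $\nu^+_\beta$ as $\Lambda\nearrow\mathbb Z^d$, and such that for some $a,b>0$ the marginal of $\nu^\zeta_{\Lambda,\beta}$ on any $\Delta\subset\overline\Lambda$ has density with respect to $\prod_{x\in\Delta\cap\Lambda}d\rho\prod_{x\in\Delta\cap\partial^{\mathrm{ext}}\Lambda}d\zeta$ at most $\prod_{x\in\Delta}e^{a\tau_x^2+b}$. When $\beta$ is considered, $\zeta$ is taken with some $\beta_0\ge\beta$. Random cluster measures: for $\mathsf a\in(\mathbb R^+)^{\overline\Lambda}$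 let $p_{xy}=1-e^{-2\beta\mathsf a_x\mathsf a_y}$. The free measure $\Psi^0_{\Lambda,\beta}$ is the probability measure on $(\omega,\mathsf a)\in\{0,1\}^{\overline E(\Lambda)}\times(\mathbb R^+)^{\overline\Lambda}$ proportional to $\prod_{xy\in\overline E(\Lambda)}\sqrt{1-p_{xy}}\big(\frac{p_{xy}}{1-p_{xy}}\big)^{\omega_{xy}}2^{k(\omega,\mathsf a)}\prod_{x\in\Lambda}d\rho(\mathsf a_x)\prod_{x\in\partial^{\mathrm{ext}}\Lambda}\delta_0(d\mathsf a_x)$ ($0^0=1$), where $k(\omega,\mathsf a)$ is the number of connected components of the graph with vertices $\{x\in\overline\Lambda:\mathsf a_x\neq0\}$ and edges $\{xy:\omega_{xy}=1\}$. The wired measure $\Psi^1_{\Lambda,\beta}$ is defined by the same formula with $\delta_0(d\mathsf a_x)$ replaced by $d\zeta(\mathsf a_x)$ and $k$ replaced by the number $k^w$ of components after identifying all vertices of $\partial^{\mathrm{ext}}\Lambda$. $\Psi^0_\beta$ and $\Psi^1_\beta$ are the limits on local events, as $\Lambda\nearrow\mathbb Z^d$, of $\Psi^0_{\Lambda,\beta}$ and $\Psi^1_{\Lambda,\beta}$ (these limits exist); they are probability measures on $\{0,1\}^{E(\mathbb Z^d)}\times(\mathbb R^+)^{\mathbb Z^d}$. *)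

theory Defs
  imports "HOL-Probability.Probability"
begin

section \<open>The lattice\<close>

type_synonym 'd site = "int ^ 'd"
type_synonym 'd edge = "'d site set"

definition adjacent :: "'d::finite site \<Rightarrow> 'd site \<Rightarrow> bool" where
  "adjacent x y \<longleftrightarrow> (\<Sum>i\<in>UNIV. \<bar>x $ i - y $ i\<bar>) = 1"

definition ext_boundary :: "'d::finite site set \<Rightarrow> 'd site set" where
  "ext_boundary \<Lambda> = {y. y \<notin> \<Lambda> \<and> (\<exists>x\<in>\<Lambda>. adjacent x y)}"

definition site_closure :: "'d::finite site set \<Rightarrow> 'd site set" where
  "site_closure \<Lambda> = \<Lambda> \<union> ext_boundary \<Lambda>"

definition inner_edges :: "'d::finite site set \<Rightarrow> 'd edge set" where
  "inner_edges \<Lambda> = {{x, y} | x y. x \<in> \<Lambda> \<and> y \<in> \<Lambda> \<and> adjacent x y}"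

definition touching_edges :: "'d::finite site set \<Rightarrow> 'd edge set" where
  "touching_edges \<Lambda> = {{x, y} | x y. x \<in> \<Lambda> \<and> adjacent x y}"


section \<open>Single-site measures and spin measures\<close>

definition admissible :: "real measure \<Rightarrow> bool" where
  "admissible \<rho> \<longleftrightarrow>
     sets \<rho> = sets borel \<and>
     (\<forall>A\<in>sets borel. emeasure \<rho> A = emeasure \<rho> (uminus ` A)) \<and>
     (\<forall>a>0. (\<integral>\<^sup>+u. ennreal (exp (a * u\<^sup>2)) \<partial>\<rho>) < \<infinity>) \<and>
     emeasure \<rho> (UNIV - {0}) > 0"

definition normalized_measure :: "'a measure \<Rightarrow> 'a measure" where
  "normalized_measure M = scale_measure (1 / emeasure M (space M)) M"

abbreviation spin_algebra :: "'d::finite site set \<Rightarrow> ('d site \<Rightarrow> real) measure" where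
  "spin_algebra \<Delta> \<equiv> PiM \<Delta> (\<lambda>_. borel)"

definition boundary_reference ::
    "real measure \<Rightarrow> ('d::finite site \<Rightarrow> real measure) \<Rightarrow> 'd site set \<Rightarrow> 'd site \<Rightarrow> real measure" where
  "boundary_reference \<rho> \<kappa> \<Lambda> x = (if x \<in> \<Lambda> then \<rho> else \<kappa> x)"

text \<open>The finite-volume measure with independent a priori laws \<open>\<kappa> x\<close> at the boundary sites.
  Both kinds of boundary condition are instances: Dirac masses at \<open>\<eta> x\<close> give
  \<open>\<nu>\<^sup>\<eta>\<close>, and the constant family \<open>\<zeta>\<close> gives \<open>\<nu>\<^sup>\<zeta>\<close>. An edge is a two-element set, so the
  product over its endpoints is \<open>\<tau> x * \<tau> y\<close>.\<close>

definition spin_measure ::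
    "real measure \<Rightarrow> real \<Rightarrow> ('d::finite site \<Rightarrow> real measure) \<Rightarrow> 'd site set
      \<Rightarrow> ('d site \<Rightarrow> real) measure" where
  "spin_measure \<rho> \<beta> \<kappa> \<Lambda> =
     normalized_measure
       (density (PiM (site_closure \<Lambda>) (boundary_reference \<rho> \<kappa> \<Lambda>))
         (\<lambda>\<tau>. ennreal (exp (\<beta> * (\<Sum>e\<in>touching_edges \<Lambda>. \<Prod>x\<in>e. \<tau> x)))))"

text \<open>The same measure for \<open>\<eta>\<close>, extended by \<open>\<eta>\<close> to a measure on all configurations.\<close>

definition gibbs_kernel ::
    "real measure \<Rightarrow> real \<Rightarrow> 'd::finite site set \<Rightarrow> ('d site \<Rightarrow> real) \<Rightarrow> ('d site \<Rightarrow> real) measure" where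
  "gibbs_kernel \<rho> \<beta> \<Lambda> \<eta> =
     distr (spin_measure \<rho> \<beta> (\<lambda>x. return borel (\<eta> x)) \<Lambda>) (spin_algebra UNIV)
       (\<lambda>\<tau>. override_on \<eta> \<tau> (site_closure \<Lambda>))"

definition density_bounded_by :: "'a measure \<Rightarrow> 'a measure \<Rightarrow> ('a \<Rightarrow> real) \<Rightarrow> bool" where
  "density_bounded_by M N h \<longleftrightarrow>
     (\<exists>g\<in>borel_measurable N. (\<forall>x\<in>space N. g x \<le> ennreal (h x)) \<and> M = density N g)"

definition spin_marginal ::
    "'d::finite site set \<Rightarrow> ('d site \<Rightarrow> real) measure \<Rightarrow> ('d site \<Rightarrow> real) measure" where
  "spin_marginal \<Delta> \<nu> = distr \<nu> (spin_algebra \<Delta>) (\<lambda>\<tau>. restrict \<tau> \<Delta>)"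

definition regular_gibbs :: "real measure \<Rightarrow> real \<Rightarrow> ('d::finite site \<Rightarrow> real) measure \<Rightarrow> bool" where
  "regular_gibbs \<rho> \<beta> \<nu> \<longleftrightarrow>
     prob_space \<nu> \<and> sets \<nu> = sets (spin_algebra UNIV) \<and>
     (\<forall>\<Lambda>. finite \<Lambda> \<longrightarrow>
       (\<forall>A\<in>sets (spin_algebra UNIV).
          emeasure \<nu> A = (\<integral>\<^sup>+\<eta>. emeasure (gibbs_kernel \<rho> \<beta> \<Lambda> \<eta>) A \<partial>\<nu>))) \<and>
     (\<exists>a>0. \<exists>b. \<forall>\<Lambda>. finite \<Lambda> \<longrightarrow>
       density_bounded_by (spin_marginal \<Lambda> \<nu>) (PiM \<Lambda> (\<lambda>_. \<rho>))
         (\<lambda>\<tau>. \<Prod>x\<in>\<Lambda>. exp (a * (\<tau> x)\<^sup>2 + b)))"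

definition stochastically_dominates ::
    "('d::finite site \<Rightarrow> real) measure \<Rightarrow> ('d site \<Rightarrow> real) measure \<Rightarrow> bool" where
  "stochastically_dominates \<nu> \<nu>' \<longleftrightarrow>
     (\<forall>f\<in>borel_measurable (spin_algebra UNIV).
        mono f \<and> bounded (range f) \<longrightarrow> (\<integral>\<tau>. f \<tau> \<partial>\<nu>') \<le> (\<integral>\<tau>. (f \<tau> :: real) \<partial>\<nu>))"

definition plus_measure :: "real measure \<Rightarrow> real \<Rightarrow> ('d::finite site \<Rightarrow> real) measure \<Rightarrow> bool" where
  "plus_measure \<rho> \<beta> \<nu> \<longleftrightarrow>
     regular_gibbs \<rho> \<beta> \<nu> \<and> (\<forall>\<nu>'. regular_gibbs \<rho> \<beta> \<nu>' \<longrightarrow> stochastically_dominates \<nu> \<nu>')"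

text \<open>Weak convergence as \<open>\<Lambda>\<close> exhausts the lattice, tested on bounded continuous functions of
  finitely many coordinates. Such a function can be integrated against a measure on the
  configurations on \<open>site_closure \<Lambda>\<close> as soon as this set contains \<open>\<Delta>\<close>. The filter
  \<open>finite_subsets_at_top UNIV\<close> is the directed set of finite volumes; convergence along it is
  convergence along every increasing exhausting sequence.\<close>

definition converges_weakly ::
    "('d::finite site set \<Rightarrow> ('d site \<Rightarrow> real) measure) \<Rightarrow> ('d site \<Rightarrow> real) measure \<Rightarrow> bool" where
  "converges_weakly \<mu> \<nu> \<longleftrightarrow>
     (\<forall>\<Delta> f. finite \<Delta> \<and> continuous_on UNIV f \<and> bounded (range f) \<and>
        (\<forall>\<tau> \<tau>'. (\<forall>x\<in>\<Delta>. \<tau> x = \<tau>' x) \<longrightarrow> f \<tau> = f \<tau>') \<longrightarrow>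
        ((\<lambda>\<Lambda>. \<integral>\<tau>. f \<tau> \<partial>\<mu> \<Lambda>) \<longlongrightarrow> (\<integral>\<tau>. (f \<tau> :: real) \<partial>\<nu>)) (finite_subsets_at_top UNIV))"

text \<open>The defining properties of the wired boundary law \<open>\<zeta>(\<rho>, \<beta>\<^sub>0)\<close>. The dimension enters
  through the type argument only.\<close>

definition wired_boundary_law :: "'d::finite itself \<Rightarrow> real measure \<Rightarrow> real \<Rightarrow> real measure \<Rightarrow> bool" where
  "wired_boundary_law _ \<rho> \<beta>\<^sub>0 \<zeta> \<longleftrightarrow>
     sets \<zeta> = sets borel \<and> emeasure \<zeta> {..<0} = 0 \<and>
     (\<forall>A>0. (\<integral>\<^sup>+t. ennreal (exp (A * t\<^sup>2)) \<partial>\<zeta>) < \<infinity>) \<and>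
     (\<forall>\<beta>. 0 \<le> \<beta> \<and> \<beta> \<le> \<beta>\<^sub>0 \<longrightarrow>
        (\<exists>\<nu> :: ('d site \<Rightarrow> real) measure.
           plus_measure \<rho> \<beta> \<nu> \<and> converges_weakly (spin_measure \<rho> \<beta> (\<lambda>_. \<zeta>)) \<nu>) \<and>
        (\<exists>a>0. \<exists>b>0. \<forall>\<Lambda> :: 'd site set. finite \<Lambda> \<longrightarrow> (\<forall>\<Delta> \<subseteq> site_closure \<Lambda>.
           density_bounded_by (spin_marginal \<Delta> (spin_measure \<rho> \<beta> (\<lambda>_. \<zeta>) \<Lambda>))
             (PiM \<Delta> (boundary_reference \<rho> (\<lambda>_. \<zeta>) \<Lambda>))
             (\<lambda>\<tau>. \<Prod>x\<in>\<Delta>. exp (a * (\<tau> x)\<^sup>2 + b)))))"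


section \<open>Random cluster measures\<close>

type_synonym 'd rc_config = "('d edge \<Rightarrow> bool) \<times> ('d site \<Rightarrow> real)"

definition nonneg_part :: "real measure \<Rightarrow> real measure" where
  "nonneg_part \<mu> = restrict_space \<mu> {0..}"

abbreviation rc_algebra :: "'d::finite edge set \<Rightarrow> 'd site set \<Rightarrow> 'd rc_config measure" where
  "rc_algebra F \<Delta> \<equiv> PiM F (\<lambda>_. count_space UNIV) \<Otimes>\<^sub>M PiM \<Delta> (\<lambda>_. nonneg_part borel)"

definition num_components :: "'v set \<Rightarrow> 'v rel \<Rightarrow> nat" where
  "num_components V R = card (V // ((R \<inter> V \<times> V)\<^sup>* \<inter> V \<times> V))"

definition nonzero_sites :: "'d::finite site set \<Rightarrow> ('d site \<Rightarrow> real) \<Rightarrow> 'd site set" where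
  "nonzero_sites \<Lambda> a = {x \<in> site_closure \<Lambda>. a x \<noteq> 0}"

definition open_relation :: "'d::finite site set \<Rightarrow> ('d edge \<Rightarrow> bool) \<Rightarrow> 'd site rel" where
  "open_relation \<Lambda> \<omega> = {(x, y). {x, y} \<in> touching_edges \<Lambda> \<and> \<omega> {x, y}}"

definition free_clusters :: "'d::finite site set \<Rightarrow> 'd rc_config \<Rightarrow> nat" where
  "free_clusters \<Lambda> = (\<lambda>(\<omega>, a). num_components (nonzero_sites \<Lambda> a) (open_relation \<Lambda> \<omega>))"

text \<open>Identifying all boundary vertices amounts to joining them pairwise. Boundary sites where the
  field vanishes are not vertices of the graph, so they do not contribute.\<close>

definition wired_clusters :: "'d::finite site set \<Rightarrow> 'd rc_config \<Rightarrow> nat" where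
  "wired_clusters \<Lambda> = (\<lambda>(\<omega>, a). num_components (nonzero_sites \<Lambda> a)
     (open_relation \<Lambda> \<omega> \<union> ext_boundary \<Lambda> \<times> ext_boundary \<Lambda>))"

definition edge_probability :: "real \<Rightarrow> ('d::finite site \<Rightarrow> real) \<Rightarrow> 'd edge \<Rightarrow> real" where
  "edge_probability \<beta> a e = 1 - exp (- 2 * \<beta> * (\<Prod>x\<in>e. a x))"

definition rc_weight ::
    "real \<Rightarrow> ('d::finite rc_config \<Rightarrow> nat) \<Rightarrow> 'd site set \<Rightarrow> 'd rc_config \<Rightarrow> real" where
  "rc_weight \<beta> k \<Lambda> = (\<lambda>(\<omega>, a).
     (\<Prod>e\<in>touching_edges \<Lambda>.
        sqrt (1 - edge_probability \<beta> a e) *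
        (edge_probability \<beta> a e / (1 - edge_probability \<beta> a e)) ^ (if \<omega> e then 1 else 0)) *
     2 ^ k (\<omega>, a))"

text \<open>The counting measure on edge configurations (finitely many edges) is the product of the counting
  measures on \<open>bool\<close>. The parameter \<open>\<kappa>\<close> is a measure on the real line, restricted to
  \<open>[0,\<infinity>)\<close> like \<open>\<rho>\<close>.\<close>

definition rc_measure ::
    "real measure \<Rightarrow> real \<Rightarrow> real measure \<Rightarrow> ('d::finite rc_config \<Rightarrow> nat) \<Rightarrow> 'd site set
      \<Rightarrow> 'd rc_config measure" where
  "rc_measure \<rho> \<beta> \<kappa> k \<Lambda> =
     normalized_measure
       (density
         (PiM (touching_edges \<Lambda>) (\<lambda>_. count_space UNIV) \<Otimes>\<^sub>M
          PiM (site_closure \<Lambda>) (\<lambda>x. nonneg_part (boundary_reference \<rho> (\<lambda>_. \<kappa>) \<Lambda> x)))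
         (\<lambda>c. ennreal (rc_weight \<beta> k \<Lambda> c)))"

definition free_rc :: "real measure \<Rightarrow> real \<Rightarrow> 'd::finite site set \<Rightarrow> 'd rc_config measure" where
  "free_rc \<rho> \<beta> \<Lambda> = rc_measure \<rho> \<beta> (return borel 0) (free_clusters \<Lambda>) \<Lambda>"

definition wired_rc ::
    "real measure \<Rightarrow> real \<Rightarrow> real measure \<Rightarrow> 'd::finite site set \<Rightarrow> 'd rc_config measure" where
  "wired_rc \<rho> \<beta> \<zeta> \<Lambda> = rc_measure \<rho> \<beta> \<zeta> (wired_clusters \<Lambda>) \<Lambda>"

definition rc_marginal ::
    "'d::finite edge set \<Rightarrow> 'd site set \<Rightarrow> 'd rc_config measure \<Rightarrow> 'd rc_config measure" where
  "rc_marginal F \<Delta> \<Psi> = distr \<Psi> (rc_algebra F \<Delta>) (\<lambda>(\<omega>, a). (restrict \<omega> F, restrict a \<Delta>))"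

text \<open>Convergence of the probabilities of all local events, that is, of all measurable events
  depending on finitely many edges \<open>F\<close> and sites \<open>\<Delta>\<close>. Only volumes \<open>\<Lambda>\<close> that are large enough to
  contain \<open>F\<close> and \<open>\<Delta>\<close> matter. The limit is unique, since local events generate
  the product algebra.\<close>

definition is_local_limit ::
    "('d::finite site set \<Rightarrow> 'd rc_config measure) \<Rightarrow> 'd rc_config measure \<Rightarrow> bool" where
  "is_local_limit \<mu> \<Psi> \<longleftrightarrow>
     prob_space \<Psi> \<and> sets \<Psi> = sets (rc_algebra (inner_edges UNIV) UNIV) \<and>
     (\<forall>F \<Delta> A. finite F \<and> F \<subseteq> inner_edges UNIV \<and> finite \<Delta> \<and> A \<in> sets (rc_algebra F \<Delta>) \<longrightarrow>
        ((\<lambda>\<Lambda>. measure (rc_marginal F \<Delta> (\<mu> \<Lambda>)) A) \<longlongrightarrow> measure (rc_marginal F \<Delta> \<Psi>) A)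
          (finite_subsets_at_top UNIV))"

definition free_rc_limit :: "real measure \<Rightarrow> real \<Rightarrow> 'd::finite rc_config measure \<Rightarrow> bool" where
  "free_rc_limit \<rho> \<beta> \<Psi> \<longleftrightarrow> is_local_limit (free_rc \<rho> \<beta>) \<Psi>"

definition wired_rc_limit :: "real measure \<Rightarrow> real \<Rightarrow> 'd::finite rc_config measure \<Rightarrow> bool" where
  "wired_rc_limit \<rho> \<beta> \<Psi> \<longleftrightarrow>
     (\<exists>\<beta>\<^sub>0 \<zeta>. \<beta> \<le> \<beta>\<^sub>0 \<and> wired_boundary_law TYPE('d) \<rho> \<beta>\<^sub>0 \<zeta> \<and>
        is_local_limit (wired_rc \<rho> \<beta> \<zeta>) \<Psi>)"

end

theory Submission imports Defs begin

text \<open>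
The idea: the energy per site of the free measure is monotone in the inverse temperature, hence
continuous off a countable set, and at a continuity point it forces the two limits to coincide.

\<^emph>\<open>From clusters to spins.\<close> Given the field \<open>a\<close> of spin sizes, the Edwards-Sokal identity turns
the probability that all edges of \<open>F\<close> are open into the product of the edge probabilities times an
Ising correlation with couplings proportional to \<open>a x * a y\<close> (\<open>wired_event\<close>, \<open>free_event\<close>).
The field itself has a product reference law weighted by the Ising partition function. This weight is
log-supermodular (GKS), so the four functions theorem gives stochastic monotonicity in the
temperature, the volume and the boundary condition (\<open>free_mono\<close>, \<open>free_le_plus\<close>).

\<^emph>\<open>Energy.\<close> The logarithm of the partition function is convex in the temperature, with the sum of the
edge energies as slope (\<open>partition_convex\<close>). Free and wired partition functions differ by a factor
exponential in the size of the boundary, by the regularity that the wired boundary law provides.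
Thus the wired energy at \<open>\<beta>\<close> is at most the free energy at any larger \<open>\<beta>'\<close>, up to a boundary term
(\<open>energy_inequality\<close>). In cubes the boundary is negligible. If the free energy density is continuous
at \<open>\<beta>\<close>, averaging over translates produces volumes exhausting the lattice along which the wired and
free energies of every fixed edge become equal (\<open>good_volumes\<close>).

\<^emph>\<open>From energies to laws.\<close> All further comparisons use one device (\<open>vanishing_dominated\<close>): if \<open>f\<close> and
\<open>g - f\<close> are both increasing and the wired and free expectations of \<open>g\<close> agree in the limit, then so
do those of \<open>f\<close>. Starting with the energy it yields, in turn, the excess of \<open>a x\<close> over a threshold
(\<open>gap_excess\<close>), the law of each \<open>a x\<close>, the joint law of the field, the correlations of all products of
spins on edges where the field is bounded below (\<open>strong_corr_step\<close>, by Lebowitz' inequality), and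
finally the probabilities of a generating family of random cluster events
(\<open>event_probabilities_agree\<close>). Edges with small field products are almost never open.
\<close>

abbreviation bm where "bm M \<equiv> borel_measurable M"
abbreviation IE where "IE \<Lambda> \<equiv> inner_edges \<Lambda>"
abbreviation TE where "TE \<Lambda> \<equiv> touching_edges \<Lambda>"
abbreviation EB where "EB \<Lambda> \<equiv> ext_boundary \<Lambda>"
abbreviation SC where "SC \<Lambda> \<equiv> site_closure \<Lambda>"
abbreviation evs (binder "EVS " 10) where "evs P \<equiv> eventually P sequentially"
abbreviation limseq (infix "~~>" 60) where "X ~~> c \<equiv> X \<longlonglongrightarrow> c"

section \<open>Correlation inequalities for the Ising model\<close>

text \<open>A spin configuration is encoded by the set of its minus sites.\<close>
definition spin_of :: "'v set => 'v => real" where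
  "spin_of A x = (if x : A then -1 else 1)"

definition spins :: "'v set => 'v set => real" where
  "spins B A = (\<Prod>x\<in>B. spin_of A x)"

text \<open>The unnormalized expectation of \<open>f\<close>, with one coupling per edge; an edge is any finite set of sites.\<close>
definition ising_sum :: "'v set => 'v set set => ('v set => real) => ('v set => real) => real" where
  "ising_sum U E K f = (\<Sum>A\<in>Pow U. f A * exp (\<Sum>e\<in>E. K e * spins e A))"

definition ising_Z :: "'v set => 'v set set => ('v set => real) => real" where
  "ising_Z U E K = ising_sum U E K (%_. 1)"

definition ising_corr :: "'v set => 'v set set => ('v set => real) => ('v set => real) => real" where
  "ising_corr U E K f = ising_sum U E K f / ising_Z U E K"

lemma spin_of_sym_diff: "spin_of (sym_diff A D) x = spin_of A x * spin_of D x"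
  by (auto simp: spin_of_def)

lemma spins_sym_diff: "spins B (sym_diff A D) = spins B A * spins B D"
  unfolding spins_def spin_of_sym_diff by (rule prod.distrib)

lemma spin_of_sq: "spin_of A x * spin_of A x = 1"
  by (auto simp: spin_of_def)

lemma spins_sq: "spins B A * spins B A = 1"
  unfolding spins_def prod.distrib[symmetric] by (simp add: spin_of_sq)

lemma spins_cases: "spins B A = 1 \<or> spins B A = -1"
  using spins_sq[of B A] by (simp add: square_eq_1_iff)

lemma spins_mult:
  assumes "finite B" "finite C"
  shows "spins B A * spins C A = spins (sym_diff B C) A"
proof -
  have B: "spins B A = spins (B - C) A * spins (B Int C) A"
	unfolding spins_def using assms
	by (subst prod.union_disjoint[symmetric]) (auto intro!: prod.cong)
  have C: "spins C A = spins (C - B) A * spins (B Int C) A"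
	unfolding spins_def using assms
	by (subst prod.union_disjoint[symmetric]) (auto intro!: prod.cong)
  have "spins B A * spins C A
	= spins (B - C) A * spins (C - B) A * (spins (B Int C) A * spins (B Int C) A)"
	unfolding B C by simp
  also have "... = spins (B - C) A * spins (C - B) A" by (simp add: spins_sq)
  also have "... = spins (sym_diff B C) A"
	unfolding spins_def using assms by (subst prod.union_disjoint[symmetric]) auto
  finally show ?thesis .
qed

lemma spins_empty[simp]: "spins {} A = 1" by (simp add: spins_def)

inductive_set pos_cone :: "('v set => real) set" where
  mono: "0 <= c ==> finite B ==> (%A. c * spins B A) : pos_cone"
| add: "f : pos_cone ==> g : pos_cone ==> (%A. f A + g A) : pos_cone"

lemma pos_cone_const: "0 <= c ==> (%_. c) : pos_cone"
  using pos_cone.mono[of c "{}"] by simp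

lemma pos_cone_spins: "finite B ==> spins B : pos_cone"
  using pos_cone.mono[of 1 B] by (simp add: eta_contract_eq)

lemma pos_cone_mult:
  assumes "f : pos_cone" "g : pos_cone"
  shows "(%A. f A * g A) : pos_cone"
  using assms(1)
proof induction
  case (mono c B)
  from assms(2) show ?case
  proof induction
	case (mono d C)
	have "(%A. (c * d) * spins (sym_diff B C) A) : pos_cone"
	  using mono \<open>0 <= c\<close> \<open>finite B\<close> by (intro pos_cone.mono) auto
	moreover have "(%A. c * spins B A * (d * spins C A)) = (%A. (c * d) * spins (sym_diff B C) A)"
	  unfolding spins_mult[OF \<open>finite B\<close> \<open>finite C\<close>, symmetric] by (simp only: mult_ac)
	ultimately show ?case by (simp only:)
  next
	case (add f g)
	then show ?case by (simp add: distrib_left pos_cone.add)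
  qed
next
  case (add f g)
  then show ?case by (simp add: distrib_right pos_cone.add)
qed

lemma pos_cone_exp:
  assumes "finite E" "!!e. e : E ==> 0 <= K e & finite e"
  shows "(%A. exp (\<Sum>e\<in>E. K e * spins e A)) : pos_cone"
  using assms
proof (induction E rule: finite_induct)
  case empty
  then show ?case by (simp add: pos_cone_const)
next
  case (insert e E)
  have eq: "exp (K e * spins e A) = cosh (K e) + sinh (K e) * spins e A" for A
	using spins_cases[of e A] by (auto simp: cosh_plus_sinh cosh_minus_sinh)
  have "(%A. cosh (K e) + sinh (K e) * spins e A) : pos_cone"
	using insert.prems[of e] by (intro pos_cone.add pos_cone_const pos_cone.mono) (auto simp: cosh_real_nonneg)
  from pos_cone_mult[OF this insert.IH] insert show ?case
	by (simp add: exp_add eq)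
qed

lemma sum_spins_nonneg:
  assumes "finite U" "finite B"
  shows "0 <= (\<Sum>A\<in>Pow U. spins B A)"
proof (cases "B Int U = {}")
  case True
  have "spins B A = 1" if "A : Pow U" for A
	unfolding spins_def using that True by (intro prod.neutral) (auto simp: spin_of_def)
  then show ?thesis by (simp add: sum_nonneg)
next
  case False
  then obtain x where x: "x : B" "x : U" by auto
  have "(\<Sum>A\<in>Pow U. spins B A) = (\<Sum>A\<in>Pow U. spins B (sym_diff A {x}))"
	by (rule sum.reindex_bij_witness[where i = "%A. sym_diff A {x}" and j = "%A. sym_diff A {x}"])
	  (use x in \<open>auto simp: spins_sym_diff spins_sq\<close>)
  also have "... = (\<Sum>A\<in>Pow U. spins B A) * spins B {x}"
	by (simp only: spins_sym_diff sum_distrib_right)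
  also have "spins B {x} = -1"
	unfolding spins_def using x assms(2) by (subst prod.remove[of _ x]) (auto simp: spin_of_def)
  finally show ?thesis by simp
qed

text \<open>A spin product that is not constant has mean zero, so elements of the cone have nonnegative sums. All correlation inequalities below reduce to this fact.\<close>
lemma sum_pos_cone_nonneg:
  assumes "finite U" "f : pos_cone"
  shows "0 <= (\<Sum>A\<in>Pow U. f A)"
  using assms(2)
proof induction
  case (mono c B)
  then show ?case
	using sum_spins_nonneg[OF assms(1), of B] by (simp add: sum_distrib_left[symmetric])
next
  case (add f g)
  then show ?case by (simp add: sum.distrib)
qed

lemma ising_sum_nonneg:
  assumes "finite U" "finite E" "!!e. e : E ==> 0 <= K e & finite e" "f : pos_cone"
  shows "0 <= ising_sum U E K f"
  unfolding ising_sum_def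
  by (intro sum_pos_cone_nonneg pos_cone_mult pos_cone_exp assms)

text \<open>Duplicated variables: the second configuration is expressed as the symmetric difference of the first one with a third, which makes products of sums sums over the cone.\<close>
lemma ising_sum_product:
  assumes "finite U"
  shows "ising_sum U E K' f * ising_sum U E K g =
	(\<Sum>D\<in>Pow U. ising_sum U E (%e. K' e + K e * spins e D) (%A. f A * g (sym_diff A D)))"
proof -
  have "ising_sum U E K' f * ising_sum U E K g = (\<Sum>A\<in>Pow U. \<Sum>B\<in>Pow U.
	 f A * g B * exp ((\<Sum>e\<in>E. K' e * spins e A) + (\<Sum>e\<in>E. K e * spins e B)))"
	unfolding ising_sum_def sum_product by (simp add: exp_add mult_ac)
  also have "... = (\<Sum>A\<in>Pow U. \<Sum>D\<in>Pow U. f A * g (sym_diff A D) *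
	 exp (\<Sum>e\<in>E. (K' e + K e * spins e D) * spins e A))"
  proof (rule sum.cong[OF refl])
	fix A assume A: "A : Pow U"
	show "(\<Sum>B\<in>Pow U. f A * g B * exp ((\<Sum>e\<in>E. K' e * spins e A) + (\<Sum>e\<in>E. K e * spins e B)))
	  = (\<Sum>D\<in>Pow U. f A * g (sym_diff A D) * exp (\<Sum>e\<in>E. (K' e + K e * spins e D) * spins e A))"
	proof (rule sum.reindex_bij_witness[where i = "%D. sym_diff A D" and j = "%D. sym_diff A D"])
	  fix B assume B: "B : Pow U"
	  show "sym_diff A (sym_diff A B) = B" by auto
	  show "sym_diff A B : Pow U" using A B by auto
	  show "f A * g (sym_diff A (sym_diff A B)) * exp (\<Sum>e\<in>E. (K' e + K e * spins e (sym_diff A B)) * spins e A)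
		= f A * g B * exp ((\<Sum>e\<in>E. K' e * spins e A) + (\<Sum>e\<in>E. K e * spins e B))"
	  proof -
		have "(K' e + K e * spins e (sym_diff A B)) * spins e A
		  = K' e * spins e A + K e * spins e B" for e
		proof -
		  have "(K' e + K e * spins e (sym_diff A B)) * spins e A
			= K' e * spins e A + K e * (spins e A * spins e A) * spins e B"
			unfolding spins_sym_diff by (simp only: distrib_right distrib_left mult_ac)
		  then show ?thesis unfolding spins_sq by simp
		qed
		moreover have "sym_diff A (sym_diff A B) = B" by auto
		ultimately show ?thesis by (simp add: sum.distrib)
	  qed
	qed (use A in auto)
  qed
  also have "... = (\<Sum>D\<in>Pow U. ising_sum U E (%e. K' e + K e * spins e D) (%A. f A * g (sym_diff A D)))"
	unfolding ising_sum_def by (rule sum.swap)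
  finally show ?thesis .
qed

lemma coupling_dup_nonneg:
  assumes "0 <= k" "k <= k'"
  shows "0 <= k' + k * spins e D"
  using spins_cases[of e D] assms by auto

lemma ising_sum_add: "ising_sum U E K (%A. f A + g A) = ising_sum U E K f + ising_sum U E K g"
  by (simp add: ising_sum_def distrib_right sum.distrib)

lemma ising_sum_scale: "ising_sum U E K (%A. c * f A) = c * ising_sum U E K f"
  by (simp add: ising_sum_def sum_distrib_left mult_ac)

lemma ising_Z_pos: "finite U ==> 0 < ising_Z U E K"
  unfolding ising_Z_def ising_sum_def by (intro sum_pos) auto

text \<open>The second inequality of Griffiths, Kelly and Sherman.\<close>
lemma ising_sum_mono_coupling:
  assumes fin: "finite U" "finite E"
	and K: "!!e. e : E ==> 0 <= K e & K e <= K' e & finite e"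
	and f: "f : pos_cone"
  shows "ising_sum U E K f * ising_Z U E K' <= ising_sum U E K' f * ising_Z U E K"
  using f
proof induction
  case (mono c B)
  have "ising_sum U E K' (%A. c * spins B A) * ising_Z U E K
	  - ising_sum U E K (%A. c * spins B A) * ising_Z U E K'
	= c * (\<Sum>D\<in>Pow U. (1 - spins B D) * ising_sum U E (%e. K' e + K e * spins e D) (spins B))"
  proof -
	have 1: "ising_sum U E K' (spins B) * ising_Z U E K
	  = (\<Sum>D\<in>Pow U. ising_sum U E (%e. K' e + K e * spins e D) (spins B))"
	  unfolding ising_Z_def ising_sum_product[OF fin(1)] by simp
	have 2: "ising_Z U E K' * ising_sum U E K (spins B)
	  = (\<Sum>D\<in>Pow U. spins B D * ising_sum U E (%e. K' e + K e * spins e D) (spins B))"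
	  unfolding ising_Z_def ising_sum_product[OF fin(1)]
	  by (simp add: spins_sym_diff ising_sum_scale[symmetric] mult.commute)
	show ?thesis
	  unfolding ising_sum_scale
	  using 1 2 by (simp add: left_diff_distrib sum_subtractf right_diff_distrib mult_ac)
  qed
  also have "... \<ge> 0"
  proof (intro mult_nonneg_nonneg sum_nonneg)
	fix D
	show "0 <= 1 - spins B D" using spins_cases[of B D] by auto
	show "0 <= ising_sum U E (%e. K' e + K e * spins e D) (spins B)"
	  using fin K mono by (intro ising_sum_nonneg pos_cone_spins) (auto intro!: coupling_dup_nonneg)
  qed (use mono in auto)
  finally show ?case by simp
next
  case (add f g)
  then show ?case by (simp add: ising_sum_add distrib_right)
qed

text \<open>Increments of a product of two spin products are controlled by the increments of the factors; this is what transfers agreement of correlations from \<open>B\<close> and \<open>C\<close> to their product.\<close>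
lemma lebowitz:
  assumes fin: "finite U" "finite E" "finite B" "finite C"
	and K: "!!e. e : E ==> 0 <= K e & K e <= K' e & finite e"
  defines "S \<equiv> ising_sum U E K" and "S' \<equiv> ising_sum U E K'"
  shows "S (spins B) * S' (spins C) - S' (spins B) * S (spins C)
	<= S' (spins (sym_diff B C)) * S (%_. 1) - S' (%_. 1) * S (spins (sym_diff B C))"
proof -
  let ?BC = "spins (sym_diff B C)"
  let ?I = "%D. ising_sum U E (%e. K' e + K e * spins e D) ?BC"
  have BC: "?BC A = spins B A * spins C A" for A
	using spins_mult fin by metis
  have 1: "S' ?BC * S (%_. 1) = (\<Sum>D\<in>Pow U. ?I D)"
	unfolding S_def S'_def ising_sum_product[OF fin(1)] by simp
  have 2: "S' (%_. 1) * S ?BC = (\<Sum>D\<in>Pow U. spins B D * spins C D * ?I D)"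
	unfolding S_def S'_def ising_sum_product[OF fin(1)]
	unfolding ising_sum_scale[symmetric]
	unfolding spins_sym_diff BC by (simp only: mult_ac mult_1)
  have 3: "S' (spins C) * S (spins B) = (\<Sum>D\<in>Pow U. spins B D * ?I D)"
	unfolding S_def S'_def ising_sum_product[OF fin(1)]
	unfolding ising_sum_scale[symmetric]
	unfolding spins_sym_diff BC by (simp only: mult_ac)
  have 4: "S' (spins B) * S (spins C) = (\<Sum>D\<in>Pow U. spins C D * ?I D)"
	unfolding S_def S'_def ising_sum_product[OF fin(1)]
	unfolding ising_sum_scale[symmetric]
	unfolding spins_sym_diff BC by (simp only: mult_ac)
  have "0 <= (\<Sum>D\<in>Pow U. (1 - spins B D) * (1 + spins C D) * ?I D)"
  proof (intro mult_nonneg_nonneg sum_nonneg)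
	fix D
	show "0 <= 1 - spins B D" using spins_cases[of B D] by auto
	show "0 <= 1 + spins C D" using spins_cases[of C D] by auto
	show "0 <= ?I D"
	  using fin K by (intro ising_sum_nonneg pos_cone_spins) (auto intro!: coupling_dup_nonneg)
  qed
  also have "... = S' ?BC * S (%_. 1) - S' (%_. 1) * S ?BC
	  - (S' (spins C) * S (spins B) - S' (spins B) * S (spins C))"
	unfolding 1 2 3 4 sum_subtractf[symmetric] by (intro sum.cong) (auto simp: algebra_simps)
  finally show ?thesis by (simp add: mult_ac)
qed

lemma ising_Z_shift:
  "ising_sum U E K (%A. exp (\<Sum>e\<in>E. U9 e * spins e A)) = ising_Z U E (%e. K e + U9 e)"
  by (simp add: ising_Z_def ising_sum_def distrib_right sum.distrib flip: exp_add) (simp add: add.commute)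

lemma ising_Z_mono:
  assumes "finite U" "finite E" "!!e. e : E ==> 0 <= K e & K e <= K' e & finite e"
  shows "ising_Z U E K <= ising_Z U E K'"
proof -
  define f :: "'a set => real" where "f = (%A. exp (\<Sum>e\<in>E. (K' e - K e) * spins e A))"
  have f: "f : pos_cone" unfolding f_def using assms by (intro pos_cone_exp) auto
  have 1: "ising_Z U E K' = ising_sum U E K f"
	unfolding f_def ising_Z_shift by simp
  \<comment> \<open>compare with zero couplings, where the sum of f is at least that of 1\<close>
  have "ising_sum U E (%_. 0) f * ising_Z U E K <= ising_sum U E K f * ising_Z U E (%_. 0)"
	using assms f by (intro ising_sum_mono_coupling) auto
  moreover have "ising_Z U E (%_. 0) <= ising_sum U E (%_. 0) f"
  proof -
	have "(\<Sum>A\<in>Pow U. 1 + (\<Sum>e\<in>E. (K' e - K e) * spins e A)) <= (\<Sum>A\<in>Pow U. f A)"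
	  unfolding f_def by (intro sum_mono exp_ge_add_one_self)
	moreover have "0 <= (\<Sum>A\<in>Pow U. \<Sum>e\<in>E. (K' e - K e) * spins e A)"
	  unfolding sum.swap[of _ E] sum_distrib_left[symmetric] using assms
	  by (intro sum_nonneg mult_nonneg_nonneg sum_spins_nonneg) auto
	ultimately show ?thesis by (simp add: ising_Z_def ising_sum_def sum.distrib)
  qed
  ultimately have "ising_Z U E (%_. 0) * ising_Z U E K <= ising_Z U E K' * ising_Z U E (%_. 0)"
	using ising_Z_pos[OF assms(1), of E K] unfolding 1
	by (meson mult_right_mono less_imp_le order_trans)
  then show ?thesis using ising_Z_pos[OF assms(1), of E "%_. 0"] by (simp add: mult.commute)
qed

text \<open>By the second GKS inequality, the logarithm of the partition function has nonnegative mixed derivatives in the couplings; here in integrated form.\<close>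
lemma ising_Z_supermodular:
  assumes fin: "finite U" "finite E"
	and "!!e. e : E ==> finite e & 0 <= K4 e & K4 e <= K1 e & K4 e <= K2 e & K1 e - K4 e + K2 e <= K3 e"
  shows "ising_Z U E K1 * ising_Z U E K2 <= ising_Z U E K3 * ising_Z U E K4"
proof -
  define f :: "'a set => real" where "f = (%A. exp (\<Sum>e\<in>E. (K1 e - K4 e) * spins e A))"
  have f: "f : pos_cone" unfolding f_def using assms by (intro pos_cone_exp) auto
  have "ising_sum U E K4 f * ising_Z U E K2 <= ising_sum U E K2 f * ising_Z U E K4"
	using assms f by (intro ising_sum_mono_coupling) auto
  moreover have "ising_sum U E K4 f = ising_Z U E K1"
	unfolding f_def ising_Z_shift by simp
  moreover have "ising_sum U E K2 f <= ising_Z U E K3"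
	unfolding f_def ising_Z_shift using assms by (intro ising_Z_mono) (auto simp: algebra_simps, smt (verit))
  ultimately show ?thesis
	using ising_Z_pos[OF fin(1), of E K4] by (smt (verit) mult_right_mono)
qed

lemma ising_corr_mono:
  assumes "finite U" "finite E" "!!e. e : E ==> 0 <= K e & K e <= K' e & finite e" "f : pos_cone"
  shows "ising_corr U E K f <= ising_corr U E K' f"
  using ising_sum_mono_coupling[OF assms] ising_Z_pos[OF assms(1), of E]
  by (simp add: ising_corr_def divide_simps)

lemma ising_corr_nonneg:
  assumes "finite U" "finite E" "!!e. e : E ==> 0 <= K e & finite e" "f : pos_cone"
  shows "0 <= ising_corr U E K f"
  using ising_sum_nonneg[OF assms] ising_Z_pos[OF assms(1), of E K]
  by (simp add: ising_corr_def)

lemma ising_corr_le_1: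
  assumes "finite U" shows "ising_corr U E K (spins B) <= 1"
proof -
  have "ising_sum U E K (spins B) <= ising_Z U E K"
	unfolding ising_Z_def ising_sum_def
  proof (intro sum_mono mult_right_mono)
	fix A show "spins B A <= 1" using spins_cases[of B A] by auto
  qed auto
  then show ?thesis using ising_Z_pos[OF assms, of E K] by (simp add: ising_corr_def)
qed

lemma ising_corr_mult:
  assumes "finite U" "finite E" "finite B" "finite C" "!!e. e : E ==> 0 <= K e & finite e"
  shows "ising_corr U E K (spins B) * ising_corr U E K (spins C)
	<= ising_corr U E K (spins (sym_diff B C))"
proof -
  let ?S = "ising_sum U E K"
  let ?BC = "spins (sym_diff B C)"
  let ?I = "%D. ising_sum U E (%e. K e + K e * spins e D) ?BC"
  have BC: "?BC A = spins B A * spins C A" for A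
	using spins_mult assms by metis
  have 1: "?S ?BC * ?S (%_. 1) = (\<Sum>D\<in>Pow U. ?I D)"
	unfolding ising_sum_product[OF assms(1)] by simp
  have 3: "?S (spins C) * ?S (spins B) = (\<Sum>D\<in>Pow U. spins B D * ?I D)"
	unfolding ising_sum_product[OF assms(1)]
	unfolding ising_sum_scale[symmetric]
	unfolding spins_sym_diff BC by (simp only: mult_ac)
  have "?S (spins C) * ?S (spins B) <= ?S ?BC * ?S (%_. 1)"
	unfolding 1 3
  proof (intro sum_mono)
	fix D
	have "0 <= ?I D"
	  using assms by (intro ising_sum_nonneg pos_cone_spins) (auto intro!: coupling_dup_nonneg)
	then show "spins B D * ?I D <= ?I D" using spins_cases[of B D] by auto
  qed
  then show ?thesis
	using ising_Z_pos[OF assms(1), of E K]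
	by (simp add: ising_corr_def divide_simps ising_Z_def[symmetric] mult_ac)
qed

lemma ising_corr_lebowitz:
  assumes fin: "finite U" "finite E" "finite B" "finite C"
	and K: "!!e. e : E ==> 0 <= K e & K e <= K' e & finite e"
  defines "X \<equiv> %B. ising_corr U E K (spins B)" and "X' \<equiv> %B. ising_corr U E K' (spins B)"
  shows "X B * (X' (sym_diff B C) - X (sym_diff B C)) <= (X' C - X C) + (X' B - X B)"
proof -
  have BB: "sym_diff B (sym_diff B C) = C" by auto
  note Zp = ising_Z_pos[OF fin(1), of E K] ising_Z_pos[OF fin(1), of E K']
  have "ising_sum U E K (spins B) * ising_sum U E K' (spins (sym_diff B C))
	  - ising_sum U E K' (spins B) * ising_sum U E K (spins (sym_diff B C))
	<= ising_sum U E K' (spins C) * ising_Z U E K - ising_Z U E K' * ising_sum U E K (spins C)"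
	using lebowitz[OF fin(1,2,3), of "sym_diff B C" K K'] K fin unfolding BB ising_Z_def by auto
  then have "(ising_sum U E K (spins B) * ising_sum U E K' (spins (sym_diff B C))
	  - ising_sum U E K' (spins B) * ising_sum U E K (spins (sym_diff B C)))
	   / (ising_Z U E K * ising_Z U E K')
	<= (ising_sum U E K' (spins C) * ising_Z U E K - ising_Z U E K' * ising_sum U E K (spins C))
	   / (ising_Z U E K * ising_Z U E K')"
	using Zp by (intro divide_right_mono) auto
  then have L: "X B * X' (sym_diff B C) - X' B * X (sym_diff B C) <= X' C - X C"
	unfolding X_def X'_def ising_corr_def using Zp by (simp add: diff_divide_distrib mult_ac)
  have "(X' B - X B) * X (sym_diff B C) <= (X' B - X B) * 1"
  proof (intro mult_left_mono)
	show "X (sym_diff B C) <= 1" unfolding X_def by (rule ising_corr_le_1[OF fin(1)])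
	show "0 <= X' B - X B" unfolding X_def X'_def
	  using ising_corr_mono[OF fin(1,2) K pos_cone_spins[OF fin(3)]] by simp
  qed
  with L show ?thesis by (simp add: algebra_simps)
qed

text \<open>Switch off all other couplings; the correlation can only decrease.\<close>
lemma ising_corr_lower:
  assumes fin: "finite U" "finite E" and K: "!!e. e : E ==> 0 <= K e & finite e"
	and e: "e : E" "0 <= c" "c <= K e"
  shows "sinh c / exp c <= ising_corr U E K (spins e)"
proof -
  let ?K0 = "%b. if b = e then c else 0"
  have s: "(\<Sum>b\<in>E. ?K0 b * spins b A) = c * spins e A" for A
	using fin e by (subst sum.mono_neutral_cong_right[where S="{e}" and h="%_. c * spins e A"]) auto
  have fe: "finite e" using K e by auto
  have n: "(\<Sum>A\<in>Pow U. sinh c) <= ising_sum U E ?K0 (spins e)"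
  proof -
	have "ising_sum U E ?K0 (spins e) = (\<Sum>A\<in>Pow U. cosh c * spins e A + sinh c)"
	  unfolding ising_sum_def s
	proof (intro sum.cong refl)
	  fix A show "spins e A * exp (c * spins e A) = cosh c * spins e A + sinh c"
		using spins_cases[of e A] by (auto simp: cosh_def sinh_def algebra_simps)
	qed
	also have "... = cosh c * (\<Sum>A\<in>Pow U. spins e A) + (\<Sum>A\<in>Pow U. sinh c)"
	  by (simp add: sum.distrib sum_distrib_left)
	finally show ?thesis using sum_spins_nonneg[OF fin(1) fe] by (simp add: cosh_real_nonneg)
  qed
  have z: "ising_Z U E ?K0 <= (\<Sum>A\<in>Pow U. exp c)"
	unfolding ising_Z_def ising_sum_def s
  proof (intro sum_mono)
	fix A show "1 * exp (c * spins e A) <= exp c"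
	  using spins_cases[of e A] e by auto
  qed
  have N: "0 < (2::real) ^ card U" by simp
  have "sinh c / exp c = (\<Sum>A\<in>Pow U. sinh c) / (\<Sum>A\<in>Pow U. exp c)"
	using fin by (simp add: card_Pow)
  also have "... <= ising_corr U E ?K0 (spins e)"
	unfolding ising_corr_def using n z ising_Z_pos[OF fin(1), of E ?K0] e
	by (intro frac_le order_trans[OF _ n]) (auto intro!: sum_nonneg)
  also have "... <= ising_corr U E K (spins e)"
	using fin K e fe by (intro ising_corr_mono pos_cone_spins) auto
  finally show ?thesis .
qed

section \<open>The four functions theorem\<close>

text \<open>The two-point case, from which the one-dimensional theorem follows by symmetrization.\<close>
lemma four_values:
  fixes a b c d :: ennreal
  assumes "a <= c" "b <= c" "a * b <= c * d"
  shows "a + b <= c + d"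
proof (cases "c = \<infinity> \<or> d = \<infinity>")
  case True
  then show ?thesis by (metis ennreal_add_eq_top infinity_ennreal_def top_greatest)
next
  case False
  then have fin: "a < \<infinity>" "b < \<infinity>" "c < \<infinity>" "d < \<infinity>"
	using assms by (auto simp: less_top)
  define a' b' c' d' where "a' = enn2real a" "b' = enn2real b" "c' = enn2real c" "d' = enn2real d"
  have eqs: "a = ennreal a'" "b = ennreal b'" "c = ennreal c'" "d = ennreal d'"
	and nn: "0 <= a'" "0 <= b'" "0 <= c'" "0 <= d'"
	using fin by (auto simp: a'_b'_c'_d'_def)
  have le: "a' <= c'" "b' <= c'" "a' * b' <= c' * d'"
	using assms nn unfolding eqs by (auto simp: ennreal_mult[symmetric])
  have "a' + b' <= c' + d'"
  proof (cases "c' = 0")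
	case True
	then show ?thesis using le nn by auto
  next
	case False
	have "0 <= (c' - a') * (c' - b')" using le by auto
	then have "c' * (a' + b') <= c' * (c' + d')" using le by (simp add: algebra_simps)
	then show ?thesis using False nn by simp
  qed
  then show ?thesis unfolding eqs using nn by (simp add: ennreal_plus[symmetric] del: ennreal_plus)
qed

text \<open>Symmetrize both double integrals and compare the integrands by the two-point case.\<close>
lemma four_functions_one:
  fixes m :: "real measure" and f1 f2 f3 f4 :: "real => ennreal"
  assumes [measurable]: "f1 : bm m" "f2 : bm m"
	  "f3 : bm m" "f4 : bm m"
	and le: "!!x y. x : space m ==> y : space m ==> f1 x * f2 y <= f3 (max x y) * f4 (min x y)"
  shows "(\<integral>\<^sup>+x. f1 x \<partial>m) * (\<integral>\<^sup>+x. f2 x \<partial>m) <= (\<integral>\<^sup>+x. f3 x \<partial>m) * (\<integral>\<^sup>+x. f4 x \<partial>m)"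
proof -
  have dbl: "2 * ((\<integral>\<^sup>+x. f x \<partial>m) * (\<integral>\<^sup>+x. g x \<partial>m)) = (\<integral>\<^sup>+x. \<integral>\<^sup>+y. (f x * g y + f y * g x) \<partial>m \<partial>m)"
	if [measurable]: "f : bm m" "g : bm m" for f g :: "real => ennreal"
  proof -
	have "(\<integral>\<^sup>+x. \<integral>\<^sup>+y. (f x * g y + f y * g x) \<partial>m \<partial>m)
	  = (\<integral>\<^sup>+x. (f x * (\<integral>\<^sup>+y. g y \<partial>m) + (\<integral>\<^sup>+y. f y \<partial>m) * g x) \<partial>m)"
	  by (intro nn_integral_cong) (simp add: nn_integral_add nn_integral_cmult nn_integral_multc)
	also have "... = (\<integral>\<^sup>+x. f x \<partial>m) * (\<integral>\<^sup>+y. g y \<partial>m) + (\<integral>\<^sup>+y. f y \<partial>m) * (\<integral>\<^sup>+x. g x \<partial>m)"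
	  by (simp add: nn_integral_add nn_integral_cmult nn_integral_multc)
	finally show ?thesis by (simp add: mult_2)
  qed
  have "f1 x * f2 y + f1 y * f2 x <= f3 x * f4 y + f3 y * f4 x" if xy: "x : space m" "y : space m" for x y
  proof -
	have "f1 x * f2 y + f1 y * f2 x <= f3 (max x y) * f4 (min x y) + f3 (min x y) * f4 (max x y)"
	proof (rule four_values)
	  show "f1 x * f2 y <= f3 (max x y) * f4 (min x y)" using le xy by blast
	  show "f1 y * f2 x <= f3 (max x y) * f4 (min x y)"
		using le[of y x] xy by (simp add: max.commute min.commute)
	  have "(f1 x * f2 x) * (f1 y * f2 y) <= (f3 x * f4 x) * (f3 y * f4 y)"
		using le[of x x] le[of y y] xy by (intro mult_mono[of "f1 x * f2 x"]) auto
	  also have "... = f3 (max x y) * f4 (min x y) * (f3 (min x y) * f4 (max x y))"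
		by (auto simp: max_def min_def mult_ac)
	  finally show "f1 x * f2 y * (f1 y * f2 x) <= f3 (max x y) * f4 (min x y) * (f3 (min x y) * f4 (max x y))"
		by (simp add: mult_ac)
	qed
	also have "... = f3 x * f4 y + f3 y * f4 x" by (auto simp: max_def min_def add.commute)
	finally show ?thesis .
  qed
  then have "2 * ((\<integral>\<^sup>+x. f1 x \<partial>m) * (\<integral>\<^sup>+x. f2 x \<partial>m)) <= 2 * ((\<integral>\<^sup>+x. f3 x \<partial>m) * (\<integral>\<^sup>+x. f4 x \<partial>m))"
	unfolding dbl[OF assms(1,2)] dbl[OF assms(3,4)] by (intro nn_integral_mono) auto
  then show ?thesis
	by (subst (asm) ennreal_mult_le_mult_iff) auto
qed

abbreviation nnb :: "real measure" where "nnb \<equiv> nonneg_part borel"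

lemma space_nonneg_borel: "space nnb = {0..}"
  by (simp add: nonneg_part_def space_restrict_space)

definition depends_on :: "'v set => (('v => real) => 'b) => bool" where
  "depends_on V f \<longleftrightarrow> (\<forall>a b. (\<forall>x\<in>V. a x = b x) --> f a = f b)"

text \<open>Independent spin sizes, with Gaussian moments of every order so that all weights below are integrable.\<close>
locale site_laws =
  fixes mu :: "'v => real measure"
  assumes prob: "!!x. prob_space (mu x)" and sets_site: "!!x. sets (mu x) = sets nnb"
	and gauss: "!!x c. (\<integral>\<^sup>+t. ennreal (exp (c * t\<^sup>2)) \<partial>mu x) < \<infinity>"
begin

lemma space_site[simp]: "space (mu x) = {0..}"
  using sets_eq_imp_space_eq[OF sets_site[of x]] by (simp add: space_nonneg_borel)

sublocale product_prob_space mu UNIV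
  by (intro product_prob_spaceI prob)

abbreviation P :: "('v => real) measure" where "P \<equiv> PiM UNIV mu"

lemma space_P: "space P = {a. \<forall>x. 0 <= a x}"
  by (auto simp: space_PiM PiE_def Pi_def)

lemma four_functions_finite:
  assumes "finite V"
	and "f1 : bm (PiM V mu)" "f2 : bm (PiM V mu)"
	  "f3 : bm (PiM V mu)" "f4 : bm (PiM V mu)"
	and "!!a b. a : space (PiM V mu) ==> b : space (PiM V mu) ==>
	  f1 a * f2 b <= f3 (%x. max (a x) (b x)) * f4 (%x. min (a x) (b x))"
  shows "(\<integral>\<^sup>+a. f1 a \<partial>PiM V mu) * (\<integral>\<^sup>+a. f2 a \<partial>PiM V mu)
	<= (\<integral>\<^sup>+a. f3 a \<partial>PiM V mu) * (\<integral>\<^sup>+a. f4 a \<partial>PiM V mu)"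
  using assms
proof (induction V arbitrary: f1 f2 f3 f4 rule: finite_induct)
  case empty
  have "f1 (%_. undefined) * f2 (%_. undefined) <= f3 (%_. undefined) * f4 (%_. undefined)"
	using empty(5)[of "%_. undefined" "%_. undefined"] by (simp add: space_PiM)
  then show ?case by (simp add: PiM_empty nn_integral_count_space_finite)
next
  case (insert i V)
  note m = insert.prems(1-4)
  have sub: "(%(a, u). a(i := u)) : measurable (PiM V mu \<Otimes>\<^sub>M mu i) (PiM (insert i V) mu)"
	by (rule measurable_add_dim)
  have m1: "(%a. \<integral>\<^sup>+u. f (a(i := u)) \<partial>mu i) : bm (PiM V mu)"
	if "f : bm (PiM (insert i V) mu)" for f :: "_ => ennreal"
	using measurable_compose[OF sub that]
	by (intro sigma_finite_measure.borel_measurable_nn_integral) (auto simp: split_beta' prob_space_imp_sigma_finite prob)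
  have m2: "(%u. f (a(i := u))) : bm (mu i)"
	if "f : bm (PiM (insert i V) mu)" "a : space (PiM V mu)" for f :: "_ => ennreal" and a
	using measurable_compose[OF measurable_Pair1'[OF that(2)] measurable_compose[OF sub that(1)]] by simp
  have sp: "a(i := u) : space (PiM (insert i V) mu)" if "a : space (PiM V mu)" "u : space (mu i)" for a u
	using that by (auto simp: space_PiM PiE_def Pi_def extensional_def)
  have upd: "(%x. max ((a(i := u)) x) ((b(i := v)) x)) = (%x. max (a x) (b x))(i := max u v)"
	 "(%x. min ((a(i := u)) x) ((b(i := v)) x)) = (%x. min (a x) (b x))(i := min u v)" for a b u v
	by auto
  show ?case
	unfolding product_nn_integral_insert[OF insert(1,2) m(1)] product_nn_integral_insert[OF insert(1,2) m(2)]
	  product_nn_integral_insert[OF insert(1,2) m(3)] product_nn_integral_insert[OF insert(1,2) m(4)]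
  proof (rule insert.IH)
	fix a b assume ab: "a : space (PiM V mu)" "b : space (PiM V mu)"
	have ab': "(%x. max (a x) (b x)) : space (PiM V mu)" "(%x. min (a x) (b x)) : space (PiM V mu)"
	  using ab by (auto simp: space_PiM PiE_def Pi_def extensional_def le_max_iff_disj)
	show "(\<integral>\<^sup>+u. f1 (a(i := u)) \<partial>mu i) * (\<integral>\<^sup>+u. f2 (b(i := u)) \<partial>mu i)
	  <= (\<integral>\<^sup>+u. f3 ((%x. max (a x) (b x))(i := u)) \<partial>mu i) * (\<integral>\<^sup>+u. f4 ((%x. min (a x) (b x))(i := u)) \<partial>mu i)"
	proof (rule four_functions_one)
	  fix u v assume "u : space (mu i)" "v : space (mu i)"
	  then show "f1 (a(i := u)) * f2 (b(i := v))
		<= f3 ((%x. max (a x) (b x))(i := max u v)) * f4 ((%x. min (a x) (b x))(i := min u v))"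
		using insert.prems(5)[OF sp sp, of a u b v] ab unfolding upd by blast
	qed (use ab ab' m in \<open>auto intro!: m2\<close>)
  qed (rule m1[OF m(1)] m1[OF m(2)] m1[OF m(3)] m1[OF m(4)])+
qed

lemma measurable_trunc: "(%a x. if x : V then a x else 0) : measurable (PiM V mu) P"
proof (rule measurable_PiM_single')
  fix i
  show "(%a. if i : V then a i else 0) : measurable (PiM V mu) (mu i)"
	by (cases "i : V") auto
qed (auto simp: space_PiM PiE_def Pi_def)

lemma nn_integral_depends_on:
  assumes f: "f : bm P" "depends_on V f"
  shows "(\<integral>\<^sup>+a. f a \<partial>P) = (\<integral>\<^sup>+a. f (%x. if x : V then a x else 0) \<partial>PiM V mu)"
proof -
  have "PiM V mu = distr P (PiM V mu) (%a. restrict a V)"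
	using distr_PiM_reindex[of UNIV mu id V] prob by (simp add: restrict_def)
  then have "(\<integral>\<^sup>+a. f (%x. if x : V then a x else 0) \<partial>PiM V mu)
	  = (\<integral>\<^sup>+a. f (%x. if x : V then a x else 0) \<partial>distr P (PiM V mu) (%a. restrict a V))" by simp
  also have "... = (\<integral>\<^sup>+a. f (%x. if x : V then restrict a V x else 0) \<partial>P)"
	by (rule nn_integral_distr) (use measurable_compose[OF measurable_trunc f(1)] in auto)
  also have "... = (\<integral>\<^sup>+a. f a \<partial>P)"
	using f(2) by (intro nn_integral_cong) (auto simp: depends_on_def)
  finally show ?thesis by simp
qed

text \<open>The theorem of Ahlswede and Daykin for products of measures on the half-line, for functions of finitely many coordinates.\<close>
lemma four_functions:
  assumes "finite V"
	and m: "f1 : bm P" "f2 : bm P" "f3 : bm P" "f4 : bm P"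
	and d: "depends_on V f1" "depends_on V f2" "depends_on V f3" "depends_on V f4"
	and le: "!!a b. \<forall>x. 0 <= a x ==> \<forall>x. 0 <= b x ==>
	  f1 a * f2 b <= f3 (%x. max (a x) (b x)) * f4 (%x. min (a x) (b x))"
  shows "(\<integral>\<^sup>+a. f1 a \<partial>P) * (\<integral>\<^sup>+a. f2 a \<partial>P) <= (\<integral>\<^sup>+a. f3 a \<partial>P) * (\<integral>\<^sup>+a. f4 a \<partial>P)"
  unfolding nn_integral_depends_on[OF m(1) d(1)] nn_integral_depends_on[OF m(2) d(2)]
	nn_integral_depends_on[OF m(3) d(3)] nn_integral_depends_on[OF m(4) d(4)]
proof (rule four_functions_finite[OF assms(1)])
  fix a b assume ab: "a : space (PiM V mu)" "b : space (PiM V mu)"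
  let ?t = "%a x. if x : V then a x else (0::real)"
  have "(%x. max (?t a x) (?t b x)) = ?t (%x. max (a x) (b x))" "(%x. min (?t a x) (?t b x)) = ?t (%x. min (a x) (b x))"
	by auto
  moreover have "\<forall>x. 0 <= ?t a x" "\<forall>x. 0 <= ?t b x" using ab by (auto simp: space_PiM)
  ultimately show "f1 (?t a) * f2 (?t b) <= f3 (?t (%x. max (a x) (b x))) * f4 (?t (%x. min (a x) (b x)))"
	using le[of "?t a" "?t b"] by simp
qed (use m measurable_compose[OF measurable_trunc] in auto)

end

section \<open>Ising models in a random field of spin sizes\<close>

definition coupling :: "('v set => real) => ('v => real) => 'v set => real" where
  "coupling J a e = J e * (\<Prod>x\<in>e. a x)"

abbreviation part_fun where "part_fun U E J a \<equiv> ising_Z U E (coupling J a)"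
abbreviation corr where "corr U E J a B \<equiv> ising_corr U E (coupling J a) (spins B)"

definition bonds :: "'v set => 'v set set => bool" where
  "bonds V E \<longleftrightarrow> finite V & (\<forall>e\<in>E. e <= V & card e = 2)"

lemma bonds_finite: "bonds V E ==> finite E"
  unfolding bonds_def by (meson PowI finite_Pow_iff finite_subset subsetI)

lemma bonds_D: "bonds V E ==> e : E ==> finite e & e <= V & card e = 2"
  unfolding bonds_def by (meson finite_subset)

lemma coupling_mono:
  assumes "finite e" "0 <= J e" "J e <= J' e" "!!x. 0 <= a x" "!!x. a x <= b x"
  shows "0 <= coupling J a e & coupling J a e <= coupling J' b e"
  unfolding coupling_def using assms
  by (auto intro!: mult_mono prod_mono mult_nonneg_nonneg prod_nonneg)

lemma corr_mono:
  assumes "finite U" "bonds V E" "!!e. e : E ==> 0 <= J e & J e <= J' e" "!!x. 0 <= a x" "!!x. a x <= b x" "finite B"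
  shows "corr U E J a B <= corr U E J' b B"
proof (rule ising_corr_mono)
  fix e assume "e : E"
  then show "0 <= coupling J a e & coupling J a e <= coupling J' b e & finite e"
	using assms bonds_D[OF assms(2), of e] coupling_mono[of e J J' a b] by auto
qed (use assms bonds_finite in \<open>auto intro: pos_cone_spins\<close>)

lemma corr_nonneg:
  assumes "finite U" "bonds V E" "!!e. e : E ==> 0 <= J e" "!!x. 0 <= a x" "finite B"
  shows "0 <= corr U E J a B"
proof (rule ising_corr_nonneg)
  fix e assume "e : E"
  then show "0 <= coupling J a e & finite e"
	using assms bonds_D[OF assms(2), of e] coupling_mono[of e J J a a] by auto
qed (use assms bonds_finite in \<open>auto intro: pos_cone_spins\<close>)

lemma part_fun_mono:
  assumes "finite U" "bonds V E" "!!e. e : E ==> 0 <= J e & J e <= J' e" "!!x. 0 <= a x" "!!x. a x <= b x"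
  shows "part_fun U E J a <= part_fun U E J' b"
proof (rule ising_Z_mono)
  fix e assume "e : E"
  then show "0 <= coupling J a e & coupling J a e <= coupling J' b e & finite e"
	using assms bonds_D[OF assms(2), of e] coupling_mono[of e J J' a b] by auto
qed (use assms bonds_finite in auto)

lemma part_fun_ge_1:
  assumes "finite U" "bonds V E" "!!e. e : E ==> 0 <= J e" "!!x. 0 <= a x"
  shows "1 <= part_fun U E J a"
proof -
  have "1 <= real (2 ^ card U)" by (simp add: one_le_power)
  also have "... = part_fun U E (%_. 0) a"
	using assms(1) by (simp add: ising_Z_def ising_sum_def coupling_def card_Pow)
  also have "... <= part_fun U E J a" by (rule part_fun_mono[OF assms(1,2)]) (use assms in auto)
  finally show ?thesis .
qed

lemma coupling_supermodular:
  assumes "card e = 2" "0 <= J e" "J e <= J' e" "!!x. 0 <= a x" "!!x. 0 <= b x"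
  shows "coupling J a e - coupling J (%x. min (a x) (b x)) e + coupling J' b e
	<= coupling J' (%x. max (a x) (b x)) e"
proof -
  obtain x y where e: "e = {x, y}" "x ~= y" using assms(1) by (meson card_2_iff)
  have p: "(\<Prod>z\<in>e. f z) = f x * f y" for f :: "_ => real" using e by simp
  have 1: "a x * a y + b x * b y <= max (a x) (b x) * max (a y) (b y) + min (a x) (b x) * min (a y) (b y)"
  proof -
	have *: "p * q + r * s <= p * s + r * q" if "r <= p" "q <= s" for p q r s :: real
	proof -
	  have "0 <= (p - r) * (s - q)" using that by auto
	  then show ?thesis by (simp add: algebra_simps)
	qed
	show ?thesis using *[of "b x" "a x" "a y" "b y"] *[of "a x" "b x" "b y" "a y"]
	  by (auto simp: max_def min_def)
  qed
  have 2: "min (a x) (b x) * min (a y) (b y) <= a x * a y" using assms(4,5) by (intro mult_mono) auto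
  have "J e * (a x * a y - min (a x) (b x) * min (a y) (b y)) <= J' e * (a x * a y - min (a x) (b x) * min (a y) (b y))"
	using 2 assms by (intro mult_right_mono) auto
  also have "... <= J' e * (max (a x) (b x) * max (a y) (b y) - b x * b y)"
	using 1 assms by (intro mult_left_mono) auto
  finally show ?thesis unfolding coupling_def p by (simp add: algebra_simps)
qed

lemma part_fun_supermodular:
  assumes "finite U" "bonds V E" "!!e. e : E ==> 0 <= J e & J e <= J' e"
	and ab: "!!x. 0 <= a x" "!!x. 0 <= b x"
  shows "part_fun U E J a * part_fun U E J' b
	<= part_fun U E J' (%x. max (a x) (b x)) * part_fun U E J (%x. min (a x) (b x))"
proof (rule ising_Z_supermodular)
  fix e assume e: "e : E"
  let ?m = "%x. min (a x) (b x)"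
  note J = assms(3)[OF e] and b = bonds_D[OF assms(2) e]
  show "finite e & 0 <= coupling J ?m e & coupling J ?m e <= coupling J a e & coupling J ?m e <= coupling J' b e &
	coupling J a e - coupling J ?m e + coupling J' b e <= coupling J' (%x. max (a x) (b x)) e"
	using J b ab coupling_mono[of e J J ?m a] coupling_mono[of e J J' ?m b] coupling_supermodular[of e J J' a b]
	by auto
qed (use assms bonds_finite in auto)

lemma depends_onI: "(!!a b. (!!x. x : V ==> a x = b x) ==> f a = f b) ==> depends_on V f"
  unfolding depends_on_def by blast

lemma depends_onD: "depends_on V f ==> (!!x. x : V ==> a x = b x) ==> f a = f b"
  unfolding depends_on_def by blast

lemma depends_on_part_fun:
  assumes "bonds V E" shows "depends_on V (part_fun U E J)"
proof (rule depends_onI)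
  fix a b :: "'a => real" assume ab: "!!x. x : V ==> a x = b x"
  have "coupling J a e = coupling J b e" if "e : E" for e
	unfolding coupling_def using bonds_D[OF assms that] ab by (auto intro!: prod.cong)
  then show "part_fun U E J a = part_fun U E J b"
	unfolding ising_Z_def ising_sum_def by (auto intro!: sum.cong arg_cong[of _ _ exp])
qed

lemma depends_on_ising_corr:
  assumes "bonds V E" shows "depends_on V (%a. ising_corr U E (coupling J a) f)"
proof (rule depends_onI)
  fix a b :: "'a => real" assume ab: "!!x. x : V ==> a x = b x"
  have "coupling J a e = coupling J b e" if "e : E" for e
	unfolding coupling_def using bonds_D[OF assms that] ab by (auto intro!: prod.cong)
  then have "ising_sum U E (coupling J a) f = ising_sum U E (coupling J b) f" for f
	unfolding ising_sum_def by (auto intro!: sum.cong arg_cong[of _ _ exp])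
  then show "ising_corr U E (coupling J a) f = ising_corr U E (coupling J b) f"
	unfolding ising_corr_def ising_Z_def by simp
qed

lemma depends_on_corr:
  assumes "bonds V E" shows "depends_on V (%a. corr U E J a B)"
  by (rule depends_on_ising_corr[OF assms])

lemma depends_on_combine:
  assumes "depends_on V f" "depends_on V g" shows "depends_on V (%a. h (f a) (g a))"
  using assms unfolding depends_on_def by metis

lemma depends_on_mono: "depends_on V f ==> V <= W ==> depends_on W f"
  unfolding depends_on_def by blast

text \<open>The growth condition under which functions are integrable for every law considered.\<close>
definition gaussian :: "'v set => (('v => real) => real) => bool" where
  "gaussian V f \<longleftrightarrow> (\<exists>C\<ge>0. \<exists>c\<ge>0. \<forall>a. (\<forall>x. 0 <= a x) --> \<bar>f a\<bar> <= C * exp (c * (\<Sum>x\<in>V. (a x)\<^sup>2)))"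

lemma gaussianI:
  assumes "0 <= C" "0 <= c" "!!a. \<forall>x. 0 <= a x ==> \<bar>f a\<bar> <= C * exp (c * (\<Sum>x\<in>V. (a x)\<^sup>2))"
  shows "gaussian V f"
  using assms unfolding gaussian_def by blast

lemma gaussian_bounded:
  assumes "!!a. \<forall>x. 0 <= a x ==> \<bar>f a\<bar> <= C" shows "gaussian V f"
proof (rule gaussianI[of "max C 0" 0])
  fix a :: "'a => real" assume "\<forall>x. 0 <= a x"
  then show "\<bar>f a\<bar> <= max C 0 * exp (0 * (\<Sum>x\<in>V. (a x)\<^sup>2))" using assms[of a] by auto
qed auto

lemma gaussian_mult:
  assumes "gaussian V f" "gaussian V g" shows "gaussian V (%a. f a * g a)"
proof -
  obtain C c where f: "0 <= C" "0 <= c" "!!a. \<forall>x. 0 <= a x ==> \<bar>f a\<bar> <= C * exp (c * (\<Sum>x\<in>V. (a x)\<^sup>2))"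
	using assms(1) unfolding gaussian_def by blast
  obtain D d where g: "0 <= D" "0 <= d" "!!a. \<forall>x. 0 <= a x ==> \<bar>g a\<bar> <= D * exp (d * (\<Sum>x\<in>V. (a x)\<^sup>2))"
	using assms(2) unfolding gaussian_def by blast
  show ?thesis
  proof (rule gaussianI[of "C * D" "c + d"])
	fix a :: "'a => real" assume a: "\<forall>x. 0 <= a x"
	have "\<bar>f a * g a\<bar> <= (C * exp (c * (\<Sum>x\<in>V. (a x)\<^sup>2))) * (D * exp (d * (\<Sum>x\<in>V. (a x)\<^sup>2)))"
	  unfolding abs_mult using f g a by (intro mult_mono) auto
	then show "\<bar>f a * g a\<bar> <= C * D * exp ((c + d) * (\<Sum>x\<in>V. (a x)\<^sup>2))"
	  by (simp add: distrib_right exp_add mult_ac)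
  qed (use f g in auto)
qed

lemma gaussian_add:
  assumes "gaussian V f" "gaussian V g" shows "gaussian V (%a. f a + g a)"
proof -
  obtain C c where f: "0 <= C" "0 <= c" "!!a. \<forall>x. 0 <= a x ==> \<bar>f a\<bar> <= C * exp (c * (\<Sum>x\<in>V. (a x)\<^sup>2))"
	using assms(1) unfolding gaussian_def by blast
  obtain D d where g: "0 <= D" "0 <= d" "!!a. \<forall>x. 0 <= a x ==> \<bar>g a\<bar> <= D * exp (d * (\<Sum>x\<in>V. (a x)\<^sup>2))"
	using assms(2) unfolding gaussian_def by blast
  show ?thesis
  proof (rule gaussianI[of "C + D" "c + d"])
	fix a :: "'a => real" assume a: "\<forall>x. 0 <= a x"
	have s: "0 <= (\<Sum>x\<in>V. (a x)\<^sup>2)" by (intro sum_nonneg) auto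
	have "C * exp (c * (\<Sum>x\<in>V. (a x)\<^sup>2)) <= C * exp ((c + d) * (\<Sum>x\<in>V. (a x)\<^sup>2))"
	  "D * exp (d * (\<Sum>x\<in>V. (a x)\<^sup>2)) <= D * exp ((c + d) * (\<Sum>x\<in>V. (a x)\<^sup>2))"
	  using f g s by (auto intro!: mult_left_mono simp: distrib_right)
	then show "\<bar>f a + g a\<bar> <= (C + D) * exp ((c + d) * (\<Sum>x\<in>V. (a x)\<^sup>2))"
	  using f(3)[OF a] g(3)[OF a] by (simp add: distrib_right)
  qed (use f g in auto)
qed

lemma gaussian_component:
  assumes "finite V" "x : V" shows "gaussian V (%a. a x)"
proof (rule gaussianI[of 1 1])
  fix a :: "'a => real" assume a: "\<forall>x. 0 <= a x"
  have "2 * a x <= (a x)\<^sup>2 + 1" using sum_squares_bound[of "a x" 1] by simp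
  moreover have "(a x)\<^sup>2 <= (\<Sum>x\<in>V. (a x)\<^sup>2)" using assms by (intro member_le_sum) auto
  moreover have "0 <= a x" using a by simp
  ultimately have "\<bar>a x\<bar> <= 1 + (\<Sum>x\<in>V. (a x)\<^sup>2)" by linarith
  also have "... <= exp (\<Sum>x\<in>V. (a x)\<^sup>2)" by (rule exp_ge_add_one_self)
  finally show "\<bar>a x\<bar> <= 1 * exp (1 * (\<Sum>x\<in>V. (a x)\<^sup>2))" by simp
qed auto

lemma gaussian_le:
  assumes "gaussian V g" "!!a. \<forall>x. 0 <= a x ==> \<bar>f a\<bar> <= \<bar>g a\<bar>"
  shows "gaussian V f"
  using assms unfolding gaussian_def by (meson order_trans)

lemma bond_prod_le:
  fixes a :: "'v => real"
  assumes "bonds V E" "e : E" "\<forall>x. 0 <= a x"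
  shows "(\<Prod>x\<in>e. a x) <= (\<Sum>x\<in>V. (a x)\<^sup>2)"
proof -
  obtain x y where e: "e = {x, y}" "x ~= y" using bonds_D[OF assms(1,2)] by (meson card_2_iff)
  have "2 * (a x * a y) <= (a x)\<^sup>2 + (a y)\<^sup>2" using sum_squares_bound[of "a x" "a y"] by simp
  moreover have "0 <= a x * a y" using assms(3) by simp
  ultimately have "a x * a y <= (\<Sum>z\<in>e. (a z)\<^sup>2)" using e by simp
  also have "... <= (\<Sum>x\<in>V. (a x)\<^sup>2)"
	using bonds_D[OF assms(1,2)] assms(1) by (intro sum_mono2) (auto simp: bonds_def)
  finally show ?thesis using e by simp
qed

lemma gaussian_part_fun:
  assumes "bonds V E" "finite U" "!!e. e : E ==> 0 <= J e"
  shows "gaussian V (part_fun U E J)"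
proof (rule gaussianI[of "2 ^ card U" "sum J E"])
  fix a :: "'a => real" assume a: "\<forall>x. 0 <= a x"
  have "part_fun U E J a <= (\<Sum>A\<in>Pow U. exp (sum J E * (\<Sum>x\<in>V. (a x)\<^sup>2)))"
	unfolding ising_Z_def ising_sum_def
  proof (intro sum_mono)
	fix A
	have "(\<Sum>e\<in>E. coupling J a e * spins e A) <= (\<Sum>e\<in>E. J e * (\<Sum>x\<in>V. (a x)\<^sup>2))"
	proof (intro sum_mono)
	  fix e assume e: "e : E"
	  have "coupling J a e * spins e A <= coupling J a e"
		using spins_cases[of e A] coupling_mono[of e J J a a] assms(3)[OF e] a bonds_D[OF assms(1) e] by auto
	  also have "... <= J e * (\<Sum>x\<in>V. (a x)\<^sup>2)"
		unfolding coupling_def by (intro mult_left_mono bond_prod_le[OF assms(1) e a] assms(3) e)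
	  finally show "coupling J a e * spins e A <= J e * (\<Sum>x\<in>V. (a x)\<^sup>2)" .
	qed
	then show "1 * exp (\<Sum>e\<in>E. coupling J a e * spins e A) <= exp (sum J E * (\<Sum>x\<in>V. (a x)\<^sup>2))"
	  by (simp add: sum_distrib_right)
  qed
  then show "\<bar>part_fun U E J a\<bar> <= 2 ^ card U * exp (sum J E * (\<Sum>x\<in>V. (a x)\<^sup>2))"
	using ising_Z_pos[OF assms(2), of E "coupling J a"] assms(2) by (simp add: card_Pow)
qed (use assms(3) in \<open>simp_all add: sum_nonneg\<close>)

text \<open>The reference product law reweighted by \<open>w\<close>.\<close>
definition gibbs_law :: "('v => real measure) => (('v => real) => real) => ('v => real) measure" where
  "gibbs_law mu w = density (PiM UNIV mu) (%a. ennreal (w a / (\<integral>a. w a \<partial>PiM UNIV mu)))"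

context site_laws begin

lemma component_measurable[measurable]: "(%a. a x) : bm P"
proof -
  have "(%t. t) : bm (mu x)"
	unfolding measurable_cong_sets[OF sets_site[of x] refl] nonneg_part_def
	by (intro measurable_restrict_space1) simp
  then show ?thesis by (rule measurable_compose[OF measurable_component_singleton[OF UNIV_I]])
qed

lemma coupling_measurable[measurable]: "(%a. coupling J a e) : bm P"
  unfolding coupling_def by measurable

lemma ising_sum_measurable[measurable]: "(%a. ising_sum U E (coupling J a) f) : bm P"
  unfolding ising_sum_def by measurable

lemma part_fun_measurable[measurable]: "part_fun U E J : bm P"
  unfolding ising_Z_def by measurable

lemma ising_corr_measurable[measurable]: "(%a. ising_corr U E (coupling J a) f) : bm P"
  unfolding ising_corr_def by measurable

lemma gauss_nn_integral:
  assumes "finite V"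
  shows "(\<integral>\<^sup>+a. ennreal (exp (c * (\<Sum>x\<in>V. (a x)\<^sup>2))) \<partial>P) = (\<Prod>x\<in>V. \<integral>\<^sup>+t. ennreal (exp (c * t\<^sup>2)) \<partial>mu x)"
proof -
  have m: "(%t. ennreal (exp (c * t\<^sup>2))) : bm (mu x)" for x
  proof -
	have "(%t. ennreal (exp (c * t\<^sup>2))) : bm nnb"
	  unfolding nonneg_part_def by (intro measurable_restrict_space1) measurable
	then show ?thesis using measurable_cong_sets[OF sets_site[of x] refl] by blast
  qed
  have "(\<integral>\<^sup>+a. ennreal (exp (c * (\<Sum>x\<in>V. (a x)\<^sup>2))) \<partial>P)
	= (\<integral>\<^sup>+a. ennreal (exp (c * (\<Sum>x\<in>V. (if x : V then a x else 0)\<^sup>2))) \<partial>PiM V mu)"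
	by (rule nn_integral_depends_on) (auto intro!: depends_onI)
  also have "... = (\<integral>\<^sup>+a. (\<Prod>x\<in>V. ennreal (exp (c * (a x)\<^sup>2))) \<partial>PiM V mu)"
	using assms by (intro nn_integral_cong) (simp add: sum_distrib_left exp_sum prod_ennreal)
  also have "... = (\<Prod>x\<in>V. \<integral>\<^sup>+t. ennreal (exp (c * t\<^sup>2)) \<partial>mu x)"
	by (rule product_nn_integral_prod) (use assms m in auto)
  finally show ?thesis .
qed

lemma gaussian_integrable:
  assumes "finite V" "gaussian V f" "f : bm P"
  shows "integrable P f"
proof -
  obtain C c where f: "0 <= C" "0 <= c" "!!a. \<forall>x. 0 <= a x ==> \<bar>f a\<bar> <= C * exp (c * (\<Sum>x\<in>V. (a x)\<^sup>2))"
	using assms(2) unfolding gaussian_def by blast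
  have "integrable P (%a. exp (c * (\<Sum>x\<in>V. (a x)\<^sup>2)))"
  proof (rule integrableI_nonneg)
	show "(\<integral>\<^sup>+a. ennreal (exp (c * (\<Sum>x\<in>V. (a x)\<^sup>2))) \<partial>P) < \<infinity>"
	  unfolding gauss_nn_integral[OF assms(1)] using assms(1)
	  by (induction V) (use gauss in \<open>auto simp: ennreal_mult_less_top\<close>)
  qed auto
  then have "integrable P (%a. C * exp (c * (\<Sum>x\<in>V. (a x)\<^sup>2)))" by simp
  then show ?thesis
	by (rule Bochner_Integration.integrable_bound[OF _ assms(3)])
	  (use f in \<open>auto intro!: AE_I2 simp: space_P\<close>)
qed

definition weight :: "'v set => (('v => real) => real) => bool" where
  "weight V w \<longleftrightarrow> finite V & w : bm P & depends_on V w & gaussian V w &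
	 (\<forall>a. (\<forall>x. 0 <= a x) --> 1 <= w a)"

lemma weight_integrable: "weight V w ==> integrable P w"
  unfolding weight_def using gaussian_integrable by blast

lemma weight_integral_pos:
  assumes "weight V w" shows "1 <= (\<integral>a. w a \<partial>P)"
proof -
  have "(1::real) = (\<integral>a. 1 \<partial>P)" by (simp add: P.prob_space)
  also have "... <= (\<integral>a. w a \<partial>P)"
	using assms weight_integrable[OF assms] by (intro integral_mono_AE) (auto simp: weight_def space_P)
  finally show ?thesis .
qed

lemma gibbs_nn_integral:
  assumes w: "weight V w" and [measurable]: "f : bm P"
  shows "(\<integral>\<^sup>+a. f a \<partial>gibbs_law mu w) = (\<integral>\<^sup>+a. f a * ennreal (w a) \<partial>P) / ennreal (\<integral>a. w a \<partial>P)"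
proof -
  have [measurable]: "w : bm P" using w by (simp add: weight_def)
  note c = weight_integral_pos[OF w]
  have "(\<integral>\<^sup>+a. f a \<partial>gibbs_law mu w) = (\<integral>\<^sup>+a. ennreal (w a / (\<integral>a. w a \<partial>P)) * f a \<partial>P)"
	unfolding gibbs_law_def by (subst nn_integral_density) auto
  also have "... = (\<integral>\<^sup>+a. f a * ennreal (w a) / ennreal (\<integral>a. w a \<partial>P) \<partial>P)"
  proof (intro nn_integral_cong)
	fix a assume "a : space P"
	then have "1 <= w a" using w by (simp add: space_P weight_def)
	then have "ennreal (w a / (\<integral>a. w a \<partial>P)) = ennreal (w a) / ennreal (\<integral>a. w a \<partial>P)"
	  using c by (intro divide_ennreal[symmetric]) auto
	then show "ennreal (w a / (\<integral>a. w a \<partial>P)) * f a = f a * ennreal (w a) / ennreal (\<integral>a. w a \<partial>P)"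
	  by (simp add: ennreal_times_divide mult.commute)
  qed
  also have "... = (\<integral>\<^sup>+a. f a * ennreal (w a) \<partial>P) / ennreal (\<integral>a. w a \<partial>P)"
	by (rule nn_integral_divide) auto
  finally show ?thesis .
qed

lemma gibbs_integral:
  assumes w: "weight V w" and [measurable]: "f : bm P"
  shows "(\<integral>a. f a \<partial>gibbs_law mu w) = (\<integral>a. f a * w a \<partial>P) / (\<integral>a. w a \<partial>P)"
proof -
  have [measurable]: "w : bm P" using w by (simp add: weight_def)
  note c = weight_integral_pos[OF w]
  have "(\<integral>a. f a \<partial>gibbs_law mu w) = (\<integral>a. (w a / (\<integral>a. w a \<partial>P)) *\<^sub>R f a \<partial>P)"
	unfolding gibbs_law_def using c w
	by (intro integral_density) (auto simp: space_P weight_def intro!: AE_I2 divide_nonneg_nonneg intro: order_trans[of 0 1])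
  also have "... = (\<integral>a. f a * w a / (\<integral>a. w a \<partial>P) \<partial>P)"
	by (intro Bochner_Integration.integral_cong) (auto simp: field_simps)
  also have "... = (\<integral>a. f a * w a \<partial>P) / (\<integral>a. w a \<partial>P)" by simp
  finally show ?thesis .
qed

lemma sets_gibbs[simp, measurable_cong]: "sets (gibbs_law mu w) = sets P"
  unfolding gibbs_law_def by simp

lemma space_gibbs: "space (gibbs_law mu w) = {a. \<forall>x. 0 <= a x}"
  unfolding gibbs_law_def by (simp add: space_P)

lemma prob_space_gibbs:
  assumes w: "weight V w" shows "prob_space (gibbs_law mu w)"
proof
  have "emeasure (gibbs_law mu w) (space (gibbs_law mu w)) = (\<integral>\<^sup>+a. 1 \<partial>gibbs_law mu w)" by simp
  also have "... = (\<integral>\<^sup>+a. ennreal (w a) \<partial>P) / ennreal (\<integral>a. w a \<partial>P)"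
	by (subst gibbs_nn_integral[OF w]) auto
  also have "(\<integral>\<^sup>+a. ennreal (w a) \<partial>P) = ennreal (\<integral>a. w a \<partial>P)"
	using weight_integrable[OF w] w
	by (intro nn_integral_eq_integral) (auto simp: space_P weight_def intro!: AE_I2 intro: order_trans[of 0 1])
  finally show "emeasure (gibbs_law mu w) (space (gibbs_law mu w)) = 1"
	using weight_integral_pos[OF w] by (simp add: divide_ennreal)
qed

lemma gibbs_integrable:
  assumes w: "weight V w" and "f : bm P" "gaussian V f"
  shows "integrable (gibbs_law mu w) f"
proof -
  have [measurable]: "w : bm P" "f : bm P" using assms by (simp_all add: weight_def)
  note c = weight_integral_pos[OF w]
  have "integrable P (%a. f a * w a)"
	using assms by (intro gaussian_integrable[of V] gaussian_mult) (auto simp: weight_def)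
  then have "integrable P (%a. (f a * w a) / (\<integral>a. w a \<partial>P))" by simp
  then have "integrable P (%a. (w a / (\<integral>a. w a \<partial>P)) *\<^sub>R f a)" by (simp add: mult.commute)
  then show ?thesis
	unfolding gibbs_law_def using c w
	by (subst integrable_density) (auto simp: space_P weight_def intro!: AE_I2 divide_nonneg_nonneg intro: order_trans[of 0 1])
qed

text \<open>The criterion of Holley: log-supermodular weights are stochastically ordered.\<close>
lemma holley:
  assumes w: "weight V w0" "weight V w1"
	and F: "F0 : bm P" "F1 : bm P" "depends_on V F0" "depends_on V F1"
	and hol: "!!a b. \<forall>x. 0 <= a x ==> \<forall>x. 0 <= b x ==>
	   w0 a * w1 b <= w1 (%x. max (a x) (b x)) * w0 (%x. min (a x) (b x))"
	and le: "!!a b. \<forall>x. 0 <= a x & a x <= b x ==> F0 a <= (F1 b :: ennreal)"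
  shows "(\<integral>\<^sup>+a. F0 a \<partial>gibbs_law mu w0) <= (\<integral>\<^sup>+a. F1 a \<partial>gibbs_law mu w1)"
proof -
  have [measurable]: "w0 : bm P" "w1 : bm P" using w by (simp_all add: weight_def)
  have fV: "finite V" using w by (simp add: weight_def)
  have d: "depends_on V w0" "depends_on V w1" using w by (simp_all add: weight_def)
  have nn: "0 <= w0 a" "0 <= w1 a" if "\<forall>x. 0 <= a x" for a
	using that w by (auto simp: weight_def intro: order_trans[of 0 1])
  have i: "(\<integral>\<^sup>+a. ennreal (w a) \<partial>P) = ennreal (\<integral>a. w a \<partial>P)" if "weight V w" for w
	using weight_integrable[OF that] that
	by (intro nn_integral_eq_integral) (auto simp: space_P weight_def intro!: AE_I2 intro: order_trans[of 0 1])
  have "(\<integral>\<^sup>+a. F0 a * ennreal (w0 a) \<partial>P) * (\<integral>\<^sup>+a. ennreal (w1 a) \<partial>P)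
	  <= (\<integral>\<^sup>+a. F1 a * ennreal (w1 a) \<partial>P) * (\<integral>\<^sup>+a. ennreal (w0 a) \<partial>P)"
  proof (rule four_functions[OF fV])
	fix a b :: "'v => real" assume ab: "\<forall>x. 0 <= a x" "\<forall>x. 0 <= b x"
	let ?M = "%x. max (a x) (b x)" and ?m = "%x. min (a x) (b x)"
	have nn': "\<forall>x. 0 <= ?M x" "\<forall>x. 0 <= ?m x" using ab by (auto simp: le_max_iff_disj)
	have "F0 a * ennreal (w0 a) * ennreal (w1 b) = F0 a * ennreal (w0 a * w1 b)"
	  using nn ab by (simp add: ennreal_mult mult.assoc)
	also have "... <= F1 ?M * ennreal (w1 ?M * w0 ?m)"
	  using hol[OF ab] le[of a ?M] ab by (intro mult_mono) (auto intro!: ennreal_leI)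
	also have "... = F1 ?M * ennreal (w1 ?M) * ennreal (w0 ?m)"
	  using nn nn' by (simp add: ennreal_mult mult.assoc)
	finally show "F0 a * ennreal (w0 a) * ennreal (w1 b) <= F1 ?M * ennreal (w1 ?M) * ennreal (w0 ?m)" .
  qed (use F d in \<open>auto intro!: depends_on_combine[of V _ _ "%u v. u * ennreal v"] depends_on_combine[of V _ _ "%u v. ennreal v"]\<close>)
  then have "(\<integral>\<^sup>+a. F0 a * ennreal (w0 a) \<partial>P) / ennreal (\<integral>a. w0 a \<partial>P)
	  <= (\<integral>\<^sup>+a. F1 a * ennreal (w1 a) \<partial>P) / ennreal (\<integral>a. w1 a \<partial>P)"
	unfolding i[OF w(1)] i[OF w(2)]
  proof -
	define A B where "A = (\<integral>\<^sup>+a. F0 a * ennreal (w0 a) \<partial>P)" and "B = (\<integral>\<^sup>+a. F1 a * ennreal (w1 a) \<partial>P)"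
	define p q where "p = ennreal (\<integral>a. w0 a \<partial>P)" and "q = ennreal (\<integral>a. w1 a \<partial>P)"
	have pq: "p ~= 0" "p ~= \<infinity>" "q ~= 0" "q ~= \<infinity>"
	  using weight_integral_pos[OF w(1)] weight_integral_pos[OF w(2)] by (auto simp: p_def q_def)
	assume "A * q <= B * p"
	then have "A * q / q / p <= B * p / q / p" by (intro divide_right_mono_ennreal)
	moreover have "A * q / q = A" using pq by (simp add: ennreal_mult_divide_eq)
	moreover have "B * p / q / p = B / q"
	proof -
	  have "B * p / q / p = B / q * p / p" by (simp add: ennreal_times_divide mult.commute)
	  then show ?thesis using pq by (simp add: ennreal_mult_divide_eq)
	qed
	ultimately show "A / p <= B / q" by simp
  qed
  then show ?thesis
	using gibbs_nn_integral[OF w(1) F(1)] gibbs_nn_integral[OF w(2) F(2)] by simp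
qed

lemma weight_part_fun:
  assumes "bonds V E" "finite U" "!!e. e : E ==> 0 <= J e"
  shows "weight V (part_fun U E J)"
  unfolding weight_def using assms
  by (auto intro!: depends_on_part_fun gaussian_part_fun part_fun_ge_1) (auto simp: bonds_def)

lemma weight_mult:
  assumes "weight V f" "weight V g" shows "weight V (%a. f a * g a)"
proof -
  have "1 <= f a * g a" if "\<forall>x. 0 <= a x" for a
	using mult_mono[of 1 "f a" 1 "g a"] assms that by (force simp: weight_def)
  then show ?thesis
	using assms unfolding weight_def
	by (auto intro!: depends_on_combine[of V f g "(*)"] gaussian_mult)
qed

text \<open>Raising the couplings, or inserting an increasing factor, raises the field stochastically.\<close>
lemma gibbs_stochastic_mono:
  assumes E: "bonds V E" and fin: "finite U" and J: "!!e. e : E ==> 0 <= J e & J e <= J' e"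
	and phi: "weight V ph" "!!a b. \<forall>x. 0 <= a x & a x <= b x ==> ph a <= ph b"
	and F: "F0 : bm P" "F1 : bm P" "depends_on V F0" "depends_on V F1"
	and le: "!!a b. \<forall>x. 0 <= a x & a x <= b x ==> F0 a <= (F1 b :: ennreal)"
  shows "(\<integral>\<^sup>+a. F0 a \<partial>gibbs_law mu (part_fun U E J)) <= (\<integral>\<^sup>+a. F1 a \<partial>gibbs_law mu (%a. ph a * part_fun U E J' a))"
proof (rule holley[of V])
  show "weight V (part_fun U E J)" using E fin J by (intro weight_part_fun) auto
  show "weight V (%a. ph a * part_fun U E J' a)"
	using E fin J phi(1) by (intro weight_mult weight_part_fun) (auto intro: order_trans)
  fix a b :: "'v => real" assume ab: "\<forall>x. 0 <= a x" "\<forall>x. 0 <= b x"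
  let ?M = "%x. max (a x) (b x)" and ?m = "%x. min (a x) (b x)"
  have p: "0 <= part_fun U E K c" for K c using ising_Z_pos[OF fin] by (rule less_imp_le)
  have "part_fun U E J a * (ph b * part_fun U E J' b) = ph b * (part_fun U E J a * part_fun U E J' b)"
	by (simp add: mult_ac)
  also have "... <= ph ?M * (part_fun U E J' ?M * part_fun U E J ?m)"
  proof (rule mult_mono)
	show "part_fun U E J a * part_fun U E J' b <= part_fun U E J' ?M * part_fun U E J ?m"
	  by (rule part_fun_supermodular[OF fin E J]) (use ab in auto)
	show "ph b <= ph ?M" using ab by (intro phi(2)) auto
	have "1 <= ph ?M" using phi(1) ab by (auto simp: weight_def le_max_iff_disj)
	then show "0 <= ph ?M" by simp
  qed (use p in auto)
  finally show "part_fun U E J a * (ph b * part_fun U E J' b) <= ph ?M * part_fun U E J' ?M * part_fun U E J ?m"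
	by (simp add: mult_ac)
qed (use F le in auto)

end

section \<open>The lattice and the two boundary conditions\<close>

lemma adjacent_neq: "adjacent x y ==> x ~= y"
  by (auto simp: adjacent_def)

lemma adjacent_commute: "adjacent x y \<longleftrightarrow> adjacent y x"
  by (simp add: adjacent_def abs_minus_commute)

definition cube :: "nat => 'd::finite site set" where
  "cube n = {x. \<forall>i. \<bar>x $ i\<bar> <= int n}"

lemma cube_eq: "cube n = vec_lambda ` (PiE UNIV (%_. {- int n..int n}))"
proof safe
  fix x :: "'d::finite site" assume "x : cube n"
  then have "(%i. x $ i) : PiE UNIV (%_. {- int n..int n})" by (auto simp: cube_def abs_le_iff minus_le_iff)
  moreover have "x = vec_lambda (%i. x $ i)" by simp
  ultimately show "x : vec_lambda ` (PiE UNIV (%_. {- int n..int n}))" by blast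
next
  fix f assume "f : PiE (UNIV::'d::finite set) (%_. {- int n..int n})"
  then have "\<bar>f i\<bar> <= int n" for i using PiE_mem[of f UNIV _ i] by (auto simp: abs_le_iff minus_le_iff)
  then show "vec_lambda f : cube n" by (auto simp: cube_def)
qed

lemma finite_cube[simp]: "finite (cube n)"
  unfolding cube_eq by (intro finite_imageI finite_PiE) auto

lemma card_cube: "card (cube n :: 'd::finite site set) = (2 * n + 1) ^ CARD('d)"
proof -
  have "inj_on vec_lambda (PiE (UNIV::'d set) (%_. {- int n..int n}))"
	by (auto simp: inj_on_def vec_lambda_inject)
  then have "card (cube n :: 'd site set) = (\<Prod>i\<in>(UNIV::'d set). card {- int n..int n})"
	unfolding cube_eq by (simp add: card_image card_PiE)
  also have "... = (2 * n + 1) ^ CARD('d)" by (simp add: nat_add_distrib nat_mult_distrib)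
  finally show ?thesis .
qed

lemma cube_mono: "m <= n ==> cube m <= cube n"
  by (auto simp: cube_def intro: order_trans)

lemma cube_add: "x : cube m ==> y : cube n ==> x + y : cube (m + n)"
  unfolding cube_def by (auto simp: intro: order_trans[OF abs_triangle_ineq] add_mono)

lemma finite_subset_cube:
  assumes "finite S" obtains n where "S <= cube n"
proof -
  define n where "n = (\<Sum>x\<in>S. \<Sum>i\<in>UNIV. nat \<bar>x $ i\<bar>)"
  have "S <= cube n"
  proof
	fix x assume x: "x : S"
	have "nat \<bar>x $ i\<bar> <= n" for i
	proof -
	  have "nat \<bar>x $ i\<bar> <= (\<Sum>i\<in>UNIV. nat \<bar>x $ i\<bar>)" by (intro member_le_sum) auto
	  also have "... <= n" unfolding n_def using x assms by (intro member_le_sum[of x S "%x. \<Sum>i\<in>UNIV. nat \<bar>x $ i\<bar>"]) auto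
	  finally show ?thesis .
	qed
	then show "x : cube n" by (auto simp: cube_def nat_le_iff)
  qed
  then show ?thesis by (rule that)
qed

lemma adjacent_diff_cube: "adjacent x y ==> y - x : cube 1"
proof -
  assume "adjacent x y"
  then have s: "(\<Sum>i\<in>UNIV. \<bar>x $ i - y $ i\<bar>) = 1" by (simp add: adjacent_def)
  have "\<bar>x $ i - y $ i\<bar> <= 1" for i
	unfolding s[symmetric] by (intro member_le_sum) auto
  then show ?thesis by (auto simp: cube_def abs_minus_commute)
qed

lemma finite_neighbours: "finite {y. adjacent x y}"
proof (rule finite_subset)
  show "{y. adjacent x y} <= (%z. z + x) ` cube 1"
  proof
	fix y assume "y : {y. adjacent x y}"
	then have "y - x : cube 1" using adjacent_diff_cube by auto
	moreover have "y = (y - x) + x" by simp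
	ultimately show "y : (%z. z + x) ` cube 1" by blast
  qed
qed auto

lemma finite_ext_boundary:
  assumes "finite U" shows "finite (EB U)"
proof -
  have "finite (\<Union>x\<in>U. {y. adjacent x y})" using assms finite_neighbours by blast
  moreover have "EB U <= (\<Union>x\<in>U. {y. adjacent x y})" by (auto simp: ext_boundary_def)
  ultimately show ?thesis by (rule rev_finite_subset)
qed

lemma finite_site_closure: "finite U ==> finite (SC U)"
  by (simp add: site_closure_def finite_ext_boundary)

lemma bonds_touching:
  assumes "finite U" shows "bonds (SC U) (TE U)"
  unfolding bonds_def
proof (intro conjI ballI)
  fix e assume "e : TE U"
  then obtain x y where e: "e = {x, y}" "x : U" "adjacent x y" by (auto simp: touching_edges_def)
  then show "e <= SC U" by (auto simp: site_closure_def ext_boundary_def)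
  show "card e = 2" using e adjacent_neq[of x y] by simp
qed (rule finite_site_closure[OF assms])

lemma bonds_inner: "finite U ==> bonds U (IE U)"
  unfolding bonds_def by (auto simp: inner_edges_def card_insert_if dest: adjacent_neq)

lemma inner_subset_touching: "IE U <= TE U"
  by (auto simp: inner_edges_def touching_edges_def)

lemma inner_edges_mono: "U <= U' ==> IE U <= IE U'"
  by (auto simp: inner_edges_def)

lemma inner_edges_iff: "e : IE U \<longleftrightarrow> e : IE UNIV & e <= U"
  by (auto simp: inner_edges_def)

lemma touching_edges_iff: "e : TE U \<longleftrightarrow> e : IE UNIV & e Int U ~= {}"
proof
  assume "e : IE UNIV & e Int U ~= {}"
  then obtain x y where e: "e = {x, y}" "adjacent x y" "x : U \<or> y : U" by (auto simp: inner_edges_def)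
  then show "e : TE U"
	unfolding touching_edges_def using adjacent_commute[of x y] by (auto simp: insert_commute)
qed (auto simp: touching_edges_def inner_edges_def)

subsection \<open>Laws\<close>

definition good_law :: "real measure => bool" where
  "good_law ka \<longleftrightarrow> sets ka = sets borel & (\<forall>c. (\<integral>\<^sup>+t. ennreal (exp (c * t\<^sup>2)) \<partial>ka) < \<infinity>) & emeasure ka {0..} > 0"

text \<open>The law of the absolute value of a spin: a nonzero value has two signs.\<close>
definition abs_law :: "real measure => real measure" where
  "abs_law rh = normalized_measure (density (nonneg_part rh) (%t. if t = 0 then 1 else 2))"

text \<open>Boundary spins carry no sign of their own, since the boundary is wired.\<close>
definition bdry_law :: "real measure => real measure" where
  "bdry_law ka = normalized_measure (nonneg_part ka)"

definition site_law :: "real measure => real measure => 'v set => 'v => real measure" where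
  "site_law rh ka U x = (if x : U then abs_law rh else bdry_law ka)"

lemma sets_normalized[simp]: "sets (normalized_measure M) = sets M"
  by (simp add: normalized_measure_def)

lemma space_normalized[simp]: "space (normalized_measure M) = space M"
  by (rule sets_eq_imp_space_eq) simp

lemma nn_integral_normalized:
  assumes "f : bm M"
  shows "(\<integral>\<^sup>+x. f x \<partial>normalized_measure M) = (\<integral>\<^sup>+x. f x \<partial>M) / emeasure M (space M)"
  using assms by (simp add: normalized_measure_def nn_integral_scale_measure divide_ennreal_def mult.commute)

lemma prob_space_normalized:
  assumes "0 < emeasure M (space M)" "emeasure M (space M) < \<infinity>"
  shows "prob_space (normalized_measure M)"
proof
  let ?e = "emeasure M (space M)"
  have "emeasure (normalized_measure M) (space (normalized_measure M)) = 1 / ?e * ?e"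
	unfolding space_normalized by (simp add: normalized_measure_def)
  also have "... = ?e / ?e" by (simp add: ennreal_times_divide mult.commute)
  also have "... = 1" using assms by (intro ennreal_divide_self) auto
  finally show "emeasure (normalized_measure M) (space (normalized_measure M)) = 1" .
qed

lemma sets_nonneg_part: "sets ka = sets borel ==> sets (nonneg_part ka) = sets nnb"
  unfolding nonneg_part_def by (rule sets_restrict_space_cong)

lemma space_nonneg_part: "sets ka = sets borel ==> space (nonneg_part ka) = {0..}"
  using sets_eq_imp_space_eq[OF sets_nonneg_part] by (simp add: space_nonneg_borel)

lemma nn_integral_nonneg_part:
  assumes "sets ka = sets borel"
  shows "(\<integral>\<^sup>+t. f t \<partial>nonneg_part ka) = (\<integral>\<^sup>+t. f t * indicator {0..} t \<partial>ka)"
  unfolding nonneg_part_def using sets_eq_imp_space_eq[OF assms]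
  by (subst nn_integral_restrict_space) (auto simp: assms)

lemma borel_measurable_nonneg_part:
  assumes "sets ka = sets borel" "f : bm borel"
  shows "f : bm (nonneg_part ka)"
  unfolding nonneg_part_def by (intro measurable_restrict_space1) (use assms measurable_cong_sets in blast)

lemma good_law_total:
  assumes "good_law ka"
  shows "0 < emeasure (nonneg_part ka) {0..}" "emeasure (nonneg_part ka) {0..} < \<infinity>"
proof -
  have s: "sets ka = sets borel" using assms by (simp add: good_law_def)
  have e: "emeasure (nonneg_part ka) {0..} = emeasure ka {0..}"
	unfolding nonneg_part_def using s sets_eq_imp_space_eq[OF s] by (subst emeasure_restrict_space) auto
  show "0 < emeasure (nonneg_part ka) {0..}" unfolding e using assms by (simp add: good_law_def)
  have "emeasure ka {0..} <= emeasure ka (space ka)" by (rule emeasure_space)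
  also have "... = (\<integral>\<^sup>+t. ennreal (exp (0 * t\<^sup>2)) \<partial>ka)" by simp
  also have "... < \<infinity>" using assms unfolding good_law_def by blast
  finally show "emeasure (nonneg_part ka) {0..} < \<infinity>" unfolding e .
qed

lemma good_law_gauss:
  assumes "good_law ka" shows "(\<integral>\<^sup>+t. ennreal (exp (c * t\<^sup>2)) \<partial>nonneg_part ka) < \<infinity>"
proof -
  have s: "sets ka = sets borel" using assms by (simp add: good_law_def)
  have "(\<integral>\<^sup>+t. ennreal (exp (c * t\<^sup>2)) \<partial>nonneg_part ka) <= (\<integral>\<^sup>+t. ennreal (exp (c * t\<^sup>2)) \<partial>ka)"
	unfolding nn_integral_nonneg_part[OF s] by (intro nn_integral_mono) (auto simp: indicator_def)
  also have "... < \<infinity>" using assms unfolding good_law_def by blast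
  finally show ?thesis .
qed

lemma sets_abs_law: "sets rh = sets borel ==> sets (abs_law rh) = sets nnb"
  unfolding abs_law_def sets_normalized sets_density by (rule sets_nonneg_part)

lemma sets_bdry_law: "sets rh = sets borel ==> sets (bdry_law rh) = sets nnb"
  unfolding bdry_law_def sets_normalized by (rule sets_nonneg_part)

definition abs_mass :: "real measure => ennreal" where
  "abs_mass rh = (\<integral>\<^sup>+t. (if t = 0 then 1 else 2) \<partial>nonneg_part rh)"

lemma abs_factor_measurable:
  assumes "sets rh = sets borel" shows "(%t. if t = 0 then 1 else 2::ennreal) : bm (nonneg_part rh)"
proof (rule borel_measurable_nonneg_part[OF assms])
  show "(%t::real. if t = 0 then 1 else 2::ennreal) : bm borel"
	by (intro measurable_If) auto
qed

lemma abs_mass: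
  assumes "good_law rh" shows "0 < abs_mass rh" "abs_mass rh < \<infinity>"
proof -
  have s: "sets rh = sets borel" using assms by (simp add: good_law_def)
  have sp: "space (nonneg_part rh) = {0..}" using space_nonneg_part[OF s] .
  have "emeasure (nonneg_part rh) {0..} = (\<integral>\<^sup>+t. 1 \<partial>nonneg_part rh)" by (simp add: sp)
  also have "... <= abs_mass rh" unfolding abs_mass_def by (intro nn_integral_mono) simp
  finally show "0 < abs_mass rh" using good_law_total[OF assms] by auto
  have "abs_mass rh <= (\<integral>\<^sup>+t. 2 \<partial>nonneg_part rh)" unfolding abs_mass_def by (intro nn_integral_mono) auto
  also have "... < \<infinity>" using good_law_total[OF assms] by (simp add: sp ennreal_mult_less_top)
  finally show "abs_mass rh < \<infinity>" .
qed

lemma nn_integral_abs_law: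
  assumes "good_law rh" "f : bm nnb"
  shows "(\<integral>\<^sup>+t. f t \<partial>abs_law rh) = (\<integral>\<^sup>+t. f t * (if t = 0 then 1 else 2) \<partial>nonneg_part rh) / abs_mass rh"
proof -
  have s: "sets rh = sets borel" using assms by (simp add: good_law_def)
  note [measurable] = abs_factor_measurable[OF s]
  have [measurable]: "f : bm (nonneg_part rh)"
	using assms(2) measurable_cong_sets[OF sets_nonneg_part[OF s] refl] by blast
  have "emeasure (density (nonneg_part rh) (%t. if t = 0 then 1 else 2)) (space (nonneg_part rh)) = abs_mass rh"
	by (subst emeasure_density) (auto simp: abs_mass_def intro!: nn_integral_cong)
  then show ?thesis
	unfolding abs_law_def by (subst nn_integral_normalized) (auto simp: nn_integral_density mult.commute)
qed

lemma nn_integral_bdry_law: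
  assumes "good_law ka" "f : bm nnb"
  shows "(\<integral>\<^sup>+t. f t \<partial>bdry_law ka) = (\<integral>\<^sup>+t. f t \<partial>nonneg_part ka) / emeasure (nonneg_part ka) {0..}"
proof -
  have s: "sets ka = sets borel" using assms by (simp add: good_law_def)
  have [measurable]: "f : bm (nonneg_part ka)"
	using assms(2) measurable_cong_sets[OF sets_nonneg_part[OF s] refl] by blast
  show ?thesis unfolding bdry_law_def by (subst nn_integral_normalized) (auto simp: space_nonneg_part[OF s])
qed

lemma prob_abs_law: assumes "good_law rh" shows "prob_space (abs_law rh)"
proof -
  have s: "sets rh = sets borel" using assms by (simp add: good_law_def)
  note [measurable] = abs_factor_measurable[OF s]
  have "emeasure (density (nonneg_part rh) (%t. if t = 0 then 1 else 2)) (space (nonneg_part rh)) = abs_mass rh"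
	by (subst emeasure_density) (auto simp: abs_mass_def intro!: nn_integral_cong)
  then show ?thesis unfolding abs_law_def using abs_mass[OF assms] by (intro prob_space_normalized) auto
qed

lemma prob_bdry_law: assumes "good_law ka" shows "prob_space (bdry_law ka)"
proof -
  have s: "sets ka = sets borel" using assms by (simp add: good_law_def)
  show ?thesis unfolding bdry_law_def using good_law_total[OF assms] space_nonneg_part[OF s]
	by (intro prob_space_normalized) auto
qed

lemma gauss_measurable: "(%t. ennreal (exp (c * t\<^sup>2))) : bm nnb"
  by (intro borel_measurable_nonneg_part) auto

lemma ennreal_divide_finite:
  fixes x y :: ennreal
  assumes "x < \<infinity>" "0 < y" shows "x / y < \<infinity>"
proof -
  have "x / y ~= top" using assms by (auto simp: ennreal_divide_eq_top_iff)
  then show ?thesis by (simp add: less_top)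
qed

lemma site_laws_site_law:
  assumes r: "good_law rh" and k: "good_law ka" shows "site_laws (site_law rh ka U)"
proof (rule site_laws.intro)
  have s: "sets rh = sets borel" "sets ka = sets borel" using r k by (simp_all add: good_law_def)
  fix x
  show "prob_space (site_law rh ka U x)"
	using prob_abs_law[OF r] prob_bdry_law[OF k] by (auto simp: site_law_def)
  show "sets (site_law rh ka U x) = sets nnb"
	using s by (auto simp: site_law_def sets_abs_law sets_bdry_law)
  fix c
  have "(\<integral>\<^sup>+t. ennreal (exp (c * t\<^sup>2)) \<partial>abs_law rh) < \<infinity>"
  proof -
	have "(\<integral>\<^sup>+t. ennreal (exp (c * t\<^sup>2)) * (if t = 0 then 1 else 2) \<partial>nonneg_part rh)
	  <= (\<integral>\<^sup>+t. ennreal (exp (c * t\<^sup>2)) * 2 \<partial>nonneg_part rh)"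
	  by (intro nn_integral_mono mult_left_mono) auto
	also have "... = (\<integral>\<^sup>+t. ennreal (exp (c * t\<^sup>2)) \<partial>nonneg_part rh) * 2"
	  by (intro nn_integral_multc borel_measurable_nonneg_part s) auto
	also have "... < \<infinity>" using good_law_gauss[OF r] by (simp add: ennreal_mult_less_top)
	finally show ?thesis
	  unfolding nn_integral_abs_law[OF r gauss_measurable] using abs_mass[OF r]
	  by (intro ennreal_divide_finite)
  qed
  moreover have "(\<integral>\<^sup>+t. ennreal (exp (c * t\<^sup>2)) \<partial>bdry_law ka) < \<infinity>"
	unfolding nn_integral_bdry_law[OF k gauss_measurable] using good_law_gauss[OF k, of c] good_law_total[OF k]
	by (intro ennreal_divide_finite)
  ultimately show "(\<integral>\<^sup>+t. ennreal (exp (c * t\<^sup>2)) \<partial>site_law rh ka U x) < \<infinity>"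
	by (auto simp: site_law_def)
qed

abbreviation FA :: "('v => real) measure" where
  "FA \<equiv> PiM UNIV (%_. nnb)"

lemma (in site_laws) sets_P: "sets P = sets FA"
  by (intro sets_PiM_cong) (auto simp: sets_site)

lemma (in site_laws) measurable_P: "measurable P N = measurable FA N"
  by (intro measurable_cong_sets sets_P refl)

lemma nn_integral_site_cong:
  assumes "site_laws mu" "site_laws mu'" "!!x. x : V ==> mu x = mu' x"
	and f: "f : bm FA" "depends_on V f"
  shows "(\<integral>\<^sup>+a. f a \<partial>PiM UNIV mu) = (\<integral>\<^sup>+a. f a \<partial>PiM UNIV mu')"
proof -
  interpret A: site_laws mu by fact
  interpret B: site_laws mu' by fact
  have "PiM V mu = PiM V mu'" using assms(3) by (intro PiM_cong) auto
  then show ?thesis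
	using A.nn_integral_depends_on[of f V] B.nn_integral_depends_on[of f V] f
	by (simp add: A.measurable_P B.measurable_P)
qed

lemma gibbs_nn_cong:
  assumes L: "site_laws mu" "site_laws mu'" and eq: "!!x. x : V ==> mu x = mu' x"
	and w: "site_laws.weight mu V w"
	and f: "f : bm FA" "depends_on V f"
  shows "(\<integral>\<^sup>+a. f a \<partial>gibbs_law mu w) = (\<integral>\<^sup>+a. f a \<partial>gibbs_law mu' w)"
proof -
  interpret A: site_laws mu by fact
  interpret B: site_laws mu' by fact
  have wm: "w : bm FA" and wd: "depends_on V w"
	using w by (auto simp: A.weight_def A.measurable_P)
  have w': "B.weight V w" using w unfolding A.weight_def B.weight_def A.measurable_P B.measurable_P .
  have i: "ennreal (\<integral>a. w a \<partial>PiM UNIV \<nu>) = (\<integral>\<^sup>+a. ennreal (w a) \<partial>PiM UNIV \<nu>)"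
	if "site_laws \<nu>" "site_laws.weight \<nu> V w" for \<nu>
  proof -
	interpret C: site_laws \<nu> by fact
	show ?thesis using C.weight_integrable[OF that(2)] that(2)
	  by (intro nn_integral_eq_integral[symmetric]) (auto simp: C.space_P C.weight_def intro!: AE_I2 intro: order_trans[of 0 1])
  qed
  have "(\<integral>\<^sup>+a. ennreal (w a) \<partial>PiM UNIV mu) = (\<integral>\<^sup>+a. ennreal (w a) \<partial>PiM UNIV mu')"
	by (rule nn_integral_site_cong[OF L eq]) (use wm wd in \<open>auto intro: depends_on_combine[of V w w "%u v. ennreal u"]\<close>)
  moreover have "(\<integral>\<^sup>+a. f a * ennreal (w a) \<partial>PiM UNIV mu) = (\<integral>\<^sup>+a. f a * ennreal (w a) \<partial>PiM UNIV mu')"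
	by (rule nn_integral_site_cong[OF L eq]) (use wm wd f in \<open>auto intro: depends_on_combine[of V f w "%u v. u * ennreal v"]\<close>)
  ultimately show ?thesis
	using A.gibbs_nn_integral[OF w, of f] B.gibbs_nn_integral[OF w', of f] f(1) i[OF L(1) w] i[OF L(2) w']
	by (simp add: A.measurable_P B.measurable_P)
qed

lemma gibbs_law_scale:
  assumes "(c::real) ~= 0" shows "gibbs_law mu (%a. c * w a) = gibbs_law mu w"
  using assms by (simp add: gibbs_law_def)

lemma ising_sum_extend:
  assumes fin: "finite U'" "U <= U'" "finite E'" "E <= E'"
	and K: "!!e. e : E' - E ==> K e = 0"
	and E: "!!e. e : E ==> e Int U' <= U" and f: "!!A. A <= U' ==> f A = f (A Int U)"
  shows "ising_sum U' E' K f = 2 ^ card (U' - U) * ising_sum U E K f"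
proof -
  let ?g = "%A. f A * exp (\<Sum>e\<in>E. K e * spins e A)"
  have g: "?g A = ?g (A Int U)" if "A <= U'" for A
  proof -
	have "spins e A = spins e (A Int U)" if "e : E" for e
	  unfolding spins_def using E[OF that] \<open>A <= U'\<close> by (intro prod.cong) (auto simp: spin_of_def)
	then show ?thesis using f[OF that] by (simp cong: sum.cong)
  qed
  have "(\<Sum>e\<in>E'. K e * spins e A) = (\<Sum>e\<in>E. K e * spins e A)" for A
	using fin K by (intro sum.mono_neutral_right) auto
  then have "ising_sum U' E' K f = (\<Sum>A\<in>Pow U'. ?g A)" by (simp add: ising_sum_def)
  also have "... = (\<Sum>(A, B)\<in>Pow U \<times> Pow (U' - U). ?g (A Un B))"
	by (rule sum.reindex_bij_witness[where i = "%(A, B). A Un B" and j = "%A. (A Int U, A - U)"])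
	  (use fin in \<open>auto simp: Un_Diff_Int Int_Diff_Un\<close>)
  also have "... = (\<Sum>(A, B)\<in>Pow U \<times> Pow (U' - U). ?g A)"
  proof (intro sum.cong refl, clarify)
	fix A B assume "A <= U" "B <= U' - U"
	then have "(A Un B) Int U = A" "A Un B <= U'" using fin by auto
	then show "?g (A Un B) = ?g A" using g[of "A Un B"] by simp
  qed
  also have "... = 2 ^ card (U' - U) * ising_sum U E K f"
	using fin by (simp add: sum.cartesian_product[symmetric] ising_sum_def sum_distrib_left card_Pow)
  finally show ?thesis .
qed

definition free_law :: "real measure => real => 'd::finite site set => ('d site => real) measure" where
  "free_law rh be U = gibbs_law (%_. abs_law rh) (part_fun U (IE U) (%_. be))"

text \<open>The boundary component contributes a factor 2 to the number of colourings exactly when some boundary site is a vertex.\<close>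
definition bdry_factor :: "'d::finite site set => ('d site => real) => real" where
  "bdry_factor U a = (if \<exists>x\<in>EB U. a x ~= 0 then 2 else 1)"

text \<open>The factor \<open>ph\<close> is the only difference between the wired random cluster field (\<open>bdry_factor\<close>) and the plus spin model (constant 1), so both are treated together.\<close>
definition plus_law :: "real measure => real measure => (('d site => real) => real) => real => 'd::finite site set => ('d site => real) measure" where
  "plus_law rh ka ph be U = gibbs_law (site_law rh ka U) (%a. ph a * part_fun U (TE U) (%_. be) a)"

abbreviation wired_law where
  "wired_law rh ka be U \<equiv> plus_law rh ka (bdry_factor U) be U"

definition bdry_weight :: "'d::finite site set => (('d site => real) => real) => bool" where
  "bdry_weight U ph \<longleftrightarrow> ph : bm FA & depends_on (SC U) ph &
	 (\<forall>a. 1 <= ph a & ph a <= 2) & (\<forall>a b. (\<forall>x. 0 <= a x & a x <= b x) --> ph a <= ph b)"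

lemma bdry_weight_1: "bdry_weight U (%_. 1)"
  by (auto simp: bdry_weight_def depends_on_def)

lemma component_field_measurable[measurable]: "(%a. a x) : bm FA"
proof -
  have "(%t. t) : bm nnb"
	unfolding nonneg_part_def by (intro measurable_restrict_space1) simp
  then show ?thesis by (rule measurable_compose[OF measurable_component_singleton[OF UNIV_I]])
qed

lemma bdry_weight_factor:
  assumes "finite U" shows "bdry_weight U (bdry_factor U)"
  unfolding bdry_weight_def
proof (intro conjI allI impI)
  have [measurable]: "Measurable.pred FA (%a. \<exists>x\<in>EB U. a x ~= 0)"
	using finite_ext_boundary[OF assms] by measurable
  show "bdry_factor U : bm FA" unfolding bdry_factor_def by measurable
  show "depends_on (SC U) (bdry_factor U)"
	by (rule depends_onI) (auto simp: bdry_factor_def site_closure_def)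
  fix a b :: "'a site => real" assume ab: "\<forall>x. 0 <= a x & a x <= b x"
  have "b x ~= 0" if "a x ~= 0" for x using ab that by (smt (verit))
  then show "bdry_factor U a <= bdry_factor U b" by (auto simp: bdry_factor_def)
qed (auto simp: bdry_factor_def)

lemma weight_bdry:
  assumes "site_laws mu" "finite U" "bdry_weight U ph" shows "site_laws.weight mu (SC U) ph"
proof -
  interpret site_laws mu by fact
  have "\<bar>ph a\<bar> <= 2" "1 <= ph a" for a using assms(3) unfolding bdry_weight_def by (smt (verit))+
  then show ?thesis
	using assms unfolding weight_def bdry_weight_def measurable_P
	by (auto simp: finite_site_closure intro!: gaussian_bounded[of _ 2])
qed

lemma site_laws_abs:
  assumes "good_law rh" shows "site_laws (%_::'a. abs_law rh)"
proof -
  have "(%_::'a. abs_law rh) = site_law rh rh UNIV" by (auto simp: site_law_def)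
  then show ?thesis using site_laws_site_law[OF assms assms, of UNIV] by simp
qed

lemma weight_free:
  assumes "site_laws mu" "finite U" "0 <= be"
  shows "site_laws.weight mu U (part_fun U (IE U) (%_. be))"
  using assms by (intro site_laws.weight_part_fun bonds_inner) auto

lemma weight_plus:
  assumes "site_laws mu" "finite U" "0 <= be" "bdry_weight U ph"
  shows "site_laws.weight mu (SC U) (%a. ph a * part_fun U (TE U) (%_. be) a)"
  using assms by (intro site_laws.weight_mult site_laws.weight_part_fun weight_bdry bonds_touching) auto

lemma part_fun_free_touching:
  assumes "finite U"
  shows "part_fun U (TE U) (%e. if e : IE U then be else 0) = part_fun U (IE U) (%_. be)"
proof
  fix a
  have "part_fun U (TE U) (%e. if e : IE U then be else 0) a
	  = part_fun U (IE U) (%e. if e : IE U then be else 0) a"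
	unfolding ising_Z_def
	using bonds_finite[OF bonds_touching[OF assms]] inner_subset_touching[of U] assms
	by (subst ising_sum_extend[of U U _ "IE U"]) (auto simp: coupling_def)
  then show "part_fun U (TE U) (%e. if e : IE U then be else 0) a = part_fun U (IE U) (%_. be) a"
	unfolding ising_Z_def ising_sum_def coupling_def by (simp cong: sum.cong)
qed

text \<open>The free law is the law with the boundary couplings switched off.\<close>
lemma free_le_plus_nn:
  assumes r: "good_law rh" "good_law ka" and fin: "finite U" and b: "0 <= be" and phi: "bdry_weight U ph"
	and F: "F0 : bm FA" "F1 : bm FA"
	  "depends_on U F0" "depends_on (SC U) F1"
	and le: "!!a b. \<forall>x. 0 <= a x & a x <= b x ==> F0 a <= (F1 b :: ennreal)"
  shows "(\<integral>\<^sup>+a. F0 a \<partial>free_law rh be U) <= (\<integral>\<^sup>+a. F1 a \<partial>plus_law rh ka ph be U)"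
proof -
  interpret A: site_laws "%_::'a site. abs_law rh" by (rule site_laws_abs[OF r(1)])
  interpret B: site_laws "site_law rh ka U" by (rule site_laws_site_law[OF r])
  let ?J = "%e. if e : IE U then be else 0"
  have "(\<integral>\<^sup>+a. F0 a \<partial>free_law rh be U)
	= (\<integral>\<^sup>+a. F0 a \<partial>gibbs_law (site_law rh ka U) (part_fun U (IE U) (%_. be)))"
	unfolding free_law_def
	by (rule gibbs_nn_cong[OF A.site_laws_axioms B.site_laws_axioms _ weight_free[OF A.site_laws_axioms fin b] F(1,3)])
	  (simp add: site_law_def)
  also have "... = (\<integral>\<^sup>+a. F0 a \<partial>gibbs_law (site_law rh ka U) (part_fun U (TE U) ?J))"
	unfolding part_fun_free_touching[OF fin] ..
  also have "... <= (\<integral>\<^sup>+a. F1 a \<partial>plus_law rh ka ph be U)"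
	unfolding plus_law_def
	by (rule B.gibbs_stochastic_mono[OF bonds_touching[OF fin] fin])
	  (use b phi F le weight_bdry[OF B.site_laws_axioms fin phi] in \<open>auto simp: B.measurable_P bdry_weight_def site_closure_def intro: depends_on_mono\<close>)
  finally show ?thesis .
qed

lemma free_mono_nn:
  assumes r: "good_law rh" and fin: "finite U'" and sub: "U <= U'" and b: "0 <= be" "be <= be'"
	and F: "F0 : bm FA" "F1 : bm FA"
	  "depends_on U' F0" "depends_on U' F1"
	and le: "!!a b. \<forall>x. 0 <= a x & a x <= b x ==> F0 a <= (F1 b :: ennreal)"
  shows "(\<integral>\<^sup>+a. F0 a \<partial>free_law rh be U) <= (\<integral>\<^sup>+a. F1 a \<partial>free_law rh be' U')"
proof -
  interpret A: site_laws "%_::'a site. abs_law rh" by (rule site_laws_abs[OF r])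
  let ?J = "%e. if e : IE U then be else 0"
  have finE: "finite (IE U')" using bonds_finite[OF bonds_inner[OF fin]] .
  have "part_fun U' (IE U') ?J a = 2 ^ card (U' - U) * part_fun U (IE U) (%_. be) a" for a
  proof -
	have "part_fun U' (IE U') ?J a = 2 ^ card (U' - U) * part_fun U (IE U) ?J a"
	  unfolding ising_Z_def using inner_edges_mono[OF sub] sub fin finE
	  by (intro ising_sum_extend) (auto simp: coupling_def inner_edges_iff[of _ U])
	also have "part_fun U (IE U) ?J a = part_fun U (IE U) (%_. be) a"
	  unfolding ising_Z_def ising_sum_def coupling_def by (simp cong: sum.cong)
	finally show ?thesis .
  qed
  then have eq: "part_fun U' (IE U') ?J = (%a. 2 ^ card (U' - U) * part_fun U (IE U) (%_. be) a)" by auto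
  have "free_law rh be U = gibbs_law (%_. abs_law rh) (part_fun U' (IE U') ?J)"
	unfolding free_law_def eq by (subst gibbs_law_scale) (auto simp: eta_contract_eq)
  also have "(\<integral>\<^sup>+a. F0 a \<partial>...) <= (\<integral>\<^sup>+a. F1 a \<partial>gibbs_law (%_. abs_law rh) (%a. 1 * part_fun U' (IE U') (%_. be') a))"
	by (rule A.gibbs_stochastic_mono[OF bonds_inner[OF fin] fin])
	  (use b F le in \<open>auto simp: A.measurable_P A.weight_def fin depends_on_def intro!: gaussian_bounded[of _ 1]\<close>)
  finally show ?thesis unfolding free_law_def by (simp add: eta_contract_eq)
qed

section \<open>The Edwards-Sokal identity\<close>

lemma card_closed_sets:
  assumes r: "equiv V r" and fin: "finite V"
  shows "card {A : Pow V. \<forall>(x, y)\<in>r. x : A --> y : A} = 2 ^ card (V // r)"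
proof -
  have "bij_betw Union (Pow (V // r)) {A : Pow V. \<forall>(x, y)\<in>r. x : A --> y : A}"
  proof (rule bij_betw_byWitness[where f' = "%A. {c : V // r. c <= A}"])
	show "\<forall>a\<in>Pow (V // r). {c : V // r. c <= \<Union> a} = a"
	proof
	  fix a assume a: "a : Pow (V // r)"
	  have "c : a" if c: "c : V // r" "c <= \<Union>a" for c
	  proof -
		obtain x where x: "x : c" using in_quotient_imp_non_empty[OF r c(1)] by auto
		then obtain d where d: "d : a" "x : d" using c by auto
		then have "c = d" using quotient_disj[OF r c(1), of d] a x by auto
		then show ?thesis using d by simp
	  qed
	  then show "{c : V // r. c <= \<Union> a} = a" using a by auto
	qed
	show "\<forall>A\<in>{A : Pow V. \<forall>(x, y)\<in>r. x : A --> y : A}. \<Union> {c : V // r. c <= A} = A"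
	proof
	  fix A assume A: "A : {A : Pow V. \<forall>(x, y)\<in>r. x : A --> y : A}"
	  have "x : \<Union> {c : V // r. c <= A}" if x: "x : A" for x
	  proof -
		have "r `` {x} : V // r" using x A by (auto intro: quotientI)
		moreover have "r `` {x} <= A" using x A by auto
		moreover have "x : r `` {x}" using r x A by (auto simp: equiv_def refl_on_def)
		ultimately show ?thesis by blast
	  qed
	  then show "\<Union> {c : V // r. c <= A} = A" by auto
	qed
	show "Union ` Pow (V // r) <= {A : Pow V. \<forall>(x, y)\<in>r. x : A --> y : A}"
	proof
	  fix A assume "A : Union ` Pow (V // r)"
	  then obtain a where a: "a <= V // r" "A = \<Union>a" by auto
	  have "A <= V" using a in_quotient_imp_subset[OF r] by blast
	  moreover have "y : A" if "(x, y) : r" "x : A" for x y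
		using a that in_quotient_imp_closed[OF r] by blast
	  ultimately show "A : {A : Pow V. \<forall>(x, y)\<in>r. x : A --> y : A}" by auto
	qed
	show "(%A. {c : V // r. c <= A}) ` {A : Pow V. \<forall>(x, y)\<in>r. x : A --> y : A} <= Pow (V // r)" by auto
  qed
  then have "card (Pow (V // r)) = card {A : Pow V. \<forall>(x, y)\<in>r. x : A --> y : A}"
	by (rule bij_betw_same_card)
  then show ?thesis using finite_quotient[OF fin, of r] r by (simp add: card_Pow equiv_type)
qed

text \<open>Two to the number of components counts the unions of components, that is, the spin configurations constant on components.\<close>
lemma two_power_components:
  assumes fin: "finite V" and R: "sym R"
  shows "2 ^ num_components V R = card {A : Pow V. \<forall>x\<in>V. \<forall>y\<in>V. (x, y) : R --> (x : A \<longleftrightarrow> y : A)}"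
proof -
  let ?r = "(R Int V \<times> V)\<^sup>* Int V \<times> V"
  have s: "sym (R Int V \<times> V)" using R by (auto simp: sym_def)
  have "equiv V ?r"
  proof -
	have "?r <= V \<times> V" "refl_on V ?r" by (auto simp: refl_on_def)
	moreover have "sym ?r" using sym_rtrancl[OF s] by (auto simp: sym_def)
	moreover have "trans ?r" by (auto simp: trans_def intro: rtrancl_trans)
	ultimately show ?thesis by (auto simp: equiv_def)
  qed
  from card_closed_sets[OF this fin]
  have "2 ^ num_components V R = card {A : Pow V. \<forall>(x, y)\<in>?r. x : A --> y : A}"
	by (simp add: num_components_def)
  also have "{A : Pow V. \<forall>(x, y)\<in>?r. x : A --> y : A}
	= {A : Pow V. \<forall>x\<in>V. \<forall>y\<in>V. (x, y) : R --> (x : A \<longleftrightarrow> y : A)}"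
  proof (rule Collect_cong, rule conj_cong[OF refl], rule iffI)
	fix A assume A: "\<forall>(x, y)\<in>?r. x : A --> y : A"
	have "x : A \<longleftrightarrow> y : A" if xy: "x : V" "y : V" "(x, y) : R" for x y
	proof -
	  have "(x, y) : ?r" "(y, x) : ?r" using xy R by (auto simp: sym_def)
	  then show "x : A \<longleftrightarrow> y : A" using A by blast
	qed
	then show "\<forall>x\<in>V. \<forall>y\<in>V. (x, y) : R --> (x : A \<longleftrightarrow> y : A)" by blast
  next
	fix A assume A: "\<forall>x\<in>V. \<forall>y\<in>V. (x, y) : R --> (x : A \<longleftrightarrow> y : A)"
	have "x : A \<longleftrightarrow> y : A" if "(x, y) : (R Int V \<times> V)\<^sup>*" for x y
	  using that by induction (use A in auto)
	then show "\<forall>(x, y)\<in>?r. x : A --> y : A" by auto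
  qed
  finally show ?thesis .
qed

lemma spins_pair: "x ~= y ==> spins {x, y} A = 1 \<longleftrightarrow> (x : A \<longleftrightarrow> y : A)"
  by (auto simp: spins_def spin_of_def)

definition es_term :: "real => 'v set set => 'v set set => ('v => real) => 'v set => real" where
  "es_term be T F a A = (\<Prod>e\<in>F. (1 - exp (- 2 * coupling (%_. be) a e)) * ((1 + spins e A) / 2)) *
	 exp (\<Sum>e\<in>T. coupling (%_. be) a e * spins e A)"

lemma es_term_cong:
  assumes "finite T" "F <= T" "!!e. e : T ==> finite e"
	and "!!e. e : T ==> (\<forall>x\<in>e. a x ~= 0) ==> spins e A = spins e B"
  shows "es_term be T F a A = es_term be T F a B"
proof -
  have 1: "spins e A = spins e B \<or> coupling (%_. be) a e = 0" if "e : T" for e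
	using assms(3)[OF that] assms(4)[OF that] by (auto simp: coupling_def)
  have "(\<Sum>e\<in>T. coupling (%_. be) a e * spins e A) = (\<Sum>e\<in>T. coupling (%_. be) a e * spins e B)"
	by (intro sum.cong refl) (use 1 in auto)
  moreover have "(\<Prod>e\<in>F. (1 - exp (- 2 * coupling (%_. be) a e)) * ((1 + spins e A) / 2))
	 = (\<Prod>e\<in>F. (1 - exp (- 2 * coupling (%_. be) a e)) * ((1 + spins e B) / 2))"
	by (intro prod.cong refl) (use 1 assms(2) in force)
  ultimately show ?thesis by (simp add: es_term_def)
qed

lemma edge_factor_sum:
  fixes u s :: real
  assumes "s = 1 \<or> s = -1"
  defines "p \<equiv> 1 - exp (- 2 * u)"
  shows "(\<Sum>b\<in>(UNIV::bool set). (if inF --> b then (if b --> s = 1 then sqrt (1 - p) * (p / (1 - p)) ^ (if b then 1 else 0) else 0) else 0))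
	= (if inF then p * ((1 + s) / 2) else 1) * exp (u * s)"
proof -
  have q: "sqrt (1 - p) = exp (- u)"
  proof -
	have "1 - p = (exp (- u))\<^sup>2" by (simp add: p_def power2_eq_square flip: exp_add)
	then show ?thesis by simp
  qed
  have e: "1 - p = exp (- u) * exp (- u)" by (simp add: p_def flip: exp_add)
  have i: "exp (- u) * exp u = 1" by (simp flip: exp_add)
  have open': "sqrt (1 - p) * (p / (1 - p)) = p * exp u"
  proof -
	have "sqrt (1 - p) * (p / (1 - p)) = p / exp (- u)" unfolding q e by simp
	also have "... = p * exp u" by (simp add: exp_minus divide_inverse)
	finally show ?thesis .
  qed
  have o1: "exp (- u) * p / (1 - p) = p * exp u" using open' q by simp
  have o2: "exp (- u) * p * 2 / (1 - p) = p * 2 * exp u"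
	using arg_cong[OF o1, of "%t. t * 2"] by (simp add: mult_ac)
  have sum: "exp (- u) + p * exp u = exp u"
	by (simp add: p_def algebra_simps flip: exp_add)
  have pe: "p * exp u = exp u - exp (- u)" using sum by simp
  from assms(1) show ?thesis
	by (cases inF) (auto simp: UNIV_bool q o1 o2 sum)
qed

context
  fixes U :: "'d::finite site set" and a :: "'d site => real" and be :: real
  assumes fin: "finite U"
begin

lemma es_sum_edges:
  assumes F: "F <= TE U"
  shows "(\<Sum>om\<in>PiE (TE U) (%_. UNIV). (if \<forall>e\<in>F. om e then rc_weight be (wired_clusters U) U (om, a) else 0))
	= (\<Sum>A\<in>{A : Pow (nonzero_sites U a). \<forall>x\<in>nonzero_sites U a Int EB U.
		 \<forall>y\<in>nonzero_sites U a Int EB U. x : A \<longleftrightarrow> y : A}. es_term be (TE U) F a A)"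
proof -
  let ?T = "TE U" and ?V = "nonzero_sites U a" and ?D = "EB U"
  let ?p = "edge_probability be a"
  define h where "h = (%e b. sqrt (1 - ?p e) * (?p e / (1 - ?p e)) ^ (if b then 1 else (0::nat)))"
  define g where "g = (%A e b. if e : F --> b then (if b --> spins e A = 1 then h e b else 0) else 0)"
  let ?C = "{A : Pow ?V. \<forall>x\<in>?V Int ?D. \<forall>y\<in>?V Int ?D. x : A \<longleftrightarrow> y : A}"
  note bT = bonds_touching[OF fin]
  have finT: "finite ?T" using bonds_finite[OF bT] .
  have finV: "finite ?V" unfolding nonzero_sites_def using finite_site_closure[OF fin] by simp
  have p: "?p e = 1 - exp (- 2 * coupling (%_. be) a e)" for e
	by (simp add: edge_probability_def coupling_def)
  have zero: "h e True = 0" if "e : ?T" "~ e <= ?V" for e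
  proof -
	have "\<exists>x\<in>e. a x = 0" using that bonds_D[OF bT that(1)] by (auto simp: nonzero_sites_def)
	then have "coupling (%_. be) a e = 0" using bonds_D[OF bT that(1)] by (auto simp: coupling_def)
	then show ?thesis by (simp add: h_def p)
  qed
  have key: "(if \<forall>e\<in>F. om e then rc_weight be (wired_clusters U) U (om, a) else 0) = (\<Sum>A\<in>?C. \<Prod>e\<in>?T. g A e (om e))" for om
  proof -
	let ?R = "open_relation U om Un ?D \<times> ?D"
	have symR: "sym ?R" by (auto simp: sym_def open_relation_def insert_commute)
	let ?S = "{A : Pow ?V. \<forall>x\<in>?V. \<forall>y\<in>?V. (x, y) : ?R --> (x : A \<longleftrightarrow> y : A)}"
	have rc: "rc_weight be (wired_clusters U) U (om, a) = (\<Prod>e\<in>?T. h e (om e)) * real (card ?S)"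
	proof -
	  have "(2::real) ^ num_components ?V ?R = real (2 ^ num_components ?V ?R)" by simp
	  also have "... = real (card ?S)" unfolding two_power_components[OF finV symR] ..
	  finally show ?thesis by (simp add: rc_weight_def wired_clusters_def h_def)
	qed
	show ?thesis
	proof (cases "\<forall>e\<in>F. om e")
	  case False
	  then obtain e where "e : F" "~ om e" by auto
	  then have "(\<Prod>e\<in>?T. g A e (om e)) = 0" for A
		using finT F by (intro prod_zero) (auto simp: g_def)
	  then show ?thesis using False by auto
	next
	  case True
	  show ?thesis
	  proof (cases "\<exists>e\<in>?T. om e & ~ e <= ?V")
		case True
		then obtain e where e: "e : ?T" "om e" "~ e <= ?V" by auto
		have "(\<Prod>e\<in>?T. g A e (om e)) = 0" for A
		  using finT e zero[OF e(1,3)] by (intro prod_zero bexI[of _ e]) (simp_all add: g_def)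
		moreover have "(\<Prod>e\<in>?T. h e (om e)) = 0"
		  using finT e zero[OF e(1,3)] by (intro prod_zero bexI[of _ e]) simp_all
		ultimately show ?thesis by (simp add: rc)
	  next
		case good: False
		have pr: "(\<Prod>e\<in>?T. g A e (om e)) = (if \<forall>e\<in>?T. om e --> spins e A = 1 then \<Prod>e\<in>?T. h e (om e) else 0)" for A
		proof (cases "\<forall>e\<in>?T. om e --> spins e A = 1")
		  case True
		  then show ?thesis using \<open>\<forall>e\<in>F. om e\<close> by (auto simp: g_def intro!: prod.cong)
		next
		  case False
		  then show ?thesis using finT by (auto simp: g_def intro!: prod_zero)
		qed
		have S: "?S = {A : ?C. \<forall>e\<in>?T. om e --> spins e A = 1}"
		proof (intro set_eqI iffI)
		  fix A assume A: "A : ?S"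
		  have "spins e A = 1" if e: "e : ?T" "om e" for e
		  proof -
			obtain x y where xy: "e = {x, y}" "x ~= y" using bonds_D[OF bT e(1)] by (meson card_2_iff)
			have "x : ?V" "y : ?V" using good e xy by auto
			moreover have "(x, y) : ?R" using e xy by (auto simp: open_relation_def)
			ultimately have "x : A \<longleftrightarrow> y : A" using A by blast
			then show ?thesis using spins_pair[OF xy(2)] xy by simp
		  qed
		  then have sp: "\<forall>e\<in>?T. om e --> spins e A = 1" by blast
		  have AP: "A : Pow ?V" and AR: "!!x y. x : ?V ==> y : ?V ==> (x, y) : ?R ==> (x : A \<longleftrightarrow> y : A)"
			using A by blast+
		  have "\<forall>x\<in>?V Int ?D. \<forall>y\<in>?V Int ?D. x : A \<longleftrightarrow> y : A"
			by (intro ballI AR) blast+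
		  then show "A : {A : ?C. \<forall>e\<in>?T. om e --> spins e A = 1}" using sp AP by (intro CollectI conjI)
		next
		  fix A assume A: "A : {A : ?C. \<forall>e\<in>?T. om e --> spins e A = 1}"
		  have "x : A \<longleftrightarrow> y : A" if xy: "x : ?V" "y : ?V" "(x, y) : ?R" for x y
		  proof (cases "(x, y) : open_relation U om")
			case True
			then have e: "{x, y} : ?T" "om {x, y}" by (auto simp: open_relation_def)
			then have "x ~= y" using bonds_D[OF bT e(1)] by (auto simp: card_insert_if split: if_splits)
			moreover have "spins {x, y} A = 1" using A e by blast
			ultimately show ?thesis using spins_pair[of x y A] by blast
		  next
			case False
			then have "x : ?V Int ?D" "y : ?V Int ?D" using xy by blast+
			moreover have "\<forall>x\<in>?V Int ?D. \<forall>y\<in>?V Int ?D. x : A \<longleftrightarrow> y : A" using A by blast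
			ultimately show ?thesis by blast
		  qed
		  then have "\<forall>x\<in>?V. \<forall>y\<in>?V. (x, y) : ?R --> (x : A \<longleftrightarrow> y : A)" by blast
		  moreover have "A : Pow ?V" using A by blast
		  ultimately show "A : ?S" by (intro CollectI conjI)
		qed
		have finC: "finite ?C" using finV by auto
		have "(\<Sum>A\<in>?C. \<Prod>e\<in>?T. g A e (om e)) = (\<Sum>A\<in>{A : ?C. \<forall>e\<in>?T. om e --> spins e A = 1}. \<Prod>e\<in>?T. h e (om e))"
		  unfolding pr using finC by (subst sum.inter_filter) auto
		also have "... = (\<Prod>e\<in>?T. h e (om e)) * real (card ?S)" unfolding S by simp
		finally show ?thesis using True rc by simp
	  qed
	qed
  qed
  have "(\<Sum>om\<in>PiE ?T (%_. UNIV). (if \<forall>e\<in>F. om e then rc_weight be (wired_clusters U) U (om, a) else 0))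
	= (\<Sum>A\<in>?C. \<Sum>om\<in>PiE ?T (%_. UNIV). \<Prod>e\<in>?T. g A e (om e))"
	unfolding key by (rule sum.swap)
  also have "... = (\<Sum>A\<in>?C. \<Prod>e\<in>?T. \<Sum>b\<in>UNIV. g A e b)"
	using finT by (subst prod_sum_PiE) auto
  also have "... = (\<Sum>A\<in>?C. es_term be ?T F a A)"
  proof (intro sum.cong refl)
	fix A
	have "(\<Prod>e\<in>?T. \<Sum>b\<in>UNIV. g A e b) = (\<Prod>e\<in>?T.
	  (if e : F then (1 - exp (- 2 * coupling (%_. be) a e)) * ((1 + spins e A) / 2) else 1) *
	  exp (coupling (%_. be) a e * spins e A))"
	  unfolding g_def h_def p by (intro prod.cong refl edge_factor_sum spins_cases)
	also have "... = es_term be ?T F a A"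
	  unfolding prod.distrib es_term_def exp_sum[OF finT]
	  using finT F by (simp add: prod.If_cases Int_absorb1 Int_absorb2 prod.distrib prod_dividef)
	finally show "(\<Prod>e\<in>?T. \<Sum>b\<in>UNIV. g A e b) = es_term be ?T F a A" .
  qed
  finally show ?thesis .
qed

lemma es_sum_boundary:
  assumes F: "F <= TE U"
  defines "V \<equiv> nonzero_sites U a" and "D \<equiv> EB U"
  shows "(\<Sum>A\<in>{A : Pow V. \<forall>x\<in>V Int D. \<forall>y\<in>V Int D. x : A \<longleftrightarrow> y : A}. es_term be (TE U) F a A)
	= bdry_factor U a * (\<Sum>A\<in>Pow (V Int U). es_term be (TE U) F a A)"
proof -
  let ?T = "TE U"
  let ?f = "es_term be ?T F a"
  note bT = bonds_touching[OF fin]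
  have finV: "finite V" unfolding V_def nonzero_sites_def using finite_site_closure[OF fin] by simp
  have VD: "V - U = V Int D" "V Int U Int D = {}" by (auto simp: V_def D_def nonzero_sites_def site_closure_def ext_boundary_def)
  let ?C = "{A : Pow V. \<forall>x\<in>V Int D. \<forall>y\<in>V Int D. x : A \<longleftrightarrow> y : A}"
  show ?thesis
  proof (cases "V Int D = {}")
	case True
	then have "bdry_factor U a = 1" by (auto simp: bdry_factor_def V_def D_def nonzero_sites_def site_closure_def)
	moreover have "?C = Pow (V Int U)" using True VD by auto
	ultimately show ?thesis by simp
  next
	case False
	then have bf: "bdry_factor U a = 2" by (auto simp: bdry_factor_def V_def D_def nonzero_sites_def)
	have C: "?C = Pow (V Int U) Un (%A. V - A) ` Pow (V Int U)" (is "_ = ?P Un ?Q")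
	proof (intro set_eqI iffI)
	  fix A assume A: "A : ?C"
	  show "A : ?P Un ?Q"
	  proof (cases "A Int (V Int D) = {}")
		case True
		then have "A <= V Int U" using A VD by auto
		then show ?thesis by auto
	  next
		case False
		then have "V Int D <= A" using A by blast
		then have "V - A : Pow (V Int U)" "A = V - (V - A)" using A VD by auto
		then show ?thesis by blast
	  qed
	next
	  fix A assume A: "A : ?P Un ?Q"
	  then consider "A <= V Int U" | B where "B <= V Int U" "A = V - B" by auto
	  then show "A : ?C"
	  proof cases
		case 1 then show ?thesis using VD by auto
	  next
		case 2 then show ?thesis using VD by auto
	  qed
	qed
	have disj: "?P Int ?Q = {}" using False VD by blast
	have inj: "inj_on (%A. V - A) (Pow (V Int U))" by (auto simp: inj_on_def)
	have "sum ?f ?C = sum ?f ?P + sum ?f ?Q"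
	  unfolding C using finV disj by (intro sum.union_disjoint) auto
	also have "sum ?f ?Q = (\<Sum>A\<in>?P. ?f (V - A))" by (subst sum.reindex[OF inj]) simp
	also have "... = sum ?f ?P"
	proof (intro sum.cong refl es_term_cong)
	  fix A e assume A: "A : ?P" and e: "e : ?T" "\<forall>x\<in>e. a x ~= 0"
	  obtain x y where xy: "e = {x, y}" "x ~= y" using bonds_D[OF bT e(1)] by (meson card_2_iff)
	  have "x : V" "y : V" using e xy bonds_D[OF bT e(1)] by (auto simp: V_def nonzero_sites_def)
	  then show "spins e (V - A) = spins e A" using A xy by (auto simp: spins_def spin_of_def)
	qed (use F bonds_finite[OF bT] bonds_D[OF bT] in auto)
	finally show ?thesis by (simp add: bf)
  qed
qed

lemma es_sum_zero_sites:
  assumes F: "F <= TE U"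
  shows "2 ^ card U * (\<Sum>A\<in>Pow (nonzero_sites U a Int U). es_term be (TE U) F a A)
	= (\<Prod>x\<in>U. if a x = 0 then 1 else 2) * (\<Sum>A\<in>Pow U. es_term be (TE U) F a A)"
proof -
  let ?T = "TE U" and ?U = "nonzero_sites U a Int U"
  let ?f = "es_term be ?T F a"
  note bT = bonds_touching[OF fin]
  have "(\<Sum>A\<in>Pow U. ?f A) = (\<Sum>(A, B)\<in>Pow ?U \<times> Pow (U - ?U). ?f (A Un B))"
	by (rule sum.reindex_bij_witness[where i = "%(A, B). A Un B" and j = "%A. (A Int ?U, A - ?U)"])
	  (auto simp: Un_Diff_Int Int_Diff_Un)
  also have "... = (\<Sum>(A, B)\<in>Pow ?U \<times> Pow (U - ?U). ?f A)"
  proof (intro sum.cong refl, clarify)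
	fix A B assume AB: "A <= ?U" "B <= U - ?U"
	show "?f (A Un B) = ?f A"
	proof (rule es_term_cong)
	  fix e assume e: "e : ?T" "\<forall>x\<in>e. a x ~= 0"
	  then have "e Int B = {}" using AB bonds_D[OF bT e(1)] by (auto simp: nonzero_sites_def)
	  then show "spins e (A Un B) = spins e A"
		unfolding spins_def by (intro prod.cong) (auto simp: spin_of_def)
	qed (use F bonds_finite[OF bT] bonds_D[OF bT] in auto)
  qed
  also have "... = 2 ^ card (U - ?U) * (\<Sum>A\<in>Pow ?U. ?f A)"
	using fin by (simp add: sum.cartesian_product[symmetric] sum_distrib_left card_Pow)
  finally have 1: "(\<Sum>A\<in>Pow U. ?f A) = 2 ^ card (U - ?U) * (\<Sum>A\<in>Pow ?U. ?f A)" .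
  have "(\<Prod>x\<in>U. if a x = 0 then 1 else (2::real)) = (\<Prod>x\<in>?U. 2)"
	using fin by (intro prod.mono_neutral_cong_right) (auto simp: nonzero_sites_def site_closure_def)
  then have 2: "(\<Prod>x\<in>U. if a x = 0 then 1 else (2::real)) = 2 ^ card ?U" by simp
  have "card U = card ?U + card (U - ?U)"
	using fin card_Un_disjoint[of ?U "U - ?U"] by (simp add: Un_absorb1 Un_Diff_cancel Int_commute finite_subset)
  then have 3: "(2::real) ^ card U = 2 ^ card ?U * 2 ^ card (U - ?U)" by (simp add: power_add)
  show ?thesis unfolding 1 2 3 by simp
qed

text \<open>Expand the power of 2 over configurations constant on clusters and sum over the edge variables: every edge factor becomes \<open>exp (J * s)\<close> with \<open>s\<close> the product of the two spins, and an edge required to be open contributes its probability times \<open>(1 + s) / 2\<close>.\<close>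
lemma edwards_sokal:
  assumes F: "F <= TE U"
  shows "2 ^ card U * (\<Sum>om\<in>PiE (TE U) (%_. UNIV). (if \<forall>e\<in>F. om e then rc_weight be (wired_clusters U) U (om, a) else 0))
	= (\<Prod>x\<in>U. if a x = 0 then 1 else 2) * (bdry_factor U a * ((\<Prod>e\<in>F. edge_probability be a e) *
		ising_sum U (TE U) (coupling (%_. be) a) (%A. \<Prod>e\<in>F. (1 + spins e A) / 2)))"
proof -
  have "(\<Sum>A\<in>Pow U. es_term be (TE U) F a A) = (\<Prod>e\<in>F. edge_probability be a e) *
		ising_sum U (TE U) (coupling (%_. be) a) (%A. \<Prod>e\<in>F. (1 + spins e A) / 2)"
	unfolding ising_sum_def es_term_def prod.distrib sum_distrib_left
	by (simp add: edge_probability_def coupling_def mult_ac)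
  then show ?thesis
	unfolding es_sum_edges[OF F] es_sum_boundary[OF F]
	using es_sum_zero_sites[OF F] by (simp add: mult_ac)
qed

end

section \<open>Integrals over the random cluster reference measure\<close>

lemma nn_integral_PiM_change:
  fixes N mu :: "'v => real measure" and c :: "'v => real => ennreal"
  assumes fin: "finite V"
	and N: "!!x. sigma_finite_measure (N x)" "!!x. sets (N x) = sets nnb"
	and M: "!!x. sigma_finite_measure (mu x)" "!!x. sets (mu x) = sets nnb"
	and c: "!!x. c x : bm nnb"
	and one: "!!x f. x : V ==> f : bm nnb ==> (\<integral>\<^sup>+t. f t * c x t \<partial>N x) = k x * (\<integral>\<^sup>+t. f t \<partial>mu x)"
	and f: "f : bm (PiM V (%_. nnb))"
  shows "(\<integral>\<^sup>+a. f a * (\<Prod>x\<in>V. c x (a x)) \<partial>PiM V N) = (\<Prod>x\<in>V. k x) * (\<integral>\<^sup>+a. f a \<partial>PiM V mu)"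
  using fin one f
proof (induction V arbitrary: f rule: finite_induct)
  case empty
  then show ?case by (simp add: PiM_empty nn_integral_count_space_finite)
next
  case (insert i V)
  interpret N: product_sigma_finite N by (rule product_sigma_finite.intro[OF N(1)])
  interpret M: product_sigma_finite mu by (rule product_sigma_finite.intro[OF M(1)])
  have mN: "measurable (N x) K = measurable nnb K" for x and K :: "ennreal measure" by (intro measurable_cong_sets N refl)
  have mM: "measurable (mu x) K = measurable nnb K" for x and K :: "ennreal measure" by (intro measurable_cong_sets M refl)
  have mPN: "measurable (PiM I N) K = measurable (PiM I (%_. nnb)) K" for I and K :: "ennreal measure"
	by (intro measurable_cong_sets sets_PiM_cong N refl)
  have mPM: "measurable (PiM I mu) K = measurable (PiM I (%_. nnb)) K" for I and K :: "ennreal measure"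
	by (intro measurable_cong_sets sets_PiM_cong M refl)
  have sub: "(%(a, u). a(i := u)) : measurable (PiM V (%_. nnb) \<Otimes>\<^sub>M nnb) (PiM (insert i V) (%_. nnb))"
	by (rule measurable_add_dim)
  have f1: "(%u. f (a(i := u))) : bm nnb" if "a : space (PiM V (%_. nnb))" for a
	using measurable_compose[OF measurable_Pair1'[OF that] measurable_compose[OF sub insert.prems(2)]]
	by (simp add: fun_upd_def)
  have f2: "(%a. \<integral>\<^sup>+u. f (a(i := u)) \<partial>mu i) : bm (PiM V (%_. nnb))"
  proof -
	have "case_prod (%a u. f (a(i := u))) : bm (PiM V (%_. nnb) \<Otimes>\<^sub>M mu i)"
	  using measurable_compose[OF sub insert.prems(2)] M(2)[of i]
	  by (subst measurable_cong_sets[OF sets_pair_measure_cong[OF refl M(2)] refl]) (simp add: split_beta' fun_upd_def)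
	then show ?thesis by (rule sigma_finite_measure.borel_measurable_nn_integral[OF M(1)])
  qed
  have cm: "(%a. \<Prod>x\<in>I. c x (a x)) : bm (PiM I (%_. nnb))" for I
  proof (intro borel_measurable_prod_ennreal)
	fix x assume "x : I"
	then show "(%a. c x (a x)) : bm (PiM I (%_. nnb))"
	  by (intro measurable_compose[OF _ c[of x]] measurable_component_singleton)
  qed
  have spN: "space (PiM V N) = space (PiM V (%_. nnb))"
	by (intro sets_eq_imp_space_eq sets_PiM_cong N refl)
  have "(\<integral>\<^sup>+a. f a * (\<Prod>x\<in>insert i V. c x (a x)) \<partial>PiM (insert i V) N)
	= (\<integral>\<^sup>+a. (\<integral>\<^sup>+u. f (a(i := u)) * (\<Prod>x\<in>insert i V. c x ((a(i := u)) x)) \<partial>N i) \<partial>PiM V N)"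
  proof (rule N.product_nn_integral_insert[OF insert.hyps])
	show "(%a. f a * (\<Prod>x\<in>insert i V. c x (a x))) : bm (PiM (insert i V) N)"
	  unfolding mPN by (intro borel_measurable_times_ennreal insert.prems(2) cm)
  qed
  also have "... = (\<integral>\<^sup>+a. (k i * (\<integral>\<^sup>+u. f (a(i := u)) \<partial>mu i)) * (\<Prod>x\<in>V. c x (a x)) \<partial>PiM V N)"
  proof (intro nn_integral_cong)
	fix a assume a: "a : space (PiM V N)"
	have "(\<Prod>x\<in>insert i V. c x ((a(i := u)) x)) = c i u * (\<Prod>x\<in>V. c x (a x))" for u
	  using insert.hyps by (simp, intro arg_cong2[of _ _ _ _ "(*)"] refl prod.cong) auto
	then have "(\<integral>\<^sup>+u. f (a(i := u)) * (\<Prod>x\<in>insert i V. c x ((a(i := u)) x)) \<partial>N i)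
	  = (\<integral>\<^sup>+u. (f (a(i := u)) * c i u) * (\<Prod>x\<in>V. c x (a x)) \<partial>N i)" by (simp add: mult_ac)
	also have "... = (\<integral>\<^sup>+u. f (a(i := u)) * c i u \<partial>N i) * (\<Prod>x\<in>V. c x (a x))"
	  using f1[of a] a c by (intro nn_integral_multc) (auto simp: mN spN)
	also have "(\<integral>\<^sup>+u. f (a(i := u)) * c i u \<partial>N i) = k i * (\<integral>\<^sup>+u. f (a(i := u)) \<partial>mu i)"
	  using f1[of a] a by (intro insert.prems(1)) (auto simp: spN)
	finally show "(\<integral>\<^sup>+u. f (a(i := u)) * (\<Prod>x\<in>insert i V. c x ((a(i := u)) x)) \<partial>N i)
	  = (k i * (\<integral>\<^sup>+u. f (a(i := u)) \<partial>mu i)) * (\<Prod>x\<in>V. c x (a x))" .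
  qed
  also have "... = k i * (\<integral>\<^sup>+a. (\<integral>\<^sup>+u. f (a(i := u)) \<partial>mu i) * (\<Prod>x\<in>V. c x (a x)) \<partial>PiM V N)"
	using f2 cm by (simp add: mult.assoc nn_integral_cmult mPN)
  also have "(\<integral>\<^sup>+a. (\<integral>\<^sup>+u. f (a(i := u)) \<partial>mu i) * (\<Prod>x\<in>V. c x (a x)) \<partial>PiM V N)
	 = (\<Prod>x\<in>V. k x) * (\<integral>\<^sup>+a. (\<integral>\<^sup>+u. f (a(i := u)) \<partial>mu i) \<partial>PiM V mu)"
	by (rule insert.IH[OF insert.prems(1) f2]) auto
  also have "(\<integral>\<^sup>+a. (\<integral>\<^sup>+u. f (a(i := u)) \<partial>mu i) \<partial>PiM V mu) = (\<integral>\<^sup>+a. f a \<partial>PiM (insert i V) mu)"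
	using insert.prems(2) insert.hyps by (intro M.product_nn_integral_insert[symmetric]) (auto simp: mPM)
  finally show ?case using insert.hyps by (simp add: mult_ac)
qed

abbreviation rc_sites :: "real measure => real measure => 'd::finite site set => 'd site => real measure" where
  "rc_sites rh ka U \<equiv> (%x. nonneg_part (boundary_reference rh (%_. ka) U x))"

abbreviation rc_base where
  "rc_base rh ka U \<equiv> PiM (TE U) (%_. count_space (UNIV::bool set)) \<Otimes>\<^sub>M PiM (SC U) (rc_sites rh ka U)"

lemma sets_rc_sites: "good_law rh ==> good_law ka ==> sets (rc_sites rh ka U x) = sets nnb"
  unfolding boundary_reference_def by (cases "x : U") (simp_all add: good_law_def, (metis sets_nonneg_part)+)

lemma finite_measure_nonneg_part: "good_law ka ==> finite_measure (nonneg_part ka)"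
  by (intro finite_measureI) (use good_law_total[of ka] space_nonneg_part[of ka] in \<open>auto simp: good_law_def\<close>)

lemma sigma_finite_rc_sites: "good_law rh ==> good_law ka ==> sigma_finite_measure (rc_sites rh ka U x)"
  using finite_measure_nonneg_part[of rh] finite_measure_nonneg_part[of ka]
  by (auto simp: boundary_reference_def finite_measure_def)

definition rc_const :: "real measure => real measure => 'd::finite site set => ennreal" where
  "rc_const rh ka U = (\<Prod>x\<in>SC U. if x : U then abs_mass rh else emeasure (nonneg_part ka) {0..})"

lemma rc_const:
  assumes "good_law rh" "good_law ka" "finite U"
  shows "rc_const rh ka U ~= 0" "rc_const rh ka U ~= \<infinity>"
proof -
  have "finite (SC U)" using finite_site_closure[OF assms(3)] .
  then show "rc_const rh ka U ~= 0" "rc_const rh ka U ~= \<infinity>"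
	unfolding rc_const_def using abs_mass[OF assms(1)] good_law_total[OF assms(2)]
	by (auto simp: ennreal_prod_eq_top less_top)
qed

lemma rc_site_integral:
  assumes r: "good_law rh" "good_law ka" and fin: "finite U"
	and f: "f : bm FA" "depends_on (SC U) f"
  shows "(\<integral>\<^sup>+a. f a * (\<Prod>x\<in>U. if a x = 0 then 1 else 2) \<partial>PiM (SC U) (rc_sites rh ka U))
	= rc_const rh ka U * (\<integral>\<^sup>+a. f a \<partial>PiM UNIV (site_law rh ka U))"
proof -
  interpret B: site_laws "site_law rh ka U" by (rule site_laws_site_law[OF r])
  let ?V = "SC U" and ?N = "rc_sites rh ka U"
  let ?c = "%x t. if x : U then (if t = 0 then 1 else 2) else (1::ennreal)"
  let ?t = "%a x. if x : ?V then a x else (0::real)"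
  have sr: "sets rh = sets borel" using r by (simp add: good_law_def)
  have ft: "(%a. f (?t a)) : bm (PiM ?V (%_. nnb))"
	using measurable_compose[OF B.measurable_trunc[of ?V], of f borel] f(1)
	  measurable_cong_sets[OF sets_PiM_cong[of ?V ?V "site_law rh ka U" "%_. nnb"] refl, of "borel :: ennreal measure"]
	by (simp add: B.measurable_P B.sets_site)
  have "(\<integral>\<^sup>+a. f a * (\<Prod>x\<in>U. if a x = 0 then 1 else 2) \<partial>PiM ?V ?N)
	= (\<integral>\<^sup>+a. f (?t a) * (\<Prod>x\<in>?V. ?c x (a x)) \<partial>PiM ?V ?N)"
  proof (intro nn_integral_cong arg_cong2[of _ _ _ _ "(*)"])
	fix a show "f a = f (?t a)" by (rule depends_onD[OF f(2)]) auto
	show "(\<Prod>x\<in>U. if a x = 0 then 1 else 2) = (\<Prod>x\<in>?V. ?c x (a x))"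
	  using finite_site_closure[OF fin] by (intro prod.mono_neutral_cong_left) (auto simp: site_closure_def)
  qed
  also have "... = (\<Prod>x\<in>?V. if x : U then abs_mass rh else emeasure (nonneg_part ka) {0..}) * (\<integral>\<^sup>+a. f (?t a) \<partial>PiM ?V (site_law rh ka U))"
  proof (rule nn_integral_PiM_change[OF finite_site_closure[OF fin]])
	fix x
	show "sigma_finite_measure (?N x)" by (rule sigma_finite_rc_sites[OF r])
	show "sets (?N x) = sets nnb" by (rule sets_rc_sites[OF r])
	show "sigma_finite_measure (site_law rh ka U x)" by (rule prob_space_imp_sigma_finite[OF B.prob])
	show "sets (site_law rh ka U x) = sets nnb" by (rule B.sets_site)
	show "?c x : bm nnb"
	  using abs_factor_measurable[of borel] by (cases "x : U") auto
	fix g :: "real => ennreal" assume g: "g : bm nnb"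
	have u: "m * (y / m) = y" if "0 < m" "m < \<infinity>" for m y :: ennreal
	proof -
	  have "m * (y / m) = y * m / m" by (simp only: ennreal_times_divide mult.commute)
	  also have "... = y" using that by (intro ennreal_mult_divide_eq) auto
	  finally show ?thesis .
	qed
	show "(\<integral>\<^sup>+t. g t * ?c x t \<partial>?N x) = (if x : U then abs_mass rh else emeasure (nonneg_part ka) {0..}) * (\<integral>\<^sup>+t. g t \<partial>site_law rh ka U x)"
	  using nn_integral_abs_law[OF r(1) g] nn_integral_bdry_law[OF r(2) g] u[OF abs_mass[OF r(1)]] u[OF good_law_total[OF r(2)]]
	  by (simp add: site_law_def boundary_reference_def)
  qed (rule ft)
  also have "(\<integral>\<^sup>+a. f (?t a) \<partial>PiM ?V (site_law rh ka U)) = (\<integral>\<^sup>+a. f a \<partial>PiM UNIV (site_law rh ka U))"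
	using f by (intro B.nn_integral_depends_on[symmetric]) (auto simp: B.measurable_P)
  finally show ?thesis by (simp add: rc_const_def)
qed

lemma rc_base_integral:
  assumes r: "good_law rh" "good_law ka" and fin: "finite U"
	and G: "G : bm (rc_base rh ka U)"
  shows "(\<integral>\<^sup>+c. G c \<partial>rc_base rh ka U)
	= (\<integral>\<^sup>+a. (\<Sum>om\<in>PiE (TE U) (%_. UNIV). G (om, a)) \<partial>PiM (SC U) (rc_sites rh ka U))"
proof -
  let ?T = "TE U"
  let ?M = "PiM (SC U) (rc_sites rh ka U)"
  have finT: "finite ?T" using bonds_finite[OF bonds_touching[OF fin]] .
  have finP: "finite (PiE ?T (%_. UNIV :: bool set))" using finT by (intro finite_PiE) auto
  have cs: "PiM ?T (%_. count_space (UNIV::bool set)) = count_space (PiE ?T (%_. UNIV))"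
	using finT by (intro count_space_PiM_finite) auto
  interpret N: product_sigma_finite "rc_sites rh ka U" by (rule product_sigma_finite.intro[OF sigma_finite_rc_sites[OF r]])
  interpret M: sigma_finite_measure ?M by (rule N.sigma_finite[OF finite_site_closure[OF fin]])
  interpret C: sigma_finite_measure "count_space (PiE ?T (%_. UNIV :: bool set))"
	using finP by (intro sigma_finite_measure_count_space_finite)
  interpret pair_sigma_finite "count_space (PiE ?T (%_. UNIV :: bool set))" ?M ..
  have "(\<integral>\<^sup>+c. G c \<partial>rc_base rh ka U) = (\<integral>\<^sup>+a. (\<integral>\<^sup>+om. G (om, a) \<partial>count_space (PiE ?T (%_. UNIV))) \<partial>?M)"
	using G unfolding cs by (intro nn_integral_snd[symmetric]) (simp add: split_beta')
  then show ?thesis using finP by (simp add: nn_integral_count_space_finite)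
qed

lemma rc_component_measurable:
  assumes r: "good_law rh" "good_law ka" and x: "x : SC U"
  shows "(%a. a x) : bm (PiM (SC U) (rc_sites rh ka U))"
proof -
  have "(%t. t) : bm nnb"
	unfolding nonneg_part_def by (intro measurable_restrict_space1) simp
  then have "(%t. t) : bm (rc_sites rh ka U x)"
	using measurable_cong_sets[OF sets_rc_sites[OF r] refl] by blast
  then show ?thesis by (rule measurable_compose[OF measurable_component_singleton[OF x]])
qed

text \<open>The number of components takes finitely many values, determined by which sites vanish and which edges are open.\<close>
lemma num_components_measurable:
  assumes r: "good_law rh" "good_law ka" and fin: "finite U"
  shows "(%(om, a). (2::real) ^ num_components (nonzero_sites U a) (R om)) : bm (rc_base rh ka U)"
proof -
  let ?T = "TE U" and ?V = "SC U"
  let ?M = "PiM ?V (rc_sites rh ka U)"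
  have finT: "finite ?T" using bonds_finite[OF bonds_touching[OF fin]] .
  have finV: "finite ?V" using finite_site_closure[OF fin] .
  have finP: "finite (PiE ?T (%_. UNIV :: bool set))" using finT by (intro finite_PiE) auto
  have cs: "PiM ?T (%_. count_space (UNIV::bool set)) = count_space (PiE ?T (%_. UNIV))"
	using finT by (intro count_space_PiM_finite) auto
  have comp: "(%a. a x) : bm ?M" if "x : ?V" for x
	by (rule rc_component_measurable[OF r that])
  have nz: "nonzero_sites U : measurable ?M (count_space (Pow ?V))"
  proof (subst measurable_count_space_eq2)
	show "finite (Pow ?V)" using finV by simp
	have "nonzero_sites U -` {S} Int space ?M : sets ?M" if S: "S <= ?V" for S
	proof -
	  have "nonzero_sites U -` {S} Int space ?M = {a : space ?M. \<forall>x\<in>?V. a x ~= 0 \<longleftrightarrow> x : S}"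
	  proof (intro set_eqI iffI)
		fix a assume "a : nonzero_sites U -` {S} Int space ?M"
		then have "S = {x : ?V. a x ~= 0}" "a : space ?M" by (auto simp: nonzero_sites_def)
		then show "a : {a : space ?M. \<forall>x\<in>?V. (a x ~= 0) = (x : S)}" by simp
	  next
		fix a assume a: "a : {a : space ?M. \<forall>x\<in>?V. (a x ~= 0) = (x : S)}"
		then have "nonzero_sites U a = S" using S unfolding nonzero_sites_def by blast
		then show "a : nonzero_sites U -` {S} Int space ?M" using a by simp
	  qed
	  also have "... : sets ?M"
	  proof (rule sets.sets_Collect_finite_All[OF _ finV])
		fix x assume x: "x : ?V"
		have "(%a. a x) -` (if x : S then - {0} else {0}) Int space ?M : sets ?M"
		  by (rule measurable_sets[OF comp[OF x]]) auto
		also have "(%a. a x) -` (if x : S then - {0} else {0}) Int space ?M = {a : space ?M. (a x ~= 0) = (x : S)}"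
		  by auto
		finally show "{a : space ?M. (a x ~= 0) = (x : S)} : sets ?M" .
	  qed
	  finally show ?thesis .
	qed
	then show "nonzero_sites U : space ?M \<rightarrow> Pow ?V & (\<forall>a\<in>Pow ?V. nonzero_sites U -` {a} Int space ?M : sets ?M)"
	  by (auto simp: nonzero_sites_def)
  qed
  show ?thesis unfolding cs
  proof (rule measurable_pair_measure_countable1)
	fix om
	have "(%a. (2::real) ^ num_components (nonzero_sites U a) (R om)) : bm ?M"
	  by (rule measurable_compose[OF nz]) simp
	then show "(%y. case (om, y) of (om, a) => (2::real) ^ num_components (nonzero_sites U a) (R om)) : bm ?M"
	  by simp
  qed (use finP in \<open>simp add: countable_finite\<close>)
qed

lemma rc_weight_measurable:
  assumes r: "good_law rh" "good_law ka" and fin: "finite U"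
	and k: "!!om a. k (om, a) = num_components (nonzero_sites U a) (R om)"
  shows "rc_weight be k U : bm (rc_base rh ka U)"
proof -
  let ?T = "TE U" and ?V = "SC U"
  let ?M = "PiM ?V (rc_sites rh ka U)"
  note bT = bonds_touching[OF fin]
  have finT: "finite ?T" using bonds_finite[OF bT] .
  have comp: "(%a. a x) : bm ?M" if "x : ?V" for x
	by (rule rc_component_measurable[OF r that])
  have p: "(%c. edge_probability be (snd c) e) : bm (rc_base rh ka U)" if "e : ?T" for e
	unfolding edge_probability_def
	by (intro borel_measurable_diff borel_measurable_const borel_measurable_exp[THEN measurable_compose, rotated]
	  borel_measurable_times borel_measurable_prod measurable_compose[OF measurable_snd comp] borel_measurable_uminus measurable_compose[OF _ borel_measurable_exp])
	  (use bonds_D[OF bT that] in auto)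
  have o: "(%c. fst c e) : measurable (rc_base rh ka U) (count_space UNIV)" if "e : ?T" for e
	by (rule measurable_compose[OF measurable_fst measurable_component_singleton[OF that]])
  have "(%c. (\<Prod>e\<in>?T. sqrt (1 - edge_probability be (snd c) e) *
	  (edge_probability be (snd c) e / (1 - edge_probability be (snd c) e)) ^ (if fst c e then 1 else 0))
	  * 2 ^ num_components (nonzero_sites U (snd c)) (R (fst c))) : bm (rc_base rh ka U)"
  proof (intro borel_measurable_times borel_measurable_prod)
	fix e assume e: "e : ?T"
	note [measurable] = p[OF e] o[OF e]
	show "(%c. sqrt (1 - edge_probability be (snd c) e)) : bm (rc_base rh ka U)" by measurable
	have "(%c. (edge_probability be (snd c) e / (1 - edge_probability be (snd c) e)) ^ (if fst c e then 1 else (0::nat)))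
	  = (%c. if fst c e then edge_probability be (snd c) e / (1 - edge_probability be (snd c) e) else 1)"
	  by (auto simp: fun_eq_iff)
	also have "... : bm (rc_base rh ka U)" by measurable
	finally show "(%c. (edge_probability be (snd c) e / (1 - edge_probability be (snd c) e)) ^ (if fst c e then 1 else (0::nat)))
	   : bm (rc_base rh ka U)" .
  next
	show "(%c. (2::real) ^ num_components (nonzero_sites U (snd c)) (R (fst c))) : bm (rc_base rh ka U)"
	  using num_components_measurable[OF r fin] by (simp add: split_beta')
  qed
  then show ?thesis unfolding rc_weight_def by (simp add: split_beta' k)
qed

section \<open>Random cluster probabilities as Ising correlations\<close>

text \<open>The conditional probability, given the field, that the edges of \<open>F\<close> are open, on the event \<open>C\<close>.\<close>
definition rc_obs :: "'d::finite site set => 'd edge set => real => 'd edge set => 'd site set => ('d site => real) set => ('d site => real) => real" where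
  "rc_obs U E be F De C a = indicator C (restrict a De) * (\<Prod>e\<in>F. edge_probability be a e) *
	 ising_corr U E (coupling (%_. be) a) (%A. \<Prod>e\<in>F. (1 + spins e A) / 2)"

lemma ennreal_cancel_left:
  fixes c x y :: ennreal
  assumes "c ~= 0" "c ~= \<infinity>" "y ~= 0" "y ~= \<infinity>"
  shows "c * x / (c * y) = x / y"
proof -
  have "x / y * y = y * (x / y)" by (rule mult.commute)
  also have "... = x * y / y" by (simp only: ennreal_times_divide mult.commute)
  also have "... = x" using assms by (intro ennreal_mult_divide_eq) auto
  finally have "c * x = c * (x / y * y)" by simp
  then have "c * x / (c * y) = x / y * (c * y) / (c * y)" by (simp only: mult_ac)
  also have "x / y * (c * y) / (c * y) = x / y"
	using assms by (intro ennreal_mult_divide_eq) (auto simp: ennreal_mult_eq_top_iff)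
  finally show ?thesis by simp
qed

lemma edge_probability_nonneg:
  "0 <= be ==> (!!x. x : e ==> 0 <= a x) ==> 0 <= edge_probability be a e"
  by (auto simp: edge_probability_def intro!: mult_nonneg_nonneg prod_nonneg)

lemma edge_probability_lt_1: "edge_probability be a e < 1"
  by (simp add: edge_probability_def)

lemma half_spins: "0 <= (1 + spins e A) / 2 & (1 + spins e A) / 2 <= 1"
  using spins_cases[of e A] by auto

lemma ising_corr_half:
  assumes "finite U"
  shows "0 <= ising_corr U E K (%A. \<Prod>e\<in>F. (1 + spins e A) / 2)"
	"ising_corr U E K (%A. \<Prod>e\<in>F. (1 + spins e A) / 2) <= 1"
proof -
  have b: "0 <= (\<Prod>e\<in>F. (1 + spins e A) / 2) & (\<Prod>e\<in>F. (1 + spins e A) / 2) <= 1" for A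
	using half_spins by (intro conjI prod_nonneg prod_le_1) blast+
  have "0 <= ising_sum U E K (%A. \<Prod>e\<in>F. (1 + spins e A) / 2)"
	unfolding ising_sum_def using b by (intro sum_nonneg mult_nonneg_nonneg) auto
  moreover have "ising_sum U E K (%A. \<Prod>e\<in>F. (1 + spins e A) / 2) <= ising_Z U E K"
	unfolding ising_Z_def ising_sum_def using b by (intro sum_mono mult_right_mono) auto
  ultimately show "0 <= ising_corr U E K (%A. \<Prod>e\<in>F. (1 + spins e A) / 2)"
	"ising_corr U E K (%A. \<Prod>e\<in>F. (1 + spins e A) / 2) <= 1"
	using ising_Z_pos[OF assms, of E K] by (auto simp: ising_corr_def)
qed

lemma rc_obs_bounds:
  assumes "finite U" "0 <= be" "\<forall>x. 0 <= a x"
  shows "0 <= rc_obs U E be F De C a" "rc_obs U E be F De C a <= 1"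
proof -
  have p: "0 <= edge_probability be a e & edge_probability be a e <= 1" for e
	using edge_probability_nonneg[of be e a] edge_probability_lt_1[of be a e] assms by auto
  have P: "0 <= (\<Prod>e\<in>F. edge_probability be a e)" "(\<Prod>e\<in>F. edge_probability be a e) <= 1"
	using p by (auto intro: prod_nonneg prod_le_1)
  note I = ising_corr_half[OF assms(1), of E "coupling (%_. be) a" F]
  show "0 <= rc_obs U E be F De C a" unfolding rc_obs_def using P I by (intro mult_nonneg_nonneg) auto
  show "rc_obs U E be F De C a <= 1" unfolding rc_obs_def using P I
	by (intro mult_le_one mult_nonneg_nonneg) (auto simp: indicator_def)
qed

lemma edge_probability_measurable[measurable]: "(%a. edge_probability be a e) : bm FA"
  unfolding edge_probability_def by measurable

lemma ising_sum_field_measurable[measurable]: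
  "(%a. ising_sum U E (coupling J a) f) : bm FA"
  unfolding ising_sum_def coupling_def by measurable

lemma ising_Z_field_measurable[measurable]: "part_fun U E J : bm FA"
  unfolding ising_Z_def by measurable

lemma ising_corr_field_measurable[measurable]:
  "(%a. ising_corr U E (coupling J a) f) : bm FA"
  unfolding ising_corr_def by measurable

lemma indicator_restrict_measurable:
  assumes "C : sets (PiM De (%_. nnb))"
  shows "(%a. indicator C (restrict a De) :: real) : bm FA"
proof -
  have "(%a. restrict a De) : measurable FA (PiM De (%_. nnb))"
	by (rule measurable_restrict_subset) auto
  then show ?thesis by (rule measurable_compose) (use assms in simp)
qed

lemma rc_obs_measurable:
  assumes "C : sets (PiM De (%_. nnb))"
  shows "rc_obs U E be F De C : bm FA"
proof -
  note [measurable] = indicator_restrict_measurable[OF assms]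
  show ?thesis unfolding rc_obs_def by measurable
qed

lemma depends_on_rc_obs:
  assumes "bonds V E" "F <= E" "De <= V"
  shows "depends_on V (rc_obs U E be F De C)"
proof (rule depends_onI)
  fix a b :: "'a site => real" assume ab: "!!x. x : V ==> a x = b x"
  have 1: "restrict a De = restrict b De" using ab assms(3) by (auto simp: restrict_def fun_eq_iff)
  have 2: "edge_probability be a e = edge_probability be b e" if "e : F" for e
	unfolding edge_probability_def using ab bonds_D[OF assms(1), of e] assms(2) that
	by (auto intro!: arg_cong[of _ _ "%t. exp (- (2 * be * t))"] prod.cong)
  have 3: "ising_corr U E (coupling (%_. be) a) f = ising_corr U E (coupling (%_. be) b) f" for f
	by (rule depends_onD[OF depends_on_ising_corr[OF assms(1)]]) (use ab in auto)
  show "rc_obs U E be F De C a = rc_obs U E be F De C b"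
	unfolding rc_obs_def 1 3 using 2 by (simp cong: prod.cong)
qed

lemma sets_rc_base_site: "good_law rh ==> good_law ka ==>
  sets (PiM V (rc_sites rh ka U)) = sets (PiM V (%_. nnb))"
  by (intro sets_PiM_cong refl sets_rc_sites)

lemma measurable_rc_restrict:
  assumes r: "good_law rh" "good_law ka" and sub: "F <= TE U" "De <= SC U"
  shows "(%(om, a). (restrict om F, restrict a De)) : measurable (rc_base rh ka U) (rc_algebra F De)"
proof -
  have 1: "(%c. restrict (fst c) F) : measurable (rc_base rh ka U) (PiM F (%_. count_space UNIV))"
	by (intro measurable_compose[OF measurable_fst measurable_restrict_subset] sub)
  have "(%a. restrict a De) : measurable (PiM (SC U) (rc_sites rh ka U)) (PiM De (rc_sites rh ka U))"
	by (intro measurable_restrict_subset sub)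
  then have "(%a. restrict a De) : measurable (PiM (SC U) (rc_sites rh ka U)) (PiM De (%_. nnb))"
	using measurable_cong_sets[OF refl sets_rc_base_site[OF r]] by blast
  then have 2: "(%c. restrict (snd c) De) : measurable (rc_base rh ka U) (PiM De (%_. nnb))"
	by (intro measurable_compose[OF measurable_snd])
  show ?thesis using measurable_Pair[OF 1 2] by (simp add: split_beta')
qed

context
  fixes rh ka :: "real measure" and U :: "'d::finite site set" and be :: real
  assumes r: "good_law rh" "good_law ka" and fin: "finite U" and b: "0 <= be"
begin

lemma rc_mass:
  assumes sub: "F <= TE U" "De <= SC U" and C: "C : sets (PiM De (%_. nnb))"
  defines "S \<equiv> {c : space (rc_base rh ka U). (\<forall>e\<in>F. fst c e) & restrict (snd c) De : C}"
  shows "S : sets (rc_base rh ka U)"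
	and "emeasure (density (rc_base rh ka U) (%c. ennreal (rc_weight be (wired_clusters U) U c))) S
	 = rc_const rh ka U * ennreal (1 / 2 ^ card U) *
	   (\<integral>\<^sup>+a. ennreal (rc_obs U (TE U) be F De C a) * ennreal (bdry_factor U a * part_fun U (TE U) (%_. be) a)
		 \<partial>PiM UNIV (site_law rh ka U))"
proof -
  let ?T = "TE U" and ?V = "SC U" and ?B = "rc_base rh ka U"
  let ?w = "rc_weight be (wired_clusters U) U"
  let ?I = "%a. ising_sum U ?T (coupling (%_. be) a) (%A. \<Prod>e\<in>F. (1 + spins e A) / 2)"
  let ?g = "%a. bdry_factor U a * ((\<Prod>e\<in>F. edge_probability be a e) * ?I a)"
  let ?n = "(2::real) ^ card U"
  interpret B: site_laws "site_law rh ka U" by (rule site_laws_site_law[OF r])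
  note bT = bonds_touching[OF fin]
  have finT: "finite ?T" using bonds_finite[OF bT] .
  have finF: "finite F" using finite_subset[OF sub(1) finT] .
  have finP: "finite (PiE ?T (%_. UNIV :: bool set))" using finT by (intro finite_PiE) auto
  have [measurable]: "?w : bm ?B"
	by (rule rc_weight_measurable[OF r fin, where R = "%om. open_relation U om Un EB U \<times> EB U"])
	  (simp add: wired_clusters_def)
  have spV: "space (PiM ?V (rc_sites rh ka U)) = PiE ?V (%_. {0..})"
	unfolding sets_eq_imp_space_eq[OF sets_rc_base_site[OF r, of ?V U]] by (simp add: space_PiM space_nonneg_borel)
  have sp: "space ?B = PiE ?T (%_. UNIV) \<times> PiE ?V (%_. {0..})"
	unfolding space_pair_measure spV by (simp add: space_PiM)
  have "(%(om, a). (restrict om F, restrict a De)) -` ({om : space (PiM F (%_. count_space UNIV)). \<forall>e\<in>F. om e} \<times> C) Int space ?B : sets ?B"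
  proof (rule measurable_sets[OF measurable_rc_restrict[OF r sub]])
	have "{om : space (PiM F (%_. count_space (UNIV::bool set))). \<forall>e\<in>F. om e} = PiE F (%_. {True})"
	  by (auto simp: space_PiM PiE_def extensional_def Pi_def fun_eq_iff restrict_def)
	also have "... : sets (PiM F (%_. count_space UNIV))" using finF by (intro sets_PiM_I_finite) auto
	finally show "{om : space (PiM F (%_. count_space UNIV)). \<forall>e\<in>F. om e} \<times> C : sets (rc_algebra F De)"
	  using C by (intro pair_measureI) auto
  qed
  also have "(%(om, a). (restrict om F, restrict a De)) -` ({om : space (PiM F (%_. count_space UNIV)). \<forall>e\<in>F. om e} \<times> C) Int space ?B = S"
	by (auto simp: S_def space_PiM)
  finally show S: "S : sets ?B" .
  have wnn: "0 <= ?w (om, a)" if "\<forall>x\<in>?V. 0 <= a x" for om a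
	unfolding rc_weight_def prod.case
  proof (rule mult_nonneg_nonneg, rule prod_nonneg)
	fix e assume e: "e : ?T"
	have "0 <= edge_probability be a e" using bonds_D[OF bT e] that b by (intro edge_probability_nonneg) auto
	then show "0 <= sqrt (1 - edge_probability be a e) * (edge_probability be a e / (1 - edge_probability be a e)) ^ (if om e then 1 else 0)"
	  using edge_probability_lt_1[of be a e] by (intro mult_nonneg_nonneg zero_le_power divide_nonneg_nonneg) auto
  qed simp
  have "emeasure (density ?B (%c. ennreal (?w c))) S = (\<integral>\<^sup>+c. ennreal (?w c) * indicator S c \<partial>?B)"
	using S by (intro emeasure_density) auto
  also have "... = (\<integral>\<^sup>+a. (\<Sum>om\<in>PiE ?T (%_. UNIV). ennreal (?w (om, a)) * indicator S (om, a)) \<partial>PiM ?V (rc_sites rh ka U))"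
	using S by (intro rc_base_integral[OF r fin]) auto
  also have "... = (\<integral>\<^sup>+a. (ennreal (indicator C (restrict a De) * ?g a / ?n)) * (\<Prod>x\<in>U. if a x = 0 then 1 else 2) \<partial>PiM ?V (rc_sites rh ka U))"
  proof (intro nn_integral_cong)
	fix a assume "a : space (PiM ?V (rc_sites rh ka U))"
	then have a: "a : PiE ?V (%_. {0..})" using spV by (simp only:)
	then have ann: "\<forall>x\<in>?V. 0 <= a x" by auto
	have "(\<Sum>om\<in>PiE ?T (%_. UNIV). ennreal (?w (om, a)) * indicator S (om, a))
	  = (\<Sum>om\<in>PiE ?T (%_. UNIV). ennreal (indicator C (restrict a De) * (if \<forall>e\<in>F. om e then ?w (om, a) else 0)))"
	proof (intro sum.cong refl)
	  fix om assume "om : PiE ?T (%_. UNIV :: bool set)"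
	  then have "(om, a) : S \<longleftrightarrow> (\<forall>e\<in>F. om e) & restrict a De : C"
		unfolding S_def sp using a by simp
	  then show "ennreal (?w (om, a)) * indicator S (om, a)
		= ennreal (indicator C (restrict a De) * (if \<forall>e\<in>F. om e then ?w (om, a) else 0))"
		by (simp add: indicator_def)
	qed
	also have "... = ennreal (\<Sum>om\<in>PiE ?T (%_. UNIV). indicator C (restrict a De) * (if \<forall>e\<in>F. om e then ?w (om, a) else 0))"
	  using wnn[OF ann] by (intro sum_ennreal) auto
	also have "(\<Sum>om\<in>PiE ?T (%_. UNIV). indicator C (restrict a De) * (if \<forall>e\<in>F. om e then ?w (om, a) else 0))
	  = indicator C (restrict a De) * ((?n * (\<Sum>om\<in>PiE ?T (%_. UNIV). (if \<forall>e\<in>F. om e then ?w (om, a) else 0))) / ?n)"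
	  by (simp flip: sum_distrib_left)
	also have "... = (indicator C (restrict a De) * ?g a / ?n) * (\<Prod>x\<in>U. if a x = 0 then 1 else 2)"
	  unfolding edwards_sokal[OF fin sub(1)] by (simp add: mult_ac)
	also have "ennreal ... = ennreal (indicator C (restrict a De) * ?g a / ?n) * ennreal (\<Prod>x\<in>U. if a x = 0 then 1 else 2)"
	  by (rule ennreal_mult'') (auto intro: prod_nonneg)
	also have "ennreal (\<Prod>x\<in>U. if a x = 0 then 1 else 2) = (\<Prod>x\<in>U. if a x = 0 then 1 else 2)"
	  by (subst prod_ennreal[symmetric]) (auto intro!: prod.cong)
	finally show "(\<Sum>om\<in>PiE ?T (%_. UNIV). ennreal (?w (om, a)) * indicator S (om, a))
	  = ennreal (indicator C (restrict a De) * ?g a / ?n) * (\<Prod>x\<in>U. if a x = 0 then 1 else 2)" .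
  qed
  also have "... = rc_const rh ka U * (\<integral>\<^sup>+a. ennreal (indicator C (restrict a De) * ?g a / ?n) \<partial>PiM UNIV (site_law rh ka U))"
  proof (rule rc_site_integral[OF r fin])
	note [measurable] = indicator_restrict_measurable[OF C]
	have [measurable]: "bdry_factor U : bm FA"
	  using bdry_weight_factor[OF fin] by (simp add: bdry_weight_def)
	show "(%a. ennreal (indicator C (restrict a De) * ?g a / ?n)) : bm FA" by measurable
	have "depends_on ?V (%a. ennreal (rc_obs U ?T be F De C a * (bdry_factor U a * part_fun U ?T (%_. be) a) / ?n))"
	  using depends_on_combine[OF depends_on_rc_obs[OF bT sub]
		depends_on_combine[of ?V "bdry_factor U" "part_fun U ?T (%_. be)" "(*)"],
		where h = "%u v. ennreal (u * v / ?n)"]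
		bdry_weight_factor[OF fin] depends_on_part_fun[OF bT]
	  by (simp add: bdry_weight_def)
	moreover have "indicator C (restrict a De) * ?g a = rc_obs U ?T be F De C a * (bdry_factor U a * part_fun U ?T (%_. be) a)" for a
	  using ising_Z_pos[OF fin, of ?T "coupling (%_. be) a"] by (simp add: rc_obs_def ising_corr_def)
	ultimately show "depends_on ?V (%a. ennreal (indicator C (restrict a De) * ?g a / ?n))" by (simp only:)
  qed
  also have "(\<integral>\<^sup>+a. ennreal (indicator C (restrict a De) * ?g a / ?n) \<partial>PiM UNIV (site_law rh ka U))
	= (\<integral>\<^sup>+a. ennreal (1 / ?n) * (ennreal (rc_obs U ?T be F De C a) * ennreal (bdry_factor U a * part_fun U ?T (%_. be) a)) \<partial>PiM UNIV (site_law rh ka U))"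
  proof (intro nn_integral_cong)
	fix a assume "a : space (PiM UNIV (site_law rh ka U))"
	then have a: "\<forall>x. 0 <= a x" by (simp add: B.space_P)
	have eq: "indicator C (restrict a De) * ?g a / ?n = 1 / ?n * (rc_obs U ?T be F De C a * (bdry_factor U a * part_fun U ?T (%_. be) a))"
	  using ising_Z_pos[OF fin, of ?T "coupling (%_. be) a"] by (simp add: rc_obs_def ising_corr_def)
	have bf: "0 <= bdry_factor U a" by (simp add: bdry_factor_def)
	note nn = rc_obs_bounds(1)[OF fin b a, of ?T F De C] ising_Z_pos[OF fin, of ?T "coupling (%_. be) a"] bf
	show "ennreal (indicator C (restrict a De) * ?g a / ?n)
	  = ennreal (1 / ?n) * (ennreal (rc_obs U ?T be F De C a) * ennreal (bdry_factor U a * part_fun U ?T (%_. be) a))"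
	  unfolding eq using nn by (simp add: ennreal_mult[symmetric] del: ennreal_1)
  qed
  also have "... = ennreal (1 / ?n) * (\<integral>\<^sup>+a. ennreal (rc_obs U ?T be F De C a) * ennreal (bdry_factor U a * part_fun U ?T (%_. be) a) \<partial>PiM UNIV (site_law rh ka U))"
  proof (rule nn_integral_cmult)
	note [measurable] = rc_obs_measurable[OF C]
	have [measurable]: "bdry_factor U : bm FA"
	  using bdry_weight_factor[OF fin] by (simp add: bdry_weight_def)
	show "(%a. ennreal (rc_obs U ?T be F De C a) * ennreal (bdry_factor U a * part_fun U ?T (%_. be) a))
	  : bm (PiM UNIV (site_law rh ka U))"
	  unfolding B.measurable_P by measurable
  qed
  finally show "emeasure (density ?B (%c. ennreal (?w c))) S = rc_const rh ka U * ennreal (1 / ?n) *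
	(\<integral>\<^sup>+a. ennreal (rc_obs U ?T be F De C a) * ennreal (bdry_factor U a * part_fun U ?T (%_. be) a) \<partial>PiM UNIV (site_law rh ka U))"
	by (simp add: mult.assoc)
qed

lemma wired_event:
  assumes sub: "F <= TE U" "De <= SC U" and C: "C : sets (PiM De (%_. nnb))"
  shows "measure (rc_marginal F De (wired_rc rh be ka U)) (PiE F (%_. {True}) \<times> C)
	= (\<integral>a. rc_obs U (TE U) be F De C a \<partial>wired_law rh ka be U)"
proof -
  let ?T = "TE U" and ?V = "SC U" and ?B = "rc_base rh ka U"
  let ?D = "density ?B (%c. ennreal (rc_weight be (wired_clusters U) U c))"
  let ?X = "rc_obs U ?T be F De C" and ?w = "%a. bdry_factor U a * part_fun U ?T (%_. be) a"
  interpret B: site_laws "site_law rh ka U" by (rule site_laws_site_law[OF r])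
  have w: "B.weight ?V ?w" by (rule weight_plus[OF B.site_laws_axioms fin b bdry_weight_factor[OF fin]])
  define S where "S = {c : space ?B. (\<forall>e\<in>F. fst c e) & restrict (snd c) De : C}"
  note m = rc_mass[OF sub C, folded S_def]
  have finF: "finite F" using finite_subset[OF sub(1) bonds_finite[OF bonds_touching[OF fin]]] .
  have wired: "wired_rc rh be ka U = normalized_measure ?D" by (simp add: wired_rc_def rc_measure_def)
  have "emeasure ?D (space ?B) = emeasure ?D {c : space ?B. (\<forall>e\<in>{}. fst c e) & restrict (snd c) {} : space (PiM {} (%_. nnb))}"
	by (intro arg_cong[of _ _ "emeasure ?D"]) (auto simp: space_PiM)
  also have "... = rc_const rh ka U * ennreal (1 / 2 ^ card U) * (\<integral>\<^sup>+a. ennreal (rc_obs U ?T be {} {} (space (PiM {} (%_. nnb))) a) * ennreal (?w a) \<partial>B.P)"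
	by (rule rc_mass) auto
  also have "(\<integral>\<^sup>+a. ennreal (rc_obs U ?T be {} {} (space (PiM {} (%_. nnb))) a) * ennreal (?w a) \<partial>B.P) = (\<integral>\<^sup>+a. ennreal (?w a) \<partial>B.P)"
  proof (intro nn_integral_cong)
	fix a :: "'d site => real"
	have "restrict a {} : space (PiM {} (%_. nnb))" by (simp add: space_PiM restrict_def)
	moreover have "ising_corr U ?T (coupling (%_. be) a) (%A. 1) = 1"
	  using ising_Z_pos[OF fin, of ?T "coupling (%_. be) a"] by (simp add: ising_corr_def ising_Z_def)
	ultimately show "ennreal (rc_obs U ?T be {} {} (space (PiM {} (%_. nnb))) a) * ennreal (?w a) = ennreal (?w a)"
	  by (simp add: rc_obs_def)
  qed
  also have "... = ennreal (\<integral>a. ?w a \<partial>B.P)"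
	using B.weight_integrable[OF w] w
	by (intro nn_integral_eq_integral) (auto simp: B.space_P B.weight_def intro!: AE_I2 intro: order_trans[of 0 1])
  finally have tot: "emeasure ?D (space ?B) = rc_const rh ka U * ennreal (1 / 2 ^ card U) * ennreal (\<integral>a. ?w a \<partial>B.P)" .
  let ?c = "rc_const rh ka U * ennreal (1 / 2 ^ card U)"
  have c: "?c ~= 0" "?c ~= \<infinity>" using rc_const[OF r fin] by (auto simp: ennreal_mult_eq_top_iff)
  have q: "ennreal (\<integral>a. ?w a \<partial>B.P) ~= 0" "ennreal (\<integral>a. ?w a \<partial>B.P) ~= \<infinity>"
	using B.weight_integral_pos[OF w] by auto
  have Xm: "(%a. ennreal (?X a)) : bm B.P"
	using rc_obs_measurable[OF C] unfolding B.measurable_P by measurable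
  have "emeasure (wired_rc rh be ka U) S = 1 / emeasure ?D (space ?B) * emeasure ?D S"
	unfolding wired normalized_measure_def by (simp add: space_density)
  also have "... = emeasure ?D S / emeasure ?D (space ?B)" by (simp add: ennreal_times_divide mult.commute)
  also have "... = (\<integral>\<^sup>+a. ennreal (?X a) * ennreal (?w a) \<partial>B.P) / ennreal (\<integral>a. ?w a \<partial>B.P)"
	unfolding m(2) tot using c q by (intro ennreal_cancel_left) auto
  also have "... = (\<integral>\<^sup>+a. ennreal (?X a) \<partial>wired_law rh ka be U)"
	unfolding plus_law_def by (rule B.gibbs_nn_integral[OF w Xm, symmetric])
  finally have e: "emeasure (wired_rc rh be ka U) S = (\<integral>\<^sup>+a. ennreal (?X a) \<partial>wired_law rh ka be U)" .
  have sets: "sets (wired_rc rh be ka U) = sets ?B" unfolding wired by simp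
  have "emeasure (rc_marginal F De (wired_rc rh be ka U)) (PiE F (%_. {True}) \<times> C) = emeasure (wired_rc rh be ka U) S"
  proof -
	have "(%(om, a). (restrict om F, restrict a De)) : measurable (wired_rc rh be ka U) (rc_algebra F De)"
	  using measurable_rc_restrict[OF r sub] measurable_cong_sets[OF sets refl] by blast
	moreover have "PiE F (%_. {True}) \<times> C : sets (rc_algebra F De)"
	  using C finF by (intro pair_measureI sets_PiM_I_finite) auto
	moreover have "(%(om, a). (restrict om F, restrict a De)) -` (PiE F (%_. {True}) \<times> C) Int space (wired_rc rh be ka U) = S"
	proof -
	  have "restrict om F : PiE F (%_. {True}) \<longleftrightarrow> (\<forall>e\<in>F. om e)" for om :: "'d edge => bool"
		unfolding PiE_iff by simp
	  then show ?thesis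
		unfolding sets_eq_imp_space_eq[OF sets] S_def
		by (intro set_eqI iffI) (simp_all add: split_beta mem_Times_iff)
	qed
	ultimately show ?thesis unfolding rc_marginal_def by (simp add: emeasure_distr)
  qed
  then have "measure (rc_marginal F De (wired_rc rh be ka U)) (PiE F (%_. {True}) \<times> C) = enn2real (\<integral>\<^sup>+a. ennreal (?X a) \<partial>wired_law rh ka be U)"
	unfolding measure_def e by simp
  also have "... = (\<integral>a. ?X a \<partial>wired_law rh ka be U)"
  proof (rule integral_eq_nn_integral[symmetric])
	show "?X : bm (wired_law rh ka be U)"
	  unfolding plus_law_def measurable_cong_sets[OF B.sets_gibbs refl] B.measurable_P by (rule rc_obs_measurable[OF C])
	show "AE a in wired_law rh ka be U. 0 <= ?X a"
	  unfolding plus_law_def using rc_obs_bounds(1)[OF fin b] by (intro AE_I2) (simp add: B.space_gibbs)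
  qed
  finally show ?thesis .
qed

end

lemma good_law_return: "good_law (return borel (0::real))"
  by (auto simp: good_law_def nn_integral_return)

lemma bdry_law_return_AE: "AE t in bdry_law (return borel (0::real)). t = 0"
proof -
  have [measurable]: "(%t::real. indicator (- {0}) t :: ennreal) : bm nnb"
	by (rule borel_measurable_nonneg_part) auto
  have s: "sets (bdry_law (return borel (0::real))) = sets nnb" by (rule sets_bdry_law) simp
  have "(\<integral>\<^sup>+t. indicator (- {0}) t \<partial>bdry_law (return borel (0::real))) = 0"
	by (subst nn_integral_bdry_law[OF good_law_return]) (auto simp: nn_integral_nonneg_part nn_integral_return)
  then have "AE t in bdry_law (return borel (0::real)). indicator (- {0}) t = (0::ennreal)"
	by (subst (asm) nn_integral_0_iff_AE) (auto simp: measurable_cong_sets[OF s refl])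
  then show ?thesis by eventually_elim (auto simp: indicator_def split: if_splits)
qed

context
  fixes rh :: "real measure" and U :: "'d::finite site set" and be :: real
  assumes r: "good_law rh" and fin: "finite U" and b: "0 <= be"
begin

private abbreviation "z \<equiv> return borel (0::real)"

lemma zero_boundary_AE: "AE a in PiM UNIV (site_law rh z U). \<forall>y\<in>EB U. a y = 0"
proof -
  interpret B: site_laws "site_law rh z U" by (rule site_laws_site_law[OF r good_law_return])
  have "AE a in PiM UNIV (site_law rh z U). a y = 0" if "y : EB U" for y
  proof (rule AE_PiM_component)
	have "y \<notin> U" using that by (simp add: ext_boundary_def)
	then have "site_law rh z U y = bdry_law z" by (simp add: site_law_def)
	then show "AE t in site_law rh z U y. t = 0" by (rule ssubst) (rule bdry_law_return_AE)
  qed (auto intro: B.prob)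
  then show ?thesis using finite_ext_boundary[OF fin] by (intro AE_finite_allI) auto
qed

text \<open>The free measure is the wired one whose boundary law is the point mass at 0, because vanishing boundary sites are no vertices.\<close>
lemma free_rc_eq_wired: "free_rc rh be U = wired_rc rh be z U"
proof -
  let ?T = "TE U" and ?V = "SC U" and ?B = "rc_base rh z U"
  note rr = r good_law_return
  interpret B: site_laws "site_law rh z U" by (rule site_laws_site_law[OF rr])
  have finP: "finite (PiE ?T (%_. UNIV :: bool set))" using bonds_finite[OF bonds_touching[OF fin]] by (intro finite_PiE) auto
  let ?bad = "%a. \<exists>y\<in>EB U. a y ~= (0::real)"
  have m1[measurable]: "Measurable.pred FA ?bad" using finite_ext_boundary[OF fin] by measurable
  have sub: "EB U <= ?V" by (auto simp: site_closure_def)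
  have m2: "Measurable.pred (PiM ?V (rc_sites rh z U)) ?bad"
  proof (rule pred_intros_finite(4)[OF finite_ext_boundary[OF fin]])
	fix y assume "y : EB U"
	then have "(%a. a y) : bm (PiM ?V (rc_sites rh z U))"
	  using sub by (intro rc_component_measurable[OF rr]) auto
	from measurable_sets[OF this, of "- {0}"]
	show "Measurable.pred (PiM ?V (rc_sites rh z U)) (%a. a y ~= 0)"
	  by (auto simp: pred_def vimage_def Int_def conj_commute intro!: back_subst[of "%S. S : sets (PiM ?V (rc_sites rh z U))"])
  qed
  have "(\<integral>\<^sup>+a. (if ?bad a then 1 else 0) \<partial>PiM ?V (rc_sites rh z U))
	<= (\<integral>\<^sup>+a. (if ?bad a then 1 else 0) * (\<Prod>x\<in>U. if a x = 0 then 1 else 2) \<partial>PiM ?V (rc_sites rh z U))"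
  proof (intro nn_integral_mono)
	fix a :: "'d site => real"
	have "(1::ennreal) <= (\<Prod>x\<in>U. if a x = 0 then 1 else 2)" by (intro prod_ge_1) auto
	then show "(if ?bad a then 1 else 0) <= (if ?bad a then 1 else 0) * (\<Prod>x\<in>U. if a x = 0 then 1 else (2::ennreal))" by auto
  qed
  also have "... = rc_const rh z U * (\<integral>\<^sup>+a. (if ?bad a then 1 else 0) \<partial>PiM UNIV (site_law rh z U))"
  proof (rule rc_site_integral[OF rr fin])
	show "(%a. if ?bad a then 1 else 0::ennreal) : bm FA" by measurable
	show "depends_on ?V (%a. if ?bad a then 1 else 0::ennreal)"
	proof (rule depends_onI)
	  fix a b :: "'d site => real" assume "!!x. x : ?V ==> a x = b x"
	  then have "a y = b y" if "y : EB U" for y using that sub by blast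
	  then have "?bad a = ?bad b" by simp
	  then show "(if ?bad a then 1 else 0) = (if ?bad b then 1 else (0::ennreal))" by simp
	qed
  qed
  also have "(\<integral>\<^sup>+a. (if ?bad a then 1 else 0) \<partial>PiM UNIV (site_law rh z U)) = (\<integral>\<^sup>+a. 0 \<partial>PiM UNIV (site_law rh z U))"
	using zero_boundary_AE by (intro nn_integral_cong_AE) (auto elim!: eventually_mono)
  finally have zero: "(\<integral>\<^sup>+a. (if ?bad a then 1 else 0) \<partial>PiM ?V (rc_sites rh z U)) = 0" by simp
  have m3: "Measurable.pred ?B (%c. ?bad (snd c))" by (rule measurable_compose[OF measurable_snd m2])
  have "(\<integral>\<^sup>+c. (if ?bad (snd c) then 1 else 0) \<partial>?B)
	= (\<integral>\<^sup>+a. (\<Sum>om\<in>PiE ?T (%_. UNIV :: bool set). (if ?bad (snd (om, a)) then 1 else 0)) \<partial>PiM ?V (rc_sites rh z U))"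
  proof -
	have "(%c. if ?bad (snd c) then 1 else 0::ennreal) : bm ?B"
	  by (rule measurable_If) (use m3 in \<open>auto simp: pred_def\<close>)
	from rc_base_integral[OF rr fin this] show ?thesis .
  qed
  also have "... = (\<integral>\<^sup>+a. of_nat (card (PiE ?T (%_. UNIV :: bool set))) * (if ?bad a then 1 else 0) \<partial>PiM ?V (rc_sites rh z U))"
	by (intro nn_integral_cong) simp
  also have "... = 0"
	using m2 by (subst nn_integral_cmult) (auto simp: zero intro!: measurable_If)
  finally have "AE c in ?B. (if ?bad (snd c) then 1 else 0) = (0::ennreal)"
	using m3 by (subst (asm) nn_integral_0_iff_AE) (auto intro!: measurable_If)
  then have "AE c in ?B. ~ ?bad (snd c)" by eventually_elim (auto split: if_splits)
  then have AE: "AE c in ?B. ennreal (rc_weight be (free_clusters U) U c) = ennreal (rc_weight be (wired_clusters U) U c)"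
  proof eventually_elim
	case (elim c)
	obtain om a where c: "c = (om, a)" by (cases c)
	have "nonzero_sites U a Int EB U = {}" using elim c by (auto simp: nonzero_sites_def)
	then have "(open_relation U om Un EB U \<times> EB U) Int nonzero_sites U a \<times> nonzero_sites U a
	  = open_relation U om Int nonzero_sites U a \<times> nonzero_sites U a" by auto
	then have "free_clusters U c = wired_clusters U c"
	  by (simp add: c free_clusters_def wired_clusters_def num_components_def)
	then show ?case by (simp add: c rc_weight_def)
  qed
  have mf: "rc_weight be (free_clusters U) U : bm ?B"
	by (rule rc_weight_measurable[OF rr fin, where R = "open_relation U"]) (simp add: free_clusters_def)
  have mw: "rc_weight be (wired_clusters U) U : bm ?B"
	by (rule rc_weight_measurable[OF rr fin, where R = "%om. open_relation U om Un EB U \<times> EB U"])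
	  (simp add: wired_clusters_def)
  have "density ?B (%c. ennreal (rc_weight be (free_clusters U) U c)) = density ?B (%c. ennreal (rc_weight be (wired_clusters U) U c))"
	using AE mf mw by (intro density_cong) auto
  then show ?thesis by (simp add: free_rc_def wired_rc_def rc_measure_def)
qed

lemma free_event:
  assumes sub: "F <= IE U" "De <= U" and C: "C : sets (PiM De (%_. nnb))"
  shows "measure (rc_marginal F De (free_rc rh be U)) (PiE F (%_. {True}) \<times> C)
	= (\<integral>a. rc_obs U (IE U) be F De C a \<partial>free_law rh be U)"
proof -
  let ?T = "TE U" and ?V = "SC U" and ?E = "IE U"
  note rr = r good_law_return
  interpret A: site_laws "%_::'d site. abs_law rh" by (rule site_laws_abs[OF r])
  interpret B: site_laws "site_law rh z U" by (rule site_laws_site_law[OF rr])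
  let ?X = "rc_obs U ?T be F De C" and ?w = "%a. bdry_factor U a * part_fun U ?T (%_. be) a"
  let ?X' = "rc_obs U ?E be F De C" and ?w' = "part_fun U ?E (%_. be)"
  have w: "B.weight ?V ?w" by (rule weight_plus[OF B.site_laws_axioms fin b bdry_weight_factor[OF fin]])
  have w': "B.weight U ?w'" "A.weight U ?w'"
	by (rule weight_free[OF B.site_laws_axioms fin b] weight_free[OF A.site_laws_axioms fin b])+
  have AE: "AE a in B.P. ?w a = ?w' a & ?X a = ?X' a"
	using zero_boundary_AE
  proof eventually_elim
	case (elim a)
	have z: "coupling (%_. be) a e = 0" if "e : ?T - ?E" for e
	proof -
	  have "\<exists>y\<in>e. y : EB U" using that bonds_D[OF bonds_touching[OF fin], of e]
		by (auto simp: inner_edges_iff[of e U] touching_edges_iff[of e U] site_closure_def)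
	  then show ?thesis using elim that bonds_D[OF bonds_touching[OF fin], of e] by (auto simp: coupling_def)
	qed
	have s': "ising_sum U ?T (coupling (%_. be) a) f = ising_sum U ?E (coupling (%_. be) a) f" for f
	proof -
	  have "ising_sum U ?T (coupling (%_. be) a) f = 2 ^ card (U - U) * ising_sum U ?E (coupling (%_. be) a) f"
	  proof (rule ising_sum_extend[OF fin order_refl bonds_finite[OF bonds_touching[OF fin]] inner_subset_touching z])
		fix A assume "A <= U"
		then show "f A = f (A Int U)" by (simp only: Int_absorb2)
	  qed auto
	  then show ?thesis by simp
	qed
	have "bdry_factor U a = 1" using elim by (simp add: bdry_factor_def)
	then show ?case by (simp add: ising_Z_def rc_obs_def ising_corr_def s')
  qed
  have mX: "?X : bm FA" "?X' : bm FA"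
	by (rule rc_obs_measurable[OF C])+
  have wm: "?w : bm FA" "?w' : bm FA"
	using w w' by (auto simp: B.weight_def B.measurable_P)
  have AE1: "AE a in B.P. ?X a * ?w a = ?X' a * ?w' a" and AE2: "AE a in B.P. ?w a = ?w' a"
	using AE by (rule eventually_mono, elim conjE, simp only:)+
  have "(\<integral>a. ?X a \<partial>wired_law rh z be U) = (\<integral>a. ?X a * ?w a \<partial>B.P) / (\<integral>a. ?w a \<partial>B.P)"
	unfolding plus_law_def by (rule B.gibbs_integral[OF w]) (simp add: mX B.measurable_P)
  also have "(\<integral>a. ?X a * ?w a \<partial>B.P) = (\<integral>a. ?X' a * ?w' a \<partial>B.P)"
	using AE1 borel_measurable_times[OF mX(1) wm(1)] borel_measurable_times[OF mX(2) wm(2)]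
	by (intro integral_cong_AE) (simp_all only: B.measurable_P)
  also have "(\<integral>a. ?w a \<partial>B.P) = (\<integral>a. ?w' a \<partial>B.P)"
	using AE2 wm by (intro integral_cong_AE) (simp_all only: B.measurable_P)
  also have "(\<integral>a. ?X' a * ?w' a \<partial>B.P) / (\<integral>a. ?w' a \<partial>B.P) = (\<integral>a. ?X' a \<partial>gibbs_law (site_law rh z U) ?w')"
	by (rule B.gibbs_integral[OF w'(1), symmetric]) (simp add: mX B.measurable_P)
  also have "... = enn2real (\<integral>\<^sup>+a. ennreal (?X' a) \<partial>gibbs_law (site_law rh z U) ?w')"
	using rc_obs_bounds(1)[OF fin b] mX
	by (intro integral_eq_nn_integral) (auto simp: measurable_cong_sets[OF B.sets_gibbs refl] B.measurable_P B.space_gibbs)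
  also have "(\<integral>\<^sup>+a. ennreal (?X' a) \<partial>gibbs_law (site_law rh z U) ?w') = (\<integral>\<^sup>+a. ennreal (?X' a) \<partial>free_law rh be U)"
	unfolding free_law_def
  proof (rule gibbs_nn_cong[OF B.site_laws_axioms A.site_laws_axioms _ w'(1)])
	have "depends_on U ?X'" by (rule depends_on_rc_obs[OF bonds_inner[OF fin] sub])
	from depends_on_combine[OF this this, where h = "%u v. ennreal u"]
	show "depends_on U (%a. ennreal (?X' a))" .
  qed (use mX in \<open>auto simp: site_law_def\<close>)
  also have "enn2real ... = (\<integral>a. ?X' a \<partial>free_law rh be U)"
	using rc_obs_bounds(1)[OF fin b] mX unfolding free_law_def
	by (intro integral_eq_nn_integral[symmetric]) (auto simp: measurable_cong_sets[OF A.sets_gibbs refl] A.measurable_P A.space_gibbs)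
  finally show ?thesis
	unfolding free_rc_eq_wired using sub inner_subset_touching[of U] C
	by (subst wired_event[OF rr fin b]) (auto simp: site_closure_def)
qed

end

section \<open>Regularity of the free law\<close>

lemma good_law_admissible:
  assumes "admissible rh" shows "good_law rh"
proof -
  have s: "sets rh = sets borel" and sym: "!!A. A : sets borel ==> emeasure rh A = emeasure rh (uminus ` A)"
	and g: "!!a. 0 < a ==> (\<integral>\<^sup>+u. ennreal (exp (a * u\<^sup>2)) \<partial>rh) < \<infinity>" and pos: "0 < emeasure rh (UNIV - {0})"
	using assms unfolding admissible_def by auto
  have "(\<integral>\<^sup>+u. ennreal (exp (c * u\<^sup>2)) \<partial>rh) < \<infinity>" for c
  proof -
	have "(\<integral>\<^sup>+u. ennreal (exp (c * u\<^sup>2)) \<partial>rh) <= (\<integral>\<^sup>+u. ennreal (exp ((\<bar>c\<bar> + 1) * u\<^sup>2)) \<partial>rh)"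
	  by (intro nn_integral_mono ennreal_leI) (auto intro!: mult_right_mono)
	also have "... < \<infinity>" by (rule g) simp
	finally show ?thesis .
  qed
  moreover have "0 < emeasure rh {0..}"
  proof (rule ccontr)
	assume "~ 0 < emeasure rh {0..}"
	then have z: "emeasure rh {0..} = 0" by simp
	have "uminus ` {0::real..} = {..0}" by auto
	then have "emeasure rh {..0} = 0" using sym[of "{0..}"] z by simp
	then have "emeasure rh ({0..} Un {..0}) = 0"
	  using emeasure_subadditive[of "{0..}" rh "{..0}"] z s by (simp add: sup.absorb1)
	moreover have "{0..} Un {..0} = (UNIV :: real set)" by auto
	ultimately have "emeasure rh UNIV = 0" by simp
	then have "emeasure rh (UNIV - {0}) = 0" using emeasure_mono[of "UNIV - {0}" UNIV rh] s by auto
	then show False using pos by simp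
  qed
  ultimately show ?thesis using s by (simp add: good_law_def)
qed

lemma admissible_reflect:
  assumes "admissible rh" "f : bm borel"
  shows "(\<integral>\<^sup>+t. f (- t) \<partial>rh) = (\<integral>\<^sup>+t. f t \<partial>rh)"
proof -
  have s: "sets rh = sets borel" and sym: "!!A. A : sets borel ==> emeasure rh A = emeasure rh (uminus ` A)"
	using assms unfolding admissible_def by auto
  have m: "uminus : measurable rh borel" unfolding measurable_cong_sets[OF s refl] by simp
  have "distr rh borel uminus = rh"
  proof (rule measure_eqI)
	fix A assume "A : sets (distr rh borel uminus)"
	then have A: "A : sets borel" by simp
	have "uminus -` A = uminus ` A" by (auto simp: image_iff) (metis minus_minus)
	then show "emeasure (distr rh borel uminus) A = emeasure rh A"
	  using A m sym[OF A] sets_eq_imp_space_eq[OF s] by (simp add: emeasure_distr)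
  qed (simp add: s)
  then have "(\<integral>\<^sup>+t. f t \<partial>rh) = (\<integral>\<^sup>+t. f t \<partial>distr rh borel uminus)" by simp
  also have "... = (\<integral>\<^sup>+t. f (- t) \<partial>rh)" using m assms(2) by (intro nn_integral_distr) auto
  finally show ?thesis by simp
qed

lemma nn_integral_admissible:
  assumes a: "admissible rh" and f[measurable]: "f : bm borel"
  shows "(\<integral>\<^sup>+t. f t \<partial>rh) = (abs_mass rh / 2) * (\<integral>\<^sup>+t. (f t + f (- t)) \<partial>abs_law rh)"
proof -
  note g = good_law_admissible[OF a]
  have s: "sets rh = sets borel" using g by (simp add: good_law_def)
  have mr: "measurable rh K = measurable borel K" for K :: "ennreal measure" by (rule measurable_cong_sets[OF s refl])
  have [measurable]: "(%t::real. if t = 0 then 1 else 2::ennreal) : bm borel"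
	by (intro measurable_If) auto
  have m1: "(%t. f t * (if t = 0 then 1 else 2) * indicator {0..} t) : bm borel"
	and m2: "(%t. f t * (if t = 0 then 1 else 2) * indicator {..0} t) : bm borel" by measurable
  have m3: "(%t. f (- t) * (if - t = 0 then 1 else 2) * indicator {..0} (- t)) : bm borel"
	by (rule measurable_compose[OF _ m2]) simp
  let ?c = "%t::real. if t = 0 then 1 else (2::ennreal)"
  have fm: "(%t. f t + f (- t)) : bm nnb"
	by (rule borel_measurable_nonneg_part) measurable
  have "(\<integral>\<^sup>+t. (f t + f (- t)) * ?c t \<partial>nonneg_part rh) = (\<integral>\<^sup>+t. (f t + f (- t)) * ?c t * indicator {0..} t \<partial>rh)"
	by (rule nn_integral_nonneg_part[OF s])
  also have "... = (\<integral>\<^sup>+t. f t * ?c t * indicator {0..} t + f (- t) * ?c (- t) * indicator {..0} (- t) \<partial>rh)"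
	by (intro nn_integral_cong) (auto simp: indicator_def distrib_right)
  also have "... = (\<integral>\<^sup>+t. f t * ?c t * indicator {0..} t \<partial>rh) + (\<integral>\<^sup>+t. f (- t) * ?c (- t) * indicator {..0} (- t) \<partial>rh)"
	by (rule nn_integral_add) (unfold mr, rule m1, rule m3)
  also have "(\<integral>\<^sup>+t. f (- t) * ?c (- t) * indicator {..0} (- t) \<partial>rh) = (\<integral>\<^sup>+t. f t * ?c t * indicator {..0} t \<partial>rh)"
	by (rule admissible_reflect[OF a m2])
  also have "(\<integral>\<^sup>+t. f t * ?c t * indicator {0..} t \<partial>rh) + (\<integral>\<^sup>+t. f t * ?c t * indicator {..0} t \<partial>rh)
	= (\<integral>\<^sup>+t. f t * ?c t * indicator {0..} t + f t * ?c t * indicator {..0} t \<partial>rh)"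
	by (rule nn_integral_add[symmetric]) (unfold mr, rule m1, rule m2)
  also have "... = (\<integral>\<^sup>+t. 2 * f t \<partial>rh)"
	by (intro nn_integral_cong) (auto simp: indicator_def mult_2 mult_2_right mult.commute[of _ 2])
  also have "... = 2 * (\<integral>\<^sup>+t. f t \<partial>rh)" by (rule nn_integral_cmult) (simp add: mr)
  finally have 1: "(\<integral>\<^sup>+t. (f t + f (- t)) * ?c t \<partial>nonneg_part rh) = 2 * (\<integral>\<^sup>+t. f t \<partial>rh)" .
  define X where "X = (\<integral>\<^sup>+t. f t \<partial>rh)"
  define m where "m = abs_mass rh"
  have m: "m ~= 0" "m ~= \<infinity>" using abs_mass[OF g] by (auto simp: m_def)
  have "(abs_mass rh / 2) * (\<integral>\<^sup>+t. (f t + f (- t)) \<partial>abs_law rh) = (m / 2) * (2 * X / m)"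
	unfolding nn_integral_abs_law[OF g fm] 1 X_def m_def ..
  also have "... = (m / 2) * (2 * X) / m" by (simp add: ennreal_times_divide)
  also have "(m / 2) * (2 * X) = X * m"
  proof -
	have "m / 2 * 2 = m" using ennreal_mult_divide_eq[of 2 m] by (simp add: ennreal_divide_times)
	then show ?thesis by (metis mult.assoc mult.commute)
  qed
  also have "X * m / m = X" using m by (intro ennreal_mult_divide_eq) auto
  finally show ?thesis by (simp add: X_def)
qed

definition flip :: "'v set => ('v => real) => 'v => real" where
  "flip A a x = (if x : A then - a x else a x)"

lemma measurable_flip: "flip A : measurable (PiM V (%_. nnb)) (PiM V (%_. borel))" if "A <= V"
proof (rule measurable_PiM_single')
  fix x assume x: "x : V"
  have "(%t. t) : bm nnb"
	unfolding nonneg_part_def by (intro measurable_restrict_space1) simp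
  then have [measurable]: "(%a. a x) : bm (PiM V (%_. nnb))"
	by (rule measurable_compose[OF measurable_component_singleton[OF x]])
  show "(%a. flip A a x) : bm (PiM V (%_. nnb))"
	unfolding flip_def by (cases "x : A") auto
qed (use that in \<open>auto simp: flip_def space_PiM PiE_def extensional_def\<close>)

text \<open>Average over independent sign flips of the coordinates, under which the reference measure is invariant.\<close>
lemma nn_integral_PiM_signs:
  fixes N mu :: "'v => real measure"
  assumes fin: "finite V"
	and N: "!!x. sigma_finite_measure (N x)" "!!x. sets (N x) = sets borel"
	and M: "!!x. sigma_finite_measure (mu x)" "!!x. sets (mu x) = sets nnb"
	and one: "!!x f. x : V ==> f : bm borel ==>
	  (\<integral>\<^sup>+t. f t \<partial>N x) = k x * (\<integral>\<^sup>+t. (if x : U then f t + f (- t) else f t) \<partial>mu x)"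
	and f: "f : bm (PiM V (%_. borel))"
  shows "(\<integral>\<^sup>+ta. f ta \<partial>PiM V N) = (\<Prod>x\<in>V. k x) * (\<integral>\<^sup>+a. (\<Sum>A\<in>Pow (V Int U). f (flip A a)) \<partial>PiM V mu)"
  using fin one f
proof (induction V arbitrary: f rule: finite_induct)
  case empty
  have "flip {} a = a" for a :: "'v => real" by (auto simp: flip_def fun_eq_iff)
  then show ?case by (simp add: PiM_empty nn_integral_count_space_finite)
next
  case (insert i V)
  interpret N: product_sigma_finite N by (rule product_sigma_finite.intro[OF N(1)])
  interpret M: product_sigma_finite mu by (rule product_sigma_finite.intro[OF M(1)])
  have mN: "measurable (N x) K = measurable borel K" for x and K :: "ennreal measure" by (intro measurable_cong_sets N refl)
  have mM: "measurable (mu x) K = measurable nnb K" for x and K :: "ennreal measure" by (intro measurable_cong_sets M refl)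
  have mPN: "measurable (PiM I N) K = measurable (PiM I (%_. borel)) K" for I and K :: "ennreal measure"
	by (intro measurable_cong_sets sets_PiM_cong N refl)
  have mPM: "measurable (PiM I mu) K = measurable (PiM I (%_. nnb)) K" for I and K :: "ennreal measure"
	by (intro measurable_cong_sets sets_PiM_cong M refl)
  have spM: "space (PiM V mu) = space (PiM V (%_. nnb))"
	by (intro sets_eq_imp_space_eq sets_PiM_cong M refl)
  have sub: "(%(a, u). a(i := u)) : measurable (PiM V (%_. borel) \<Otimes>\<^sub>M borel) (PiM (insert i V) (%_. borel :: real measure))"
	by (rule measurable_add_dim)
  have f1: "(%u. f (ta(i := u))) : bm borel" if "ta : space (PiM V (%_. borel))" for ta
	using measurable_compose[OF measurable_Pair1'[OF that] measurable_compose[OF sub insert.prems(2)]]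
	by (simp add: fun_upd_def)
  define G where "G = (%ta. \<integral>\<^sup>+u. f (ta(i := u)) \<partial>N i)"
  have G: "G : bm (PiM V (%_. borel))"
  proof -
	have "case_prod (%a u. f (a(i := u))) : bm (PiM V (%_. borel) \<Otimes>\<^sub>M N i)"
	  using measurable_compose[OF sub insert.prems(2)]
	  by (subst measurable_cong_sets[OF sets_pair_measure_cong[OF refl N(2)] refl]) (simp add: split_beta' fun_upd_def)
	then show ?thesis unfolding G_def by (rule sigma_finite_measure.borel_measurable_nn_integral[OF N(1)])
  qed
  let ?S = "%a. \<Sum>A\<in>Pow (insert i V Int U). f (flip A a)"
  have S: "?S : bm (PiM (insert i V) (%_. nnb))"
	by (intro borel_measurable_sum measurable_compose[OF measurable_flip insert.prems(2)]) auto
  have "(\<integral>\<^sup>+ta. f ta \<partial>PiM (insert i V) N) = (\<integral>\<^sup>+ta. G ta \<partial>PiM V N)"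
	unfolding G_def using insert.prems(2) insert.hyps by (intro N.product_nn_integral_insert) (auto simp: mPN)
  also have "... = (\<Prod>x\<in>V. k x) * (\<integral>\<^sup>+a. (\<Sum>A\<in>Pow (V Int U). G (flip A a)) \<partial>PiM V mu)"
	by (rule insert.IH[OF insert.prems(1) G]) auto
  also have "(\<integral>\<^sup>+a. (\<Sum>A\<in>Pow (V Int U). G (flip A a)) \<partial>PiM V mu)
	= (\<integral>\<^sup>+a. k i * (\<integral>\<^sup>+u. ?S (a(i := u)) \<partial>mu i) \<partial>PiM V mu)"
  proof (intro nn_integral_cong)
	fix a assume "a : space (PiM V mu)"
	then have a: "a : space (PiM V (%_. nnb))" by (simp add: spM)
	have fl: "flip A a : space (PiM V (%_. borel))" if "A <= V" for A
	  using measurable_space[OF measurable_flip[OF that] a] .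
	have nnb: "g : bm nnb" if "g : bm borel" for g :: "real => ennreal"
	  by (rule borel_measurable_nonneg_part[OF refl that])
	have m2: "(%t. if i : U then f ((flip A a)(i := t)) + f ((flip A a)(i := - t)) else f ((flip A a)(i := t))) : bm (mu i)"
	  if "A <= V" for A
	proof -
	  have "(%u. f ((flip A a)(i := - u))) : bm borel"
		by (rule measurable_compose[OF _ f1[OF fl[OF that]]]) simp
	  then show ?thesis unfolding mM using f1[OF fl[OF that]] by (cases "i : U") (auto intro!: nnb)
	qed
	have "(\<Sum>A\<in>Pow (V Int U). G (flip A a)) = (\<Sum>A\<in>Pow (V Int U). k i *
	   (\<integral>\<^sup>+t. (if i : U then f ((flip A a)(i := t)) + f ((flip A a)(i := - t)) else f ((flip A a)(i := t))) \<partial>mu i))"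
	  unfolding G_def by (intro sum.cong refl insert.prems(1) f1 fl) auto
	also have "... = k i * (\<integral>\<^sup>+t. (\<Sum>A\<in>Pow (V Int U). (if i : U then f ((flip A a)(i := t)) + f ((flip A a)(i := - t)) else f ((flip A a)(i := t)))) \<partial>mu i)"
	  unfolding sum_distrib_left[symmetric] using m2 by (subst nn_integral_sum) auto
	also have "(\<integral>\<^sup>+t. (\<Sum>A\<in>Pow (V Int U). (if i : U then f ((flip A a)(i := t)) + f ((flip A a)(i := - t)) else f ((flip A a)(i := t)))) \<partial>mu i)
	   = (\<integral>\<^sup>+u. ?S (a(i := u)) \<partial>mu i)"
	proof (intro nn_integral_cong)
	  fix t
	  have 1: "flip A (a(i := t)) = (flip A a)(i := t)" if "i \<notin> A" for A using that by (auto simp: flip_def)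
	  have 2: "flip (insert i A) (a(i := t)) = (flip A a)(i := - t)" for A by (auto simp: flip_def)
	  have iA: "i \<notin> A" if "A : Pow (V Int U)" for A using that insert.hyps by auto
	  show "(\<Sum>A\<in>Pow (V Int U). (if i : U then f ((flip A a)(i := t)) + f ((flip A a)(i := - t)) else f ((flip A a)(i := t)))) = ?S (a(i := t))"
	  proof (cases "i : U")
		case True
		have P: "Pow (insert i V Int U) = Pow (V Int U) Un insert i ` Pow (V Int U)"
		  using True by (simp add: Pow_insert)
		have "?S (a(i := t)) = (\<Sum>A\<in>Pow (V Int U). f (flip A (a(i := t)))) + (\<Sum>A\<in>insert i ` Pow (V Int U). f (flip A (a(i := t))))"
		  unfolding P using insert.hyps by (intro sum.union_disjoint) auto
		also have "(\<Sum>A\<in>insert i ` Pow (V Int U). f (flip A (a(i := t)))) = (\<Sum>A\<in>Pow (V Int U). f (flip (insert i A) (a(i := t))))"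
		  by (rule sum.reindex[unfolded o_def]) (use insert.hyps in \<open>auto intro!: inj_onI\<close>)
		also have "(\<Sum>A\<in>Pow (V Int U). f (flip A (a(i := t)))) = (\<Sum>A\<in>Pow (V Int U). f ((flip A a)(i := t)))"
		  using 1 iA by (intro sum.cong refl) simp
		finally show ?thesis by (simp only: if_P[OF True] sum.distrib 2)
	  next
		case False
		then have "insert i V Int U = V Int U" by auto
		then show ?thesis using False 1 iA by (auto intro!: sum.cong)
	  qed
	qed
	finally show "(\<Sum>A\<in>Pow (V Int U). G (flip A a)) = k i * (\<integral>\<^sup>+u. ?S (a(i := u)) \<partial>mu i)" .
  qed
  also have "... = k i * (\<integral>\<^sup>+a. (\<integral>\<^sup>+u. ?S (a(i := u)) \<partial>mu i) \<partial>PiM V mu)"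
  proof (rule nn_integral_cmult)
	have sub': "(%(a, u). a(i := u)) : measurable (PiM V mu \<Otimes>\<^sub>M mu i) (PiM (insert i V) mu)" by (rule measurable_add_dim)
	have "?S : bm (PiM (insert i V) mu)" unfolding mPM by (rule S)
	from measurable_compose[OF sub' this]
	show "(%a. \<integral>\<^sup>+u. ?S (a(i := u)) \<partial>mu i) : bm (PiM V mu)"
	  by (intro sigma_finite_measure.borel_measurable_nn_integral[OF M(1)]) (simp add: split_beta')
  qed
  also have "(\<integral>\<^sup>+a. (\<integral>\<^sup>+u. ?S (a(i := u)) \<partial>mu i) \<partial>PiM V mu) = (\<integral>\<^sup>+a. ?S a \<partial>PiM (insert i V) mu)"
	using S insert.hyps by (intro M.product_nn_integral_insert[symmetric]) (auto simp: mPM)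
  finally show ?case using insert.hyps by (simp add: mult_ac)
qed

lemma good_law_finite:
  assumes "good_law rh" shows "finite_measure rh"
proof (rule finite_measureI)
  have "(\<integral>\<^sup>+t. ennreal (exp (0 * t\<^sup>2)) \<partial>rh) < \<infinity>" using assms unfolding good_law_def by blast
  then show "emeasure rh (space rh) ~= \<infinity>" by simp
qed

lemma ext_boundary_nonempty:
  fixes U :: "'d::finite site set"
  assumes "finite U" "U ~= {}" shows "EB U ~= {}"
proof -
  obtain i :: 'd where True by simp
  define m where "m = Max ((%x. x $ i) ` U)"
  have "m : (%x. x $ i) ` U" unfolding m_def using assms by (intro Max_in) auto
  then obtain x where x: "x : U" "x $ i = m" by auto
  define y where "y = (\<chi> j. x $ j + (if j = i then 1 else 0))"
  have "y \<notin> U"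
  proof
	assume "y : U"
	then have "y $ i <= m" unfolding m_def using assms by (intro Max_ge) auto
	then show False using x by (simp add: y_def)
  qed
  moreover have "adjacent x y"
  proof -
	have "(\<Sum>j\<in>UNIV. \<bar>x $ j - y $ j\<bar>) = (\<Sum>j\<in>UNIV. if j = i then 1 else 0)"
	  by (intro sum.cong) (auto simp: y_def)
	then show ?thesis by (simp add: adjacent_def)
  qed
  ultimately show ?thesis using x by (auto simp: ext_boundary_def)
qed

lemma spin_weight_measurable:
  fixes U :: "'d::finite site set"
  assumes "finite U" "!!x. sets (N x) = sets borel"
  shows "(%ta. ennreal (exp (be * (\<Sum>e\<in>TE U. \<Prod>x\<in>e. ta x)))) : bm (PiM (SC U) N)"
proof -
  have c: "(%ta. ta x) : bm (PiM (SC U) (%_. borel :: real measure))" if "x : SC U" for x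
	by (rule measurable_component_singleton[OF that])
  have "(%ta. \<Sum>e\<in>TE U. \<Prod>x\<in>e. ta x) : bm (PiM (SC U) (%_. borel :: real measure))"
	using bonds_D[OF bonds_touching[OF assms(1)]] by (intro borel_measurable_sum borel_measurable_prod c) auto
  then have "(%ta. ennreal (exp (be * (\<Sum>e\<in>TE U. \<Prod>x\<in>e. ta x)))) : bm (PiM (SC U) (%_. borel :: real measure))"
	by measurable
  moreover have "sets (PiM (SC U) N) = sets (PiM (SC U) (%_. borel :: real measure))"
	by (intro sets_PiM_cong refl assms)
  ultimately show ?thesis using measurable_cong_sets by blast
qed

lemma good_law_wired_boundary:
  assumes r: "good_law rh" and w: "wired_boundary_law TYPE('d::finite) rh be\<^sub>0 ze" and b: "0 <= be" "be <= be\<^sub>0"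
  shows "good_law ze"
proof -
  have s: "sets ze = sets borel" and neg: "emeasure ze {..<0} = 0"
	and g: "!!A. 0 < A ==> (\<integral>\<^sup>+t. ennreal (exp (A * t\<^sup>2)) \<partial>ze) < \<infinity>"
	using w by (auto simp: wired_boundary_law_def)
  obtain \<nu> :: "('d site => real) measure" where \<nu>: "plus_measure rh be \<nu>" "converges_weakly (spin_measure rh be (%_. ze)) \<nu>"
	using w b unfolding wired_boundary_law_def by blast
  have "(\<integral>\<^sup>+u. ennreal (exp (c * u\<^sup>2)) \<partial>ze) < \<infinity>" for c
  proof -
	have "(\<integral>\<^sup>+u. ennreal (exp (c * u\<^sup>2)) \<partial>ze) <= (\<integral>\<^sup>+u. ennreal (exp ((\<bar>c\<bar> + 1) * u\<^sup>2)) \<partial>ze)"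
	  by (intro nn_integral_mono ennreal_leI) (auto intro!: mult_right_mono)
	also have "... < \<infinity>" by (rule g) simp
	finally show ?thesis .
  qed
  moreover have "0 < emeasure ze {0..}"
  proof (rule ccontr)
	assume "~ 0 < emeasure ze {0..}"
	then have "emeasure ze {0..} = 0" by simp
	then have "emeasure ze ({0..} Un {..<0}) = 0"
	  using emeasure_subadditive[of "{0..}" ze "{..<0}"] neg s by (simp add: sup.absorb1)
	moreover have "{0..} Un {..<0} = (UNIV :: real set)" by auto
	ultimately have z: "emeasure ze (space ze) = 0" using sets_eq_imp_space_eq[OF s] by simp
	\<comment> \<open>then all finite-volume measures vanish, against convergence to a probability measure\<close>
	have spin0: "(\<integral>ta. 1 \<partial>spin_measure rh be (%_. ze) U) = (0::real)"
	  if L: "U ~= {}" "finite U" for U :: "'d site set"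
	proof -
	  have sr: "sets rh = sets borel" and sgrh: "sigma_finite_measure rh"
		using r good_law_finite[OF r] by (auto simp: good_law_def finite_measure_def)
	  have sg: "sigma_finite_measure (boundary_reference rh (%_. ze) U x)" for x
	  proof (cases "x : U")
		case True then show ?thesis using sgrh by (simp add: boundary_reference_def)
	  next
		case False
		have "finite_measure ze" by (rule finite_measureI) (simp add: z)
		then show ?thesis using False by (simp add: boundary_reference_def finite_measure_def)
	  qed
	  interpret N: product_sigma_finite "boundary_reference rh (%_. ze) U" by (rule product_sigma_finite.intro[OF sg])
	  let ?M = "PiM (SC U) (boundary_reference rh (%_. ze) U)"
	  let ?h = "%ta. ennreal (exp (be * (\<Sum>e\<in>TE U. \<Prod>x\<in>e. ta x)))"
	  have h: "?h : bm ?M"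
		using spin_weight_measurable[OF L(2), of "boundary_reference rh (%_. ze) U" be] s sr
		by (simp add: boundary_reference_def)
	  obtain y where y: "y : EB U" using ext_boundary_nonempty[OF L(2,1)] by auto
	  have fV: "finite (SC U)" by (rule finite_site_closure[OF L(2)])
	  have "emeasure ?M (space ?M) = (\<Prod>x\<in>SC U. emeasure (boundary_reference rh (%_. ze) U x) (space (boundary_reference rh (%_. ze) U x)))"
		unfolding space_PiM by (rule N.emeasure_PiM[OF fV]) auto
	  also have "... = 0"
		using y z fV by (intro prod_zero bexI[of _ y]) (auto simp: boundary_reference_def ext_boundary_def site_closure_def)
	  finally have "space ?M : null_sets ?M" by auto
	  then have "AE ta in ?M. ?h ta = 0" using AE_not_in[of "space ?M" ?M] AE_space[of ?M] by auto
	  then have "(\<integral>\<^sup>+ta. ?h ta \<partial>?M) = 0" using h by (simp add: nn_integral_0_iff_AE)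
	  moreover have "emeasure (density ?M ?h) (space ?M) = (\<integral>\<^sup>+ta. ?h ta \<partial>?M)"
		using h by (subst emeasure_density) (auto intro!: nn_integral_cong)
	  ultimately have "emeasure (spin_measure rh be (%_. ze) U) (space ?M) = 0"
		by (simp add: spin_measure_def normalized_measure_def)
	  then show ?thesis by (simp add: measure_def spin_measure_def space_density)
	qed
	have "((%U. \<integral>ta. 1 \<partial>spin_measure rh be (%_. ze) U) \<longlongrightarrow> (\<integral>ta. (1::real) \<partial>\<nu>)) (finite_subsets_at_top (UNIV :: 'd site set))"
	proof -
	  have "bounded (range (%_ :: 'd site => real. 1 :: real))" by (rule finite_imp_bounded) (simp add: image_constant_conv)
	  then show ?thesis
		using \<nu>(2)[unfolded converges_weakly_def, rule_format, of "{}" "%_. 1"] by simp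
	qed
	moreover have "(\<integral>ta. (1::real) \<partial>\<nu>) = 1"
	proof -
	  interpret prob_space \<nu> using \<nu>(1) by (auto simp: plus_measure_def regular_gibbs_def)
	  show ?thesis by (simp add: prob_space)
	qed
	moreover have "((%U. \<integral>ta. 1 \<partial>spin_measure rh be (%_. ze) U) \<longlongrightarrow> (0::real)) (finite_subsets_at_top (UNIV :: 'd site set))"
	  unfolding eventually_finite_subsets_at_top
	  by (rule tendsto_eventually, unfold eventually_finite_subsets_at_top, rule exI[of _ "{0}"])
		(intro conjI allI impI spin0, auto)
	ultimately have "(0::real) = 1" by (metis tendsto_unique finite_subsets_at_top_neq_bot)
	then show False by simp
  qed
  ultimately show ?thesis using s by (simp add: good_law_def)
qed

lemma spin_measure_integral:
  fixes U :: "'d::finite site set" and c :: real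
  assumes adm: "admissible rh" and z: "good_law ze" "emeasure ze {..<0} = 0" and fin: "finite U" and b: "0 <= be"
	and D: "De <= U"
  defines "f \<equiv> %ta. \<Prod>x\<in>De. ennreal (exp (c * (ta x)\<^sup>2))"
  shows "(\<integral>\<^sup>+ta. f ta \<partial>spin_measure rh be (%_. ze) U) = (\<integral>\<^sup>+a. f a \<partial>plus_law rh ze (%_. 1) be U)"
proof -
  note r = good_law_admissible[OF adm]
  have sr: "sets rh = sets borel" "sets ze = sets borel" using r z by (simp_all add: good_law_def)
  let ?V = "SC U" and ?T = "TE U"
  let ?N = "boundary_reference rh (%_. ze) U"
  let ?h = "%ta. ennreal (exp (be * (\<Sum>e\<in>?T. \<Prod>x\<in>e. ta x)))"
  let ?Z = "part_fun U ?T (%_. be)"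
  let ?k = "%x. if x : U then abs_mass rh / 2 else emeasure (nonneg_part ze) {0..}"
  interpret B: site_laws "site_law rh ze U" by (rule site_laws_site_law[OF r z(1)])
  have sN: "sets (?N x) = sets borel" for x using sr by (simp add: boundary_reference_def)
  have sgN: "sigma_finite_measure (?N x)" for x
	using good_law_finite[OF r] good_law_finite[OF z(1)] by (simp add: boundary_reference_def finite_measure_def)
  have fV: "finite ?V" by (rule finite_site_closure[OF fin])
  have sub: "U <= ?V" by (auto simp: site_closure_def)
  have mPN: "measurable (PiM ?V ?N) K = measurable (PiM ?V (%_. borel)) K" for K :: "ennreal measure"
	by (intro measurable_cong_sets sets_PiM_cong sN refl)
  have hm: "?h : bm (PiM ?V ?N)" by (rule spin_weight_measurable[OF fin sN])
  have fm: "(%ta. \<Prod>x\<in>D. ennreal (exp (c * (ta x)\<^sup>2))) : bm (PiM ?V ?N)" if "D <= U" for D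
	unfolding mPN
  proof (intro borel_measurable_prod_ennreal)
	fix x assume "x : D"
	then have [measurable]: "(%ta. ta x) : bm (PiM ?V (%_. borel :: real measure))"
	  using that sub by (intro measurable_component_singleton) auto
	show "(%ta. ennreal (exp (c * (ta x)\<^sup>2))) : bm (PiM ?V (%_. borel :: real measure))" by measurable
  qed
  have one: "(\<integral>\<^sup>+t. g t \<partial>?N x) = ?k x * (\<integral>\<^sup>+t. (if x : U then g t + g (- t) else g t) \<partial>site_law rh ze U x)"
	if g: "g : bm borel" for g x
  proof (cases "x : U")
	case True
	then show ?thesis using nn_integral_admissible[OF adm g] by (simp add: boundary_reference_def site_law_def)
  next
	case False
	have gm: "g : bm nnb" by (rule borel_measurable_nonneg_part[OF refl g])
	have "(\<integral>\<^sup>+t. g t \<partial>ze) = (\<integral>\<^sup>+t. g t * indicator {0..} t \<partial>ze)"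
	proof (rule nn_integral_cong_AE)
	  have "{..<0} : null_sets ze" using z(2) sr by auto
	  from AE_not_in[OF this] show "AE t in ze. g t = g t * indicator {0..} t"
		by eventually_elim (auto simp: indicator_def)
	qed
	also have "... = (\<integral>\<^sup>+t. g t \<partial>nonneg_part ze)" by (rule nn_integral_nonneg_part[OF sr(2), symmetric])
	also have "... = emeasure (nonneg_part ze) {0..} * (\<integral>\<^sup>+t. g t \<partial>bdry_law ze)"
	proof -
	  define m Y where "m = emeasure (nonneg_part ze) {0..}" and "Y = (\<integral>\<^sup>+t. g t \<partial>nonneg_part ze)"
	  have "m ~= 0" "m ~= \<infinity>" using good_law_total[OF z(1)] by (auto simp: m_def)
	  then have "Y * m / m = Y" by (intro ennreal_mult_divide_eq) auto
	  then have "Y = m * (Y / m)" by (simp add: ennreal_times_divide mult.commute)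
	  then show ?thesis unfolding nn_integral_bdry_law[OF z(1) gm] m_def Y_def .
	qed
	finally show ?thesis using False by (simp add: boundary_reference_def site_law_def)
  qed
  have total: "(\<integral>\<^sup>+ta. (\<Prod>x\<in>D. ennreal (exp (c * (ta x)\<^sup>2))) \<partial>density (PiM ?V ?N) ?h)
	= (\<Prod>x\<in>?V. ?k x) * (\<integral>\<^sup>+a. (\<Prod>x\<in>D. ennreal (exp (c * (a x)\<^sup>2))) * ennreal (?Z a) \<partial>B.P)" if DL: "D <= U" for D
  proof -
	let ?g = "%ta. \<Prod>x\<in>D. ennreal (exp (c * (ta x)\<^sup>2))"
	have "(\<integral>\<^sup>+ta. ?g ta \<partial>density (PiM ?V ?N) ?h) = (\<integral>\<^sup>+ta. ?h ta * ?g ta \<partial>PiM ?V ?N)"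
	  by (rule nn_integral_density[OF hm fm[OF DL]])
	also have "... = (\<Prod>x\<in>?V. ?k x) * (\<integral>\<^sup>+a. (\<Sum>A\<in>Pow (?V Int U). ?h (flip A a) * ?g (flip A a)) \<partial>PiM ?V (site_law rh ze U))"
	  by (rule nn_integral_PiM_signs[OF fV sgN sN prob_space_imp_sigma_finite[OF B.prob] B.sets_site one])
		(use hm fm[OF DL] in \<open>auto simp: mPN\<close>)
	also have "(\<integral>\<^sup>+a. (\<Sum>A\<in>Pow (?V Int U). ?h (flip A a) * ?g (flip A a)) \<partial>PiM ?V (site_law rh ze U))
	  = (\<integral>\<^sup>+a. ?g (%x. if x : ?V then a x else 0) * ennreal (?Z (%x. if x : ?V then a x else 0)) \<partial>PiM ?V (site_law rh ze U))"
	proof (intro nn_integral_cong)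
	  fix a :: "'d site => real"
	  let ?t = "%x. if x : ?V then a x else 0"
	  have g1: "?g (flip A a) = ?g a" for A by (intro prod.cong refl) (auto simp: flip_def)
	  have g2: "?g ?t = ?g a" using DL sub by (intro prod.cong refl) auto
	  have Zt: "?Z ?t = ?Z a" by (rule depends_onD[OF depends_on_part_fun[OF bonds_touching[OF fin]]]) auto
	  have H: "be * (\<Sum>e\<in>?T. \<Prod>x\<in>e. flip A a x) = (\<Sum>e\<in>?T. coupling (%_. be) a e * spins e A)" for A
		unfolding sum_distrib_left
		by (intro sum.cong refl) (auto simp: coupling_def spins_def flip_def spin_of_def simp flip: prod.distrib intro!: prod.cong)
	  have VL: "?V Int U = U" using sub by auto
	  have "(\<Sum>A\<in>Pow (?V Int U). ?h (flip A a) * ?g (flip A a)) = (\<Sum>A\<in>Pow U. ennreal (exp (\<Sum>e\<in>?T. coupling (%_. be) a e * spins e A))) * ?g a"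
		unfolding VL g1 H sum_distrib_right ..
	  also have "(\<Sum>A\<in>Pow U. ennreal (exp (\<Sum>e\<in>?T. coupling (%_. be) a e * spins e A))) = ennreal (?Z a)"
		unfolding ising_Z_def ising_sum_def by (subst sum_ennreal) auto
	  finally show "(\<Sum>A\<in>Pow (?V Int U). ?h (flip A a) * ?g (flip A a)) = ?g ?t * ennreal (?Z ?t)"
		unfolding g2 Zt by (simp add: mult.commute)
	qed
	also have "... = (\<integral>\<^sup>+a. ?g a * ennreal (?Z a) \<partial>B.P)"
	proof (rule B.nn_integral_depends_on[symmetric])
	  show "(%a. ?g a * ennreal (?Z a)) : bm B.P" by measurable
	  have "depends_on ?V ?g" using DL sub by (intro depends_onI prod.cong refl) auto
	  from depends_on_combine[OF this depends_on_part_fun[OF bonds_touching[OF fin]], where h = "%u v. u * ennreal v"]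
	  show "depends_on ?V (%a. ?g a * ennreal (?Z a))" .
	qed
	finally show ?thesis .
  qed
  have k: "(\<Prod>x\<in>?V. ?k x) ~= 0" "(\<Prod>x\<in>?V. ?k x) ~= \<infinity>"
  proof -
	have "abs_mass rh / 2 ~= 0" using abs_mass[OF r] by (simp add: ennreal_divide_eq_0_iff)
	moreover have "abs_mass rh / 2 < \<infinity>" by (rule ennreal_divide_finite) (use abs_mass[OF r] in auto)
	ultimately show "(\<Prod>x\<in>?V. ?k x) ~= 0" "(\<Prod>x\<in>?V. ?k x) ~= \<infinity>"
	  using good_law_total[OF z(1)] fV by (auto simp: ennreal_prod_eq_top less_top)
  qed
  have w: "B.weight ?V (%a. 1 * ?Z a)" by (rule weight_plus[OF B.site_laws_axioms fin b bdry_weight_1])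
  have wi: "(\<integral>\<^sup>+a. ennreal (?Z a) \<partial>B.P) = ennreal (\<integral>a. ?Z a \<partial>B.P)"
	using B.weight_integrable[OF w] w
	by (intro nn_integral_eq_integral) (auto simp: B.space_P B.weight_def intro!: AE_I2 intro: order_trans[of 0 1])
  have q: "ennreal (\<integral>a. ?Z a \<partial>B.P) ~= 0" "ennreal (\<integral>a. ?Z a \<partial>B.P) ~= \<infinity>"
	using B.weight_integral_pos[OF w] by auto
  have "(\<integral>\<^sup>+ta. f ta \<partial>spin_measure rh be (%_. ze) U) = (\<integral>\<^sup>+ta. f ta \<partial>density (PiM ?V ?N) ?h) / emeasure (density (PiM ?V ?N) ?h) (space (PiM ?V ?N))"
	unfolding spin_measure_def using fm[OF D] unfolding f_def by (subst nn_integral_normalized) auto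
  also have "emeasure (density (PiM ?V ?N) ?h) (space (PiM ?V ?N)) = (\<integral>\<^sup>+ta. (\<Prod>x\<in>{}. ennreal (exp (c * (ta x)\<^sup>2))) \<partial>density (PiM ?V ?N) ?h)"
	by simp
  also have "... = (\<Prod>x\<in>?V. ?k x) * ennreal (\<integral>a. ?Z a \<partial>B.P)" unfolding wi[symmetric] by (subst total) auto
  also have "(\<integral>\<^sup>+ta. f ta \<partial>density (PiM ?V ?N) ?h) = (\<Prod>x\<in>?V. ?k x) * (\<integral>\<^sup>+a. f a * ennreal (?Z a) \<partial>B.P)"
	unfolding f_def by (rule total[OF D])
  also have "(\<Prod>x\<in>?V. ?k x) * (\<integral>\<^sup>+a. f a * ennreal (?Z a) \<partial>B.P) / ((\<Prod>x\<in>?V. ?k x) * ennreal (\<integral>a. ?Z a \<partial>B.P))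
	= (\<integral>\<^sup>+a. f a * ennreal (?Z a) \<partial>B.P) / ennreal (\<integral>a. ?Z a \<partial>B.P)"
	by (rule ennreal_cancel_left[OF k q])
  also have "... = (\<integral>\<^sup>+a. f a \<partial>plus_law rh ze (%_. 1) be U)"
  proof -
	have "f : bm B.P" unfolding f_def by measurable
	from B.gibbs_nn_integral[OF w this] show ?thesis unfolding plus_law_def by simp
  qed
  finally show ?thesis .
qed

text \<open>The free law is dominated by the absolute field of the spin model with boundary law \<open>ze\<close>, whose marginals have a bounded density by the assumption on \<open>ze\<close>.\<close>
lemma free_regularity:
  fixes c :: real
  assumes adm: "admissible rh" and w: "wired_boundary_law TYPE('d::finite) rh be\<^sub>0 ze" and b: "0 <= be" "be <= be\<^sub>0"
  obtains C :: real where "1 <= C" "!!(U::'d site set) De. finite U ==> De <= U ==>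
	(\<integral>\<^sup>+a. (\<Prod>x\<in>De. ennreal (exp (c * (a x)\<^sup>2))) \<partial>free_law rh be U) <= ennreal (C ^ card De)"
proof -
  note r = good_law_admissible[OF adm]
  have z: "good_law ze" by (rule good_law_wired_boundary[OF r w b])
  have zn: "emeasure ze {..<0} = 0" using w by (simp add: wired_boundary_law_def)
  have sr: "sets rh = sets borel" "sets ze = sets borel" using r z by (simp_all add: good_law_def)
  obtain a0 b0 where ab: "!!(U :: 'd site set) De. finite U ==> De <= SC U ==>
		   density_bounded_by (spin_marginal De (spin_measure rh be (%_. ze) U))
			 (PiM De (boundary_reference rh (%_. ze) U)) (%ta. \<Prod>x\<in>De. exp (a0 * (ta x)\<^sup>2 + b0))"
	using w b unfolding wired_boundary_law_def by metis
  define K where "K = (\<integral>\<^sup>+t. ennreal (exp ((c + a0) * t\<^sup>2)) \<partial>rh)"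
  have K: "K < \<infinity>" using r unfolding K_def good_law_def by blast
  define C where "C = max 1 (exp b0 * enn2real K)"
  have bound: "(\<integral>\<^sup>+a. (\<Prod>x\<in>De. ennreal (exp (c * (a x)\<^sup>2))) \<partial>free_law rh be U) <= ennreal (C ^ card De)"
	if fin: "finite U" and D: "De <= U" for U De :: "'d site set"
  proof -
	let ?f = "%ta::'d site => real. \<Prod>x\<in>De. ennreal (exp (c * (ta x)\<^sup>2))"
	let ?N = "boundary_reference rh (%_. ze) U" and ?\<nu> = "spin_measure rh be (%_. ze) U"
	have sub: "De <= SC U" using D by (auto simp: site_closure_def)
	have fD: "finite De" using finite_subset[OF D fin] .
	have dep: "depends_on De ?f" by (intro depends_onI prod.cong refl) auto
	have "(\<integral>\<^sup>+a. ?f a \<partial>free_law rh be U) <= (\<integral>\<^sup>+a. ?f a \<partial>plus_law rh ze (%_. 1) be U) \<or> c < 0"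
	proof (cases "c < 0")
	  case False
	  have "(\<integral>\<^sup>+a. ?f a \<partial>free_law rh be U) <= (\<integral>\<^sup>+a. ?f a \<partial>plus_law rh ze (%_. 1) be U)"
	  proof (rule free_le_plus_nn[OF r z fin b(1) bdry_weight_1])
		show "?f : bm FA" "?f : bm FA" by measurable
		show "depends_on U ?f" "depends_on (SC U) ?f"
		  using depends_on_mono[OF dep] D sub by auto
		fix a a' :: "'d site => real" assume "\<forall>x. 0 <= a x & a x <= a' x"
		then show "?f a <= ?f a'"
		  unfolding prod_ennreal[OF exp_ge_zero]
		  using False by (intro ennreal_leI prod_mono conjI) (auto intro!: mult_left_mono power_mono)
	  qed
	  then show ?thesis ..
	qed auto
	moreover have "(\<integral>\<^sup>+a. ?f a \<partial>free_law rh be U) <= 1" if "c < 0"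
	proof -
	  interpret A: site_laws "%_::'d site. abs_law rh" by (rule site_laws_abs[OF r])
	  interpret prob_space "free_law rh be U"
		unfolding free_law_def by (rule A.prob_space_gibbs[OF weight_free[OF A.site_laws_axioms fin b(1)]])
	  have "(\<integral>\<^sup>+a. ?f a \<partial>free_law rh be U) <= (\<integral>\<^sup>+a. 1 \<partial>free_law rh be U)"
	  proof (intro nn_integral_mono)
		fix a :: "'d site => real"
		have "(\<Prod>x\<in>De. exp (c * (a x)\<^sup>2)) <= 1" using that by (intro prod_le_1) (auto simp: mult_nonpos_nonneg)
		then show "?f a <= 1" unfolding prod_ennreal[OF exp_ge_zero] by simp
	  qed
	  then show ?thesis by (simp add: emeasure_space_1)
	qed
	moreover have "(1::ennreal) <= ennreal (C ^ card De)"
	  by (subst ennreal_1[symmetric], intro ennreal_leI one_le_power) (simp add: C_def)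
	moreover have "(\<integral>\<^sup>+a. ?f a \<partial>plus_law rh ze (%_. 1) be U) <= ennreal (C ^ card De)"
	proof -
	  obtain g where g: "g : bm (PiM De ?N)"
		 "!!ta. ta : space (PiM De ?N) ==> g ta <= ennreal (\<Prod>x\<in>De. exp (a0 * (ta x)\<^sup>2 + b0))"
		 "spin_marginal De ?\<nu> = density (PiM De ?N) g"
		using ab[OF fin sub] unfolding density_bounded_by_def by blast
	  have sN: "sets (?N x) = sets borel" for x using sr by (simp add: boundary_reference_def)
	  have sgN: "sigma_finite_measure (?N x)" for x
		using good_law_finite[OF r] good_law_finite[OF z] by (simp add: boundary_reference_def finite_measure_def)
	  interpret N: product_sigma_finite ?N by (rule product_sigma_finite.intro[OF sgN])
	  have mb: "(%ta. \<Prod>x\<in>De. ennreal (exp (c * (ta x)\<^sup>2))) : bm (PiM De (%_. borel))"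
	  proof (intro borel_measurable_prod_ennreal)
		fix x assume "x : De"
		then have [measurable]: "(%ta. ta x) : bm (PiM De (%_. borel :: real measure))"
		  by (intro measurable_component_singleton)
		show "(%ta. ennreal (exp (c * (ta x)\<^sup>2))) : bm (PiM De (%_. borel :: real measure))" by measurable
	  qed
	  have sP: "sets (PiM I ?N) = sets (PiM I (%_. borel))" for I by (intro sets_PiM_cong refl sN)
	  have mr: "(%ta. restrict ta De) : measurable ?\<nu> (PiM De (%_. borel))"
	  proof -
		have "sets ?\<nu> = sets (PiM (SC U) (%_. borel :: real measure))" by (simp add: spin_measure_def sP)
		then show ?thesis using measurable_cong_sets measurable_restrict_subset[OF sub] by blast
	  qed
	  have "(\<integral>\<^sup>+a. ?f a \<partial>plus_law rh ze (%_. 1) be U) = (\<integral>\<^sup>+ta. ?f ta \<partial>?\<nu>)"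
		by (rule spin_measure_integral[OF adm z zn fin b(1) D, symmetric])
	  also have "... = (\<integral>\<^sup>+ta. ?f (restrict ta De) \<partial>?\<nu>)" by (intro nn_integral_cong prod.cong) auto
	  also have "... = (\<integral>\<^sup>+ta. ?f ta \<partial>spin_marginal De ?\<nu>)"
		unfolding spin_marginal_def
	  proof (rule nn_integral_distr[symmetric])
		show "?f : bm (distr ?\<nu> (spin_algebra De) (%ta. restrict ta De))" using mb by simp
	  qed (rule mr)
	  also have "... = (\<integral>\<^sup>+ta. g ta * ?f ta \<partial>PiM De ?N)"
		unfolding g(3) using g(1) mb measurable_cong_sets[OF sP[of De] refl, of "borel :: ennreal measure"] by (intro nn_integral_density) auto
	  also have "... <= (\<integral>\<^sup>+ta. (\<Prod>x\<in>De. ennreal (exp b0) * ennreal (exp ((c + a0) * (ta x)\<^sup>2))) \<partial>PiM De ?N)"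
	  proof (intro nn_integral_mono)
		fix ta assume t: "ta : space (PiM De ?N)"
		have "g ta * ?f ta <= ennreal (\<Prod>x\<in>De. exp (a0 * (ta x)\<^sup>2 + b0)) * ?f ta" using g(2)[OF t] by (intro mult_right_mono) auto
		also have "... = (\<Prod>x\<in>De. ennreal (exp (a0 * (ta x)\<^sup>2 + b0)) * ennreal (exp (c * (ta x)\<^sup>2)))"
		  by (simp add: prod_ennreal prod.distrib)
		also have "... = (\<Prod>x\<in>De. ennreal (exp b0) * ennreal (exp ((c + a0) * (ta x)\<^sup>2)))"
		  by (intro prod.cong refl) (simp add: ennreal_mult[symmetric] exp_add[symmetric] algebra_simps)
		finally show "g ta * ?f ta <= ..." .
	  qed
	  also have "... = (\<Prod>x\<in>De. \<integral>\<^sup>+t. ennreal (exp b0) * ennreal (exp ((c + a0) * t\<^sup>2)) \<partial>?N x)"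
		by (rule N.product_nn_integral_prod[OF fD]) (simp add: measurable_cong_sets[OF sN refl])
	  also have "... = (\<Prod>x\<in>De. ennreal (exp b0) * K)"
	  proof (intro prod.cong refl)
		fix x assume "x : De"
		then have "?N x = rh" using D by (auto simp: boundary_reference_def)
		then show "(\<integral>\<^sup>+t. ennreal (exp b0) * ennreal (exp ((c + a0) * t\<^sup>2)) \<partial>?N x) = ennreal (exp b0) * K"
		  unfolding K_def by (simp add: nn_integral_cmult measurable_cong_sets[OF sr(1) refl])
	  qed
	  also have "ennreal (exp b0) * K = ennreal (exp b0 * enn2real K)" using K by (simp add: ennreal_mult)
	  also have "(\<Prod>x\<in>De. ennreal (exp b0 * enn2real K)) = ennreal ((exp b0 * enn2real K) ^ card De)"
		by (simp add: ennreal_power)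
	  also have "... <= ennreal (C ^ card De)" by (intro ennreal_leI power_mono) (auto simp: C_def)
	  finally show ?thesis .
	qed
	ultimately show ?thesis by (meson order_trans)
  qed
  show ?thesis by (rule that[of C]) (use bound in \<open>auto simp: C_def\<close>)
qed

section \<open>Monotonicity and the energy\<close>

lemma integral_nonneg_nn:
  assumes "f : bm M" "!!a. a : space M ==> 0 <= f a"
  shows "(\<integral>a. f a \<partial>M) = enn2real (\<integral>\<^sup>+a. ennreal (f a) \<partial>M)"
  using assms by (intro integral_eq_nn_integral) auto

lemma (in site_laws) measurable_gibbs: "measurable (gibbs_law mu w) N = measurable FA N"
  by (rule measurable_cong_sets) (simp_all add: sets_P)

lemma (in site_laws) gibbs_integral_le_of_nn:
  assumes w: "weight V w" and w': "site_laws mu'" "site_laws.weight mu' V' w'"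
	and m: "F0 : bm FA" "F1 : bm FA"
	and nn: "!!a. \<forall>x. 0 <= a x ==> 0 <= F0 a" "!!a. \<forall>x. 0 <= a x ==> 0 <= F1 a"
	and g: "gaussian V' F1"
	and le: "(\<integral>\<^sup>+a. ennreal (F0 a) \<partial>gibbs_law mu w) <= (\<integral>\<^sup>+a. ennreal (F1 a) \<partial>gibbs_law mu' w')"
  shows "(\<integral>a. F0 a \<partial>gibbs_law mu w) <= (\<integral>a. F1 a \<partial>gibbs_law mu' w')"
proof -
  interpret B: site_laws mu' by fact
  have i: "integrable (gibbs_law mu' w') F1"
	by (rule B.gibbs_integrable[OF w'(2) _ g]) (simp add: m B.measurable_P)
  have "(\<integral>\<^sup>+a. ennreal (F1 a) \<partial>gibbs_law mu' w') = ennreal (\<integral>a. F1 a \<partial>gibbs_law mu' w')"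
	using i nn by (intro nn_integral_eq_integral) (auto simp: B.space_gibbs intro!: AE_I2)
  then have fin: "(\<integral>\<^sup>+a. ennreal (F1 a) \<partial>gibbs_law mu' w') < \<infinity>" by simp
  show ?thesis
	using le fin nn m
	by (subst (1 2) integral_nonneg_nn)
	  (auto simp: measurable_gibbs B.measurable_gibbs space_gibbs B.space_gibbs intro!: enn2real_mono)
qed

lemma free_le_plus:
  assumes r: "good_law rh" "good_law ka" and fin: "finite U" and b: "0 <= be" and phi: "bdry_weight U ph"
	and F: "F0 : bm FA" "F1 : bm FA"
	  "depends_on U F0" "depends_on (SC U) F1" "gaussian (SC U) F1"
	and nn: "!!a. \<forall>x. 0 <= a x ==> 0 <= F0 a"
	and le: "!!a b. \<forall>x. 0 <= a x & a x <= b x ==> F0 a <= F1 b"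
  shows "(\<integral>a. F0 a \<partial>free_law rh be U) <= (\<integral>a. F1 a \<partial>plus_law rh ka ph be U)"
proof -
  interpret A: site_laws "%_::'a site. abs_law rh" by (rule site_laws_abs[OF r(1)])
  have B: "site_laws (site_law rh ka U)" by (rule site_laws_site_law[OF r])
  have nn1: "0 <= F1 a" if "\<forall>x. 0 <= a x" for a using le[of a a] nn[of a] that by auto
  have nnle: "(\<integral>\<^sup>+a. ennreal (F0 a) \<partial>free_law rh be U) <= (\<integral>\<^sup>+a. ennreal (F1 a) \<partial>plus_law rh ka ph be U)"
	by (rule free_le_plus_nn[OF r fin b phi])
	  (use F le in \<open>auto intro!: ennreal_leI depends_on_combine[OF F(3) F(3), where h = "%u v. ennreal u"]
		  depends_on_combine[OF F(4) F(4), where h = "%u v. ennreal u"]\<close>)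
  show ?thesis
	using A.gibbs_integral_le_of_nn[OF weight_free[OF A.site_laws_axioms fin b] B weight_plus[OF B fin b phi] F(1,2) nn nn1 F(5)] nnle
	unfolding free_law_def plus_law_def by blast
qed

lemma free_mono:
  assumes r: "good_law rh" and fin: "finite U'" and sub: "U <= U'" and b: "0 <= be" "be <= be'"
	and F: "F0 : bm FA" "F1 : bm FA"
	  "depends_on U' F0" "depends_on U' F1" "gaussian U' F1"
	and nn: "!!a. \<forall>x. 0 <= a x ==> 0 <= F0 a"
	and le: "!!a b. \<forall>x. 0 <= a x & a x <= b x ==> F0 a <= F1 b"
  shows "(\<integral>a. F0 a \<partial>free_law rh be U) <= (\<integral>a. F1 a \<partial>free_law rh be' U')"
proof -
  interpret A: site_laws "%_::'a site. abs_law rh" by (rule site_laws_abs[OF r(1)])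
  have fin0: "finite U" using sub fin by (rule finite_subset)
  have nn1: "0 <= F1 a" if "\<forall>x. 0 <= a x" for a using le[of a a] nn[of a] that by auto
  have nnle: "(\<integral>\<^sup>+a. ennreal (F0 a) \<partial>free_law rh be U) <= (\<integral>\<^sup>+a. ennreal (F1 a) \<partial>free_law rh be' U')"
	by (rule free_mono_nn[OF r fin sub b])
	  (use F le in \<open>auto intro!: ennreal_leI depends_on_combine[OF F(3) F(3), where h = "%u v. ennreal u"]
		  depends_on_combine[OF F(4) F(4), where h = "%u v. ennreal u"]\<close>)
  have b': "0 <= be'" using b by simp
  show ?thesis
	using A.gibbs_integral_le_of_nn[OF weight_free[OF A.site_laws_axioms fin0 b(1)] A.site_laws_axioms
		weight_free[OF A.site_laws_axioms fin b'] F(1,2) nn nn1 F(5)] nnle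
	unfolding free_law_def by blast
qed

lemma corr_abs_le_1:
  assumes "finite U" shows "\<bar>ising_corr U E K (spins B)\<bar> <= 1"
proof -
  have "\<bar>ising_sum U E K (spins B)\<bar> <= (\<Sum>A\<in>Pow U. \<bar>spins B A * exp (\<Sum>e\<in>E. K e * spins e A)\<bar>)"
	unfolding ising_sum_def by (rule sum_abs)
  also have "... = ising_Z U E K"
	unfolding ising_Z_def ising_sum_def
  proof (intro sum.cong refl)
	fix A show "\<bar>spins B A * exp (\<Sum>e\<in>E. K e * spins e A)\<bar> = 1 * exp (\<Sum>e\<in>E. K e * spins e A)"
	  using spins_cases[of B A] by (auto simp: abs_mult)
  qed
  finally show ?thesis using ising_Z_pos[OF assms, of E K] by (simp add: ising_corr_def abs_div)
qed

text \<open>Its expectation is the derivative of the logarithm of the partition function in the coupling of \<open>e\<close>.\<close>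
definition edge_obs :: "'v set => 'v set set => real => 'v set => ('v => real) => real" where
  "edge_obs U E be e a = (\<Prod>x\<in>e. a x) * corr U E (%_. be) a e"

lemma prod_measurable[measurable]: "(%a. \<Prod>x\<in>e. a x) : bm FA"
  by measurable

lemma edge_obs_measurable[measurable]: "edge_obs U E be e : bm FA"
  unfolding edge_obs_def by measurable

lemma edge_obs_depends: "bonds V E ==> e <= V ==> depends_on V (edge_obs U E be e)"
  unfolding edge_obs_def
  by (intro depends_on_combine[where h = "(*)"] depends_on_corr depends_onI prod.cong) auto

lemma gaussian_prod_sites:
  assumes "finite V" "e <= V" shows "gaussian V (%a. \<Prod>x\<in>e. a x)"
proof -
  have "finite e" using assms finite_subset by blast
  then show ?thesis using assms(2)
  proof (induction e rule: finite_induct)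
	case empty
	show ?case by (rule gaussian_bounded[of _ 1]) simp
  next
	case (insert x e)
	then have "gaussian V (%a. a x * (\<Prod>x\<in>e. a x))"
	  by (intro gaussian_mult gaussian_component assms(1)) auto
	then show ?case using insert.hyps by simp
  qed
qed

lemma edge_obs_gauss:
  assumes "finite V" "e <= V" "finite U" shows "gaussian V (edge_obs U E be e)"
  unfolding edge_obs_def
  by (intro gaussian_mult gaussian_prod_sites gaussian_bounded[of _ 1] corr_abs_le_1 assms)

lemma edge_obs_nonneg:
  assumes "finite U" "bonds V E" "0 <= be" "\<forall>x. 0 <= a x" "finite e"
  shows "0 <= edge_obs U E be e a"
  unfolding edge_obs_def using assms by (intro mult_nonneg_nonneg prod_nonneg corr_nonneg) auto

definition free_edge where
  "free_edge rh be U e = (\<integral>a. edge_obs U (IE U) be e a \<partial>free_law rh be U)"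

definition wired_edge where
  "wired_edge rh ka be U e = (\<integral>a. edge_obs U (TE U) be e a \<partial>wired_law rh ka be U)"

lemma corr_extend:
  assumes fin: "finite U'" "U <= U'" "finite E'" "E <= E'" "!!e. e : E ==> e Int U' <= U" and B: "B Int U' <= U"
  shows "corr U' E' (%e. if e : E then be else 0) a B = corr U E (%_. be) a B"
proof -
  let ?K = "coupling (%e. if e : E then be else 0) a"
  have s: "ising_sum U' E' ?K f = 2 ^ card (U' - U) * ising_sum U E (coupling (%_. be) a) f"
	if "!!A. A <= U' ==> f A = f (A Int U)" for f
  proof -
	have "ising_sum U' E' ?K f = 2 ^ card (U' - U) * ising_sum U E ?K f"
	proof (rule ising_sum_extend[OF fin(1-4)])
	  show "?K e = 0" if "e : E' - E" for e using that by (simp add: coupling_def)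
	qed (fact fin(5), fact that)
	also have "ising_sum U E ?K f = ising_sum U E (coupling (%_. be) a) f"
	  unfolding ising_sum_def coupling_def by (simp cong: sum.cong)
	finally show ?thesis .
  qed
  have "spins B A = spins B (A Int U)" if "A <= U'" for A
	unfolding spins_def using B that by (intro prod.cong) (auto simp: spin_of_def)
  then show ?thesis unfolding ising_corr_def ising_Z_def by (subst (1 2) s) auto
qed

lemma corr_free_le_wired:
  assumes "finite U" "0 <= be" "\<forall>x. 0 <= a x & a x <= b x" "finite B" "B Int U <= U"
  shows "corr U (IE U) (%_. be) a B <= corr U (TE U) (%_. be) b B"
proof -
  have "corr U (IE U) (%_. be) a B = corr U (TE U) (%e. if e : IE U then be else 0) a B"
	using assms bonds_finite[OF bonds_touching[OF assms(1)]] inner_subset_touching[of U]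
	by (intro corr_extend[symmetric]) auto
  also have "... <= corr U (TE U) (%_. be) b B"
	by (rule corr_mono[OF assms(1) bonds_touching[OF assms(1)]]) (use assms in auto)
  finally show ?thesis .
qed

lemma corr_free_mono:
  assumes "finite U'" "U <= U'" "0 <= be" "be <= be'" "\<forall>x. 0 <= a x & a x <= b x" "finite B" "B <= U"
  shows "corr U (IE U) (%_. be) a B <= corr U' (IE U') (%_. be') b B"
proof -
  have "corr U (IE U) (%_. be) a B = corr U' (IE U') (%e. if e : IE U then be else 0) a B"
	using assms bonds_finite[OF bonds_inner[OF assms(1)]] inner_edges_mono[OF assms(2)]
	by (intro corr_extend[symmetric]) (auto simp: inner_edges_iff[of _ U])
  also have "... <= corr U' (IE U') (%_. be') b B"
	by (rule corr_mono[OF assms(1) bonds_inner[OF assms(1)]]) (use assms in auto)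
  finally show ?thesis .
qed

lemma free_edge_le_wired:
  assumes r: "good_law rh" "good_law ka" and fin: "finite U" and b: "0 <= be" and e: "e : IE U"
  shows "free_edge rh be U e <= wired_edge rh ka be U e"
  unfolding free_edge_def wired_edge_def
proof (rule free_le_plus[OF r fin b bdry_weight_factor[OF fin]])
  note bi = bonds_inner[OF fin] and bt = bonds_touching[OF fin]
  have eL: "e <= U" "finite e" using bonds_D[OF bi e] by auto
  have eV: "e <= SC U" using eL by (auto simp: site_closure_def)
  show "depends_on U (edge_obs U (IE U) be e)" by (rule edge_obs_depends[OF bi eL(1)])
  show "depends_on (SC U) (edge_obs U (TE U) be e)" by (rule edge_obs_depends[OF bt eV])
  show "gaussian (SC U) (edge_obs U (TE U) be e)"
	by (rule edge_obs_gauss[OF finite_site_closure[OF fin] eV fin])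
  show "0 <= edge_obs U (IE U) be e a" if "\<forall>x. 0 <= a x" for a
	by (rule edge_obs_nonneg[OF fin bi b that eL(2)])
  show "edge_obs U (IE U) be e a <= edge_obs U (TE U) be e a'" if "\<forall>x. 0 <= a x & a x <= a' x" for a a'
	unfolding edge_obs_def using that fin b eL bi
	by (intro mult_mono prod_mono corr_free_le_wired corr_nonneg[OF fin bi] prod_nonneg) (auto intro: order_trans)
qed measurable

lemma free_edge_mono:
  assumes r: "good_law rh" and fin: "finite U'" and sub: "U <= U'" and b: "0 <= be" "be <= be'" and e: "e : IE U"
  shows "free_edge rh be U e <= free_edge rh be' U' e"
  unfolding free_edge_def
proof (rule free_mono[OF r fin sub b])
  have fin0: "finite U" using sub fin by (rule finite_subset)
  note bi = bonds_inner[OF fin0] and bi' = bonds_inner[OF fin]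
  have eL: "e <= U" "finite e" using bonds_D[OF bi e] by auto
  have eV: "e <= U'" using eL sub by auto
  show "depends_on U' (edge_obs U (IE U) be e)"
	by (rule depends_on_mono[OF edge_obs_depends[OF bi eL(1)] sub])
  show "depends_on U' (edge_obs U' (IE U') be' e)" by (rule edge_obs_depends[OF bi' eV])
  show "gaussian U' (edge_obs U' (IE U') be' e)"
	by (rule edge_obs_gauss[OF fin eV fin])
  show "0 <= edge_obs U (IE U) be e a" if "\<forall>x. 0 <= a x" for a
	by (rule edge_obs_nonneg[OF fin0 bi b(1) that eL(2)])
  show "edge_obs U (IE U) be e a <= edge_obs U' (IE U') be' e a'" if "\<forall>x. 0 <= a x & a x <= a' x" for a a'
	unfolding edge_obs_def using that fin b eL bi sub
	by (intro mult_mono prod_mono corr_free_mono corr_nonneg[OF fin0 bi] prod_nonneg) (auto intro: order_trans)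
qed measurable

lemma free_edge_nonneg:
  assumes r: "good_law rh" and fin: "finite U" and b: "0 <= be" and e: "e : IE U"
  shows "0 <= free_edge rh be U e"
proof -
  interpret A: site_laws "%_::'a site. abs_law rh" by (rule site_laws_abs[OF r])
  show ?thesis unfolding free_edge_def free_law_def
	using edge_obs_nonneg[OF fin bonds_inner[OF fin] b] bonds_D[OF bonds_inner[OF fin] e]
	by (intro Bochner_Integration.integral_nonneg) (simp add: A.space_gibbs)
qed

lemma wired_edge_nonneg:
  assumes r: "good_law rh" "good_law ka" and fin: "finite U" and b: "0 <= be" and e: "e : TE U"
  shows "0 <= wired_edge rh ka be U e"
proof -
  interpret B: site_laws "site_law rh ka U" by (rule site_laws_site_law[OF r])
  have "0 <= (\<integral>a. edge_obs U (TE U) be e a \<partial>plus_law rh ka (bdry_factor U) be U)"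
	unfolding plus_law_def
	using edge_obs_nonneg[OF fin bonds_touching[OF fin] b] bonds_D[OF bonds_touching[OF fin] e]
	by (intro Bochner_Integration.integral_nonneg) (simp add: B.space_gibbs)
  then show ?thesis unfolding wired_edge_def .
qed

text \<open>Jensen for the exponential, in tangent form: \<open>exp x \<ge> 1 + x\<close> around the mean energy.\<close>
lemma (in site_laws) partition_convex:
  assumes E: "bonds V E" and fin: "finite U" and b: "0 <= be" "0 <= be'" and phi: "weight V ph"
  defines "h \<equiv> \<Sum>e\<in>E. \<integral>a. edge_obs U E be e a \<partial>gibbs_law mu (%a. ph a * part_fun U E (%_. be) a)"
  shows "exp ((be' - be) * h) * (\<integral>a. ph a * part_fun U E (%_. be) a \<partial>P) <= (\<integral>a. ph a * part_fun U E (%_. be') a \<partial>P)"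
proof -
  let ?Z = "%be a. ph a * part_fun U E (%_. be) a"
  let ?S = "%e a. ising_sum U E (coupling (%_. be) a) (spins e)"
  have w: "weight V (?Z be)" if "0 <= be" for be using that E fin phi by (intro weight_mult weight_part_fun) auto
  note i = weight_integrable[OF w]
  let ?z = "\<integral>a. ?Z be a \<partial>P"
  have zp: "1 <= ?z" by (rule weight_integral_pos[OF w[OF b(1)]])
  have [measurable]: "ph : bm P" using phi by (simp add: weight_def)
  have fV: "finite V" using E by (simp add: bonds_def)
  have gphi: "gaussian V ph" using phi by (simp add: weight_def)
  have eq: "edge_obs U E be e a * ?Z be a = ph a * ((\<Prod>x\<in>e. a x) * ?S e a)" for e a
	using ising_Z_pos[OF fin, of E "coupling (%_. be) a"] by (simp add: edge_obs_def ising_corr_def)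
  have eo: "edge_obs U E be e : bm P" for e using edge_obs_measurable[of U E be e] by (simp add: measurable_P)
  have ie: "integrable P (%a. ph a * ((\<Prod>x\<in>e. a x) * ?S e a))" if "e : E" for e
	unfolding eq[symmetric] using that bonds_D[OF E that] w[OF b(1)] eo
	by (intro gaussian_integrable[OF fV] gaussian_mult[of V "edge_obs U E be e"] edge_obs_gauss fV fin borel_measurable_times[OF eo]) (auto simp: weight_def)
  have he: "(\<Sum>e\<in>E. \<integral>a. ph a * ((\<Prod>x\<in>e. a x) * ?S e a) \<partial>P) = h * ?z"
	unfolding h_def gibbs_integral[OF w[OF b(1)] eo] eq sum_distrib_right using zp by (intro sum.cong refl) auto
  let ?d = "be' - be"
  have pw: "exp (?d * h) * ((1 - ?d * h) * ?Z be a + ?d * (\<Sum>e\<in>E. ph a * ((\<Prod>x\<in>e. a x) * ?S e a))) <= ?Z be' a"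
	if a: "\<forall>x. 0 <= a x" for a
  proof -
	define H where "H A = (\<Sum>e\<in>E. (\<Prod>x\<in>e. a x) * spins e A)" for A
	have c: "(\<Sum>e\<in>E. coupling (%_. t) a e * spins e A) = t * H A" for t A
	  by (simp add: H_def coupling_def sum_distrib_left mult_ac)
	have S: "(\<Sum>e\<in>E. (\<Prod>x\<in>e. a x) * ?S e a) = (\<Sum>A\<in>Pow U. H A * exp (be * H A))"
	  unfolding ising_sum_def c H_def sum_distrib_left sum_distrib_right by (subst sum.swap) (simp add: mult_ac)
	have "exp (?d * h) * ((1 - ?d * h) * part_fun U E (%_. be) a + ?d * (\<Sum>e\<in>E. (\<Prod>x\<in>e. a x) * ?S e a))
	  = (\<Sum>A\<in>Pow U. exp (be * H A) * (exp (?d * h) * (1 + (?d * H A - ?d * h))))"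
	  unfolding S unfolding ising_Z_def ising_sum_def c sum_distrib_left sum.distrib[symmetric]
	  by (intro sum.cong refl) (simp add: algebra_simps)
	also have "... <= (\<Sum>A\<in>Pow U. exp (be * H A) * (exp (?d * h) * exp (?d * H A - ?d * h)))"
	  by (intro sum_mono mult_left_mono exp_ge_add_one_self) auto
	also have "... = part_fun U E (%_. be') a"
	  unfolding ising_Z_def ising_sum_def c by (intro sum.cong refl) (simp add: algebra_simps flip: exp_add)
	finally have *: "exp (?d * h) * ((1 - ?d * h) * part_fun U E (%_. be) a + ?d * (\<Sum>e\<in>E. (\<Prod>x\<in>e. a x) * ?S e a)) <= part_fun U E (%_. be') a" .
	have "0 <= ph a" using phi a by (auto simp: weight_def intro: order_trans[of 0 1])
	from mult_left_mono[OF * this] show ?thesis by (simp add: algebra_simps sum_distrib_left)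
  qed
  have isum: "integrable P (%a. \<Sum>e\<in>E. ph a * ((\<Prod>x\<in>e. a x) * ?S e a))" using ie by simp
  have "(\<integral>a. exp (?d * h) * ((1 - ?d * h) * ?Z be a + ?d * (\<Sum>e\<in>E. ph a * ((\<Prod>x\<in>e. a x) * ?S e a))) \<partial>P) <= (\<integral>a. ?Z be' a \<partial>P)"
	by (rule integral_mono_AE) (use i[OF b(1)] i[OF b(2)] isum pw in \<open>auto intro!: AE_I2 simp: space_P\<close>)
  also have "(\<integral>a. exp (?d * h) * ((1 - ?d * h) * ?Z be a + ?d * (\<Sum>e\<in>E. ph a * ((\<Prod>x\<in>e. a x) * ?S e a))) \<partial>P)
	= exp (?d * h) * ((1 - ?d * h) * ?z + ?d * (\<Sum>e\<in>E. \<integral>a. ph a * ((\<Prod>x\<in>e. a x) * ?S e a) \<partial>P))"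
	using i[OF b(1)] isum ie by (simp add: Bochner_Integration.integral_add Bochner_Integration.integral_sum)
  also have "... = exp (?d * h) * ?z" unfolding he by (simp add: algebra_simps)
  finally show ?thesis .
qed

section \<open>Comparing partition functions\<close>

lemma (in site_laws) nn_integral_independent:
  assumes fin: "finite I" "finite K" "I Int K = {}"
	and f: "f : bm P" "depends_on I f" and g: "g : bm P" "depends_on K g"
  shows "(\<integral>\<^sup>+a. f a * g a \<partial>P) = (\<integral>\<^sup>+a. f a \<partial>P) * (\<integral>\<^sup>+a. g a \<partial>P)"
proof -
  let ?t = "%V a x. if x : V then a x else (0::real)"
  have d: "depends_on (I Un K) (%a. f a * g a)"
	by (intro depends_on_combine[where h = "(*)"] depends_on_mono[OF f(2)] depends_on_mono[OF g(2)]) auto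
  have mt: "(%a. f (?t V a) * g (?t V a)) : bm (PiM V mu)" for V
	by (intro borel_measurable_times_ennreal measurable_compose[OF measurable_trunc] f g)
  have mf: "(%a. f (?t V a)) : bm (PiM V mu)" "(%a. g (?t V a)) : bm (PiM V mu)" for V
	by (intro measurable_compose[OF measurable_trunc] f g)+
  have "(\<integral>\<^sup>+a. f a * g a \<partial>P) = (\<integral>\<^sup>+a. f (?t (I Un K) a) * g (?t (I Un K) a) \<partial>PiM (I Un K) mu)"
	by (rule nn_integral_depends_on[OF _ d]) (use f g in auto)
  also have "... = (\<integral>\<^sup>+x. (\<integral>\<^sup>+y. f (?t (I Un K) (merge I K (x, y))) * g (?t (I Un K) (merge I K (x, y))) \<partial>PiM K mu) \<partial>PiM I mu)"
	by (rule product_nn_integral_fold[OF fin(3,1,2) mt])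
  also have "... = (\<integral>\<^sup>+x. (\<integral>\<^sup>+y. f (?t I x) * g (?t K y) \<partial>PiM K mu) \<partial>PiM I mu)"
  proof (intro nn_integral_cong arg_cong2[of _ _ _ _ "(*)"])
	fix x y
	show "f (?t (I Un K) (merge I K (x, y))) = f (?t I x)"
	  by (rule depends_onD[OF f(2)]) (auto simp: merge_def)
	show "g (?t (I Un K) (merge I K (x, y))) = g (?t K y)"
	  by (rule depends_onD[OF g(2)]) (use fin(3) in \<open>auto simp: merge_def\<close>)
  qed
  also have "... = (\<integral>\<^sup>+x. f (?t I x) \<partial>PiM I mu) * (\<integral>\<^sup>+y. g (?t K y) \<partial>PiM K mu)"
	using mf by (simp add: nn_integral_cmult nn_integral_multc)
  also have "... = (\<integral>\<^sup>+a. f a \<partial>P) * (\<integral>\<^sup>+a. g a \<partial>P)"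
	using nn_integral_depends_on[OF f] nn_integral_depends_on[OF g] by simp
  finally show ?thesis .
qed

definition inner_boundary :: "'d::finite site set => 'd site set" where
  "inner_boundary U = {x : U. \<exists>y. y \<notin> U & adjacent x y}"

lemma card_edges_at: "card {e : IE UNIV. (v :: 'd::finite site) : e} <= card (cube 1 :: 'd site set)"
  and finite_edges_at: "finite {e : IE UNIV. (v :: 'd::finite site) : e}"
proof -
  have sub: "{e : IE UNIV. v : e} <= (%z. {v, v + z}) ` (cube 1 :: 'd site set)"
  proof
	fix e assume "e : {e : IE UNIV. v : e}"
	then obtain y where "e = {v, y}" "adjacent v y"
	  unfolding inner_edges_def using adjacent_commute by (auto simp: insert_commute)
	then show "e : (%z. {v, v + z}) ` cube 1"
	  using adjacent_diff_cube[of v y] by (intro image_eqI[of _ _ "y - v"]) auto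
  qed
  show "finite {e : IE UNIV. v : e}" by (rule finite_subset[OF sub]) simp
  show "card {e : IE UNIV. v : e} <= card (cube 1 :: 'd site set)"
	by (rule surj_card_le[OF _ sub]) simp
qed

lemma boundary_edges_sum:
  fixes U :: "'d::finite site set"
  assumes fin: "finite U" and a: "\<forall>x. 0 <= a x"
  shows "(\<Sum>e\<in>TE U - IE U. \<Prod>x\<in>e. a x)
	<= real (card (cube 1 :: 'd site set)) * ((\<Sum>x\<in>inner_boundary U. (a x)\<^sup>2) + (\<Sum>x\<in>EB U. (a x)\<^sup>2))"
proof -
  let ?S = "TE U - IE U" and ?W = "inner_boundary U Un EB U"
  let ?D = "real (card (cube 1 :: 'd site set))"
  have finS: "finite ?S" using bonds_finite[OF bonds_touching[OF fin]] by simp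
  have finI: "finite (inner_boundary U)" using fin by (simp add: inner_boundary_def)
  have finW: "finite ?W" using finI finite_ext_boundary[OF fin] by simp
  have eW: "e <= ?W & card e = 2 & finite e" if "e : ?S" for e
  proof -
	from that have "e : TE U" by simp
	then obtain x y where e: "e = {x, y}" "x : U" "adjacent x y" unfolding touching_edges_def by blast
	have "y \<notin> U" using that e unfolding inner_edges_def by blast
	then show ?thesis using e adjacent_neq[of x y] by (auto simp: inner_boundary_def ext_boundary_def)
  qed
  have "(\<Sum>e\<in>?S. \<Prod>x\<in>e. a x) <= (\<Sum>e\<in>?S. \<Sum>x\<in>e. (a x)\<^sup>2)"
  proof (intro sum_mono)
	fix e assume "e : ?S"
	then have "bonds e {e}" using eW by (auto simp: bonds_def)
	then show "(\<Prod>x\<in>e. a x) <= (\<Sum>x\<in>e. (a x)\<^sup>2)" using bond_prod_le[of e "{e}" e a] a by auto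
  qed
  also have "... = (\<Sum>e\<in>?S. \<Sum>x\<in>?W. if x : e then (a x)\<^sup>2 else 0)"
  proof (rule sum.cong[OF refl])
	fix e assume "e : ?S"
	then have "e = {x : ?W. x : e}" using eW by auto
	then show "(\<Sum>x\<in>e. (a x)\<^sup>2) = (\<Sum>x\<in>?W. if x : e then (a x)\<^sup>2 else 0)"
	  using finW by (simp add: sum.inter_filter[symmetric])
  qed
  also have "... = (\<Sum>x\<in>?W. \<Sum>e\<in>?S. if x : e then (a x)\<^sup>2 else 0)" by (rule sum.swap)
  also have "... <= (\<Sum>x\<in>?W. ?D * (a x)\<^sup>2)"
  proof (intro sum_mono)
	fix x
	have "(\<Sum>e\<in>?S. if x : e then (a x)\<^sup>2 else 0) = real (card {e : ?S. x : e}) * (a x)\<^sup>2"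
	  using finS by (simp add: sum.inter_filter[symmetric])
	also have "... <= ?D * (a x)\<^sup>2"
	proof (intro mult_right_mono)
	  have "card {e : ?S. x : e} <= card {e : IE UNIV. x : e}"
		by (intro card_mono finite_edges_at) (auto simp: touching_edges_iff[of _ U])
	  then show "real (card {e : ?S. x : e}) <= ?D" using card_edges_at[of x] by linarith
	qed simp
	finally show "(\<Sum>e\<in>?S. if x : e then (a x)\<^sup>2 else 0) <= ?D * (a x)\<^sup>2" .
  qed
  also have "... = ?D * (\<Sum>x\<in>?W. (a x)\<^sup>2)" by (simp add: sum_distrib_left)
  also have "(\<Sum>x\<in>?W. (a x)\<^sup>2) = (\<Sum>x\<in>inner_boundary U. (a x)\<^sup>2) + (\<Sum>x\<in>EB U. (a x)\<^sup>2)"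
	by (rule sum.union_disjoint[OF finI finite_ext_boundary[OF fin]]) (auto simp: inner_boundary_def ext_boundary_def)
  finally show ?thesis .
qed

text \<open>Every boundary edge has one end in the inner and one in the outer boundary, and each site lies on a bounded number of edges.\<close>
lemma part_fun_touching_le:
  fixes U :: "'d::finite site set"
  assumes fin: "finite U" and b: "0 <= be" and a: "\<forall>x. 0 <= a x"
  defines "c \<equiv> be * real (card (cube 1 :: 'd site set))"
  shows "part_fun U (TE U) (%_. be) a <=
	part_fun U (IE U) (%_. be) a * exp (c * (\<Sum>x\<in>inner_boundary U. (a x)\<^sup>2)) * exp (c * (\<Sum>x\<in>EB U. (a x)\<^sup>2))"
proof -
  let ?T = "TE U" and ?I = "IE U" and ?k = "coupling (%_. be) a"
  let ?X = "exp (c * (\<Sum>x\<in>inner_boundary U. (a x)\<^sup>2)) * exp (c * (\<Sum>x\<in>EB U. (a x)\<^sup>2))"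
  have finT: "finite ?T" using bonds_finite[OF bonds_touching[OF fin]] .
  have "(\<Sum>e\<in>?T. ?k e * spins e A) <= (\<Sum>e\<in>?I. ?k e * spins e A) + (c * (\<Sum>x\<in>inner_boundary U. (a x)\<^sup>2) + c * (\<Sum>x\<in>EB U. (a x)\<^sup>2))" for A
  proof -
	have "(\<Sum>e\<in>?T. ?k e * spins e A) = (\<Sum>e\<in>?I. ?k e * spins e A) + (\<Sum>e\<in>?T - ?I. ?k e * spins e A)"
	  using finT inner_subset_touching[of U] by (simp add: sum.subset_diff add.commute)
	also have "(\<Sum>e\<in>?T - ?I. ?k e * spins e A) <= (\<Sum>e\<in>?T - ?I. be * (\<Prod>x\<in>e. a x))"
	proof (intro sum_mono)
	  fix e
	  have "0 <= ?k e" unfolding coupling_def using a b by (intro mult_nonneg_nonneg prod_nonneg) auto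
	  then have "?k e * spins e A <= ?k e" using spins_cases[of e A] by auto
	  then show "?k e * spins e A <= be * (\<Prod>x\<in>e. a x)" by (simp add: coupling_def)
	qed
	also have "... = be * (\<Sum>e\<in>?T - ?I. \<Prod>x\<in>e. a x)" by (simp add: sum_distrib_left)
	also have "... <= be * (real (card (cube 1 :: 'd site set)) * ((\<Sum>x\<in>inner_boundary U. (a x)\<^sup>2) + (\<Sum>x\<in>EB U. (a x)\<^sup>2)))"
	  by (intro mult_left_mono boundary_edges_sum fin a b)
	finally show ?thesis by (simp add: c_def algebra_simps)
  qed
  then have "part_fun U ?T (%_. be) a <= (\<Sum>A\<in>Pow U. exp ((\<Sum>e\<in>?I. ?k e * spins e A) + (c * (\<Sum>x\<in>inner_boundary U. (a x)\<^sup>2) + c * (\<Sum>x\<in>EB U. (a x)\<^sup>2))))"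
	unfolding ising_Z_def ising_sum_def by (intro sum_mono) simp
  also have "... = part_fun U ?I (%_. be) a * ?X"
	unfolding ising_Z_def ising_sum_def exp_add sum_distrib_right by simp
  finally show ?thesis by (simp add: mult.assoc)
qed

definition free_Z where "free_Z rh be U = (\<integral>a. part_fun U (IE U) (%_. be) a \<partial>PiM UNIV (%_. abs_law rh))"

definition wired_Z where "wired_Z rh ka be U =
  (\<integral>a. bdry_factor U a * part_fun U (TE U) (%_. be) a \<partial>PiM UNIV (site_law rh ka U))"

lemma (in site_laws) weight_nn:
  assumes "weight V w" shows "(\<integral>\<^sup>+a. ennreal (w a) \<partial>P) = ennreal (\<integral>a. w a \<partial>P)"
proof (rule nn_integral_eq_integral[OF weight_integrable[OF assms]], rule AE_I2)
  fix a assume "a : space P"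
  then have "1 <= w a" using assms by (simp add: space_P weight_def)
  then show "0 <= w a" by simp
qed

lemma free_Z_site:
  assumes r: "good_law rh" "good_law ka" and fin: "finite U" and b: "0 <= be"
  shows "(\<integral>a. part_fun U (IE U) (%_. be) a \<partial>PiM UNIV (site_law rh ka U)) = free_Z rh be U"
proof -
  interpret A: site_laws "%_::'a site. abs_law rh" by (rule site_laws_abs[OF r(1)])
  interpret B: site_laws "site_law rh ka U" by (rule site_laws_site_law[OF r])
  let ?Z = "part_fun U (IE U) (%_. be)"
  have wA: "A.weight U ?Z" and wB: "B.weight U ?Z"
	by (rule weight_free[OF A.site_laws_axioms fin b] weight_free[OF B.site_laws_axioms fin b])+
  have d: "depends_on U (%a. ennreal (?Z a))"
	using depends_on_part_fun[OF bonds_inner[OF fin]] by (intro depends_on_combine[where h = "%u v. ennreal u"])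
  have "(\<integral>\<^sup>+a. ennreal (?Z a) \<partial>B.P) = (\<integral>\<^sup>+a. ennreal (?Z a) \<partial>A.P)"
	by (rule nn_integral_site_cong[OF B.site_laws_axioms A.site_laws_axioms _ _ d]) (auto simp: site_law_def)
  then have "ennreal (\<integral>a. ?Z a \<partial>B.P) = ennreal (\<integral>a. ?Z a \<partial>A.P)"
	unfolding A.weight_nn[OF wA] B.weight_nn[OF wB] .
  then show ?thesis
	using A.weight_integral_pos[OF wA] B.weight_integral_pos[OF wB] by (simp add: free_Z_def)
qed

lemma free_Z_le_wired_Z:
  assumes r: "good_law rh" "good_law ka" and fin: "finite U" and b: "0 <= be"
  shows "1 <= free_Z rh be U" "free_Z rh be U <= wired_Z rh ka be U"
proof -
  interpret B: site_laws "site_law rh ka U" by (rule site_laws_site_law[OF r])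
  let ?Z = "part_fun U (IE U) (%_. be)" and ?W = "%a. bdry_factor U a * part_fun U (TE U) (%_. be) a"
  have wZ: "B.weight U ?Z" by (rule weight_free[OF B.site_laws_axioms fin b])
  have wW: "B.weight (SC U) ?W" by (rule weight_plus[OF B.site_laws_axioms fin b bdry_weight_factor[OF fin]])
  show "1 <= free_Z rh be U" using B.weight_integral_pos[OF wZ] free_Z_site[OF r fin b] by simp
  have "?Z a <= ?W a" if a: "\<forall>x. 0 <= a x" for a
  proof -
	have "?Z a = part_fun U (TE U) (%e. if e : IE U then be else 0) a"
	  by (rule fun_cong[OF part_fun_free_touching[OF fin], symmetric])
	also have "... <= part_fun U (TE U) (%_. be) a"
	  by (rule part_fun_mono[OF fin bonds_touching[OF fin]]) (use b a in auto)
	also have "... <= ?W a"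
	  using ising_Z_pos[OF fin, of "TE U" "coupling (%_. be) a"] by (simp add: bdry_factor_def)
	finally show ?thesis .
  qed
  then show "free_Z rh be U <= wired_Z rh ka be U"
	unfolding free_Z_site[OF r fin b, symmetric] wired_Z_def
	using B.weight_integrable[OF wZ] B.weight_integrable[OF wW] by (intro integral_mono_AE) (auto simp: B.space_P)
qed

text \<open>Boundary terms factor out; the inner ones are bounded by regularity of the free law, the outer ones by independence.\<close>
lemma wired_Z_le_free_Z:
  assumes adm: "admissible rh" and w: "wired_boundary_law TYPE('d::finite) rh be\<^sub>0 ze" and b: "0 <= be" "be <= be\<^sub>0"
	and k: "good_law ka"
  obtains M where "1 <= M" "!!U::'d site set. finite U ==>
	wired_Z rh ka be U <= 2 * M ^ (card (inner_boundary U) + card (EB U)) * free_Z rh be U"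
proof -
  note r = good_law_admissible[OF adm]
  define c where "c = be * real (card (cube 1 :: 'd site set))"
  obtain C where C: "1 <= C" "!!(U::'d site set) De. finite U ==> De <= U ==>
	(\<integral>\<^sup>+a. (\<Prod>x\<in>De. ennreal (exp (c * (a x)\<^sup>2))) \<partial>free_law rh be U) <= ennreal (C ^ card De)"
	using free_regularity[OF adm w b, of c] by blast
  define K where "K = (\<integral>\<^sup>+t. ennreal (exp (c * t\<^sup>2)) \<partial>bdry_law ka)"
  define M where "M = max C (enn2real K)"
  have M1: "1 <= M" using C(1) by (simp add: M_def)
  have "wired_Z rh ka be U <= 2 * M ^ (card (inner_boundary U) + card (EB U)) * free_Z rh be U"
	if fin: "finite U" for U :: "'d site set"
  proof -
	interpret A: site_laws "%_::'d site. abs_law rh" by (rule site_laws_abs[OF r])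
	interpret B: site_laws "site_law rh ka U" by (rule site_laws_site_law[OF r k])
	let ?Z = "part_fun U (IE U) (%_. be)" and ?W = "%a. bdry_factor U a * part_fun U (TE U) (%_. be) a"
	let ?in = "inner_boundary U" and ?ex = "EB U"
	have wZ: "B.weight U ?Z" by (rule weight_free[OF B.site_laws_axioms fin b(1)])
	have wW: "B.weight (SC U) ?W" by (rule weight_plus[OF B.site_laws_axioms fin b(1) bdry_weight_factor[OF fin]])
	have inL: "?in <= U" by (auto simp: inner_boundary_def)
	have finin: "finite ?in" using finite_subset[OF inL fin] .
	note finex = finite_ext_boundary[OF fin]
	let ?f = "%a. ennreal (exp (c * (\<Sum>x\<in>?in. (a x)\<^sup>2)))" and ?g = "%a. ennreal (exp (c * (\<Sum>x\<in>?ex. (a x)\<^sup>2)))"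
	have fm: "?f : bm FA" "?g : bm FA" by measurable
	have fd: "depends_on U ?f" and gd: "depends_on ?ex ?g"
	  using inL by (auto intro!: depends_onI arg_cong[of _ _ "%t. ennreal (exp (c * t))"] sum.cong)
	have Zd: "depends_on U (%a. ?f a * ennreal (?Z a))"
	  using depends_on_combine[OF fd depends_on_part_fun[OF bonds_inner[OF fin]], where h = "%u v. u * ennreal v"] .
	have "ennreal (wired_Z rh ka be U) = (\<integral>\<^sup>+a. ennreal (?W a) \<partial>B.P)"
	  unfolding wired_Z_def by (rule B.weight_nn[OF wW, symmetric])
	also have "... <= (\<integral>\<^sup>+a. 2 * ((?f a * ennreal (?Z a)) * ?g a) \<partial>B.P)"
	proof (intro nn_integral_mono)
	  fix a assume "a : space B.P"
	  then have a: "\<forall>x. 0 <= a x" by (simp add: B.space_P)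
	  have Zp: "0 <= ?Z a" "0 <= part_fun U (TE U) (%_. be) a"
		using ising_Z_pos[OF fin, of "IE U"] ising_Z_pos[OF fin, of "TE U"] by (auto intro: less_imp_le)
	  have "?W a <= 2 * (?Z a * exp (c * (\<Sum>x\<in>?in. (a x)\<^sup>2)) * exp (c * (\<Sum>x\<in>?ex. (a x)\<^sup>2)))"
		using part_fun_touching_le[OF fin b(1) a] Zp unfolding c_def
		by (intro mult_mono) (auto simp: bdry_factor_def)
	  then have "ennreal (?W a) <= ennreal (2 * (?Z a * exp (c * (\<Sum>x\<in>?in. (a x)\<^sup>2)) * exp (c * (\<Sum>x\<in>?ex. (a x)\<^sup>2))))"
		by (rule ennreal_leI)
	  also have "... = 2 * ((?f a * ennreal (?Z a)) * ?g a)"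
		using Zp(1) by (simp add: ennreal_mult mult_ac)
	  finally show "ennreal (?W a) <= 2 * ((?f a * ennreal (?Z a)) * ?g a)" .
	qed
	also have "... = 2 * (\<integral>\<^sup>+a. (?f a * ennreal (?Z a)) * ?g a \<partial>B.P)"
	  using fm by (intro nn_integral_cmult) (auto simp: B.measurable_P)
	also have "(\<integral>\<^sup>+a. (?f a * ennreal (?Z a)) * ?g a \<partial>B.P) = (\<integral>\<^sup>+a. ?f a * ennreal (?Z a) \<partial>B.P) * (\<integral>\<^sup>+a. ?g a \<partial>B.P)"
	  by (rule B.nn_integral_independent[OF fin finex _ _ Zd _ gd]) (use fm in \<open>auto simp: B.measurable_P ext_boundary_def\<close>)
	also have "(\<integral>\<^sup>+a. ?g a \<partial>B.P) = ennreal (enn2real K ^ card ?ex)"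
	proof -
	  have "K < \<infinity>" unfolding K_def nn_integral_bdry_law[OF k gauss_measurable]
		using good_law_gauss[OF k, of c] good_law_total[OF k] by (intro ennreal_divide_finite)
	  then have K: "K = ennreal (enn2real K)" by simp
	  have "(\<integral>\<^sup>+a. ?g a \<partial>B.P) = (\<Prod>x\<in>?ex. \<integral>\<^sup>+t. ennreal (exp (c * t\<^sup>2)) \<partial>site_law rh ka U x)"
		by (rule B.gauss_nn_integral[OF finex])
	  also have "... = (\<Prod>x\<in>?ex. K)" unfolding K_def by (intro prod.cong refl) (auto simp: site_law_def ext_boundary_def)
	  also have "... = K ^ card ?ex" by simp
	  finally show ?thesis by (subst (asm) K) (simp add: ennreal_power)
	qed
	also have "(\<integral>\<^sup>+a. ?f a * ennreal (?Z a) \<partial>B.P) <= ennreal (C ^ card ?in * free_Z rh be U)"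
	proof -
	  define z where "z = free_Z rh be U"
	  have z: "1 <= z" "(\<integral>a. ?Z a \<partial>B.P) = z" using free_Z_le_wired_Z(1)[OF r k fin b(1)] free_Z_site[OF r k fin b(1)] by (auto simp: z_def)
	  have "(\<integral>\<^sup>+a. ?f a * ennreal (?Z a) \<partial>B.P) / ennreal z = (\<integral>\<^sup>+a. ?f a \<partial>gibbs_law (site_law rh ka U) ?Z)"
		using B.gibbs_nn_integral[OF wZ, of ?f] fm z by (simp add: B.measurable_P)
	  also have "... = (\<integral>\<^sup>+a. ?f a \<partial>free_law rh be U)"
		unfolding free_law_def
		by (rule gibbs_nn_cong[OF B.site_laws_axioms A.site_laws_axioms _ wZ fm(1) fd]) (simp add: site_law_def)
	  also have "... = (\<integral>\<^sup>+a. (\<Prod>x\<in>?in. ennreal (exp (c * (a x)\<^sup>2))) \<partial>free_law rh be U)"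
		using finin by (intro nn_integral_cong) (simp add: sum_distrib_left exp_sum prod_ennreal)
	  also have "... <= ennreal (C ^ card ?in)" by (rule C(2)[OF fin inL])
	  finally have "(\<integral>\<^sup>+a. ?f a * ennreal (?Z a) \<partial>B.P) / ennreal z * ennreal z <= ennreal (C ^ card ?in) * ennreal z"
		by (rule mult_right_mono) simp
	  moreover have "(\<integral>\<^sup>+a. ?f a * ennreal (?Z a) \<partial>B.P) / ennreal z * ennreal z = (\<integral>\<^sup>+a. ?f a * ennreal (?Z a) \<partial>B.P)"
	  proof -
		define Y where "Y = (\<integral>\<^sup>+a. ?f a * ennreal (?Z a) \<partial>B.P)"
		have "Y / ennreal z * ennreal z = Y * ennreal z / ennreal z"
		  by (simp only: ennreal_times_divide mult.commute)
		also have "... = Y" using z by (intro ennreal_mult_divide_eq) auto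
		finally show ?thesis by (simp add: Y_def)
	  qed
	  ultimately show ?thesis using z C(1) by (simp add: z_def ennreal_mult)
	qed
	finally have "ennreal (wired_Z rh ka be U) <= 2 * (ennreal (C ^ card ?in * free_Z rh be U) * ennreal (enn2real K ^ card ?ex))"
	  by (simp add: mult_left_mono mult_right_mono)
	also have "... = ennreal (2 * (C ^ card ?in * free_Z rh be U * enn2real K ^ card ?ex))"
	  using C(1) free_Z_le_wired_Z(1)[OF r k fin b(1)] by (simp add: ennreal_mult)
	finally have "wired_Z rh ka be U <= 2 * (C ^ card ?in * free_Z rh be U * enn2real K ^ card ?ex)"
	  using C(1) free_Z_le_wired_Z(1)[OF r k fin b(1)] by (subst (asm) ennreal_le_iff) auto
	also have "... <= 2 * (M ^ card ?in * free_Z rh be U * M ^ card ?ex)"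
	  using C(1) free_Z_le_wired_Z(1)[OF r k fin b(1)] by (intro mult_mono power_mono) (auto simp: M_def)
	finally show ?thesis by (simp add: power_add mult_ac)
  qed
  then show ?thesis using that M1 by blast
qed

text \<open>Convexity is used from \<open>be\<close> to \<open>be'\<close> on the wired side and from \<open>be'\<close> to \<open>be\<close> on the free side, and the two partition functions are comparable.\<close>
lemma energy_inequality:
  assumes adm: "admissible rh" and w: "wired_boundary_law TYPE('d::finite) rh be\<^sub>0 ze" and b: "0 <= be" "be < be'" "be' <= be\<^sub>0"
	and k: "good_law ka"
  obtains L where "0 <= L" "!!U::'d site set. finite U ==>
	(\<Sum>e\<in>TE U. wired_edge rh ka be U e) <= (\<Sum>e\<in>IE U. free_edge rh be' U e)
	  + L * real (1 + card (inner_boundary U) + card (EB U))"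
proof -
  note r = good_law_admissible[OF adm]
  have b': "0 <= be'" using b by simp
  obtain M where M: "1 <= M" "!!U::'d site set. finite U ==>
	wired_Z rh ka be' U <= 2 * M ^ (card (inner_boundary U) + card (EB U)) * free_Z rh be' U"
	using wired_Z_le_free_Z[OF adm w b' b(3) k] by blast
  define d where "d = be' - be"
  have d: "0 < d" using b by (simp add: d_def)
  define L where "L = (ln 2 + ln M) / d"
  have L0: "0 <= L" using d M(1) by (simp add: L_def)
  have "(\<Sum>e\<in>TE U. wired_edge rh ka be U e) <= (\<Sum>e\<in>IE U. free_edge rh be' U e)
	  + L * real (1 + card (inner_boundary U) + card (EB U))" if fin: "finite U" for U :: "'d site set"
  proof -
	interpret A: site_laws "%_::'d site. abs_law rh" by (rule site_laws_abs[OF r])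
	interpret B: site_laws "site_law rh ka U" by (rule site_laws_site_law[OF r k])
	define n where "n = card (inner_boundary U) + card (EB U)"
	define hw where "hw = (\<Sum>e\<in>TE U. wired_edge rh ka be U e)"
	define h0 where "h0 = (\<Sum>e\<in>IE U. free_edge rh be' U e)"
	have 1: "exp (d * hw) * wired_Z rh ka be U <= wired_Z rh ka be' U"
	  using B.partition_convex[OF bonds_touching[OF fin] fin b(1) b' weight_bdry[OF B.site_laws_axioms fin bdry_weight_factor[OF fin]]]
	  unfolding d_def hw_def wired_Z_def wired_edge_def plus_law_def .
	have w1: "A.weight U (%_. 1)"
	  using fin by (auto simp: A.weight_def depends_on_def intro!: gaussian_bounded[of _ 1])
	have 2: "exp (- d * h0) * free_Z rh be' U <= free_Z rh be U"
	  using A.partition_convex[OF bonds_inner[OF fin] fin b' b(1) w1]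
	  unfolding d_def h0_def free_Z_def free_edge_def free_law_def by (simp add: eta_contract_eq)
	have f1: "1 <= free_Z rh be U" "1 <= free_Z rh be' U" and fw: "free_Z rh be U <= wired_Z rh ka be U"
	  using free_Z_le_wired_Z[OF r k fin] b b' by auto
	have Mn: "0 < 2 * M ^ n" using M(1) by simp
	have e: "exp (d * h0) * exp (- d * h0) = 1" by (simp flip: exp_add)
	have 3: "free_Z rh be' U <= exp (d * h0) * free_Z rh be U"
	proof -
	  have "free_Z rh be' U = exp (d * h0) * (exp (- d * h0) * free_Z rh be' U)" using e by (simp only: mult.assoc[symmetric] mult_1_left)
	  also have "... <= exp (d * h0) * free_Z rh be U" using 2 by (intro mult_left_mono) auto
	  finally show ?thesis .
	qed
	have "exp (d * hw) * wired_Z rh ka be U <= 2 * M ^ n * free_Z rh be' U" using 1 M(2)[OF fin] by (simp add: n_def)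
	also have "... <= 2 * M ^ n * (exp (d * h0) * wired_Z rh ka be U)"
	  using 3 fw Mn by (intro mult_left_mono order_trans[OF 3]) auto
	finally have "exp (d * hw) * wired_Z rh ka be U <= (2 * M ^ n * exp (d * h0)) * wired_Z rh ka be U" by (simp only: mult.assoc)
	then have "exp (d * hw) <= 2 * M ^ n * exp (d * h0)" using f1 fw by (subst (asm) mult_le_cancel_right) auto
	then have "ln (exp (d * hw)) <= ln (2 * M ^ n * exp (d * h0))" using Mn by (subst ln_le_cancel_iff) auto
	then have "d * hw <= ln 2 + real n * ln M + d * h0" using M(1) by (simp add: ln_mult ln_realpow)
	then have "hw <= h0 + (ln 2 + real n * ln M) / d" using d by (simp add: field_simps)
	also have "(ln 2 + real n * ln M) / d <= L * real (1 + n)"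
	proof -
	  have "ln 2 + real n * ln M <= (ln 2 + ln M) * real (1 + n)" using M(1) by (simp add: algebra_simps)
	  then show ?thesis using d by (simp add: L_def divide_simps)
	qed
	finally show ?thesis by (simp add: hw_def h0_def n_def add.assoc)
  qed
  then show ?thesis using that L0 by blast
qed

section \<open>Translations and cubes\<close>

lemma ising_sum_image:
  assumes p: "inj p" and K: "!!e. e : E ==> K' (p ` e) = K e" and f: "!!A. f' (p ` A) = f A"
  shows "ising_sum (p ` U) ((`) p ` E) K' f' = ising_sum U E K f"
proof -
  have s: "spins (p ` e) (p ` A) = spins e A" for e A
  proof -
	have "inj_on p e" using p by (rule inj_on_subset) simp
	then show ?thesis using p by (simp add: spins_def prod.reindex spin_of_def inj_image_mem_iff)
  qed
  have i: "inj_on ((`) p) S" for S using p by (auto simp: inj_on_def inj_image_eq_iff)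
  have "Pow (p ` U) = (`) p ` Pow U" by (rule image_Pow_surj[symmetric, OF refl])
  then have "ising_sum (p ` U) ((`) p ` E) K' f' = (\<Sum>A\<in>Pow U. f' (p ` A) * exp (\<Sum>e\<in>(`) p ` E. K' e * spins e (p ` A)))"
	unfolding ising_sum_def by (simp add: sum.reindex[OF i])
  also have "... = ising_sum U E K f"
	unfolding ising_sum_def by (simp add: sum.reindex[OF i] s K f cong: sum.cong)
  finally show ?thesis .
qed

lemma adjacent_translate[simp]: "adjacent (v + x) (v + y) \<longleftrightarrow> adjacent x (y :: 'd::finite site)"
  by (simp add: adjacent_def)

lemma ext_boundary_translate: "EB ((+) v ` U) = (+) v ` EB (U :: 'd::finite site set)"
proof (intro set_eqI iffI)
  fix y assume "y : EB ((+) v ` U)"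
  then obtain x where x: "x : U" "adjacent (v + x) y" "y \<notin> (+) v ` U" by (auto simp: ext_boundary_def)
  have "y = v + (y - v)" by simp
  moreover have "y - v : EB U"
	unfolding ext_boundary_def using x adjacent_translate[of v x "y - v"] by (auto intro: image_eqI[of _ _ "y - v"])
  ultimately show "y : (+) v ` EB U" by blast
next
  fix y assume "y : (+) v ` EB U"
  then show "y : EB ((+) v ` U)" by (auto simp: ext_boundary_def)
qed

lemma inner_edges_translate: "IE ((+) v ` U) = (`) ((+) v) ` IE (U :: 'd::finite site set)"
proof (intro set_eqI iffI)
  fix e assume "e : IE ((+) v ` U)"
  then obtain x y where "x : U" "y : U" "adjacent x y" "e = {v + x, v + y}" unfolding inner_edges_def by auto
  then show "e : (`) ((+) v) ` IE U" by (intro image_eqI[of _ _ "{x, y}"]) (auto simp: inner_edges_def)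
next
  fix e assume "e : (`) ((+) v) ` IE U"
  then obtain x y where "x : U" "y : U" "adjacent x y" "e = {v + x, v + y}" unfolding inner_edges_def by auto
  then show "e : IE ((+) v ` U)" unfolding inner_edges_def
	by (intro CollectI exI[of _ "v + x"] exI[of _ "v + y"]) auto
qed

lemma touching_edges_translate: "TE ((+) v ` U) = (`) ((+) v) ` TE (U :: 'd::finite site set)"
proof (intro set_eqI iffI)
  fix e assume "e : TE ((+) v ` U)"
  then obtain x y where xy: "x : U" "adjacent (v + x) y" "e = {v + x, y}" unfolding touching_edges_def by auto
  then have "adjacent x (y - v)" using adjacent_translate[of v x "y - v"] by simp
  then show "e : (`) ((+) v) ` TE U" using xy
	by (intro image_eqI[of _ _ "{x, y - v}"]) (auto simp: touching_edges_def)
next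
  fix e assume "e : (`) ((+) v) ` TE U"
  then obtain x y where "x : U" "adjacent x y" "e = {v + x, v + y}" unfolding touching_edges_def by auto
  then show "e : TE ((+) v ` U)" unfolding touching_edges_def
	by (intro CollectI exI[of _ "v + x"] exI[of _ "v + y"]) auto
qed

context
  fixes v :: "'d::finite site"
begin

abbreviation moved :: "('d site => real) => 'd site => real" where "moved a \<equiv> %x. a (x - v)"

lemma coupling_moved: "coupling (%_. be) (moved a) ((+) v ` e) = coupling (%_. be) a e"
  by (simp add: coupling_def prod.reindex)

lemma part_fun_moved: "part_fun ((+) v ` U) ((`) ((+) v) ` E) (%_. be) (moved a) = part_fun U E (%_. be) a"
  unfolding ising_Z_def by (intro ising_sum_image coupling_moved) auto

lemma edge_obs_moved: "edge_obs ((+) v ` U) ((`) ((+) v) ` E) be ((+) v ` e) (moved a) = edge_obs U E be e a"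
proof -
  have "ising_sum ((+) v ` U) ((`) ((+) v) ` E) (coupling (%_. be) (moved a)) (spins ((+) v ` e))
	  = ising_sum U E (coupling (%_. be) a) (spins e)"
	by (intro ising_sum_image coupling_moved) (auto simp: spins_def prod.reindex spin_of_def inj_image_mem_iff)
  then show ?thesis by (simp add: edge_obs_def ising_corr_def part_fun_moved prod.reindex)
qed

lemma gibbs_law_moved:
  assumes m: "site_laws mu" "site_laws.weight mu V w" and m': "site_laws mu'" "site_laws.weight mu' V' w'"
	and eq: "!!x. mu' x = mu (x - v)" "!!a. w' (moved a) = w a" and F: "F : bm FA"
  shows "(\<integral>a. (F a :: real) \<partial>gibbs_law mu' w') = (\<integral>a. F (moved a) \<partial>gibbs_law mu w)"
proof -
  interpret A: site_laws mu by fact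
  interpret B: site_laws mu' by fact
  have mu': "mu' = (%x. mu (x - v))" using eq by auto
  have d: "distr A.P B.P moved = B.P"
	using distr_PiM_reindex[of UNIV mu "%x. x - v" UNIV] A.prob unfolding mu' by (simp add: restrict_UNIV inj_on_def)
  have mm: "moved : measurable A.P B.P"
	unfolding mu' by (intro measurable_PiM_single') (auto simp: A.space_P intro: measurable_component_singleton)
  have i: "(\<integral>a. G a \<partial>B.P) = (\<integral>a. G (moved a) \<partial>A.P)" if "G : bm B.P" for G :: "('d site => real) => real"
	by (subst d[symmetric], rule integral_distr[OF mm that])
  have w: "w' : bm B.P" using m'(2) by (simp add: B.weight_def)
  have FB: "F : bm B.P" using F by (simp add: B.measurable_P)
  have FA: "(%a. F (moved a)) : bm A.P" by (rule measurable_compose[OF mm FB])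
  show ?thesis unfolding A.gibbs_integral[OF m(2) FA] B.gibbs_integral[OF m'(2) FB]
	using i[OF w] i[OF borel_measurable_times[OF FB w]] by (simp add: eq)
qed

lemma free_edge_translate:
  assumes r: "good_law rh" and fin: "finite U" and b: "0 <= be"
  shows "free_edge rh be ((+) v ` U) ((+) v ` e) = free_edge rh be U e"
proof -
  note A = site_laws_abs[OF r, where 'a = "'d site"]
  have fin': "finite ((+) v ` U)" using fin by simp
  show ?thesis
	unfolding free_edge_def free_law_def
	by (subst gibbs_law_moved[OF A weight_free[OF A fin b] A weight_free[OF A fin' b]])
	  (simp_all add: inner_edges_translate part_fun_moved edge_obs_moved)
qed

lemma wired_edge_translate:
  assumes r: "good_law rh" "good_law ka" and fin: "finite U" and b: "0 <= be"
  shows "wired_edge rh ka be ((+) v ` U) ((+) v ` e) = wired_edge rh ka be U e"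
proof -
  have fin': "finite ((+) v ` U)" using fin by simp
  note A = site_laws_site_law[OF r, of U] and B = site_laws_site_law[OF r, of "(+) v ` U"]
  have s: "site_law rh ka ((+) v ` U) x = site_law rh ka U (x - v)" for x
  proof -
	have "x : (+) v ` U \<longleftrightarrow> x - v : U" by (auto intro: image_eqI[of _ _ "x - v"])
	then show ?thesis by (simp add: site_law_def)
  qed
  have "bdry_factor ((+) v ` U) (moved a) = bdry_factor U a" for a
	by (simp add: bdry_factor_def ext_boundary_translate)
  then show ?thesis
	unfolding wired_edge_def plus_law_def
	by (subst gibbs_law_moved[OF A weight_plus[OF A fin b bdry_weight_factor[OF fin]] B weight_plus[OF B fin' b bdry_weight_factor[OF fin']] s])
	  (simp_all add: touching_edges_translate part_fun_moved edge_obs_moved)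
qed

end

text \<open>Every edge has two endpoints.\<close>
lemma sum_edges_at:
  fixes f :: "'d::finite edge => real"
  assumes fin: "finite U"
  shows "(\<Sum>x\<in>U. \<Sum>e | e : IE U & x : e. f e) = 2 * (\<Sum>e\<in>IE U. f e)"
proof -
  have finE: "finite (IE U)" using bonds_finite[OF bonds_inner[OF fin]] .
  have "(\<Sum>x\<in>U. \<Sum>e | e : IE U & x : e. f e) = (\<Sum>x\<in>U. \<Sum>e\<in>IE U. if x : e then f e else 0)"
	using finE by (simp add: sum.inter_filter)
  also have "... = (\<Sum>e\<in>IE U. \<Sum>x\<in>U. if x : e then f e else 0)" by (rule sum.swap)
  also have "... = (\<Sum>e\<in>IE U. 2 * f e)"
  proof (rule sum.cong[OF refl])
	fix e assume e: "e : IE U"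
	have "{x : U. x : e} = e" "card e = 2" using bonds_D[OF bonds_inner[OF fin] e] by auto
	then show "(\<Sum>x\<in>U. if x : e then f e else 0) = 2 * f e"
	  using fin by (simp add: sum.inter_filter[symmetric])
  qed
  finally show ?thesis by (simp add: sum_distrib_left)
qed

lemma sum_edges_at_le:
  fixes f :: "'d::finite edge => real"
  assumes fin: "finite U" and sub: "U' <= U" and f: "!!e. e : IE U ==> 0 <= f e"
  shows "(\<Sum>e\<in>IE U'. f e) <= (\<Sum>x\<in>U'. \<Sum>e | e : IE U & x : e. f e)"
proof -
  have fin': "finite U'" using sub fin by (rule finite_subset)
  have finE: "finite (IE U)" using bonds_finite[OF bonds_inner[OF fin]] .
  note m = inner_edges_mono[OF sub]
  have "0 <= (\<Sum>e\<in>IE U'. f e)" using m f by (intro sum_nonneg) auto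
  then have "(\<Sum>e\<in>IE U'. f e) <= 2 * (\<Sum>e\<in>IE U'. f e)" by simp
  also have "... = (\<Sum>x\<in>U'. \<Sum>e | e : IE U' & x : e. f e)" by (rule sum_edges_at[OF fin', symmetric])
  also have "... <= (\<Sum>x\<in>U'. \<Sum>e | e : IE U & x : e. f e)"
	using finE m f by (intro sum_mono sum_mono2) auto
  finally show ?thesis .
qed

lemma translate_cube: "v : cube m ==> (+) v ` cube n <= cube (m + n)"
  using cube_add by auto

lemma inner_boundary_cube: "inner_boundary (cube (Suc n)) <= cube (Suc n) - cube n"
proof
  fix x assume "x : inner_boundary (cube (Suc n))"
  then obtain y where y: "x : cube (Suc n)" "y \<notin> cube (Suc n)" "adjacent x y" by (auto simp: inner_boundary_def)
  have "x \<notin> cube n" using cube_add[of x n "y - x" 1] adjacent_diff_cube[OF y(3)] y(2) by auto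
  then show "x : cube (Suc n) - cube n" using y by simp
qed

lemma ext_boundary_cube: "EB (cube n) <= cube (Suc n) - cube n"
proof
  fix y assume "y : EB (cube n)"
  then obtain x where y: "y \<notin> cube n" "x : cube n" "adjacent x y" by (auto simp: ext_boundary_def)
  have "y : cube (Suc n)" using cube_add[of x n "y - x" 1] adjacent_diff_cube[OF y(3)] y(2) by auto
  then show "y : cube (Suc n) - cube n" using y by simp
qed

lemma cube_ratio: "(%n. real (card (cube (n + a) :: 'd::finite site set)) / real (card (cube (n + b) :: 'd site set))) ~~> 1"
proof -
  have "(%n. ((2 * (real n + real a) + 1) / (2 * (real n + real b) + 1)) ^ CARD('d)) ~~> 1 ^ CARD('d)"
	by (intro tendsto_power) real_asymp
  then show ?thesis by (simp add: card_cube power_divide ac_simps)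
qed

lemma boundary_ratio:
  "(%n. real (1 + card (inner_boundary (cube (n + k) :: 'd::finite site set)) + card (EB (cube (n + k) :: 'd site set)))
	  / real (card (cube (n + k) :: 'd site set))) ~~> 0"
proof (rule tendsto_sandwich[OF _ _ tendsto_const])
  let ?c = "%n. real (card (cube n :: 'd site set))"
  have cp: "0 < ?c n" for n by (simp add: card_cube)
  have one: "(%n. 1 / ?c (n + k)) ~~> 0"
  proof (rule tendsto_sandwich[OF _ _ tendsto_const])
	show "EVS n. 0 <= 1 / ?c (n + k)" by simp
	show "EVS n. 1 / ?c (n + k) <= 1 / (2 * real n + 1)"
	proof (intro always_eventually allI divide_left_mono)
	  fix n
	  have "(2 * n + 1) ^ 1 <= (2 * (n + k) + 1) ^ CARD('d)"
		by (rule order_trans[OF power_mono power_increasing]) (auto simp: Suc_leI)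
	  then have "real ((2 * n + 1) ^ 1) <= ?c (n + k)" unfolding card_cube by (rule of_nat_mono)
	  then show "2 * real n + 1 <= ?c (n + k)" by simp
	qed (use cp in auto)
	show "(%n. 1 / (2 * real n + 1)) ~~> 0" by real_asymp
  qed
  have "(%n. 1 / ?c (n + k) + (1 - ?c (n + k - 1) / ?c (n + k)) + (?c (n + (k + 1)) / ?c (n + k) - 1)) ~~> 0 + (1 - 1) + (1 - 1)"
  proof (intro tendsto_add tendsto_diff tendsto_const one cube_ratio)
	have "(%n. ?c (n + k) / ?c (n + (k + 1))) ~~> 1" by (rule cube_ratio)
	then have "(%n. ?c (Suc n + k - 1) / ?c (Suc n + k)) ~~> 1" by simp
	then show "(%n. ?c (n + k - 1) / ?c (n + k)) ~~> 1" by (subst (asm) filterlim_sequentially_Suc)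
  qed
  then show "(%n. 1 / ?c (n + k) + (1 - ?c (n + k - 1) / ?c (n + k)) + (?c (n + (k + 1)) / ?c (n + k) - 1)) ~~> 0" by simp
  show "EVS n. real (1 + card (inner_boundary (cube (n + k) :: 'd site set)) + card (EB (cube (n + k) :: 'd site set))) / ?c (n + k)
	<= 1 / ?c (n + k) + (1 - ?c (n + k - 1) / ?c (n + k)) + (?c (n + (k + 1)) / ?c (n + k) - 1)"
	using eventually_gt_at_top[of 0]
  proof eventually_elim
	case (elim n)
	define m where "m = n + k - 1"
	have m: "n + k = Suc m" "n + k - 1 = m" "n + (k + 1) = Suc (Suc m)" using elim by (auto simp: m_def)
	have d: "real (card (cube (Suc j) - cube j :: 'd site set)) = ?c (Suc j) - ?c j" for j
	proof -
	  have sub: "(cube j :: 'd site set) <= cube (Suc j)" by (rule cube_mono) simp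
	  then show ?thesis using card_mono[OF finite_cube sub] by (simp add: card_Diff_subset of_nat_diff)
	qed
	have "real (card (inner_boundary (cube (Suc m) :: 'd site set))) <= ?c (Suc m) - ?c m"
	  unfolding d[symmetric] by (intro of_nat_mono card_mono inner_boundary_cube) simp
	moreover have "real (card (EB (cube (Suc m) :: 'd site set))) <= ?c (Suc (Suc m)) - ?c (Suc m)"
	  unfolding d[symmetric] by (intro of_nat_mono card_mono ext_boundary_cube) simp
	ultimately have "real (1 + card (inner_boundary (cube (Suc m) :: 'd site set)) + card (EB (cube (Suc m) :: 'd site set)))
	  <= 1 + (?c (Suc m) - ?c m) + (?c (Suc (Suc m)) - ?c (Suc m))" by simp
	then have "real (1 + card (inner_boundary (cube (Suc m) :: 'd site set)) + card (EB (cube (Suc m) :: 'd site set))) / ?c (Suc m)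
	  <= (1 + (?c (Suc m) - ?c m) + (?c (Suc (Suc m)) - ?c (Suc m))) / ?c (Suc m)"
	  using cp[of "Suc m"] by (intro divide_right_mono) auto
	also have "... = 1 / ?c (Suc m) + (1 - ?c m / ?c (Suc m)) + (?c (Suc (Suc m)) / ?c (Suc m) - 1)"
	  using cp[of "Suc m"] by (simp add: add_divide_distrib diff_divide_distrib)
	finally show ?case unfolding m(2) unfolding m(1,3) .
  qed
qed simp

lemma free_edge_bounded:
  assumes adm: "admissible rh" and w: "wired_boundary_law TYPE('d::finite) rh be\<^sub>0 ze" and b: "0 <= be" "be <= be\<^sub>0"
  obtains M where "0 <= M" "!!(U::'d site set) e. finite U ==> e : IE U ==> free_edge rh be U e <= M"
proof -
  note r = good_law_admissible[OF adm]
  obtain C :: real where C: "1 <= C" "!!(U::'d site set) De. finite U ==> De <= U ==>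
	(\<integral>\<^sup>+a. (\<Prod>x\<in>De. ennreal (exp (1 * (a x)\<^sup>2))) \<partial>free_law rh be U) <= ennreal (C ^ card De)"
	using free_regularity[OF adm w b, of 1] by blast
  have "free_edge rh be U e <= 2 * C" if fin: "finite U" and e: "e : IE U" for U :: "'d site set" and e
  proof -
	interpret A: site_laws "%_::'d site. abs_law rh" by (rule site_laws_abs[OF r])
	note bi = bonds_inner[OF fin] and wf = weight_free[OF A.site_laws_axioms fin b(1)]
	have sp: "space (free_law rh be U) = {a. \<forall>x. 0 <= a x}" unfolding free_law_def by (simp add: A.space_gibbs A.space_P)
	have ms: "measurable (free_law rh be U) N = measurable FA N" for N :: "real measure"
	  unfolding free_law_def by (rule A.measurable_gibbs)
	have ms': "measurable (free_law rh be U) N = measurable FA N" for N :: "ennreal measure"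
	  unfolding free_law_def by (rule A.measurable_gibbs)
	have eD: "finite e" "e <= U" "card e = 2" using bonds_D[OF bi e] by auto
	have eb: "bonds U {e}" using eD fin by (auto simp: bonds_def)
	have le: "edge_obs U (IE U) be e a <= (\<Sum>x\<in>e. exp (1 * (a x)\<^sup>2))" if a: "\<forall>x. 0 <= a x" for a
	proof -
	  have pn: "0 <= (\<Prod>x\<in>e. a x)" using a by (intro prod_nonneg) auto
	  have "edge_obs U (IE U) be e a <= (\<Prod>x\<in>e. a x) * 1"
		unfolding edge_obs_def using corr_abs_le_1[OF fin, of "IE U" "coupling (%_. be) a" e] pn
		by (intro mult_left_mono) auto
	  also have "... <= (\<Sum>x\<in>e. (a x)\<^sup>2)"
	  proof -
		have "bonds e {e}" using eD by (auto simp: bonds_def)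
		then show ?thesis using bond_prod_le[of e "{e}" e a] a by simp
	  qed
	  also have "... <= (\<Sum>x\<in>e. exp (1 * (a x)\<^sup>2))"
	  proof (rule sum_mono)
		fix x
		have "(a x)\<^sup>2 <= exp ((a x)\<^sup>2)" using exp_ge_add_one_self[of "(a x)\<^sup>2"] by linarith
		then show "(a x)\<^sup>2 <= exp (1 * (a x)\<^sup>2)" by simp
	  qed
	  finally show ?thesis .
	qed
	have "(\<integral>\<^sup>+a. ennreal (edge_obs U (IE U) be e a) \<partial>free_law rh be U)
	  <= (\<integral>\<^sup>+a. (\<Sum>x\<in>e. ennreal (exp (1 * (a x)\<^sup>2))) \<partial>free_law rh be U)"
	proof (rule nn_integral_mono)
	  fix a assume "a : space (free_law rh be U)"
	  then have "\<forall>x. 0 <= a x" by (simp add: sp)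
	  from ennreal_leI[OF le[OF this]]
	  show "ennreal (edge_obs U (IE U) be e a) <= (\<Sum>x\<in>e. ennreal (exp (1 * (a x)\<^sup>2)))"
		by (subst sum_ennreal) auto
	qed
	also have "... = (\<Sum>x\<in>e. \<integral>\<^sup>+a. ennreal (exp (1 * (a x)\<^sup>2)) \<partial>free_law rh be U)"
	proof (rule nn_integral_sum)
	  fix x
	  show "(%a. ennreal (exp (1 * (a x)\<^sup>2))) : bm (free_law rh be U)" unfolding ms' by measurable
	qed
	also have "... <= (\<Sum>x\<in>e. ennreal C)"
	proof (rule sum_mono)
	  fix x assume "x : e"
	  then show "(\<integral>\<^sup>+a. ennreal (exp (1 * (a x)\<^sup>2)) \<partial>free_law rh be U) <= ennreal C"
		using C(2)[OF fin, of "{x}"] eD by auto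
	qed
	also have "... = ennreal (2 * C)" using eD C(1) by (subst sum_ennreal) auto
	finally have "enn2real (\<integral>\<^sup>+a. ennreal (edge_obs U (IE U) be e a) \<partial>free_law rh be U) <= 2 * C"
	  using C(1) by (intro enn2real_leI) auto
	then show ?thesis unfolding free_edge_def
	  by (subst integral_nonneg_nn) (auto simp: ms sp intro!: edge_obs_nonneg[OF fin bi b(1) _ eD(1)])
  qed
  moreover have "0 <= 2 * C" using C(1) by simp
  ultimately show ?thesis using that by blast
qed

definition site_energy where
  "site_energy rh be U x = (\<Sum>e | e : IE U & x : e. free_edge rh be U e)"

text \<open>The type argument carries the dimension.\<close>
definition energy :: "'d::finite itself => real measure => real => real" where
  "energy _ rh be = (SUP U\<in>{U::'d site set. finite U}. site_energy rh be U 0)"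

section \<open>Volumes in which the energies agree\<close>

definition energy_gap where
  "energy_gap rh ka be U e = wired_edge rh ka be U e - free_edge rh be U e"

context
  fixes rh :: "real measure" and d :: "'d::finite itself"
  assumes adm: "admissible rh"
	and laws: "!!be. 0 <= be ==> \<exists>be\<^sub>0 ze. be <= be\<^sub>0 & wired_boundary_law TYPE('d) rh be\<^sub>0 ze"
begin

lemma rho_good: "good_law rh" by (rule good_law_admissible[OF adm])

lemma finite_edges_in: "finite {e. e : IE (U :: 'd site set) & x : e}"
  by (rule finite_subset[OF _ finite_edges_at[of x]]) (auto simp: inner_edges_iff[of _ U])

lemma site_energy_bdd:
  assumes b: "0 <= be"
  shows "bdd_above ((%U. site_energy rh be U x) ` {U::'d site set. finite U})"
proof -
  obtain be\<^sub>0 ze where w: "be <= be\<^sub>0" "wired_boundary_law TYPE('d) rh be\<^sub>0 ze" using laws[OF b] by blast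
  obtain M where M: "0 <= M" "!!(U::'d site set) e. finite U ==> e : IE U ==> free_edge rh be U e <= M"
	using free_edge_bounded[OF adm w(2) b w(1)] by blast
  have "site_energy rh be U x <= real (card (cube 1 :: 'd site set)) * M" if "finite U" for U :: "'d site set"
  proof -
	have "site_energy rh be U x <= (\<Sum>e | e : IE U & x : e. M)"
	  unfolding site_energy_def using M(2)[OF that] by (intro sum_mono) auto
	also have "... = real (card {e. e : IE U & x : e}) * M" by simp
	also have "... <= real (card (cube 1 :: 'd site set)) * M"
	proof (intro mult_right_mono M(1) of_nat_mono)
	  have "card {e. e : IE U & x : e} <= card {e : IE UNIV. x : e}"
		by (intro card_mono finite_edges_at) (auto simp: inner_edges_iff[of _ U])
	  then show "card {e. e : IE U & x : e} <= card (cube 1 :: 'd site set)"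
		using card_edges_at[of x] by linarith
	qed
	finally show ?thesis .
  qed
  then show ?thesis by (intro bdd_aboveI[of _ "real (card (cube 1 :: 'd site set)) * M"]) auto
qed

lemma site_energy_translate:
  assumes "finite (U :: 'd site set)" "0 <= be"
  shows "site_energy rh be ((+) v ` U) (v + x) = site_energy rh be U x"
proof -
  have i: "inj_on ((`) ((+) v)) S" for S :: "'d site set set" by (auto simp: inj_on_def inj_image_eq_iff)
  have "{e. e : IE ((+) v ` U) & v + x : e} = (`) ((+) v) ` {e. e : IE U & x : e}"
	unfolding inner_edges_translate by auto
  then show ?thesis unfolding site_energy_def
	by (simp add: sum.reindex[OF i] free_edge_translate[OF rho_good assms])
qed

lemma site_energy_mono:
  assumes fin: "finite (U' :: 'd site set)" and sub: "U <= U'" and b: "0 <= be" "be <= be'"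
  shows "site_energy rh be U x <= site_energy rh be' U' x"
proof -
  have b': "0 <= be'" using b by simp
  have "site_energy rh be U x <= (\<Sum>e | e : IE U & x : e. free_edge rh be' U' e)"
	unfolding site_energy_def by (intro sum_mono free_edge_mono[OF rho_good fin sub b]) auto
  also have "... <= site_energy rh be' U' x"
	unfolding site_energy_def using inner_edges_mono[OF sub] free_edge_nonneg[OF rho_good fin b']
	by (intro sum_mono2 finite_edges_in) auto
  finally show ?thesis .
qed

lemma site_energy_le:
  assumes "finite (U :: 'd site set)" "0 <= be" shows "site_energy rh be U x <= energy TYPE('d) rh be"
proof -
  have "site_energy rh be U x = site_energy rh be ((+) (- x) ` U) (- x + x)" by (rule site_energy_translate[OF assms, symmetric])
  also have "... <= energy TYPE('d) rh be"
	unfolding energy_def using assms site_energy_bdd[OF assms(2)] by (intro cSUP_upper2[of _ _ "(+) (- x) ` U"]) auto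
  finally show ?thesis .
qed

lemma energy_mono:
  assumes "0 <= be" "be <= be'" shows "energy TYPE('d) rh be <= energy TYPE('d) rh be'"
  unfolding energy_def[of _ _ be]
proof (rule cSUP_least)
  fix U :: "'d site set" assume "U : {U. finite U}"
  then have f: "finite U" by simp
  have "site_energy rh be U 0 <= site_energy rh be' U 0" by (rule site_energy_mono[OF f order_refl assms])
  also have "... <= energy TYPE('d) rh be'" using assms by (intro site_energy_le f) simp
  finally show "site_energy rh be U 0 <= energy TYPE('d) rh be'" .
qed auto

lemma energy_gap_nonneg:
  assumes "good_law ka" "finite U" "0 <= be" "e : IE U" shows "0 <= energy_gap rh ka be U e"
  unfolding energy_gap_def using free_edge_le_wired[OF rho_good assms] by simp

text \<open>A finite volume nearly attaining the supremum, translated to every site of a cube away from its boundary, bounds the free energy of the cube from below; the wired energy is bounded by the energy inequality.\<close>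
lemma energy_gap_density:
  assumes b: "0 <= be" and k: "good_law ka"
	and cont: "!!et. 0 < et ==> \<exists>be'>be. energy TYPE('d) rh be' <= energy TYPE('d) rh be + et"
	and \<delta>: "0 < \<delta>"
  shows "EVS n. (\<Sum>e\<in>IE (cube n :: 'd site set). energy_gap rh ka be (cube n) e)
	<= \<delta> * real (card (cube n :: 'd site set))"
proof -
  let ?G = "energy TYPE('d) rh" and ?c = "%n. real (card (cube n :: 'd site set))"
  have cp: "0 < ?c n" for n by (simp add: card_cube)
  define et where "et = \<delta> / 2"
  have et: "0 < et" using \<delta> by (simp add: et_def)
  obtain be' where b': "be < be'" "?G be' <= ?G be + et" using cont[OF et] by blast
  have b0': "0 <= be'" using b b' by simp
  obtain be\<^sub>0 ze where w: "be' <= be\<^sub>0" "wired_boundary_law TYPE('d) rh be\<^sub>0 ze" using laws[OF b0'] by blast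
  obtain L where L: "0 <= L" "!!U::'d site set. finite U ==>
	(\<Sum>e\<in>TE U. wired_edge rh ka be U e) <= (\<Sum>e\<in>IE U. free_edge rh be' U e)
	  + L * real (1 + card (inner_boundary U) + card (EB U))"
	using energy_inequality[OF adm w(2) b b'(1) w(1) k] by blast
  obtain U0 :: "'d site set" where L0: "finite U0" "?G be - et < site_energy rh be U0 0"
	using less_cSUP_iff[of "{U::'d site set. finite U}" "%U. site_energy rh be U 0" "?G be - et"] site_energy_bdd[OF b] et
	unfolding energy_def by auto
  obtain k where k0: "U0 <= cube k" using finite_subset_cube[OF L0(1)] by blast
  let ?B = "%n. real (1 + card (inner_boundary (cube n :: 'd site set)) + card (EB (cube n :: 'd site set)))"
  have step: "(\<Sum>e\<in>IE (cube (n + k) :: 'd site set). energy_gap rh ka be (cube (n + k)) e)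
	  <= (?G be + et) / 2 * ?c (n + k) - (?G be - et) / 2 * ?c n + L * ?B (n + k)" for n
  proof -
	let ?U = "cube (n + k) :: 'd site set"
	have fin: "finite ?U" by simp
	have "(\<Sum>e\<in>IE ?U. wired_edge rh ka be ?U e) <= (\<Sum>e\<in>TE ?U. wired_edge rh ka be ?U e)"
	  using bonds_finite[OF bonds_touching[OF fin]] wired_edge_nonneg[OF rho_good k fin b] inner_subset_touching[of ?U]
	  by (intro sum_mono2) auto
	also have "... <= (\<Sum>e\<in>IE ?U. free_edge rh be' ?U e) + L * ?B (n + k)" by (rule L(2)[OF fin])
	also have "2 * (\<Sum>e\<in>IE ?U. free_edge rh be' ?U e) = (\<Sum>x\<in>?U. site_energy rh be' ?U x)"
	  unfolding site_energy_def by (rule sum_edges_at[OF fin, symmetric])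
	then have "(\<Sum>e\<in>IE ?U. free_edge rh be' ?U e) = (\<Sum>x\<in>?U. site_energy rh be' ?U x) / 2" by simp
	also have "(\<Sum>x\<in>?U. site_energy rh be' ?U x) <= (\<Sum>x\<in>?U. ?G be + et)"
	  by (intro sum_mono order_trans[OF site_energy_le[OF fin b0'] b'(2)])
	also have "... = (?G be + et) * ?c (n + k)" by simp
	finally have 1: "(\<Sum>e\<in>IE ?U. wired_edge rh ka be ?U e) <= (?G be + et) * ?c (n + k) / 2 + L * ?B (n + k)" by simp
	have "(\<Sum>x\<in>(cube n :: 'd site set). ?G be - et) <= (\<Sum>x\<in>cube n. site_energy rh be ?U x)"
	proof (rule sum_mono)
	  fix x :: "'d site" assume x: "x : cube n"
	  have "(+) x ` U0 <= ?U" by (rule order_trans[OF image_mono[OF k0] translate_cube[OF x, of k]])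
	  then have "site_energy rh be ((+) x ` U0) (x + 0) <= site_energy rh be ?U (x + 0)"
		by (rule site_energy_mono[OF fin _ b order_refl])
	  then show "?G be - et <= site_energy rh be ?U x" using L0 site_energy_translate[OF L0(1) b, of x 0] by simp
	qed
	also have "... <= (\<Sum>x\<in>?U. site_energy rh be ?U x)"
	  using cube_mono[of n "n + k"] free_edge_nonneg[OF rho_good fin b]
	  by (intro sum_mono2) (auto simp: site_energy_def intro!: sum_nonneg)
	also have "... = 2 * (\<Sum>e\<in>IE ?U. free_edge rh be ?U e)"
	  unfolding site_energy_def by (rule sum_edges_at[OF fin])
	finally have 2: "?c n * (?G be - et) <= 2 * (\<Sum>e\<in>IE ?U. free_edge rh be ?U e)" by simp
	show ?thesis unfolding energy_gap_def sum_subtractf using 1 2 by (simp add: field_simps)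
  qed
  have normalise: "A * y - B * x + l * z = (A - B * (x / y) + l * (z / y)) * y" if "0 < y" for A B l x y z :: real
	using that by (simp add: field_simps)
  have c1: "(%n. ?c n / ?c (n + k)) ~~> 1" using cube_ratio[of 0 k] by simp
  have "(%n. (?G be + et) / 2 - (?G be - et) / 2 * (?c n / ?c (n + k)) + L * (?B (n + k) / ?c (n + k)))
	~~> (?G be + et) / 2 - (?G be - et) / 2 * 1 + L * 0"
	by (intro tendsto_intros c1 boundary_ratio)
  moreover have "(?G be + et) / 2 - (?G be - et) / 2 * 1 + L * 0 < \<delta>"
	using \<delta> by (simp add: et_def field_simps)
  ultimately have "EVS n. (?G be + et) / 2 - (?G be - et) / 2 * (?c n / ?c (n + k)) + L * (?B (n + k) / ?c (n + k)) < \<delta>"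
	by (rule order_tendstoD(2))
  then have "EVS n. (\<Sum>e\<in>IE (cube (n + k) :: 'd site set). energy_gap rh ka be (cube (n + k)) e)
	<= \<delta> * ?c (n + k)"
  proof eventually_elim
	case (elim n)
	have "(?G be + et) / 2 * ?c (n + k) - (?G be - et) / 2 * ?c n + L * ?B (n + k)
	  = ((?G be + et) / 2 - (?G be - et) / 2 * (?c n / ?c (n + k)) + L * (?B (n + k) / ?c (n + k))) * ?c (n + k)"
	  by (rule normalise[OF cp])
	also have "... <= \<delta> * ?c (n + k)" using elim by (intro mult_right_mono) auto
	finally show ?case using step[of n] by linarith
  qed
  then show ?thesis by (rule iffD1[OF eventually_sequentially_seg])
qed

text \<open>Among the translates of a small cube inside a large one, some translate has at most the average gap; shift it back to the origin.\<close>
lemma good_volume: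
  assumes b: "0 <= be" and k: "good_law ka"
	and cont: "!!et. 0 < et ==> \<exists>be'>be. energy TYPE('d) rh be' <= energy TYPE('d) rh be + et"
	and ep: "0 < ep"
  obtains U :: "'d site set" where "finite U" "cube m <= U"
	"(\<Sum>e\<in>IE (cube m). energy_gap rh ka be U e) <= ep"
proof -
  let ?c = "%n. real (card (cube n :: 'd site set))"
  have cp: "0 < ?c n" for n by (simp add: card_cube)
  define \<delta> where "\<delta> = ep / (4 * ?c m)"
  have \<delta>: "0 < \<delta>" using ep cp[of m] by (simp add: \<delta>_def)
  have "EVS n. (\<Sum>e\<in>IE (cube (n + m) :: 'd site set). energy_gap rh ka be (cube (n + m)) e) <= \<delta> * ?c (n + m)"
	using energy_gap_density[OF b k cont \<delta>] by (rule iffD2[OF eventually_sequentially_seg])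
  moreover have "(%n. ?c (n + m) / ?c n) ~~> 1" using cube_ratio[of m 0] by simp
  then have "EVS n. ?c (n + m) / ?c n < 2" by (rule order_tendstoD) simp
  ultimately have "EVS n. (\<Sum>e\<in>IE (cube (n + m) :: 'd site set). energy_gap rh ka be (cube (n + m)) e) <= \<delta> * ?c (n + m)
	  & ?c (n + m) / ?c n < 2" by (rule eventually_conj)
  then obtain n where n: "(\<Sum>e\<in>IE (cube (n + m) :: 'd site set). energy_gap rh ka be (cube (n + m)) e) <= \<delta> * ?c (n + m)"
	  "?c (n + m) / ?c n < 2" using eventually_happens'[OF sequentially_bot] by blast
  let ?U = "cube (n + m) :: 'd site set" and ?D = "energy_gap rh ka be (cube (n + m) :: 'd site set)"
  have fin: "finite ?U" by simp
  let ?d = "%x. \<Sum>e | e : IE ?U & x : e. ?D e"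
  have d0: "0 <= ?d x" for x using energy_gap_nonneg[OF k fin b] by (intro sum_nonneg) auto
  have sub: "(+) v ` cube m <= ?U" if "v : cube n" for v by (rule translate_cube[OF that])
  have "(\<Sum>v\<in>cube n. \<Sum>e\<in>IE ((+) v ` cube m). ?D e) <= (\<Sum>v\<in>cube n. \<Sum>x\<in>(+) v ` cube m. ?d x)"
	by (intro sum_mono sum_edges_at_le[OF fin sub energy_gap_nonneg[OF k fin b]])
  also have "... = (\<Sum>v\<in>cube n. \<Sum>x\<in>cube m. ?d (v + x))" by (simp add: sum.reindex)
  also have "... = (\<Sum>x\<in>cube m. \<Sum>v\<in>cube n. ?d (v + x))" by (rule sum.swap)
  also have "... <= (\<Sum>x\<in>(cube m :: 'd site set). \<Sum>y\<in>?U. ?d y)"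
  proof (rule sum_mono)
	fix x :: "'d site" assume x: "x : cube m"
	have "(\<Sum>v\<in>cube n. ?d (v + x)) = (\<Sum>y\<in>(%v. v + x) ` cube n. ?d y)" by (simp add: sum.reindex inj_on_def)
	also have "... <= (\<Sum>y\<in>?U. ?d y)" using cube_add[OF _ x] d0 by (intro sum_mono2) auto
	finally show "(\<Sum>v\<in>cube n. ?d (v + x)) <= (\<Sum>y\<in>?U. ?d y)" .
  qed
  also have "... = ?c m * (2 * (\<Sum>e\<in>IE ?U. ?D e))" unfolding sum_edges_at[OF fin] by simp
  also have "... <= ?c m * (2 * (\<delta> * ?c (n + m)))" using n(1) by (intro mult_left_mono) auto
  also have "... <= ?c m * (2 * (\<delta> * (2 * ?c n)))"
	using n(2) cp[of n] \<delta> by (intro mult_left_mono) (auto simp: field_simps)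
  also have "... = ep * ?c n" using cp[of m] by (simp add: \<delta>_def card_gt_0_iff)
  finally have tot: "(\<Sum>v\<in>cube n. \<Sum>e\<in>IE ((+) v ` cube m). ?D e) <= (\<Sum>v\<in>(cube n::'d site set). ep)" by (simp add: mult.commute)
  have "\<exists>v\<in>cube n. (\<Sum>e\<in>IE ((+) v ` cube m). ?D e) <= ep"
  proof (rule ccontr)
	assume "~ ?thesis"
	then have lt: "ep < (\<Sum>e\<in>IE ((+) v ` cube m). ?D e)" if "v : cube n" for v using that by force
	have "cube n ~= ({} :: 'd site set)" using cp[of n] by auto
	then have "(\<Sum>v\<in>(cube n::'d site set). ep) < (\<Sum>v\<in>cube n. \<Sum>e\<in>IE ((+) v ` cube m). ?D e)"
	  by (intro sum_strict_mono lt) auto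
	then show False using tot by simp
  qed
  then obtain v :: "'d site" where v: "v : cube n" "(\<Sum>e\<in>IE ((+) v ` cube m). ?D e) <= ep" by blast
  let ?U' = "(+) (- v) ` ?U"
  have L: "(+) v ` ?U' = ?U" by (simp add: image_image)
  have fin': "finite ?U'" by simp
  have gap: "energy_gap rh ka be ?U' e = ?D ((+) v ` e)" for e
	using free_edge_translate[OF rho_good fin' b, of v e] wired_edge_translate[OF rho_good k fin' b, of v e]
	unfolding L energy_gap_def by simp
  have i: "inj_on ((`) ((+) v)) S" for S :: "'d site set set" by (auto simp: inj_on_def inj_image_eq_iff)
  show ?thesis
  proof (rule that[OF fin'])
	show "cube m <= ?U'"
	proof
	  fix x :: "'d site" assume "x : cube m"
	  then have "v + x : ?U" using sub[OF v(1)] by blast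
	  then show "x : ?U'" by (intro image_eqI[of _ _ "v + x"]) auto
	qed
	show "(\<Sum>e\<in>IE (cube m). energy_gap rh ka be ?U' e) <= ep"
	  using v(2) unfolding gap inner_edges_translate by (simp add: sum.reindex[OF i])
  qed
qed

lemma good_volumes:
  assumes b: "0 <= be" and k: "good_law ka"
	and cont: "!!et. 0 < et ==> \<exists>be'>be. energy TYPE('d) rh be' <= energy TYPE('d) rh be + et"
  obtains V :: "nat => 'd site set" where "filterlim V (finite_subsets_at_top UNIV) sequentially"
	"!!e. e : IE UNIV ==> (%n. energy_gap rh ka be (V n) e) ~~> 0"
proof -
  have "\<exists>U::'d site set. finite U & cube m <= U & (\<Sum>e\<in>IE (cube m). energy_gap rh ka be U e) <= 1 / real (Suc m)" for m
	by (rule good_volume[OF b k cont, of "1 / real (Suc m)" m]) auto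
  then obtain V :: "nat => 'd site set" where V: "!!m. finite (V m)" "!!m. cube m <= V m"
	"!!m. (\<Sum>e\<in>IE (cube m). energy_gap rh ka be (V m) e) <= 1 / real (Suc m)" by metis
  have ev: "\<forall>\<^sub>F m in sequentially. S <= cube m" if fS: "finite S" for S :: "'d site set"
  proof -
	obtain n where "S <= cube n" using finite_subset_cube[OF fS] by blast
	then show ?thesis using cube_mono by (intro eventually_sequentiallyI[of n]) blast
  qed
  show ?thesis
  proof (rule that)
	show "filterlim V (finite_subsets_at_top UNIV) sequentially"
	  unfolding filterlim_finite_subsets_at_top
	proof (intro allI impI)
	  fix X :: "'d site set" assume "finite X & X <= UNIV"
	  then have "\<forall>\<^sub>F m in sequentially. X <= cube m" using ev by simp
	  then show "\<forall>\<^sub>F m in sequentially. finite (V m) & X <= V m & V m <= UNIV"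
		by eventually_elim (use V in blast)
	qed
	show "(%n. energy_gap rh ka be (V n) e) ~~> 0" if e: "e : IE UNIV" for e
	proof (rule tendsto_sandwich[OF _ _ tendsto_const])
	  have "finite e" using e by (auto simp: inner_edges_def)
	  then have fe: "\<forall>\<^sub>F m in sequentially. e : IE (cube m)"
		using ev[of e] e by (auto elim!: eventually_mono simp: inner_edges_iff[of _ "cube _"])
	  then show "EVS n. 0 <= energy_gap rh ka be (V n) e"
		by eventually_elim (use V inner_edges_mono in \<open>blast intro: energy_gap_nonneg[OF k _ b]\<close>)
	  show "EVS n. energy_gap rh ka be (V n) e <= 1 / real (Suc n)"
		using fe
	  proof eventually_elim
		case (elim m)
		have "energy_gap rh ka be (V m) e <= (\<Sum>e\<in>IE (cube m). energy_gap rh ka be (V m) e)"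
		  using elim energy_gap_nonneg[OF k V(1) b] inner_edges_mono[OF V(2)] bonds_finite[OF bonds_inner[OF finite_cube]]
		  by (intro member_le_sum) auto
		then show ?case using V(3)[of m] by linarith
	  qed
	  show "(%n. 1 / real (Suc n)) ~~> 0" by real_asymp
	qed
  qed
qed

end

section \<open>Integrating out one neighbour\<close>

definition resample :: "real measure => 'v => (('v => real) => real) => ('v => real) => ennreal" where
  "resample m y f a = (\<integral>\<^sup>+u. ennreal (f (a(y := u))) \<partial>m)"

text \<open>The mean of \<open>a y\<close> times the correlation along the edge \<open>e\<close> when the field at \<open>y\<close> is resampled. Integrating \<open>y\<close> out matters, since \<open>a y\<close> may vanish with positive probability.\<close>
definition mean_field :: "real measure => 'v set => 'v set set => real => 'v => 'v set => ('v => real) => real" where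
  "mean_field m U E be y e a =
	 enn2real (resample m y (%a. a y * ising_sum U E (coupling (%_. be) a) (spins e)) a) /
	 enn2real (resample m y (part_fun U E (%_. be)) a)"

context site_laws begin

lemma update_measurable: "(%(u, a). a(y := u)) : measurable (mu y \<Otimes>\<^sub>M P) P"
proof -
  have "(%z. (snd z)(y := fst z)) : measurable (mu y \<Otimes>\<^sub>M P) P"
	by (rule measurable_fun_upd[where J = UNIV]) auto
  then show ?thesis by (simp add: case_prod_beta)
qed

lemma nn_integral_resample:
  assumes f: "f : bm P"
  shows "(\<integral>\<^sup>+a. f a \<partial>P) = (\<integral>\<^sup>+a. (\<integral>\<^sup>+u. f (a(y := u)) \<partial>mu y) \<partial>P)"
proof -
  interpret YP: pair_sigma_finite "mu y" P
	by (intro pair_sigma_finite.intro prob_space_imp_sigma_finite prob P.prob_space_axioms)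
  have d: "distr (mu y \<Otimes>\<^sub>M P) P (%(u, a). a(y := u)) = P"
	using distr_pair_PiM_eq_PiM[of UNIV mu y] prob by simp
  have "(\<integral>\<^sup>+a. f a \<partial>P) = (\<integral>\<^sup>+z. f ((snd z)(y := fst z)) \<partial>(mu y \<Otimes>\<^sub>M P))"
	by (subst d[symmetric], subst nn_integral_distr[OF update_measurable])
	  (auto simp: f case_prod_beta)
  also have "... = (\<integral>\<^sup>+a. (\<integral>\<^sup>+u. f (a(y := u)) \<partial>mu y) \<partial>P)"
	by (subst YP.nn_integral_snd[symmetric]) (use measurable_compose[OF update_measurable f] in \<open>auto simp: case_prod_beta\<close>)
  finally show ?thesis .
qed

lemma resample_measurable:
  assumes f: "f : bm P" shows "resample (mu y) y f : bm P"
proof -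
  have "(%(a, u). ennreal (f (a(y := u)))) : bm (P \<Otimes>\<^sub>M mu y)"
	using measurable_compose[OF measurable_compose[OF measurable_pair_swap' update_measurable] f]
	by (simp add: case_prod_beta)
  then show ?thesis unfolding resample_def 
	by (rule sigma_finite_measure.borel_measurable_nn_integral[OF prob_space_imp_sigma_finite[OF prob]])
qed

lemma update_measurable_site:
  assumes f: "f : bm P" and a: "\<forall>x. 0 <= a x"
  shows "(%u. f (a(y := u))) : bm (mu y)"
proof -
  have "(%u. (u, a)) : measurable (mu y) (mu y \<Otimes>\<^sub>M P)" using a by (intro measurable_Pair) (auto simp: space_P)
  from measurable_compose[OF measurable_compose[OF this update_measurable] f] show ?thesis by simp
qed

lemma resample_finite:
  assumes V: "finite V" "y : V" and f: "gaussian V f"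
  shows "\<exists>C\<ge>0. \<exists>c\<ge>0. \<forall>a. (\<forall>x. 0 <= a x) --> resample (mu y) y f a <= ennreal (C * exp (c * (\<Sum>x\<in>V. (a x)\<^sup>2)))"
proof -
  obtain C c where f: "0 <= C" "0 <= c" "!!a. \<forall>x. 0 <= a x ==> \<bar>f a\<bar> <= C * exp (c * (\<Sum>x\<in>V. (a x)\<^sup>2))"
	using f unfolding gaussian_def by blast
  define K where "K = enn2real (\<integral>\<^sup>+u. ennreal (exp (c * u\<^sup>2)) \<partial>mu y)"
  have K: "(\<integral>\<^sup>+u. ennreal (exp (c * u\<^sup>2)) \<partial>mu y) = ennreal K" "0 <= K" using gauss[where x = y and c = c] by (auto simp: K_def)
  have "resample (mu y) y f a <= ennreal ((C * K) * exp (c * (\<Sum>x\<in>V. (a x)\<^sup>2)))" if a: "\<forall>x. 0 <= a x" for a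
  proof -
	have "resample (mu y) y f a <= (\<integral>\<^sup>+u. ennreal (C * exp (c * (\<Sum>x\<in>V. (a x)\<^sup>2))) * ennreal (exp (c * u\<^sup>2)) \<partial>mu y)"
	  unfolding resample_def
	proof (rule nn_integral_mono)
	  fix u assume "u : space (mu y)"
	  then have u: "\<forall>x. 0 <= (a(y := u)) x" using a by simp
	  have "(\<Sum>x\<in>V. ((a(y := u)) x)\<^sup>2) = u\<^sup>2 + (\<Sum>x\<in>V - {y}. (a x)\<^sup>2)"
		using V by (simp add: sum.remove)
	  also have "... <= u\<^sup>2 + (\<Sum>x\<in>V. (a x)\<^sup>2)" using V by (intro add_left_mono sum_mono2) auto
	  finally have e: "exp (c * (\<Sum>x\<in>V. ((a(y := u)) x)\<^sup>2)) <= exp (c * (\<Sum>x\<in>V. (a x)\<^sup>2)) * exp (c * u\<^sup>2)"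
		using f(2) by (simp add: exp_add[symmetric] distrib_left[symmetric] mult_left_mono add.commute)
	  have "f (a(y := u)) <= C * exp (c * (\<Sum>x\<in>V. ((a(y := u)) x)\<^sup>2))" by (rule abs_le_D1[OF f(3)[OF u]])
	  also have "... <= C * (exp (c * (\<Sum>x\<in>V. (a x)\<^sup>2)) * exp (c * u\<^sup>2))" by (rule mult_left_mono[OF e f(1)])
	  finally have "f (a(y := u)) <= (C * exp (c * (\<Sum>x\<in>V. (a x)\<^sup>2))) * exp (c * u\<^sup>2)" by (simp only: mult.assoc)
	  then show "ennreal (f (a(y := u))) <= ennreal (C * exp (c * (\<Sum>x\<in>V. (a x)\<^sup>2))) * ennreal (exp (c * u\<^sup>2))"
		using f(1) by (subst ennreal_mult[symmetric]) (auto intro: ennreal_leI)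
	qed
	also have "... = ennreal (C * exp (c * (\<Sum>x\<in>V. (a x)\<^sup>2))) * ennreal K"
	  using gauss_measurable[of c] measurable_cong_sets[OF sets_site[of y] refl, of borel]
	  by (subst nn_integral_cmult) (auto simp: K)
	also have "... = ennreal ((C * K) * exp (c * (\<Sum>x\<in>V. (a x)\<^sup>2)))"
	  using f(1) K(2) by (simp add: ennreal_mult[symmetric] mult_ac)
	finally show ?thesis .
  qed
  then show ?thesis using f K by (intro exI[of _ "C * K"] exI[of _ c] conjI) auto
qed

lemma resample_less_top:
  assumes "finite V" "y : V" "gaussian V f" "\<forall>x. 0 <= a x" shows "resample (mu y) y f a < \<infinity>"
proof -
  obtain C c where "\<forall>a. (\<forall>x. 0 <= a x) --> resample (mu y) y f a <= ennreal (C * exp (c * (\<Sum>x\<in>V. (a x)\<^sup>2)))"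
	using resample_finite[OF assms(1-3)] by blast
  then have "resample (mu y) y f a <= ennreal (C * exp (c * (\<Sum>x\<in>V. (a x)\<^sup>2)))" using assms(4) by blast
  then show ?thesis by (rule order_le_less_trans) simp
qed

context
  fixes U V :: "'v set" and E :: "'v set set" and be :: real and x y :: 'v and ph :: "('v => real) => real"
  assumes fin: "finite U" and E: "bonds V E" and b: "0 <= be" and xy: "x ~= y" "y : V" "x : V"
	and w: "weight V (%a. ph a * part_fun U E (%_. be) a)" and phi: "weight V ph" "!!a u. ph (a(y := u)) = ph a"
begin

lemma finV: "finite V" using E by (simp add: bonds_def)

abbreviation "Z \<equiv> part_fun U E (%_. be)"
abbreviation "N \<equiv> (%a. a y * ising_sum U E (coupling (%_. be) a) (spins {x, y}))"

lemma Z_measurable: "Z : bm P" and N_measurable: "N : bm P"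
  unfolding measurable_P by measurable

lemma N_nonneg_le: assumes a: "\<forall>x. 0 <= a x" shows "0 <= N a" "N a <= a y * Z a"
proof -
  have c: "ising_sum U E (coupling (%_. be) a) (spins {x, y}) = corr U E (%_. be) a {x, y} * Z a"
	using ising_Z_pos[OF fin, of E "coupling (%_. be) a"] by (simp add: ising_corr_def)
  have "0 <= corr U E (%_. be) a {x, y}" by (rule corr_nonneg[OF fin E]) (use a b in auto)
  moreover have "0 <= Z a" using ising_Z_pos[OF fin, of E "coupling (%_. be) a"] by simp
  ultimately show "0 <= N a" "N a <= a y * Z a" unfolding c
	using a ising_corr_le_1[OF fin, of E "coupling (%_. be) a" "{x, y}"]
	by (auto intro!: mult_left_mono mult_left_le_one_le mult_nonneg_nonneg)
qed

lemma gauss_N: "gaussian V (%a. a y * Z a)" "gaussian V Z" "gaussian V N"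
proof -
  show Z: "gaussian V Z" by (rule gaussian_part_fun[OF E fin]) (use b in auto)
  show Y: "gaussian V (%a. a y * Z a)" by (intro gaussian_mult gaussian_component finV xy Z)
  show "gaussian V N" 
  proof (rule gaussian_le[OF Y])
	fix a :: "'v => real" assume "\<forall>x. 0 <= a x"
	from N_nonneg_le[OF this] show "\<bar>N a\<bar> <= \<bar>a y * Z a\<bar>" by linarith
  qed
qed

lemma resample_Z: assumes a: "\<forall>x. 0 <= a x" shows "1 <= resample (mu y) y Z a" "resample (mu y) y Z a < \<infinity>"
proof -
  have "(1::ennreal) = (\<integral>\<^sup>+u. 1 \<partial>mu y)" by (simp add: prob_space.emeasure_space_1[OF prob] del: space_site)
  also have "... <= resample (mu y) y Z a" unfolding resample_def
	using part_fun_ge_1[OF fin E, of "%_. be"] a b by (intro nn_integral_mono) auto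
  finally show "1 <= resample (mu y) y Z a" .
  show "resample (mu y) y Z a < \<infinity>" by (rule resample_less_top[OF finV xy(2) gauss_N(2) a])
qed

lemma resample_N: assumes a: "\<forall>x. 0 <= a x" shows "resample (mu y) y N a < \<infinity>"
  by (rule resample_less_top[OF finV xy(2) gauss_N(3) a])

lemma mean_field_measurable: "mean_field (mu y) U E be y {x, y} : bm P"
  unfolding mean_field_def
  using resample_measurable[OF N_measurable, of y] resample_measurable[OF Z_measurable, of y]
  by (intro borel_measurable_divide) simp_all

lemma mean_field_nonneg: "0 <= mean_field (mu y) U E be y {x, y} a"
  unfolding mean_field_def by (intro divide_nonneg_nonneg) auto

lemma mean_field_gauss: "gaussian V (mean_field (mu y) U E be y {x, y})"
proof -
  obtain C c where C: "0 <= C" "0 <= c" "!!a. \<forall>x. 0 <= a x ==> resample (mu y) y N a <= ennreal (C * exp (c * (\<Sum>x\<in>V. (a x)\<^sup>2)))"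
	using resample_finite[OF finV xy(2) gauss_N(3)] by blast
  show ?thesis
  proof (rule gaussianI[OF C(1,2)])
	fix a :: "'v => real" assume a: "\<forall>x. 0 <= a x"
	have "enn2real (resample (mu y) y N a) <= C * exp (c * (\<Sum>x\<in>V. (a x)\<^sup>2))"
	  using C(3)[OF a] C(1) by (intro enn2real_leI) auto
	moreover have "1 <= enn2real (resample (mu y) y Z a)"
	  using resample_Z[OF a] enn2real_mono[of 1 "resample (mu y) y Z a"] by auto
	then have "mean_field (mu y) U E be y {x, y} a <= enn2real (resample (mu y) y N a)"
	  unfolding mean_field_def
	  using divide_left_mono[of 1 "enn2real (resample (mu y) y Z a)" "enn2real (resample (mu y) y N a)"] by simp
	ultimately show "\<bar>mean_field (mu y) U E be y {x, y} a\<bar> <= C * exp (c * (\<Sum>x\<in>V. (a x)\<^sup>2))"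
	  using mean_field_nonneg[of a] by linarith
  qed
qed

lemma mean_field_depends: "depends_on V (mean_field (mu y) U E be y {x, y})"
proof (rule depends_onI)
  fix a a' :: "'v => real" assume eq: "!!x. x : V ==> a x = a' x"
  have "coupling (%_. be) (a(y := u)) e = coupling (%_. be) (a'(y := u)) e" if "e : E" for u e
	unfolding coupling_def using bonds_D[OF E that] eq by (intro arg_cong[of _ _ "(*) be"] prod.cong) auto
  then have "ising_sum U E (coupling (%_. be) (a(y := u))) f = ising_sum U E (coupling (%_. be) (a'(y := u))) f" for u f
	unfolding ising_sum_def by (auto intro!: sum.cong arg_cong[of _ _ exp])
  then show "mean_field (mu y) U E be y {x, y} a = mean_field (mu y) U E be y {x, y} a'"
	by (simp add: mean_field_def resample_def ising_Z_def)
qed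

lemma integral_edge_obs_mean_field:
  "(\<integral>a. edge_obs U E be {x, y} a \<partial>gibbs_law mu (%a. ph a * Z a)) =
   (\<integral>a. a x * mean_field (mu y) U E be y {x, y} a \<partial>gibbs_law mu (%a. ph a * Z a))"
proof -
  let ?X = "mean_field (mu y) U E be y {x, y}" and ?w = "%a. ph a * Z a"
  have phm: "ph : bm P" using phi by (simp add: weight_def)
  have sp: "space (gibbs_law mu ?w) = {a. \<forall>x. 0 <= a x}" by (rule space_gibbs)
  have eom: "edge_obs U E be {x, y} : bm P" unfolding measurable_P by measurable
  have xXm: "(%a. a x * ?X a) : bm P" by (intro borel_measurable_times component_measurable mean_field_measurable)
  have ph0: "0 <= ph a" if "\<forall>x. 0 <= a x" for a
  proof -
	have "1 <= ph a" using phi(1) that by (simp add: weight_def)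
	then show ?thesis by simp
  qed
  have Z0: "0 <= Z a" for a using ising_Z_pos[OF fin, of E "coupling (%_. be) a"] by simp
  have upd: "\<forall>z. 0 <= (a(y := u)) z" if "\<forall>x. 0 <= a x" "u : space (mu y)" for a u using that by simp
  have eq1: "edge_obs U E be {x, y} a * ?w a = (a x * ph a) * N a" for a
	using ising_Z_pos[OF fin, of E "coupling (%_. be) a"] xy(1) by (simp add: edge_obs_def ising_corr_def)
  have "(\<integral>\<^sup>+a. ennreal (edge_obs U E be {x, y} a) * ennreal (?w a) \<partial>P) = (\<integral>\<^sup>+a. ennreal (a x * ph a) * ennreal (N a) \<partial>P)"
  proof (rule nn_integral_cong)
	fix a assume "a : space P"
	then have a: "\<forall>x. 0 <= a x" by (simp add: space_P)
	have "ennreal (edge_obs U E be {x, y} a) * ennreal (?w a) = ennreal (edge_obs U E be {x, y} a * ?w a)"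
	  using edge_obs_nonneg[OF fin E b a, of "{x, y}"] ph0[OF a] Z0 by (intro ennreal_mult[symmetric]) auto
	also have "... = ennreal (a x * ph a) * ennreal (N a)"
	  unfolding eq1 using a ph0[OF a] N_nonneg_le[OF a] by (intro ennreal_mult) auto
	finally show "ennreal (edge_obs U E be {x, y} a) * ennreal (?w a) = ennreal (a x * ph a) * ennreal (N a)" .
  qed
  also have "... = (\<integral>\<^sup>+a. (\<integral>\<^sup>+u. ennreal (a x * ph a) * ennreal (N (a(y := u))) \<partial>mu y) \<partial>P)"
	by (subst nn_integral_resample[of _ y]) (use phm N_measurable xy phi in auto)
  also have "... = (\<integral>\<^sup>+a. ennreal (a x * ph a) * resample (mu y) y N a \<partial>P)"
	unfolding resample_def
	by (intro nn_integral_cong nn_integral_cmult measurable_compose[OF update_measurable_site[OF N_measurable] measurable_ennreal])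
	  (simp add: space_P)
  also have "... = (\<integral>\<^sup>+a. ennreal (a x * ph a * ?X a) * resample (mu y) y Z a \<partial>P)"
  proof (rule nn_integral_cong)
	fix a assume "a : space P"
	then have a: "\<forall>x. 0 <= a x" by (simp add: space_P)
	obtain n where n: "resample (mu y) y N a = ennreal n" "0 <= n" using resample_N[OF a] by (cases "resample (mu y) y N a") auto
	obtain z where z: "resample (mu y) y Z a = ennreal z" "0 <= z" using resample_Z[OF a] by (cases "resample (mu y) y Z a") auto
	have z1: "1 <= z" using resample_Z(1)[OF a] z by simp
	have "?X a = n / z" unfolding mean_field_def n(1) z(1) using n z by simp
	then show "ennreal (a x * ph a) * resample (mu y) y N a = ennreal (a x * ph a * ?X a) * resample (mu y) y Z a"
	  unfolding n(1) z(1) using a ph0[OF a] n z1 by (simp add: ennreal_mult[symmetric])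
  qed
  also have "... = (\<integral>\<^sup>+a. (\<integral>\<^sup>+u. ennreal (a x * ph a * ?X a) * ennreal (Z (a(y := u))) \<partial>mu y) \<partial>P)"
	unfolding resample_def
	by (intro nn_integral_cong nn_integral_cmult[symmetric] measurable_compose[OF update_measurable_site[OF Z_measurable] measurable_ennreal])
	  (simp add: space_P)
  also have "... = (\<integral>\<^sup>+a. ennreal (a x * ph a * ?X a) * ennreal (Z a) \<partial>P)"
  proof -
	have "?X (a(y := u)) = ?X a" for a u by (simp add: mean_field_def resample_def)
	then show ?thesis
	  by (subst nn_integral_resample[of "%a. ennreal (a x * ph a * ?X a) * ennreal (Z a)" y])
		(use phm Z_measurable mean_field_measurable xy phi in auto)
  qed
  also have "... = (\<integral>\<^sup>+a. ennreal (a x * ?X a) * ennreal (?w a) \<partial>P)"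
	by (intro nn_integral_cong) (use ph0 Z0 mean_field_nonneg in \<open>simp add: space_P ennreal_mult[symmetric] mult_ac\<close>)
  finally have "(\<integral>\<^sup>+a. ennreal (edge_obs U E be {x, y} a) \<partial>gibbs_law mu ?w) = (\<integral>\<^sup>+a. ennreal (a x * ?X a) \<partial>gibbs_law mu ?w)"
	using eom xXm by (simp add: gibbs_nn_integral[OF w])
  moreover have "edge_obs U E be {x, y} : bm (gibbs_law mu ?w)" "(%a. a x * ?X a) : bm (gibbs_law mu ?w)"
	using eom xXm by (simp_all add: measurable_gibbs measurable_P)
  ultimately show ?thesis
	using edge_obs_nonneg[OF fin E b, of _ "{x, y}"] mean_field_nonneg
	by (subst (1 2) integral_nonneg_nn) (auto simp: sp)
qed

end

end

section \<open>A lower bound for the mean field\<close>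

text \<open>Holley on the line.\<close>
lemma tilted_mean_mono:
  fixes h0 h1 w0 w1 :: "real => real"
  assumes [measurable]: "h0 : bm m" "h1 : bm m" "w0 : bm m" "w1 : bm m"
	and sp: "space m = {0..}"
	and nn: "!!u. 0 <= u ==> 0 <= h0 u & 0 <= w0 u & 0 <= w1 u"
	and h: "!!u v. 0 <= u ==> u <= v ==> h0 u <= h1 v"
	and w: "!!u v. 0 <= u ==> 0 <= v ==> w0 u * w1 v <= w1 (max u v) * w0 (min u v)"
  shows "(\<integral>\<^sup>+u. ennreal (h0 u * w0 u) \<partial>m) * (\<integral>\<^sup>+u. ennreal (w1 u) \<partial>m)
	<= (\<integral>\<^sup>+u. ennreal (h1 u * w1 u) \<partial>m) * (\<integral>\<^sup>+u. ennreal (w0 u) \<partial>m)"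
proof (rule four_functions_one)
  fix u v assume "u : space m" "v : space m"
  then have uv: "0 <= u" "0 <= v" by (auto simp: sp)
  have "(h0 u * w0 u) * w1 v = h0 u * (w0 u * w1 v)" by simp
  also have "... <= h1 (max u v) * (w1 (max u v) * w0 (min u v))"
  proof (rule mult_mono')
	show "h0 u <= h1 (max u v)" using h[of u "max u v"] uv by simp
	show "w0 u * w1 v <= w1 (max u v) * w0 (min u v)" by (rule w[OF uv])
	show "0 <= h0 u" "0 <= w0 u * w1 v" using nn uv by simp_all
  qed
  finally have "(h0 u * w0 u) * w1 v <= (h1 (max u v) * w1 (max u v)) * w0 (min u v)" by (simp only: mult.assoc)
  moreover have "0 <= h1 (max u v)" using nn[of u] h[of u "max u v"] uv by auto
  ultimately show "ennreal (h0 u * w0 u) * ennreal (w1 v) <= ennreal (h1 (max u v) * w1 (max u v)) * ennreal (w0 (min u v))"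
	using uv nn[of u] nn[of v] nn[of "max u v"] nn[of "min u v"]
	by (subst (1 2) ennreal_mult[symmetric]) (auto intro: ennreal_leI)
qed measurable

lemma ennreal_ratio_le:
  assumes "n0 * z1 <= n1 * z0" "n0 < \<infinity>" "n1 < \<infinity>" "1 <= z0" "z0 < \<infinity>" "1 <= z1" "z1 < (\<infinity>::ennreal)"
  shows "enn2real n0 / enn2real z0 <= enn2real n1 / enn2real z1"
proof -
  obtain a where a: "n0 = ennreal a" "0 <= a" using assms by (cases n0) auto
  obtain b where b: "n1 = ennreal b" "0 <= b" using assms by (cases n1) auto
  obtain c where c: "z0 = ennreal c" "0 <= c" using assms by (cases z0) auto
  obtain d where d: "z1 = ennreal d" "0 <= d" using assms by (cases z1) auto
  have "a * d <= b * c" using assms(1) a b c d by (simp add: ennreal_mult[symmetric])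
  moreover have "1 <= c" "1 <= d" using assms(4,6) c d by auto
  ultimately show ?thesis using a b c d by (simp add: divide_simps)
qed

lemma abs_law_basic:
  assumes "good_law rh"
  shows "prob_space (abs_law rh)" "space (abs_law rh) = {0..}" "sets (abs_law rh) = sets nnb"
proof -
  interpret A: site_laws "%_::unit. abs_law rh" by (rule site_laws_abs[OF assms])
  show "prob_space (abs_law rh)" "space (abs_law rh) = {0..}" "sets (abs_law rh) = sets nnb"
	using A.prob A.space_site A.sets_site by auto
qed

text \<open>A lower bound, uniform in the volume, for the mean field at a site whose neighbour has size at least \<open>s\<close>.\<close>
definition field_floor :: "real measure => real => real => real" where
  "field_floor rh be s = enn2real (\<integral>\<^sup>+u. ennreal (u * ((1 - exp (- 2 * be * s * u)) / 2)) \<partial>abs_law rh)"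

lemma abs_law_positive:
  assumes adm: "admissible rh" shows "emeasure (abs_law rh) {0<..} > 0"
proof -
  note r = good_law_admissible[OF adm]
  have s: "sets rh = sets borel" using adm by (simp add: admissible_def)
  have spr: "space rh = UNIV" using sets_eq_imp_space_eq[OF s] by simp
  have "\<forall>A\<in>sets borel. emeasure rh A = emeasure rh (uminus ` A)" using adm unfolding admissible_def by blast
  then have "emeasure rh {0<..} = emeasure rh (uminus ` {0<..})" by (rule bspec) simp
  also have "uminus ` {0<..} = {..<(0::real)}" by simp
  finally have sym: "emeasure rh {0<..} = emeasure rh {..<0}" .
  have "UNIV - {0} = {0<..} Un {..<(0::real)}" by auto
  then have le: "emeasure rh (UNIV - {0}) <= emeasure rh {0<..} + emeasure rh {..<0}"
	using emeasure_subadditive[of "{0<..}" rh "{..<0}"] s by simp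
  have pos: "0 < emeasure rh (UNIV - {0})" using adm unfolding admissible_def by blast
  have "emeasure rh {0<..} ~= 0"
  proof
	assume "emeasure rh {0<..} = 0"
	then have "emeasure rh (UNIV - {0}) <= 0" using le sym by simp
	then show False using pos by simp
  qed
  then have p: "0 < emeasure rh {0<..}" by (simp add: zero_less_iff_neq_zero)
  have im: "indicator {0<..} : bm nnb"
	by (intro borel_measurable_nonneg_part) auto
  have m0: "{0<..} : sets (abs_law rh)"
  proof -
	have "{0<..} = {0<..} Int {0::real..}" by auto
	also have "{0<..} Int {0::real..} : sets nnb" unfolding nonneg_part_def by (auto simp: sets_restrict_space)
	finally show ?thesis by (simp add: abs_law_basic[OF r])
  qed
  have i: "indicator {0<..} t * indicator {0..} t = (indicator {0<..} t :: ennreal)" for t :: real by (auto simp: indicator_def)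
  have "emeasure rh {0<..} = (\<integral>\<^sup>+t. indicator {0<..} t * indicator {0..} t \<partial>rh)"
	unfolding i using s by (simp add: nn_integral_indicator)
  also have "... <= (\<integral>\<^sup>+t. indicator {0<..} t * (if t = 0 then 1 else 2) \<partial>nonneg_part rh)"
	unfolding nn_integral_nonneg_part[OF s] by (intro nn_integral_mono) (auto simp: indicator_def)
  finally have "0 < (\<integral>\<^sup>+t. indicator {0<..} t * (if t = 0 then 1 else 2) \<partial>nonneg_part rh)" using p by simp
  then have "0 < (\<integral>\<^sup>+t. indicator {0<..} t \<partial>abs_law rh)"
	using abs_mass[OF r] nn_integral_abs_law[OF r im] by (auto simp: ennreal_zero_less_divide)
  then show ?thesis using m0 by simp
qed

lemma field_floor_pos:
  assumes adm: "admissible rh" and b: "0 < be" "0 < s" shows "0 < field_floor rh be s"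
proof -
  note r = good_law_admissible[OF adm]
  interpret A: site_laws "%_::unit. abs_law rh" by (rule site_laws_abs[OF r])
  let ?g = "%u. ennreal (u * ((1 - exp (- 2 * be * s * u)) / 2))"
  have gm: "?g : bm (abs_law rh)"
  proof -
	have "?g : bm nnb" by (intro borel_measurable_nonneg_part) auto
	then show ?thesis using measurable_cong_sets[OF abs_law_basic(3)[OF r] refl] by blast
  qed
  have n0: "(\<integral>\<^sup>+u. ?g u \<partial>abs_law rh) ~= 0"
  proof
	assume "(\<integral>\<^sup>+u. ?g u \<partial>abs_law rh) = 0"
	then have "AE u in abs_law rh. ?g u = 0" using nn_integral_0_iff_AE[OF gm] by simp
	then have "AE u in abs_law rh. u \<notin> {0<..}"
	proof (rule AE_mp, intro AE_I2 impI notI)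
	  fix u assume "?g u = 0" "u : {0<..}"
	  then have u: "u * ((1 - exp (- 2 * be * s * u)) / 2) <= 0" "0 < u" by (auto simp: ennreal_eq_0_iff)
	  have "0 < 2 * be * s * u" using b u by simp
	  then have "exp (- 2 * be * s * u) < 1" by simp
	  then have "0 < u * ((1 - exp (- 2 * be * s * u)) / 2)" using u by (intro mult_pos_pos) auto
	  then show False using u by simp
	qed
	then have "emeasure (abs_law rh) {0<..} = 0"
	  by (subst (asm) AE_iff_measurable[of "{0<..}"])
		(use emeasure_notin_sets in \<open>auto simp: abs_law_basic[OF r] nonneg_part_def sets_restrict_space\<close>)
	then show False using abs_law_positive[OF adm] by simp
  qed
  have le: "(\<integral>\<^sup>+u. ?g u \<partial>abs_law rh) <= (\<integral>\<^sup>+u. ennreal (exp (1 * u\<^sup>2)) \<partial>abs_law rh)"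
  proof (intro nn_integral_mono ennreal_leI)
	fix u assume "u : space (abs_law rh)"
	then have u: "0 <= u" by simp
	have "u * ((1 - exp (- 2 * be * s * u)) / 2) <= u * (1 / 2)"
	  using u by (intro mult_left_mono divide_right_mono) auto
	also have "... <= 1 + u\<^sup>2" using sum_squares_bound[of u 1] u by simp
	also have "... <= exp (1 * u\<^sup>2)" using exp_ge_add_one_self[of "u\<^sup>2"] by simp
	finally show "u * ((1 - exp (- 2 * be * s * u)) / 2) <= exp (1 * u\<^sup>2)" .
  qed
  have lt: "(\<integral>\<^sup>+u. ennreal (exp (1 * u\<^sup>2)) \<partial>abs_law rh) < \<infinity>" by (rule A.gauss)
  show ?thesis unfolding field_floor_def enn2real_positive_iff zero_less_iff_neq_zero
	using n0 order_le_less_trans[OF le lt] by simp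
qed

context
  fixes rh :: "real measure" and be :: real and U :: "'d::finite site set" and x y :: "'d site"
  assumes r: "good_law rh" and fin: "finite U" and b: "0 <= be" and e: "{x, y} : IE U"
begin

lemma ends: "x : U" "y : U" "x ~= y"
  using bonds_D[OF bonds_inner[OF fin] e] by (auto simp: card_insert_if split: if_splits)

lemma slice_measurable:
  assumes "f : bm FA" "\<forall>z. 0 <= a z"
  shows "(%u. f (a(y := u))) : bm (abs_law rh)"
proof -
  interpret A: site_laws "%_::'d site. abs_law rh" by (rule site_laws_abs[OF r])
  show ?thesis using A.update_measurable_site[of f a y] assms by (simp add: A.measurable_P)
qed

lemma slice_bounds:
  fixes V :: "'d site set" and E :: "'d edge set"
  assumes E: "bonds V E" "U <= V" and a: "\<forall>z. 0 <= a z"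
  shows "1 <= resample (abs_law rh) y (part_fun U E (%_. be)) a" "resample (abs_law rh) y (part_fun U E (%_. be)) a < \<infinity>"
	"resample (abs_law rh) y (%a. a y * ising_sum U E (coupling (%_. be) a) (spins {x, y})) a < \<infinity>"
proof -
  interpret A: site_laws "%_::'d site. abs_law rh" by (rule site_laws_abs[OF r])
  have finV: "finite V" using E(1) by (simp add: bonds_def)
  have w1: "A.weight V (%_. 1)" using finV by (auto simp: A.weight_def depends_on_def intro!: gaussian_bounded[of _ 1])
  have w: "A.weight V (%a. 1 * part_fun U E (%_. be) a)" by (intro A.weight_mult w1 A.weight_part_fun E fin b)
  have v: "y : V" "x : V" using ends E by auto
  show "1 <= resample (abs_law rh) y (part_fun U E (%_. be)) a" "resample (abs_law rh) y (part_fun U E (%_. be)) a < \<infinity>"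
	using A.resample_Z[OF fin E(1) b ends(3) v w w1] a by auto
  show "resample (abs_law rh) y (%a. a y * ising_sum U E (coupling (%_. be) a) (spins {x, y})) a < \<infinity>"
	using A.resample_N[OF fin E(1) b ends(3) v w w1] a by auto
qed

lemma slice_N:
  "u * ising_sum U E (coupling (%_. be) a) (spins {x, y}) = (u * corr U E (%_. be) a {x, y}) * part_fun U E (%_. be) a"
  using ising_Z_pos[OF fin, of E "coupling (%_. be) a"] by (simp add: ising_corr_def)

lemma corr_measurable: "(%a. corr U E J a B) : bm FA"
  unfolding ising_corr_def by measurable

lemma mean_field_mono:
  assumes ab: "\<forall>z. 0 <= a z & a z <= a' z"
  shows "mean_field (abs_law rh) U (IE U) be y {x, y} a <= mean_field (abs_law rh) U (TE U) be y {x, y} a'"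
proof -
  note bi = bonds_inner[OF fin] and bt = bonds_touching[OF fin]
  have a: "\<forall>z. 0 <= a z" "\<forall>z. 0 <= a' z" using ab by (auto intro: order_trans)
  have sub: "U <= SC U" by (auto simp: site_closure_def)
  let ?Z0 = "part_fun U (IE U) (%_. be)" and ?Z1 = "part_fun U (TE U) (%_. be)"
  let ?h0 = "%u. u * corr U (IE U) (%_. be) (a(y := u)) {x, y}" and ?h1 = "%u. u * corr U (TE U) (%_. be) (a'(y := u)) {x, y}"
  have id: "(%u. u) : bm (abs_law rh)" using slice_measurable[of "%a. a y", OF _ a(1)] by simp
  have "(\<integral>\<^sup>+u. ennreal (?h0 u * ?Z0 (a(y := u))) \<partial>abs_law rh) * (\<integral>\<^sup>+u. ennreal (?Z1 (a'(y := u))) \<partial>abs_law rh)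
	<= (\<integral>\<^sup>+u. ennreal (?h1 u * ?Z1 (a'(y := u))) \<partial>abs_law rh) * (\<integral>\<^sup>+u. ennreal (?Z0 (a(y := u))) \<partial>abs_law rh)"
  proof (rule tilted_mean_mono)
	show "?h0 : bm (abs_law rh)" "?h1 : bm (abs_law rh)"
	  using slice_measurable[OF corr_measurable a(1)] slice_measurable[OF corr_measurable a(2)] id by auto
	show "(%u. ?Z0 (a(y := u))) : bm (abs_law rh)" "(%u. ?Z1 (a'(y := u))) : bm (abs_law rh)"
	  using slice_measurable[OF ising_Z_field_measurable a(1)] slice_measurable[OF ising_Z_field_measurable a(2)] by auto
	show "space (abs_law rh) = {0..}" by (rule abs_law_basic(2)[OF r])
	show "0 <= ?h0 u & 0 <= ?Z0 (a(y := u)) & 0 <= ?Z1 (a'(y := u))" if "0 <= u" for u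
	  using that a b less_imp_le[OF ising_Z_pos[OF fin]] by (auto intro!: mult_nonneg_nonneg corr_nonneg[OF fin bi])
	show "?h0 u <= ?h1 v" if "0 <= u" "u <= v" for u v
	  using that ab a b ends by (intro mult_mono corr_free_le_wired[OF fin b] corr_nonneg[OF fin bi]) auto
	show "?Z0 (a(y := u)) * ?Z1 (a'(y := v)) <= ?Z1 (a'(y := max u v)) * ?Z0 (a(y := min u v))" if "0 <= u" "0 <= v" for u v
	proof -
	  let ?J = "%e. if e : IE U then be else 0"
	  have mx: "(%z. max ((a(y := u)) z) ((a'(y := v)) z)) = a'(y := max u v)" "(%z. min ((a(y := u)) z) ((a'(y := v)) z)) = a(y := min u v)"
		using ab by (auto simp: fun_eq_iff max_def min_def)
	  have z: "?Z0 c = part_fun U (TE U) ?J c" for c by (rule fun_cong[OF part_fun_free_touching[OF fin], symmetric])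
	  have "part_fun U (TE U) ?J (a(y := u)) * ?Z1 (a'(y := v))
		<= ?Z1 (%z. max ((a(y := u)) z) ((a'(y := v)) z)) * part_fun U (TE U) ?J (%z. min ((a(y := u)) z) ((a'(y := v)) z))"
		by (rule part_fun_supermodular[OF fin bt]) (use that a b in auto)
	  then show ?thesis unfolding mx z .
	qed
  qed
  then have "resample (abs_law rh) y (%a. a y * ising_sum U (IE U) (coupling (%_. be) a) (spins {x, y})) a * resample (abs_law rh) y ?Z1 a'
	<= resample (abs_law rh) y (%a. a y * ising_sum U (TE U) (coupling (%_. be) a) (spins {x, y})) a' * resample (abs_law rh) y ?Z0 a"
	unfolding resample_def fun_upd_same slice_N .
  then show ?thesis unfolding mean_field_def
	by (rule ennreal_ratio_le) (use slice_bounds[OF bi order_refl a(1)] slice_bounds[OF bt sub a(2)] in auto)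
qed

lemma mean_field_lower:
  assumes a: "\<forall>z. 0 <= a z" and s: "0 <= s" "s <= a x"
  shows "field_floor rh be s <= mean_field (abs_law rh) U (IE U) be y {x, y} a"
proof -
  note bi = bonds_inner[OF fin]
  interpret Y: prob_space "abs_law rh" by (rule abs_law_basic(1)[OF r])
  let ?Z0 = "part_fun U (IE U) (%_. be)"
  let ?h = "%u. u * ((1 - exp (- 2 * be * s * u)) / 2)" and ?h1 = "%u. u * corr U (IE U) (%_. be) (a(y := u)) {x, y}"
  have id[measurable]: "(%u. u) : bm (abs_law rh)" using slice_measurable[of "%a. a y", OF _ a] by simp
  have h0: "0 <= ?h u" if "0 <= u" for u using that b s by (intro mult_nonneg_nonneg) auto
  have "(\<integral>\<^sup>+u. ennreal (?h u * 1) \<partial>abs_law rh) * (\<integral>\<^sup>+u. ennreal (?Z0 (a(y := u))) \<partial>abs_law rh)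
	<= (\<integral>\<^sup>+u. ennreal (?h1 u * ?Z0 (a(y := u))) \<partial>abs_law rh) * (\<integral>\<^sup>+u. ennreal 1 \<partial>abs_law rh)"
  proof (rule tilted_mean_mono)
	show "?h : bm (abs_law rh)" by measurable
	show "?h1 : bm (abs_law rh)" using slice_measurable[OF corr_measurable a] id by auto
	show "(%u. ?Z0 (a(y := u))) : bm (abs_law rh)" by (rule slice_measurable[OF ising_Z_field_measurable a])
	show "space (abs_law rh) = {0..}" by (rule abs_law_basic(2)[OF r])
	show "0 <= ?h u & 0 <= (1::real) & 0 <= ?Z0 (a(y := u))" if "0 <= u" for u
	  using h0[OF that] less_imp_le[OF ising_Z_pos[OF fin]] by auto
	show "1 * ?Z0 (a(y := v)) <= ?Z0 (a(y := max u v)) * 1" if "0 <= u" "0 <= v" for u v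
	  using part_fun_mono[OF fin bi, of "%_. be" "%_. be" "a(y := v)" "a(y := max u v)"] that a b by auto
	show "?h u <= ?h1 v" if uv: "0 <= u" "u <= v" for u v
	proof (rule mult_mono)
	  let ?c = "be * s * u"
	  have c: "0 <= ?c" using b s uv by simp
	  have K: "coupling (%_. be) (a(y := v)) {x, y} = be * (a x * v)" using ends by (simp add: coupling_def)
	  have "sinh ?c / exp ?c <= corr U (IE U) (%_. be) (a(y := v)) {x, y}"
	  proof (rule ising_corr_lower[OF fin bonds_finite[OF bi] _ e c])
		show "0 <= coupling (%_. be) (a(y := v)) e' & finite e'" if "e' : IE U" for e'
		  using bonds_D[OF bi that] a b uv by (auto simp: coupling_def intro!: mult_nonneg_nonneg prod_nonneg)
		show "?c <= coupling (%_. be) (a(y := v)) {x, y}"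
		  unfolding K using b s uv a by (simp add: mult.assoc mult_left_mono mult_mono)
	  qed
	  moreover have "sinh ?c / exp ?c = (1 - exp (- 2 * be * s * u)) / 2"
	  proof -
		have "exp (- ?c) / exp ?c = exp (- 2 * be * s * u)"
		  by (subst exp_diff[symmetric]) (simp add: algebra_simps)
		moreover have "sinh ?c / exp ?c = (1 - exp (- ?c) / exp ?c) / 2"
		  unfolding sinh_field_def diff_divide_distrib by simp
		ultimately show ?thesis by simp
	  qed
	  ultimately show "(1 - exp (- 2 * be * s * u)) / 2 <= corr U (IE U) (%_. be) (a(y := v)) {x, y}" by simp
	qed (use uv b s in auto)
  qed measurable
  then have le: "(\<integral>\<^sup>+u. ennreal (?h u) \<partial>abs_law rh) * resample (abs_law rh) y ?Z0 a
	<= resample (abs_law rh) y (%a. a y * ising_sum U (IE U) (coupling (%_. be) a) (spins {x, y})) a * 1"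
	unfolding resample_def fun_upd_same slice_N by (simp add: Y.emeasure_space_1)
  note sb = slice_bounds[OF bi order_refl a]
  have "(\<integral>\<^sup>+u. ennreal (?h u) \<partial>abs_law rh) <= (\<integral>\<^sup>+u. ennreal (?h u) \<partial>abs_law rh) * resample (abs_law rh) y ?Z0 a"
	using mult_left_mono[OF sb(1), of "\<integral>\<^sup>+u. ennreal (?h u) \<partial>abs_law rh"] by simp
  also have "... < \<infinity>" using le sb(3) by (simp add: order_le_less_trans)
  finally have hf: "(\<integral>\<^sup>+u. ennreal (?h u) \<partial>abs_law rh) < \<infinity>" .
  have "enn2real (\<integral>\<^sup>+u. ennreal (?h u) \<partial>abs_law rh) / enn2real 1 <=
	enn2real (resample (abs_law rh) y (%a. a y * ising_sum U (IE U) (coupling (%_. be) a) (spins {x, y})) a) / enn2real (resample (abs_law rh) y ?Z0 a)"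
	by (rule ennreal_ratio_le[OF le]) (use hf sb in auto)
  then show ?thesis by (simp add: mean_field_def field_floor_def)
qed

end

section \<open>Pairs of observables\<close>

text \<open>Measurable, local and integrable for every law considered.\<close>
definition nice :: "'v set => (('v => real) => real) => bool" where
  "nice V f \<longleftrightarrow> f : bm FA & depends_on V f & gaussian V f"

lemma nice_const: "nice V (%_. c)"
  unfolding nice_def by (auto simp: depends_on_def intro!: gaussian_bounded[of _ "\<bar>c\<bar>"])

lemma nice_mult: "nice V f ==> nice V g ==> nice V (%a. f a * g a)"
  unfolding nice_def by (auto intro: gaussian_mult depends_on_combine[where h = "(*)"])

lemma nice_add: "nice V f ==> nice V g ==> nice V (%a. f a + g a)"
  unfolding nice_def by (auto intro: gaussian_add depends_on_combine[where h = "(+)"])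

lemma nice_cmult: "nice V f ==> nice V (%a. c * f a)"
  by (rule nice_mult[OF nice_const])

lemma nice_diff: "nice V f ==> nice V g ==> nice V (%a. f a - g a)"
  using nice_add[of V f "%a. (- 1) * g a"] nice_cmult[of V g "- 1"] by simp

lemma nice_sum: "(!!i. i : I ==> nice V (f i)) ==> nice V (%a. \<Sum>i\<in>I. f i a)"
  by (induction I rule: infinite_finite_induct) (auto intro: nice_add nice_const)

lemma nice_bounded:
  assumes "f : bm FA" "depends_on V f" "!!a. \<forall>x. 0 <= a x ==> \<bar>f a\<bar> <= C"
  shows "nice V f"
  unfolding nice_def by (intro conjI gaussian_bounded[of f C]) (fact assms)+

definition region :: "'d::finite site set => bool => 'd site set" where
  "region U w = (if w then SC U else U)"

definition edges_of :: "'d::finite site set => bool => 'd edge set" where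
  "edges_of U w = (if w then TE U else IE U)"

type_synonym 'd observable = "bool => ('d site => real) => real"

definition admits :: "'d::finite site set => 'd observable => bool" where
  "admits U f \<longleftrightarrow> finite U & (\<forall>w. nice (region U w) (f w))"

text \<open>Increasing and nonnegative, also when passing from the free to the wired component.\<close>
definition grows :: "'d::finite observable => bool" where
  "grows f \<longleftrightarrow> (\<forall>a a'. (\<forall>x. 0 <= a x & a x <= a' x) --> 0 <= f False a & f False a <= f True a')"

definition gap :: "real measure => real measure => real => 'd::finite site set => 'd observable => real" where
  "gap rh ka be U f = (\<integral>a. f True a \<partial>wired_law rh ka be U) - (\<integral>a. f False a \<partial>free_law rh be U)"

lemma region_bonds: "finite U ==> bonds (region U w) (edges_of U w)"
  by (simp add: region_def edges_of_def bonds_touching bonds_inner)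

lemma region_sup: "U <= region U w"
  by (auto simp: region_def site_closure_def)

lemma growsD: "grows f ==> \<forall>x. 0 <= a x & a x <= a' x ==> 0 <= f False a & f False a <= f True a'"
  unfolding grows_def by blast

lemma admits_const: "finite U ==> admits U (%_ _. c)"
  by (simp add: admits_def nice_const)

lemma admits_add: "admits U f ==> admits U g ==> admits U (%w a. f w a + g w a)"
  by (simp add: admits_def nice_add)

lemma admits_diff: "admits U f ==> admits U g ==> admits U (%w a. f w a - g w a)"
  by (simp add: admits_def nice_diff)

lemma admits_mult: "admits U f ==> admits U g ==> admits U (%w a. f w a * g w a)"
  by (simp add: admits_def nice_mult)

lemma admits_cmult: "admits U f ==> admits U (%w a. c * f w a)"
  by (simp add: admits_def nice_cmult)

lemma admits_local:
  assumes "finite U" "De <= U" "f : bm FA" "depends_on De f" "!!a. \<forall>x. 0 <= a x ==> \<bar>f a\<bar> <= C"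
  shows "admits U (%_. f)"
  unfolding admits_def
  by (intro conjI allI nice_bounded[where C = C] assms depends_on_mono[OF assms(4)] subset_trans[OF assms(2) region_sup]) auto

context
  fixes rh ka :: "real measure" and be :: real
  assumes r: "good_law rh" "good_law ka" and b: "0 <= be"
begin

lemma law_facts:
  assumes fin: "finite (U :: 'd::finite site set)"
  shows "space (free_law rh be U) = {a. \<forall>x. 0 <= a x}" "space (wired_law rh ka be U) = {a. \<forall>x. 0 <= a x}"
	"prob_space (free_law rh be U)" "prob_space (wired_law rh ka be U)"
	"nice U f ==> integrable (free_law rh be U) f" "nice (SC U) g ==> integrable (wired_law rh ka be U) g"
proof -
  interpret A: site_laws "%_::'d site. abs_law rh" by (rule site_laws_abs[OF r(1)])
  interpret B: site_laws "site_law rh ka U" by (rule site_laws_site_law[OF r])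
  note wA = weight_free[OF A.site_laws_axioms fin b] and wB = weight_plus[OF B.site_laws_axioms fin b bdry_weight_factor[OF fin]]
  show "space (free_law rh be U) = {a. \<forall>x. 0 <= a x}" unfolding free_law_def by (rule A.space_gibbs)
  show "space (wired_law rh ka be U) = {a. \<forall>x. 0 <= a x}" unfolding plus_law_def by (rule B.space_gibbs)
  show "prob_space (free_law rh be U)" unfolding free_law_def by (rule A.prob_space_gibbs[OF wA])
  show "prob_space (wired_law rh ka be U)" unfolding plus_law_def by (rule B.prob_space_gibbs[OF wB])
  show "integrable (free_law rh be U) f" if "nice U f"
	unfolding free_law_def by (rule A.gibbs_integrable[OF wA]) (use that in \<open>auto simp: nice_def A.measurable_P\<close>)
  show "integrable (wired_law rh ka be U) g" if "nice (SC U) g"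
	unfolding plus_law_def by (rule B.gibbs_integrable[OF wB]) (use that in \<open>auto simp: nice_def B.measurable_P\<close>)
qed

lemma admits_integrable:
  assumes "admits U f" shows "integrable (free_law rh be U) (f False)" "integrable (wired_law rh ka be U) (f True)"
proof -
  have "nice U (f False)" "nice (SC U) (f True)" "finite U"
	using assms unfolding admits_def region_def by (auto split: if_splits)
  then show "integrable (free_law rh be U) (f False)" "integrable (wired_law rh ka be U) (f True)"
	using law_facts(5,6) by blast+
qed

lemma gap_add: "admits U f ==> admits U g ==> gap rh ka be U (%w a. f w a + g w a) = gap rh ka be U f + gap rh ka be U g"
  unfolding gap_def by (simp add: admits_integrable)

lemma gap_diff: "admits U f ==> admits U g ==> gap rh ka be U (%w a. f w a - g w a) = gap rh ka be U f - gap rh ka be U g"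
  unfolding gap_def by (simp add: admits_integrable)

lemma gap_cmult: "gap rh ka be U (%w a. c * f w a) = c * gap rh ka be U f"
  unfolding gap_def by (simp add: right_diff_distrib)

lemma gap_const:
  assumes "finite U" shows "gap rh ka be U (%_ _. c) = 0"
  unfolding gap_def using prob_space.prob_space[OF law_facts(3)[OF assms]] prob_space.prob_space[OF law_facts(4)[OF assms]] by simp

lemma gap_nonneg:
  assumes f: "admits U f" "grows f" shows "0 <= gap rh ka be U f"
proof -
  have n: "nice U (f False)" "nice (SC U) (f True)" "finite U"
	using f(1) unfolding admits_def region_def by (auto split: if_splits)
  have "(\<integral>a. f False a \<partial>free_law rh be U) <= (\<integral>a. f True a \<partial>wired_law rh ka be U)"
  proof (rule free_le_plus[OF r n(3) b bdry_weight_factor[OF n(3)]])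
	show "0 <= f False a" if "\<forall>x. 0 <= a x" for a using growsD[OF f(2), of a a] that by auto
	show "f False a <= f True a'" if "\<forall>x. 0 <= a x & a x <= a' x" for a a' using growsD[OF f(2) that] by auto
  qed (use n in \<open>auto simp: nice_def\<close>)
  then show ?thesis by (simp add: gap_def)
qed

text \<open>The edge energy is the mean of \<open>a x\<close> times the mean field, which is increasing and at least \<open>field_floor\<close> where \<open>a x \<ge> s\<close>; hence subtracting a multiple of the excess leaves an increasing function.\<close>
lemma gap_excess:
  fixes U :: "'d::finite site set"
  assumes fin: "finite U" and e: "{x, y} : IE U" and s: "0 <= s"
  shows "admits U (%_ a. max (a x - s) 0)"
	"gap rh ka be U (%_ a. max (a x - s) 0) * field_floor rh be s <= energy_gap rh ka be U {x, y}"
proof -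
  interpret A: site_laws "%_::'d site. abs_law rh" by (rule site_laws_abs[OF r(1)])
  interpret B: site_laws "site_law rh ka U" by (rule site_laws_site_law[OF r])
  note xy = ends[OF r(1) fin b e] and bi = bonds_inner[OF fin] and bt = bonds_touching[OF fin]
  have xy': "x : SC U" "y : SC U" using xy by (auto simp: site_closure_def)
  have finV: "finite (region U w)" for w using fin by (simp add: region_def finite_site_closure)
  have comp: "nice (region U w) (%a. a x)" for w
	unfolding nice_def using xy(1) region_sup[of U w] finV
	by (intro conjI component_field_measurable gaussian_component) (auto simp: depends_on_def)
  define h :: "'d observable" where "h = (%_ a. max (a x - s) 0)"
  show adm_h: "admits U (%_ a. max (a x - s) 0)"
	unfolding admits_def nice_def
  proof (intro conjI allI fin)
	fix w
	show "(%a. max (a x - s) 0) : bm FA" by measurable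
	show "depends_on (region U w) (%a. max (a x - s) 0)" using xy(1) region_sup[of U w] by (auto simp: depends_on_def)
	show "gaussian (region U w) (%a. max (a x - s) 0)"
	proof (rule gaussian_le[of _ "%a. a x"])
	  show "gaussian (region U w) (%a. a x)" using comp[of w] by (simp add: nice_def)
	  fix a :: "'d site => real" assume "\<forall>x. 0 <= a x"
	  then have "0 <= a x" by simp
	  then show "\<bar>max (a x - s) 0\<bar> <= \<bar>a x\<bar>" using s by auto
	qed
  qed
  then have ah: "admits U h" by (simp add: h_def)
  define X where "X w = mean_field (abs_law rh) U (edges_of U w) be y {x, y}" for w
  define f :: "'d observable" where "f = (%w a. a x * X w a)"
  let ?m = "field_floor rh be s"
  have sy: "site_law rh ka U y = abs_law rh" using xy by (simp add: site_law_def)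
  have one: "A.weight U (%_. 1)" using fin by (auto simp: A.weight_def depends_on_def intro!: gaussian_bounded[of _ 1])
  have wA: "A.weight U (%a. 1 * part_fun U (IE U) (%_. be) a)" by (intro A.weight_mult one A.weight_part_fun bi fin b)
  have wB: "B.weight (SC U) (%a. bdry_factor U a * part_fun U (TE U) (%_. be) a)"
	by (rule weight_plus[OF B.site_laws_axioms fin b bdry_weight_factor[OF fin]])
  have pB: "B.weight (SC U) (bdry_factor U)" by (rule weight_bdry[OF B.site_laws_axioms fin bdry_weight_factor[OF fin]])
  have yb: "bdry_factor U (a(y := u)) = bdry_factor U a" for a u
  proof -
	have "y \<notin> EB U" using xy by (auto simp: ext_boundary_def)
	then have "(\<exists>z\<in>EB U. (a(y := u)) z ~= 0) \<longleftrightarrow> (\<exists>z\<in>EB U. a z ~= 0)" by (metis fun_upd_other)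
	then show ?thesis unfolding bdry_factor_def by simp
  qed
  note mA = A.mean_field_measurable[OF fin bi b xy(3,2,1) wA one] A.mean_field_depends[OF fin bi b xy(3,2,1) wA one]
	  A.mean_field_gauss[OF fin bi b xy(3,2,1) wA one] A.integral_edge_obs_mean_field[OF fin bi b xy(3,2,1) wA one]
  note mB = B.mean_field_measurable[OF fin bt b xy(3) xy'(2,1) wB pB yb] B.mean_field_depends[OF fin bt b xy(3) xy'(2,1) wB pB yb]
	  B.mean_field_gauss[OF fin bt b xy(3) xy'(2,1) wB pB yb] B.integral_edge_obs_mean_field[OF fin bt b xy(3) xy'(2,1) wB pB yb]
  have nX: "nice (region U w) (X w)" for w
	using mA(1-3) mB(1-3)[unfolded sy]
	by (cases w) (auto simp: nice_def X_def region_def edges_of_def A.measurable_P B.measurable_P)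
  have af: "admits U f" unfolding admits_def f_def using nX comp fin by (auto intro: nice_mult)
  have X0: "0 <= X w a" for w a unfolding X_def mean_field_def by (intro divide_nonneg_nonneg) auto
  have Xm: "X False a <= X True a'" if "\<forall>x. 0 <= a x & a x <= a' x" for a a'
	using mean_field_mono[OF r(1) fin b e that] by (simp add: X_def edges_of_def)
  have Xl: "?m <= X False a" if "\<forall>x. 0 <= a x" "s <= a x" for a
	using mean_field_lower[OF r(1) fin b e that(1) s that(2)] by (simp add: X_def edges_of_def)
  have m0: "0 <= ?m" by (simp add: field_floor_def)
  have "grows (%w a. f w a - ?m * h w a)"
	unfolding grows_def
  proof (intro allI impI conjI)
	fix a a' :: "'d site => real" assume ab: "\<forall>x. 0 <= a x & a x <= a' x"
	then have a: "\<forall>x. 0 <= a x" "\<forall>x. 0 <= a' x" "0 <= a x" "a x <= a' x" by (auto intro: order_trans)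
	show "0 <= f False a - ?m * h False a"
	proof (cases "s <= a x")
	  case True
	  have "?m * (a x - s) <= X False a * a x" using Xl[OF a(1) True] a s True m0 by (intro mult_mono) auto
	  then show ?thesis using True by (simp add: f_def h_def mult.commute)
	next
	  case False
	  then show ?thesis using a X0[of False a] by (simp add: f_def h_def)
	qed
	have X01: "a x * X False a <= a x * X True a'" by (intro mult_left_mono Xm ab a)
	show "f False a - ?m * h False a <= f True a' - ?m * h True a'"
	proof (cases "s <= a' x")
	  case True
	  have Xl': "?m <= X True a'"
		using Xl[OF a(2) True] Xm[of a' a'] a(2) by (auto intro: order_trans)
	  have "max (a' x - s) 0 - max (a x - s) 0 <= a' x - a x" using a by auto
	  then have "?m * (max (a' x - s) 0 - max (a x - s) 0) <= X True a' * (a' x - a x)"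
		using Xl' a m0 True s by (intro mult_mono) auto
	  then show ?thesis using X01 unfolding f_def h_def by (simp add: algebra_simps)
	next
	  case False
	  have "a x * X True a' <= a' x * X True a'" by (intro mult_right_mono a X0)
	  then show ?thesis using X01 False a unfolding f_def h_def by simp
	qed
  qed
  then have "0 <= gap rh ka be U (%w a. f w a - ?m * h w a)"
	by (intro gap_nonneg admits_diff af admits_cmult ah)
  also have "... = gap rh ka be U f - ?m * gap rh ka be U h"
	by (simp add: gap_diff[OF af admits_cmult[OF ah]] gap_cmult)
  also have "gap rh ka be U f = energy_gap rh ka be U {x, y}"
	using mA(4) mB(4)[unfolded sy]
	by (simp add: gap_def energy_gap_def wired_edge_def free_edge_def f_def X_def edges_of_def free_law_def plus_law_def)
  finally show "gap rh ka be U (%_ a. max (a x - s) 0) * ?m <= energy_gap rh ka be U {x, y}"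
	by (simp add: h_def mult.commute)
qed

end

section \<open>A generator for the random cluster configurations\<close>

lemma exists_neighbour: "\<exists>y. adjacent x (y :: 'd::finite site)"
proof -
  obtain i :: 'd where True by simp
  have "(\<Sum>j\<in>UNIV. \<bar>x $ j - (\<chi> j. x $ j + (if j = i then 1 else 0)) $ j\<bar>) = (\<Sum>j\<in>UNIV. if j = i then 1 else 0)"
	by (intro sum.cong) auto
  also have "... = 1" by simp
  finally show ?thesis unfolding adjacent_def by blast
qed

lemma marginal_measurable:
  assumes "F <= I" "De <= J"
  shows "(%(om, a). (restrict om F, restrict a De)) : measurable (rc_algebra I J) (rc_algebra F De)"
  unfolding case_prod_beta
  by (intro measurable_Pair measurable_compose[OF measurable_fst measurable_restrict_subset]
	  measurable_compose[OF measurable_snd measurable_restrict_subset] assms)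

text \<open>Events that some edges are open and some field values are large: an intersection-stable generator.\<close>
definition corner :: "'d::finite edge set => 'd site set => 'd edge set => 'd site set => ('d site => real) => 'd rc_config set" where
  "corner I J F S t = {c : space (rc_algebra I J). (\<forall>e\<in>F. fst c e) & (\<forall>x\<in>S. t x <= snd c x)}"

lemma corner_Int:
  "corner I J F S t Int corner I J F' S' t' =
   corner I J (F Un F') (S Un S') (%x. if x : S Int S' then max (t x) (t' x) else if x : S then t x else t' x)"
  unfolding corner_def by (auto split: if_splits)

lemma measure_eqI_corners:
  assumes M: "prob_space M" "sets M = sets (rc_algebra I J)" and N: "prob_space N" "sets N = sets (rc_algebra I J)"
	and eq: "!!F S t. finite F ==> F <= I ==> finite S ==> S <= J ==> measure M (corner I J F S t) = measure N (corner I J F S t)"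
  shows "M = (N :: 'd::finite rc_config measure)"
proof -
  interpret M: prob_space M by fact
  interpret N: prob_space N by fact
  define \<Omega> where "\<Omega> = space (rc_algebra I J :: 'd rc_config measure)"
  define G where "G = {corner I J F S t | F S t. finite F & F <= I & finite S & S <= J}"
  have G: "corner I J F S t : G" if "finite F" "F <= I" "finite S" "S <= J" for F S t using that unfolding G_def by blast
  have Gsub: "G <= Pow \<Omega>" by (auto simp: G_def corner_def \<Omega>_def)
  have whole: "corner I J {} {} t = \<Omega>" for t by (simp add: corner_def \<Omega>_def)
  let ?S = "sigma \<Omega> G"
  have setsS: "sets ?S = sigma_sets \<Omega> G" and spS: "space ?S = \<Omega>" using Gsub by (simp_all add: space_measure_of)
  have fe: "(%c. fst c e) : measurable ?S (count_space (UNIV :: bool set))" if "e : I" for e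
  proof -
	have "{c : space ?S. fst c e} = corner I J {e} {} (%_. 0)" unfolding spS by (auto simp: corner_def \<Omega>_def)
	also have "... : sets ?S" unfolding setsS using G[of "{e}" "{}"] that by (intro sigma_sets.Basic) auto
	finally show ?thesis by (simp add: measurable_count_space_eq2_countable pred_def[symmetric])
  qed
  have sx: "(%c. snd c x) : measurable ?S nnb" if "x : J" for x
  proof -
	have "(%c. snd c x) : bm ?S"
	proof (rule borel_measurableI_ge)
	  fix y :: real
	  have "{c : space ?S. y <= snd c x} = corner I J {} {x} (%_. y)" unfolding spS by (auto simp: corner_def \<Omega>_def)
	  also have "... : sets ?S" unfolding setsS using G[of "{}" "{x}"] that by (intro sigma_sets.Basic) auto
	  finally show "{c : space ?S. y <= snd c x} : sets ?S" .
	qed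
	moreover have "snd c x : {0..}" if "c : space ?S" for c
	proof -
	  have "c : \<Omega>" using that spS by simp
	  then have "snd c : space (PiM J (%_. nnb))" by (auto simp: \<Omega>_def space_pair_measure)
	  then have "snd c x : space nnb" using \<open>x : J\<close> by (auto simp: space_PiM)
	  then show ?thesis by (simp add: space_nonneg_borel)
	qed
	ultimately show ?thesis unfolding nonneg_part_def by (intro measurable_restrict_space2) auto
  qed
  have inI: "fst c : extensional I" "snd c : extensional J" if "c : \<Omega>" for c
	using that by (auto simp: \<Omega>_def space_pair_measure space_PiM PiE_def)
  have id: "(%c. (fst c, snd c)) : measurable ?S (rc_algebra I J)"
  proof (rule measurable_Pair)
	show "fst : measurable ?S (PiM I (%_. count_space UNIV))"
	  by (rule measurable_PiM_single') (use fe inI in \<open>auto simp: spS PiE_def\<close>)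
	show "snd : measurable ?S (PiM J (%_. nonneg_part borel))"
	  by (rule measurable_PiM_single') (use sx inI measurable_space[OF sx] in \<open>auto simp: spS PiE_def\<close>)
  qed
  have sub1: "sets (rc_algebra I J :: 'd rc_config measure) <= sigma_sets \<Omega> G"
  proof
	fix A assume A: "A : sets (rc_algebra I J :: 'd rc_config measure)"
	have "(%c. (fst c, snd c)) -` A Int space ?S : sets ?S" by (rule measurable_sets[OF id A])
	moreover have "(%c. (fst c, snd c)) -` A Int space ?S = A"
	  using sets.sets_into_space[OF A] unfolding spS by (auto simp: \<Omega>_def)
	ultimately show "A : sigma_sets \<Omega> G" by (simp add: setsS)
  qed
  have cs: "corner I J F S t : sets (rc_algebra I J)" if "finite F" "F <= I" "finite S" "S <= J" for F S t
  proof -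
	have 1: "(%c. fst c e) : measurable (rc_algebra I J :: 'd rc_config measure) (count_space (UNIV :: bool set))" if "e : I" for e
	  by (rule measurable_compose[OF measurable_fst measurable_component_singleton[OF that]])
	have 2: "(%c. snd c x) : bm (rc_algebra I J :: 'd rc_config measure)" if "x : J" for x
	proof -
	  have "(%c. snd c x) : measurable (rc_algebra I J :: 'd rc_config measure) nnb"
		by (rule measurable_compose[OF measurable_snd measurable_component_singleton[OF that]])
	  moreover have "(%t. t) : bm nnb" by (rule borel_measurable_nonneg_part) auto
	  ultimately show ?thesis by (rule measurable_compose)
	qed
	have 3: "{c : space (rc_algebra I J :: 'd rc_config measure). fst c e} : sets (rc_algebra I J)" if "e : I" for e
	  using measurable_sets[OF 1[OF that], of "{True}"] by (simp add: vimage_def Int_def conj_commute)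
	have 4: "{c : space (rc_algebra I J). t x <= snd c x} : sets (rc_algebra I J :: 'd rc_config measure)" if "x : J" for x
	  using 2[OF that] by (simp add: borel_measurable_iff_ge)
	show ?thesis unfolding corner_def
	proof (intro sets.sets_Collect_conj sets.sets_Collect_finite_All)
	  show "{c : space (rc_algebra I J :: 'd rc_config measure). fst c e} : sets (rc_algebra I J)" if "e : F" for e
		by (rule 3) (use that \<open>F <= I\<close> in blast)
	  show "{c : space (rc_algebra I J). t x <= snd c x} : sets (rc_algebra I J :: 'd rc_config measure)" if "x : S" for x
		by (rule 4) (use that \<open>S <= J\<close> in blast)
	qed fact+
  qed
  have sub2: "sigma_sets \<Omega> G <= sets (rc_algebra I J :: 'd rc_config measure)"
	unfolding \<Omega>_def by (rule sets.sigma_sets_subset) (auto simp: G_def cs)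
  show ?thesis
  proof (rule measure_eqI_generator_eq[of G \<Omega> M N "%_. \<Omega>"])
	show "Int_stable G"
	proof (rule Int_stableI)
	  fix A B assume "A : G" "B : G"
	  then obtain F S t F' S' t' where
		"A = corner I J F S t" "finite F" "F <= I" "finite S" "S <= J"
		"B = corner I J F' S' t'" "finite F'" "F' <= I" "finite S'" "S' <= J" unfolding G_def by blast
	  then show "A Int B : G" by (simp add: corner_Int G)
	qed
	show "G <= Pow \<Omega>" by (rule Gsub)
	show "emeasure M X = emeasure N X" if "X : G" for X
	  using that eq unfolding G_def by (auto simp: M.emeasure_eq_measure N.emeasure_eq_measure)
	show "sets M = sigma_sets \<Omega> G" "sets N = sigma_sets \<Omega> G" using M N sub1 sub2 by auto
	show "range (%_. \<Omega>) <= G" using G[of "{}" "{}"] whole by auto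
  qed auto
qed

lemma gap_cong:
  assumes r: "good_law rh" "good_law ka" and b: "0 <= be" and fin: "finite U"
	and eq: "!!w a. \<forall>x. 0 <= a x ==> f w a = g w a"
  shows "gap rh ka be U f = gap rh ka be U g"
  unfolding gap_def using law_facts(1,2)[OF r b fin] eq
  by (intro arg_cong2[of _ _ _ _ "(-)"] Bochner_Integration.integral_cong) auto

lemma ising_corr_one: "finite U ==> ising_corr U E K (%A. 1) = 1"
  using ising_Z_pos[of U E K] by (simp add: ising_corr_def ising_Z_def)

definition exceeds :: "('v => real) => 'v set => ('v => real) => real" where
  "exceeds t S a = of_bool (\<forall>x\<in>S. t x <= a x)"

lemma exceeds_measurable: assumes "finite S" shows "exceeds t S : bm FA"
proof -
  have "(%a. \<Prod>x\<in>S. (if t x <= a x then 1 else 0 :: real)) : bm FA" by measurable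
  moreover have "(\<Prod>x\<in>S. (if t x <= a x then 1 else 0 :: real)) = exceeds t S a" for a
	using assms by (induction S) (auto simp: exceeds_def)
  ultimately show ?thesis by simp
qed

lemma exceeds_depends: "depends_on S (exceeds t S)"
proof (rule depends_onI)
  fix a b :: "'a => real" assume "!!x. x : S ==> a x = b x"
  then show "exceeds t S a = exceeds t S b" by (simp add: exceeds_def)
qed

lemma exceeds_mono: "\<forall>x. a x <= a' x ==> exceeds t S a <= exceeds t S a'"
  by (auto simp: exceeds_def intro: order_trans)

lemma floor_levels:
  fixes r :: real
  assumes "0 <= r" "r <= 1" "0 < N"
  shows "(\<Sum>j=1..N. of_bool (real j / real N <= r)) / real N <= r" "r <= (\<Sum>j=1..N. of_bool (real j / real N <= r)) / real N + 1 / real N"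
proof -
  have "{j : {1..N}. real j / real N <= r} = {1..nat \<lfloor>real N * r\<rfloor>}"
  proof (intro set_eqI iffI)
	fix j assume "j : {j : {1..N}. real j / real N <= r}"
	then have "1 <= j" "real j <= real N * r" using assms by (auto simp: field_simps)
	then show "j : {1..nat \<lfloor>real N * r\<rfloor>}" by (simp add: le_nat_iff le_floor_iff)
  next
	fix j assume "j : {1..nat \<lfloor>real N * r\<rfloor>}"
	then have j: "1 <= j" "real j <= real N * r" using assms by (auto simp: le_nat_iff le_floor_iff)
	moreover have "real N * r <= real N" using assms by (simp add: mult_left_le)
	ultimately have "real j <= real N" by linarith
	then show "j : {j : {1..N}. real j / real N <= r}" using j assms by (auto simp: field_simps)
  qed
  then have "(\<Sum>j=1..N. of_bool (real j / real N <= r)) = real (nat \<lfloor>real N * r\<rfloor>)"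
	by (simp add: sum.inter_filter[symmetric] of_bool_def)
  moreover have "real (nat \<lfloor>real N * r\<rfloor>) <= real N * r" "real N * r <= real (nat \<lfloor>real N * r\<rfloor>) + 1"
	using assms by (auto simp: of_nat_nat)
  ultimately show "(\<Sum>j=1..N. of_bool (real j / real N <= r)) / real N <= r" "r <= (\<Sum>j=1..N. of_bool (real j / real N <= r)) / real N + 1 / real N"
	using assms by (auto simp: field_simps)
qed

section \<open>The field has the same law under both limits\<close>

lemma exceeds_grows: "grows (%_. exceeds t (S :: 'd::finite site set))"
  unfolding grows_def
proof (intro allI impI conjI)
  fix a a' :: "'d site => real" assume ab: "\<forall>x. 0 <= a x & a x <= a' x"
  show "0 <= exceeds t S a" by (simp add: exceeds_def)
  show "exceeds t S a <= exceeds t S a'" by (rule exceeds_mono) (use ab in blast)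
qed

text \<open>The situation at a continuity point of the energy.\<close>
locale good_limits =
  fixes rh ka :: "real measure" and be :: real and V :: "nat => 'd::finite site set" and \<Psi>0 \<Psi>1 :: "'d rc_config measure"
  assumes adm: "admissible rh" and k: "good_law ka" and b: "0 < be"
	and V: "filterlim V (finite_subsets_at_top UNIV) sequentially"
	and D: "!!e. e : IE UNIV ==> (%n. energy_gap rh ka be (V n) e) ~~> 0"
	and L0: "is_local_limit (free_rc rh be) \<Psi>0" and L1: "is_local_limit (wired_rc rh be ka) \<Psi>1"
begin

abbreviation "G \<equiv> gap rh ka be"

lemma rg: "good_law rh" by (rule good_law_admissible[OF adm])
lemma b0: "0 <= be" using b by simp

lemma eventually_volume:
  assumes "finite S" shows "EVS n. finite (V n) & S <= V n"
proof -
  have "EVS n. finite (V n) & S <= V n & V n <= UNIV"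
	using V assms unfolding filterlim_finite_subsets_at_top by blast
  then show ?thesis by (rule eventually_mono) blast
qed

lemma eventually_finite: "EVS n. finite (V n)"
  using eventually_volume[of "{}"] by (auto elim: eventually_mono)

definition vanishing :: "('d site set => 'd observable) => bool" where
  "vanishing f \<longleftrightarrow> (EVS n. admits (V n) (f (V n))) & (%n. G (V n) (f (V n))) ~~> 0"

lemma vanishing_const: "vanishing (%_ _ _. c)"
proof -
  have "(%n. 0) ~~> (0::real)" by simp
  then have "(%n. G (V n) (%_ _. c)) ~~> 0"
	by (rule Lim_transform_eventually) (use eventually_finite in \<open>eventually_elim, simp add: gap_const[OF rg k b0]\<close>)
  then show ?thesis unfolding vanishing_def using eventually_finite by (auto elim!: eventually_mono intro: admits_const)
qed

lemma vanishing_add: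
  assumes "vanishing f" "vanishing g" shows "vanishing (%U w a. f U w a + g U w a)"
proof -
  have ev: "EVS n. admits (V n) (f (V n)) & admits (V n) (g (V n))"
	using assms by (auto simp: vanishing_def intro: eventually_conj)
  have "(%n. G (V n) (f (V n)) + G (V n) (g (V n))) ~~> 0 + 0"
	using assms by (intro tendsto_add) (auto simp: vanishing_def)
  then have "(%n. G (V n) (%w a. f (V n) w a + g (V n) w a)) ~~> 0 + 0"
	by (rule Lim_transform_eventually) (use ev in \<open>eventually_elim, simp add: gap_add[OF rg k b0]\<close>)
  then show ?thesis unfolding vanishing_def using ev by (auto elim!: eventually_mono intro: admits_add)
qed

lemma vanishing_cmult:
  assumes "vanishing f" shows "vanishing (%U w a. c * f U w a)"
proof -
  have "(%n. c * G (V n) (f (V n))) ~~> c * 0"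
	using assms by (intro tendsto_mult tendsto_const) (auto simp: vanishing_def)
  then show ?thesis using assms unfolding vanishing_def
	by (auto simp: gap_cmult[OF rg k b0] elim!: eventually_mono intro: admits_cmult)
qed

lemma vanishing_diff:
  assumes "vanishing f" "vanishing g" shows "vanishing (%U w a. f U w a - g U w a)"
  using vanishing_add[OF assms(1) vanishing_cmult[OF assms(2), of "- 1"]] by simp

lemma vanishing_sum:
  "finite I ==> (!!i. i : I ==> vanishing (f i)) ==> vanishing (%U w a. \<Sum>i\<in>I. f i U w a)"
  by (induction I rule: finite_induct) (auto intro: vanishing_add vanishing_const)

lemma vanishing_dominated:
  assumes f: "EVS n. admits (V n) (f (V n))" and g: "vanishing g"
	and inc: "EVS n. grows (f (V n)) & grows (%w a. g (V n) w a - f (V n) w a)"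
  shows "vanishing f"
proof -
  have ag: "EVS n. admits (V n) (g (V n))" and tg: "(%n. G (V n) (g (V n))) ~~> 0"
	using g by (auto simp: vanishing_def)
  have lo: "EVS n. 0 <= G (V n) (f (V n))"
	using f inc by eventually_elim (auto intro: gap_nonneg[OF rg k b0])
  have hi: "EVS n. G (V n) (f (V n)) <= G (V n) (g (V n))"
	using f ag inc
  proof eventually_elim
	case (elim n)
	then have "0 <= G (V n) (%w a. g (V n) w a - f (V n) w a)"
	  by (intro gap_nonneg[OF rg k b0] admits_diff) auto
	then show ?case using elim by (simp add: gap_diff[OF rg k b0])
  qed
  show ?thesis unfolding vanishing_def using f tendsto_sandwich[OF lo hi tendsto_const tg] by blast
qed

lemma event_limit:
  assumes F: "finite F" "F <= IE UNIV" and fD: "finite De" and C: "C : sets (PiM De (%_. nnb))"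
  shows "(%n. \<integral>a. rc_obs (V n) (IE (V n)) be F De C a \<partial>free_law rh be (V n)) ~~> measure (rc_marginal F De \<Psi>0) (PiE F (%_. {True}) \<times> C)"
	"(%n. \<integral>a. rc_obs (V n) (TE (V n)) be F De C a \<partial>wired_law rh ka be (V n)) ~~> measure (rc_marginal F De \<Psi>1) (PiE F (%_. {True}) \<times> C)"
proof -
  have "PiE F (%_. {True}) : sets (PiM F (%_. count_space UNIV))" by (rule sets_PiM_I_finite[OF F(1)]) auto
  then have A: "PiE F (%_. {True}) \<times> C : sets (rc_algebra F De)" using C by (intro pair_measureI) auto
  have fU: "finite (\<Union>F Un De)" using F fD by (auto simp: inner_edges_def)
  have ev: "EVS n. finite (V n) & F <= IE (V n) & De <= V n"
	using eventually_volume[OF fU]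
  proof eventually_elim
	case (elim n)
	then show ?case using F(2) inner_edges_iff[of _ "V n"] by blast
  qed
  have "((%U. measure (rc_marginal F De (free_rc rh be U)) (PiE F (%_. {True}) \<times> C)) \<longlongrightarrow> measure (rc_marginal F De \<Psi>0) (PiE F (%_. {True}) \<times> C)) (finite_subsets_at_top UNIV)"
	using L0 F fD A unfolding is_local_limit_def by blast
  from filterlim_compose[OF this V]
  show "(%n. \<integral>a. rc_obs (V n) (IE (V n)) be F De C a \<partial>free_law rh be (V n)) ~~> measure (rc_marginal F De \<Psi>0) (PiE F (%_. {True}) \<times> C)"
  proof (rule Lim_transform_eventually)
	show "EVS n. measure (rc_marginal F De (free_rc rh be (V n))) (PiE F (%_. {True}) \<times> C)
	  = (\<integral>a. rc_obs (V n) (IE (V n)) be F De C a \<partial>free_law rh be (V n))"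
	  using ev
	proof eventually_elim
	  case (elim n)
	  then show ?case using C by (intro free_event[OF rg _ b0]) auto
	qed
  qed
  have "((%U. measure (rc_marginal F De (wired_rc rh be ka U)) (PiE F (%_. {True}) \<times> C)) \<longlongrightarrow> measure (rc_marginal F De \<Psi>1) (PiE F (%_. {True}) \<times> C)) (finite_subsets_at_top UNIV)"
	using L1 F fD A unfolding is_local_limit_def by blast
  from filterlim_compose[OF this V]
  show "(%n. \<integral>a. rc_obs (V n) (TE (V n)) be F De C a \<partial>wired_law rh ka be (V n)) ~~> measure (rc_marginal F De \<Psi>1) (PiE F (%_. {True}) \<times> C)"
  proof (rule Lim_transform_eventually)
	show "EVS n. measure (rc_marginal F De (wired_rc rh be ka (V n))) (PiE F (%_. {True}) \<times> C)
	  = (\<integral>a. rc_obs (V n) (TE (V n)) be F De C a \<partial>wired_law rh ka be (V n))"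
	  using ev
	proof eventually_elim
	  case (elim n)
	  then show ?case using C inner_subset_touching[of "V n"] region_sup[of "V n" True]
		by (intro wired_event[OF rg k _ b0]) (auto simp: region_def)
	qed
  qed
qed

definition ind :: "'d site set => ('d site => real) set => ('d site => real) => real" where
  "ind De C a = indicator C (restrict a De)"

lemma ind_admits:
  assumes "finite De" "C : sets (PiM De (%_. nnb))"
  shows "EVS n. admits (V n) (%_. ind De C)"
  using eventually_volume[OF assms(1)]
proof eventually_elim
  case (elim n)
  show ?case
  proof (rule admits_local[of _ De _ 1])
	show "ind De C : bm FA" unfolding ind_def by (rule indicator_restrict_measurable[OF assms(2)])
	show "depends_on De (ind De C)"
	proof (rule depends_onI)
	  fix a a' :: "'d site => real" assume "!!x. x : De ==> a x = a' x"
	  then have "restrict a De = restrict a' De" by (auto simp: restrict_def fun_eq_iff)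
	  then show "ind De C a = ind De C a'" by (simp add: ind_def)
	qed
  qed (use elim in \<open>auto simp: ind_def indicator_def\<close>)
qed

abbreviation "marg0 De C \<equiv> measure (rc_marginal {} De \<Psi>0) (PiE {} (%_. {True}) \<times> C)"
abbreviation "marg1 De C \<equiv> measure (rc_marginal {} De \<Psi>1) (PiE {} (%_. {True}) \<times> C)"

lemma ind_limit:
  assumes fD: "finite De" and C: "C : sets (PiM De (%_. nnb))"
  shows "(%n. \<integral>a. ind De C a \<partial>free_law rh be (V n)) ~~> marg0 De C" "(%n. \<integral>a. ind De C a \<partial>wired_law rh ka be (V n)) ~~> marg1 De C"
	"(%n. G (V n) (%_. ind De C)) ~~> marg1 De C - marg0 De C"
proof -
  have eq: "rc_obs (V n) E be {} De C = ind De C" if "finite (V n)" for n E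
	using that by (auto simp: rc_obs_def ind_def ising_corr_one)
  show 0: "(%n. \<integral>a. ind De C a \<partial>free_law rh be (V n)) ~~> marg0 De C"
	by (rule Lim_transform_eventually[OF event_limit(1)[of "{}", OF _ _ fD C]]) (use eventually_finite in \<open>auto elim!: eventually_mono simp: eq\<close>)
  show 1: "(%n. \<integral>a. ind De C a \<partial>wired_law rh ka be (V n)) ~~> marg1 De C"
	by (rule Lim_transform_eventually[OF event_limit(2)[of "{}", OF _ _ fD C]]) (use eventually_finite in \<open>auto elim!: eventually_mono simp: eq\<close>)
  show "(%n. G (V n) (%_. ind De C)) ~~> marg1 De C - marg0 De C"
	unfolding gap_def by (rule tendsto_diff[OF 1 0])
qed

definition up :: "'d site set => 'd site set => ('d site => real) => ('d site => real) set" where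
  "up De S t = {c : space (PiM De (%_. nnb)). \<forall>x\<in>S. t x <= c x}"

lemma ind_up:
  assumes "S <= De" "\<forall>x. 0 <= a x" shows "ind De (up De S t) a = exceeds t S a"
proof -
  have "restrict a De : space (PiM De (%_. nnb))" using assms(2) by (auto simp: space_PiM space_nonneg_borel)
  then show ?thesis using assms(1) by (auto simp: ind_def up_def exceeds_def indicator_def subset_eq)
qed

lemma up_sets:
  assumes "finite S" "S <= De" shows "up De S t : sets (PiM De (%_. nnb))"
proof -
  have "{c : space (PiM De (%_. nnb)). t x <= c x} : sets (PiM De (%_. nnb))" if "x : De" for x
  proof -
	have "(%c. c x) : measurable (PiM De (%_. nnb)) nnb" by (rule measurable_component_singleton[OF that])
	moreover have "(%t. t) : bm nnb" by (rule borel_measurable_nonneg_part) auto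
	ultimately have "(%c. c x) : bm (PiM De (%_. nnb))" by (rule measurable_compose)
	then show ?thesis by (simp add: borel_measurable_iff_ge)
  qed
  then have "(\<Inter>x\<in>S. {c : space (PiM De (%_. nnb)). t x <= c x}) : sets (PiM De (%_. nnb))" if "S ~= {}"
	using assms that by (intro sets.finite_INT) auto
  moreover have "up De S t = (if S = {} then space (PiM De (%_. nnb)) else (\<Inter>x\<in>S. {c : space (PiM De (%_. nnb)). t x <= c x}))"
	by (auto simp: up_def)
  ultimately show ?thesis by auto
qed

lemma exceeds_admits: "finite S ==> EVS n. admits (V n) (%_. exceeds t S)"
  using eventually_volume
  by (rule eventually_mono) (auto intro!: admits_local[of _ S _ 1] exceeds_measurable exceeds_depends simp: exceeds_def)

lemma exceeds_gap_limit:
  assumes "finite De" "S <= De"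
  shows "(%n. G (V n) (%_. exceeds t S)) ~~> marg1 De (up De S t) - marg0 De (up De S t)"
proof (rule Lim_transform_eventually[OF ind_limit(3)[OF assms(1) up_sets]])
  show "finite S" using assms finite_subset by blast
  show "EVS n. G (V n) (%_. ind De (up De S t)) = G (V n) (%_. exceeds t S)"
	using eventually_finite by eventually_elim (rule gap_cong[OF rg k b0], use ind_up[OF assms(2)] in auto)
qed (fact assms(2))

lemma marginal_prob:
  assumes "F <= IE UNIV"
  shows "prob_space (rc_marginal F De \<Psi>0)" "prob_space (rc_marginal F De \<Psi>1)"
proof -
  have s: "sets \<Psi>0 = sets (rc_algebra (IE UNIV) UNIV)" "sets \<Psi>1 = sets (rc_algebra (IE UNIV) UNIV)"
	and p: "prob_space \<Psi>0" "prob_space \<Psi>1" using L0 L1 by (auto simp: is_local_limit_def)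
  have "(%(om, a). (restrict om F, restrict a De)) : measurable \<Psi>0 (rc_algebra F De)"
	using marginal_measurable[OF assms subset_UNIV[of De]] measurable_cong_sets[OF s(1) refl] by blast
  then show "prob_space (rc_marginal F De \<Psi>0)" unfolding rc_marginal_def by (rule prob_space.prob_space_distr[OF p(1)])
  have "(%(om, a). (restrict om F, restrict a De)) : measurable \<Psi>1 (rc_algebra F De)"
	using marginal_measurable[OF assms subset_UNIV[of De]] measurable_cong_sets[OF s(2) refl] by blast
  then show "prob_space (rc_marginal F De \<Psi>1)" unfolding rc_marginal_def by (rule prob_space.prob_space_distr[OF p(2)])
qed

lemma excess_vanishing: "0 < s ==> vanishing (%_ _ a. max (a x - s) 0)"
proof -
  assume s: "0 < s"
  obtain y where y: "adjacent x y" using exists_neighbour by blast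
  then have e: "{x, y} : IE UNIV" by (auto simp: inner_edges_def)
  let ?m = "field_floor rh be s"
  have m: "0 < ?m" by (rule field_floor_pos[OF adm b s])
  have ev: "EVS n. finite (V n) & {x, y} : IE (V n)"
	using eventually_volume[of "{x, y}"] by (auto elim!: eventually_mono simp: inner_edges_iff[of _ "V _"] e)
  have ad: "EVS n. admits (V n) (%_ a. max (a x - s) 0)"
	using ev
  proof eventually_elim
	case (elim n)
	show ?case by (rule gap_excess(1)[OF rg k b0, where y = y]) (use elim s in auto)
  qed
  have lo: "EVS n. 0 <= G (V n) (%_ a. max (a x - s) 0)"
	using ad
  proof eventually_elim
	case (elim n)
	have "max (u - s) 0 <= max (v - s) 0" if "u <= v" for u v using that by auto
	then show ?case by (intro gap_nonneg[OF rg k b0 elim]) (auto simp: grows_def)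
  qed
  have hi: "EVS n. G (V n) (%_ a. max (a x - s) 0) <= energy_gap rh ka be (V n) {x, y} / ?m"
	using ev
  proof eventually_elim
	case (elim n)
	have "G (V n) (%_ a. max (a x - s) 0) * ?m <= energy_gap rh ka be (V n) {x, y}"
	  by (rule gap_excess(2)[OF rg k b0]) (use elim s in auto)
	then show ?case using m by (simp add: pos_le_divide_eq)
  qed
  have "(%n. energy_gap rh ka be (V n) {x, y} / ?m) ~~> 0 / ?m"
	by (intro tendsto_divide D[OF e] tendsto_const) (use m in auto)
  then show ?thesis unfolding vanishing_def using ad tendsto_sandwich[OF lo hi tendsto_const] by simp
qed

text \<open>A difference of two excesses interpolates between the two indicator functions.\<close>
lemma tail_le:
  assumes st: "0 < s" "s < t" shows "marg1 {x} (up {x} {x} (%_. t)) <= marg0 {x} (up {x} {x} (%_. s))"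
proof -
  let ?h = "%a::'d site => real. (1 / (t - s)) * (max (a x - s) 0 - max (a x - t) 0)"
  have v: "vanishing (%_ _. ?h)" using st by (intro vanishing_cmult vanishing_diff excess_vanishing) auto
  have h: "exceeds (%_. t) {x} a <= ?h a" "?h a <= exceeds (%_. s) {x} a" for a
	using st by (auto simp: exceeds_def field_simps max_def)
  have ev: "EVS n. (\<integral>a. ind {x} (up {x} {x} (%_. t)) a \<partial>wired_law rh ka be (V n))
	  <= (\<integral>a. ind {x} (up {x} {x} (%_. s)) a \<partial>free_law rh be (V n)) + G (V n) (%_. ?h)"
  proof -
	have "EVS n. admits (V n) (%_. ?h)" using v by (simp add: vanishing_def)
	moreover have us: "up {x} {x} (%_. t) : sets (PiM {x} (%_. nnb))" for t by (rule up_sets) auto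
	have "EVS n. admits (V n) (%_. ind {x} (up {x} {x} (%_. t)))" for t
	  by (rule ind_admits[OF _ us]) simp
	note this[of t] this[of s]
	ultimately show ?thesis using eventually_finite
	proof (eventually_elim)
	  case (elim n)
	  note sp = law_facts(1,2)[OF rg k b0 elim(4)]
	  note i = admits_integrable[OF rg k b0]
	  have "(\<integral>a. ind {x} (up {x} {x} (%_. t)) a \<partial>wired_law rh ka be (V n)) <= (\<integral>a. ?h a \<partial>wired_law rh ka be (V n))"
		using i(2)[OF elim(2)] i(2)[OF elim(1)] h(1) by (intro integral_mono) (auto simp: sp ind_up)
	  moreover have "(\<integral>a. ?h a \<partial>free_law rh be (V n)) <= (\<integral>a. ind {x} (up {x} {x} (%_. s)) a \<partial>free_law rh be (V n))"
		using i(1)[OF elim(3)] i(1)[OF elim(1)] h(2) by (intro integral_mono) (auto simp: sp ind_up)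
	  ultimately show ?case unfolding gap_def by linarith
	qed
  qed
  have us: "up {x} {x} (%_. t) : sets (PiM {x} (%_. nnb))" for t by (rule up_sets) auto
  have "(%n. (\<integral>a. ind {x} (up {x} {x} (%_. s)) a \<partial>free_law rh be (V n)) + G (V n) (%_. ?h)) ~~> marg0 {x} (up {x} {x} (%_. s)) + 0"
	using v by (intro tendsto_add ind_limit(1)[OF _ us]) (auto simp: vanishing_def)
  from tendsto_le[OF sequentially_bot this ind_limit(2)[OF _ us] ev] show ?thesis by simp
qed

text \<open>Let \<open>s\<close> increase to \<open>t\<close> in the previous inequality; the reverse inequality is stochastic domination.\<close>
lemma site_vanishing: "vanishing (%_ _. exceeds t {x})"
proof -
  let ?U = "%t. up {x} {x} (%_. t)"
  have bt: "exceeds t {x} = exceeds (%_. t x) {x}" by (auto simp: exceeds_def)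
  have us: "?U t : sets (PiM {x} (%_. nnb))" for t by (rule up_sets) auto
  have ge: "0 <= marg1 {x} (?U t) - marg0 {x} (?U t)" for t
  proof (rule tendsto_lowerbound[OF exceeds_gap_limit[of "{x}" "{x}" "%_. t"]])
	show "EVS n. 0 <= G (V n) (%_. exceeds (%_. t) {x})"
	  using exceeds_admits[of "{x}" "%_. t"]
	  by (rule eventually_mono) (auto intro!: gap_nonneg[OF rg k b0] exceeds_grows)
  qed auto
  interpret P0: prob_space "rc_marginal {} {x} \<Psi>0" by (rule marginal_prob) simp
  have "marg1 {x} (?U (t x)) <= marg0 {x} (?U (t x))"
  proof (cases "0 < t x")
	case True
	define s where "s n = t x - t x / (real n + 2)" for n
	have s: "0 < s n" "s n < t x" "s n <= s (Suc n)" for n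
	  using True add_pos_nonneg[of "t x" "real n * t x"] by (auto simp: s_def field_simps)
	have sl: "s ~~> t x" unfolding s_def by real_asymp
	define A where "A n = (PiE {} (%_. {True}) \<times> ?U (s n) :: 'd rc_config set)" for n
	have e: "PiE {} (%_. {True}) : sets (PiM {} (%_::'d edge. count_space (UNIV::bool set)))" by (rule sets_PiM_I_finite) auto
	have setsA: "range A <= sets (rc_marginal {} {x} \<Psi>0)"
	  unfolding A_def rc_marginal_def sets_distr using pair_measureI[OF e us] by blast
	have dec: "decseq A" unfolding decseq_Suc_iff A_def up_def using s(3) by (auto intro: order_trans)
	have "(\<Inter>n. A n) = PiE {} (%_. {True}) \<times> ?U (t x)"
	proof -
	  have "(\<forall>n. s n <= u) \<longleftrightarrow> t x <= u" for u
	  proof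
		assume "\<forall>n. s n <= u"
		then show "t x <= u" using LIMSEQ_le_const2[OF sl] by blast
	  next
		assume "t x <= u"
		then show "\<forall>n. s n <= u" by (intro allI order_trans[OF less_imp_le[OF s(2)]])
	  qed
	  then show ?thesis unfolding A_def up_def by auto
	qed
	then have lim: "(%n. measure (rc_marginal {} {x} \<Psi>0) (A n)) ~~> marg0 {x} (?U (t x))"
	  using P0.finite_Lim_measure_decseq[OF setsA dec] by simp
	show ?thesis
	  by (rule LIMSEQ_le_const[OF lim]) (use tail_le[OF s(1,2)] in \<open>auto simp: A_def\<close>)
  next
	case False
	have U9: "?U (t x) = space (PiM {x} (%_. nnb))"
	  using False by (auto simp: up_def space_PiM space_nonneg_borel PiE_def Pi_def intro: order_trans)
	have "marg0 {x} (?U (t x)) = 1"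
	  unfolding U9 PiE_empty_domain using P0.prob_space by (simp add: rc_marginal_def space_pair_measure space_PiM)
	then show ?thesis using prob_space.prob_le_1[OF marginal_prob(2)[of "{}" "{x}"]] by simp
  qed
  then have "marg1 {x} (?U (t x)) - marg0 {x} (?U (t x)) = 0" using ge[of "t x"] by simp
  then show ?thesis unfolding vanishing_def bt
	using exceeds_admits[of "{x}" "%_. t x"] exceeds_gap_limit[of "{x}" "{x}" "%_. t x"] by simp
qed

text \<open>The sum of indicator functions minus their product is increasing.\<close>
lemma exceeds_vanishing:
  assumes "finite S" shows "vanishing (%_ _. exceeds t S)"
proof (cases "S = {}")
  case True
  then have "exceeds t S = (%_. 1)" by (auto simp: exceeds_def)
  then show ?thesis using vanishing_const[of 1] by simp
next
  case False
  have s: "exceeds t S a = (\<Prod>x\<in>S. exceeds t {x} a)" for a using assms by (induction S) (auto simp: exceeds_def)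
  have g: "grows (%_ a. (\<Sum>x\<in>S. exceeds t {x} a) - exceeds t S a)"
	unfolding grows_def
  proof (intro allI impI conjI)
	fix a a' :: "'d site => real" assume ab: "\<forall>x. 0 <= a x & a x <= a' x"
	have m: "exceeds t {x} a <= exceeds t {x} a'" "0 <= exceeds t {x} a" for x
	  using exceeds_mono[of a a' t "{x}"] ab by (auto simp: exceeds_def)
	obtain z where z: "z : S" using False by blast
	have "exceeds t S a <= exceeds t {z} a" using z by (auto simp: exceeds_def)
	also have "... <= (\<Sum>x\<in>S. exceeds t {x} a)" using assms z m by (intro member_le_sum) auto
	finally show "0 <= (\<Sum>x\<in>S. exceeds t {x} a) - exceeds t S a" by simp
	have sm: "(\<Sum>x\<in>S. exceeds t {x} a) <= (\<Sum>x\<in>S. exceeds t {x} a')" by (intro sum_mono m)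
	show "(\<Sum>x\<in>S. exceeds t {x} a) - exceeds t S a <= (\<Sum>x\<in>S. exceeds t {x} a') - exceeds t S a'"
	proof (cases "exceeds t S a' = exceeds t S a")
	  case False
	  have "exceeds t S a <= exceeds t S a'" by (rule exceeds_mono) (use ab in blast)
	  then have "~ (\<forall>x\<in>S. t x <= a x) & (\<forall>x\<in>S. t x <= a' x)"
		using False unfolding exceeds_def by (cases "\<forall>x\<in>S. t x <= a x"; cases "\<forall>x\<in>S. t x <= a' x") simp_all
	  then obtain y where y: "y : S" "~ t y <= a y" "\<forall>x\<in>S. t x <= a' x" by blast
	  then have "exceeds t {y} a = 0" "exceeds t {y} a' = 1" "exceeds t S a = 0" "exceeds t S a' = 1" by (auto simp: exceeds_def)
	  moreover have "(\<Sum>x\<in>S. exceeds t {x} a) = exceeds t {y} a + (\<Sum>x\<in>S - {y}. exceeds t {x} a)" "(\<Sum>x\<in>S. exceeds t {x} a') = exceeds t {y} a' + (\<Sum>x\<in>S - {y}. exceeds t {x} a')"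
		using assms y by (auto intro: sum.remove)
	  moreover have "(\<Sum>x\<in>S - {y}. exceeds t {x} a) <= (\<Sum>x\<in>S - {y}. exceeds t {x} a')" by (intro sum_mono m)
	  ultimately show ?thesis by linarith
	qed (use sm in simp)
  qed
  have g2: "grows (%_. exceeds t S)" by (rule exceeds_grows)
  show ?thesis
	by (rule vanishing_dominated[OF exceeds_admits[OF assms] vanishing_sum[OF assms site_vanishing]]) (use g g2 in simp)
qed

lemma field_marginals_agree:
  assumes fD: "finite De" shows "rc_marginal {} De \<Psi>0 = rc_marginal {} De \<Psi>1"
proof (rule measure_eqI_corners[OF marginal_prob(1)[of "{}" De] _ marginal_prob(2)[of "{}" De], of "{}" De])
  fix F :: "'d edge set" and S :: "'d site set" and t :: "'d site => real"
  assume F: "F <= {}" and S: "finite S" "S <= De"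
  have c: "corner {} De F S t = PiE {} (%_. {True}) \<times> up De S t"
	using F by (auto simp: corner_def up_def space_pair_measure space_PiM)
  have "(%n. G (V n) (%_. exceeds t S)) ~~> 0" using exceeds_vanishing[OF S(1)] by (simp add: vanishing_def)
  from LIMSEQ_unique[OF this exceeds_gap_limit[OF fD S(2)]]
  show "measure (rc_marginal {} De \<Psi>0) (corner {} De F S t) = measure (rc_marginal {} De \<Psi>1) (corner {} De F S t)"
	unfolding c by simp
qed (auto simp: rc_marginal_def)

lemma ind_vanishing:
  assumes "finite De" "C : sets (PiM De (%_. nnb))" shows "vanishing (%_ _. ind De C)"
  unfolding vanishing_def using ind_admits[OF assms] ind_limit(3)[OF assms] field_marginals_agree[OF assms(1)] by simp

end

section \<open>Correlations on strong edges\<close>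

lemma gap_le:
  assumes r: "good_law rh" "good_law ka" and b: "0 <= be" and f: "admits U f" and g: "admits U g"
	and le: "!!a. \<forall>x. 0 <= a x ==> f True a <= g True a + c" "!!a. \<forall>x. 0 <= a x ==> g False a <= f False a"
  shows "gap rh ka be U f <= gap rh ka be U g + c"
proof -
  have fin: "finite U" using f by (simp add: admits_def)
  note sp = law_facts(1,2)[OF r b fin] and i = admits_integrable[OF r b f] admits_integrable[OF r b g]
  interpret W: prob_space "wired_law rh ka be U" by (rule law_facts(4)[OF r b fin])
  have "(\<integral>a. f True a \<partial>wired_law rh ka be U) <= (\<integral>a. g True a + c \<partial>wired_law rh ka be U)"
	using i le by (intro integral_mono) (auto simp: sp)
  also have "... = (\<integral>a. g True a \<partial>wired_law rh ka be U) + c" using i by (simp add: W.prob_space)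
  finally have 1: "(\<integral>a. f True a \<partial>wired_law rh ka be U) <= (\<integral>a. g True a \<partial>wired_law rh ka be U) + c" .
  have 2: "(\<integral>a. g False a \<partial>free_law rh be U) <= (\<integral>a. f False a \<partial>free_law rh be U)"
	using i le by (intro integral_mono) (auto simp: sp)
  show ?thesis unfolding gap_def using 1 2 by linarith
qed

lemma extend_measurable: "(%c x. if x : De then c x else 0) : measurable (PiM De (%_. nnb)) FA"
proof (rule measurable_PiM_single')
  fix x
  show "(%c. if x : De then c x else 0) : measurable (PiM De (%_. nnb)) nnb"
	by (cases "x : De") (auto intro: measurable_component_singleton simp: space_nonneg_borel)
qed (auto simp: space_PiM space_nonneg_borel)

text \<open>The indicator that the field products on all edges of \<open>F\<close> are at least \<open>s\<close>.\<close>
definition strong :: "real => 'v set set => ('v => real) => real" where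
  "strong s F a = of_bool (\<forall>e\<in>F. s <= (\<Prod>x\<in>e. a x))"

lemma strong_measurable: assumes "finite F" shows "strong s F : bm FA"
proof -
  have "(%a. \<Prod>e\<in>F. (if s <= (\<Prod>x\<in>e. a x) then 1 else 0 :: real)) : bm FA" by measurable
  moreover have "(\<Prod>e\<in>F. (if s <= (\<Prod>x\<in>e. a x) then 1 else 0 :: real)) = strong s F a" for a
	using assms by (induction F) (auto simp: strong_def)
  ultimately show ?thesis by simp
qed

lemma strong_depends: "depends_on (\<Union>F) (strong s F)"
proof (rule depends_onI)
  fix a b :: "'a => real" assume ab: "!!x. x : \<Union>F ==> a x = b x"
  have "(\<Prod>x\<in>e. a x) = (\<Prod>x\<in>e. b x)" if "e : F" for e using ab that by (intro prod.cong) auto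
  then show "strong s F a = strong s F b" by (simp add: strong_def)
qed

lemma strong_mono:
  assumes "\<forall>x. 0 <= a x & a x <= a' x" shows "strong s F a <= strong s F a'"
proof -
  have "(\<Prod>x\<in>e. a x) <= (\<Prod>x\<in>e. a' x)" for e using assms by (intro prod_mono) auto
  then have "(\<forall>e\<in>F. s <= (\<Prod>x\<in>e. a x)) ==> (\<forall>e\<in>F. s <= (\<Prod>x\<in>e. a' x))" by (meson order_trans)
  then show ?thesis unfolding strong_def of_bool_less_eq_iff by blast
qed

lemma strong_cases: "strong s F a = 0 \<or> strong s F a = 1" by (simp add: strong_def) blast

definition half_corr :: "'d::finite site set => bool => real => 'd edge set => ('d site => real) => real" where
  "half_corr U w be F a = ising_corr U (edges_of U w) (coupling (%_. be) a) (%A. \<Prod>e\<in>F. (1 + spins e A) / 2)"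

definition pair_corr :: "'d::finite site set => bool => real => 'd site set => ('d site => real) => real" where
  "pair_corr U w be B a = corr U (edges_of U w) (%_. be) a B"

lemma pair_corr_bounds:
  assumes "finite U" "0 <= be" "\<forall>x. 0 <= a x" "finite B"
  shows "0 <= pair_corr U w be B a" "pair_corr U w be B a <= 1"
  unfolding pair_corr_def using corr_nonneg[OF assms(1) region_bonds[OF assms(1), of w], of "%_. be" a B] ising_corr_le_1[OF assms(1)] assms
  by auto

lemma pair_corr_mono:
  assumes "finite U" "0 <= be" "\<forall>x. 0 <= a x & a x <= a' x" "finite B"
  shows "pair_corr U False be B a <= pair_corr U True be B a'"
  unfolding pair_corr_def edges_of_def using corr_free_le_wired[OF assms(1-3), of B] assms(4) by simp

lemma pair_corr_admits:
  assumes "finite U" "0 <= be" "finite B" shows "admits U (%w. pair_corr U w be B)"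
  unfolding admits_def
proof (intro conjI allI assms nice_bounded[where C = 1])
  fix w
  show "pair_corr U w be B : bm FA" unfolding pair_corr_def ising_corr_def by measurable
  show "depends_on (region U w) (pair_corr U w be B)" unfolding pair_corr_def by (rule depends_on_corr[OF region_bonds[OF assms(1)]])
  show "\<bar>pair_corr U w be B a\<bar> <= 1" for a unfolding pair_corr_def by (rule corr_abs_le_1[OF assms(1)])
qed

lemma half_corr_expand:
  assumes "finite F" "finite U" "!!S A. S <= F ==> (\<Prod>e\<in>S. spins e A) = spins (B S) A"
  shows "half_corr U w be F a = (1 / 2 ^ card F) * (\<Sum>S\<in>Pow F. pair_corr U w be (B S) a)"
proof -
  let ?K = "coupling (%_. be) a" and ?E = "edges_of U w"
  have "(\<Prod>e\<in>F. (1 + spins e A) / 2) = (1 / 2 ^ card F) * (\<Sum>S\<in>Pow F. spins (B S) A)" for A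
  proof -
	have "(\<Prod>e\<in>F. (spins e A + 1) / 2) = (\<Prod>e\<in>F. spins e A + 1) / 2 ^ card F"
	  by (simp add: prod_dividef)
	also have "(\<Prod>e\<in>F. spins e A + 1) = (\<Sum>S\<in>Pow F. \<Prod>e\<in>S. spins e A)"
	  using prod_add[OF assms(1), of "%e. spins e A" "%_. 1"] by simp
	also have "(\<Sum>S\<in>Pow F. \<Prod>e\<in>S. spins e A) = (\<Sum>S\<in>Pow F. spins (B S) A)" using assms(3) by (intro sum.cong) auto
	finally show ?thesis by (simp add: add.commute)
  qed
  then have "ising_sum U ?E ?K (%A. \<Prod>e\<in>F. (1 + spins e A) / 2)
	= ising_sum U ?E ?K (%A. (1 / 2 ^ card F) * (\<Sum>S\<in>Pow F. spins (B S) A))" by simp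
  also have "... = (1 / 2 ^ card F) * (\<Sum>S\<in>Pow F. ising_sum U ?E ?K (spins (B S)))"
	unfolding ising_sum_def by (subst sum.swap) (simp add: sum_distrib_left sum_distrib_right mult.assoc)
  finally show ?thesis unfolding half_corr_def pair_corr_def ising_corr_def
	by (simp add: sum_divide_distrib mult.commute)
qed

context good_limits begin

lemma vanishing_cong:
  assumes f: "vanishing f" and eq: "!!n. finite (V n) ==> f (V n) = g (V n)" shows "vanishing g"
proof -
  have ev: "EVS n. f (V n) = g (V n)" using eventually_finite by (rule eventually_mono) (rule eq)
  have eqG: "EVS n. G (V n) (f (V n)) = G (V n) (g (V n))" using ev by (rule eventually_mono) simp
  have "(%n. G (V n) (f (V n))) ~~> 0" using f by (simp add: vanishing_def)
  from Lim_transform_eventually[OF this eqG] have "(%n. G (V n) (g (V n))) ~~> 0" .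
  moreover have "EVS n. admits (V n) (g (V n))"
	using f[unfolded vanishing_def, THEN conjunct1] ev by eventually_elim simp
  ultimately show ?thesis by (simp add: vanishing_def)
qed

text \<open>Approximate by level sets.\<close>
lemma local_vanishing:
  assumes fD: "finite De" and m: "ph : bm FA" and d: "depends_on De ph"
	and bd: "!!a. \<forall>x. 0 <= a x ==> 0 <= ph a & ph a <= 1"
  shows "vanishing (%_ _. ph)"
proof -
  have ad: "EVS n. admits (V n) (%_. ph)"
	using eventually_volume[OF fD] by (rule eventually_mono) (auto intro!: admits_local[OF _ _ m d, of _ 1] dest: bd)
  let ?ext = "%c x. if x : De then c x else (0::real)"
  define C where "C u = {c : space (PiM De (%_. nnb)). u <= ph (?ext c)}" for u
  have Cs: "C u : sets (PiM De (%_. nnb))" for u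
	using measurable_compose[OF extend_measurable m] unfolding C_def by (simp add: borel_measurable_iff_ge)
  have iC: "ind De (C u) a = of_bool (u <= ph a)" if a: "\<forall>x. 0 <= a x" for u a
  proof -
	have "restrict a De : space (PiM De (%_. nnb))" using a by (auto simp: space_PiM space_nonneg_borel)
	moreover have "ph (?ext (restrict a De)) = ph a" by (rule depends_onD[OF d]) simp
	ultimately show ?thesis by (simp add: ind_def C_def indicator_def)
  qed
  have "(%n. G (V n) (%_. ph)) ~~> 0"
  proof (rule tendstoI)
	fix ep :: real assume ep: "0 < ep"
	obtain N where N: "0 < N" "1 / real N < ep / 2" using ep real_arch_inverse[of "ep / 2"] by (auto simp: inverse_eq_divide)
	define S where "S a = (1 / real N) * (\<Sum>j\<in>{1..N}. ind De (C (real j / real N)) a)" for a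
	have S: "S a <= ph a" "ph a <= S a + 1 / real N" if a: "\<forall>x. 0 <= a x" for a
	  using floor_levels[of "ph a" N] bd[OF a] N(1) by (auto simp: S_def iC[OF a])
	have vS: "vanishing (%_ _. S)" unfolding S_def by (intro vanishing_cmult vanishing_sum ind_vanishing fD Cs) simp
	then have "EVS n. dist (G (V n) (%_. S)) 0 < ep / 2"
	  using ep unfolding vanishing_def by (intro tendstoD) auto
	moreover have "EVS n. admits (V n) (%_. S)" using vS by (simp add: vanishing_def)
	ultimately show "EVS n. dist (G (V n) (%_. ph)) 0 < ep" using ad
	proof eventually_elim
	  case (elim n)
	  have "G (V n) (%_. ph) <= G (V n) (%_. S) + 1 / real N"
		by (rule gap_le[OF rg k b0 elim(3,2)]) (use S in auto)
	  moreover have "G (V n) (%_. S) <= G (V n) (%w a. ph a - (if w then 0 else 1 / real N)) + 0"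
	  proof (rule gap_le[OF rg k b0 elim(2)])
		show "admits (V n) (%w a. ph a - (if w then 0 else 1 / real N))"
		  using elim(3) by (auto simp: admits_def intro!: nice_diff nice_const)
		show "S a <= ph a - (if True then 0 else 1 / real N) + 0" if "\<forall>x. 0 <= a x" for a using S[OF that] by simp
		show "ph a - (if False then 0 else 1 / real N) <= S a" if "\<forall>x. 0 <= a x" for a using S[OF that] by simp
	  qed
	  moreover have "G (V n) (%w a. ph a - (if w then 0 else 1 / real N)) = G (V n) (%_. ph) + 1 / real N"
	  proof -
		have fin: "finite (V n)" using elim(3) by (simp add: admits_def)
		interpret F: prob_space "free_law rh be (V n)" by (rule law_facts(3)[OF rg k b0 fin])
		show ?thesis using admits_integrable[OF rg k b0 elim(3)] by (simp add: gap_def F.prob_space)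
	  qed
	  ultimately show ?case using elim(1) N(2) by (simp add: dist_real_def)
	qed
  qed
  then show ?thesis using ad by (simp add: vanishing_def)
qed

lemma strong_vanishing:
  assumes F: "finite F" "F <= IE UNIV" shows "vanishing (%_ _. strong s F)"
proof (rule local_vanishing)
  show "finite (\<Union>F)" using F by (auto simp: inner_edges_def)
qed (use F in \<open>auto intro: strong_measurable strong_depends simp: strong_def\<close>)

lemma edge_vanishing:
  assumes e: "e : IE UNIV"
  shows "vanishing (%U w. edge_obs U (edges_of U w) be e)"
proof -
  have fe: "finite e" using e by (auto simp: inner_edges_def)
  have "EVS n. admits (V n) (%w. edge_obs (V n) (edges_of (V n) w) be e)"
	using eventually_volume[OF fe]
  proof eventually_elim
	case (elim n)
	have "e <= region (V n) w" for w using elim region_sup[of "V n" w] by auto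
	moreover have "finite (region (V n) w)" for w using region_bonds[of "V n" w] elim by (simp add: bonds_def)
	ultimately show ?case using elim unfolding admits_def nice_def
	  by (auto intro!: edge_obs_measurable edge_obs_depends[OF region_bonds] edge_obs_gauss)
  qed
  moreover have "G (V n) (%w. edge_obs (V n) (edges_of (V n) w) be e) = energy_gap rh ka be (V n) e" for n
	by (simp add: gap_def energy_gap_def wired_edge_def free_edge_def edges_of_def)
  ultimately show ?thesis using D[OF e] by (simp add: vanishing_def)
qed

text \<open>Where the field is strong, the correlation of \<open>B\<close> is at least \<open>th\<close>, so Lebowitz bounds the increment for the product of \<open>B\<close> with an edge by the increments for the edge, controlled by its energy, and for \<open>B\<close>.\<close>
lemma strong_corr_step:
  assumes F: "finite F" "F <= IE UNIV" and e: "e : F" and s: "0 < s" and B: "finite B" and th: "0 < th"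
	and low: "EVS n. \<forall>a. (\<forall>x. 0 <= a x) & strong s F a = 1 --> th <= pair_corr (V n) False be B a"
	and van: "vanishing (%U w a. strong s F a * pair_corr U w be B a)"
  shows "vanishing (%U w a. strong s F a * pair_corr U w be (sym_diff B e) a)"
proof -
  have eU: "e : IE UNIV" using e F by blast
  have fe: "finite e" using eU by (auto simp: inner_edges_def)
  have fBe: "finite (sym_diff B e)" using B fe by simp
  let ?\<chi> = "strong s F"
  let ?X = "%U w a. pair_corr U w be B a" and ?Y = "%U w a. pair_corr U w be (sym_diff B e) a" and ?e = "%U w a. edge_obs U (edges_of U w) be e a"
  let ?g = "%U w a. (1 / th) * ((1 / s) * ?e U w a + ?\<chi> a * ?X U w a) + ?\<chi> a"
  have chi: "vanishing (%_ _. ?\<chi>)" by (rule strong_vanishing[OF F])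
  have g: "vanishing ?g"
	by (intro vanishing_add vanishing_cmult edge_vanishing eU van chi)
  have f: "EVS n. admits (V n) (%w a. ?\<chi> a * ?Y (V n) w a)"
  proof -
	have "EVS n. admits (V n) (%_. ?\<chi>)" using chi by (simp add: vanishing_def)
	then show ?thesis using eventually_finite
	  by eventually_elim (intro admits_mult pair_corr_admits b0 fBe)
  qed
  show ?thesis
  proof (rule vanishing_dominated[OF f g])
	show "EVS n. grows (%w a. ?\<chi> a * ?Y (V n) w a) & grows (%w a. ?g (V n) w a - ?\<chi> a * ?Y (V n) w a)"
	  using low eventually_finite
	proof eventually_elim
	  case (elim n)
	  let ?U = "V n"
	  have fin: "finite ?U" by fact
	  note c = pair_corr_bounds[OF fin b0] and cm = pair_corr_mono[OF fin b0]
	  have key: "(1 / s) * ?e ?U False a + ?X ?U False a + th * (?Y ?U True a' - ?Y ?U False a) <= (1 / s) * ?e ?U True a' + ?X ?U True a'"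
		if ab: "\<forall>x. 0 <= a x & a x <= a' x" and ch: "?\<chi> a = 1" "?\<chi> a' = 1" for a a'
	  proof -
		have a: "\<forall>x. 0 <= a x" "\<forall>x. 0 <= a' x" using ab by (auto intro: order_trans)
		let ?K = "%b. if b : IE ?U then coupling (%_. be) a b else 0" and ?K' = "coupling (%_. be) a'"
		have K0: "pair_corr ?U False be B0 a = ising_corr ?U (TE ?U) ?K (spins B0)" if "finite B0" for B0
		proof -
		  have "coupling (%e. if e : IE ?U then be else 0) a = ?K" by (auto simp: coupling_def)
		  moreover have "corr ?U (TE ?U) (%e. if e : IE ?U then be else 0) a B0 = corr ?U (IE ?U) (%_. be) a B0"
			using fin bonds_finite[OF bonds_touching[OF fin]] inner_subset_touching[of ?U] by (intro corr_extend) auto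
		  ultimately show ?thesis by (simp add: pair_corr_def edges_of_def)
		qed
		have K1: "pair_corr ?U True be B0 a' = ising_corr ?U (TE ?U) ?K' (spins B0)" for B0
		  by (simp add: pair_corr_def edges_of_def)
		have KK: "0 <= ?K b & ?K b <= ?K' b & finite b" if "b : TE ?U" for b
		  using coupling_mono[of b "%_. be" "%_. be" a a'] coupling_mono[of b "%_. be" "%_. be" a' a'] ab a b0 bonds_D[OF bonds_touching[OF fin] that] by auto
		have leb: "?X ?U False a * (?Y ?U True a' - ?Y ?U False a) <=
		   (pair_corr ?U True be e a' - pair_corr ?U False be e a) + (?X ?U True a' - ?X ?U False a)"
		  unfolding K0[OF B] K0[OF fBe] K0[OF fe] K1
		  by (rule ising_corr_lebowitz[OF fin bonds_finite[OF bonds_touching[OF fin]] B fe KK])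
		have th: "th <= ?X ?U False a" using elim a ch by blast
		have Ym: "0 <= ?Y ?U True a' - ?Y ?U False a" using cm[OF ab fBe] by simp
		have 1: "th * (?Y ?U True a' - ?Y ?U False a) <= ?X ?U False a * (?Y ?U True a' - ?Y ?U False a)"
		  by (rule mult_right_mono[OF th Ym])
		define p where "p = (\<Prod>x\<in>e. a x)"
		define p' where "p' = (\<Prod>x\<in>e. a' x)"
		have p: "s <= p" "p <= p'" using ch(1) e ab by (auto simp: strong_def p_def p'_def intro!: prod_mono)
		have Xe: "0 <= pair_corr ?U False be e a" "pair_corr ?U False be e a <= pair_corr ?U True be e a'"
		  using c(1)[OF a(1) fe] cm[OF ab fe] by auto
		have eo: "?e ?U False a = p * pair_corr ?U False be e a" "?e ?U True a' = p' * pair_corr ?U True be e a'"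
		  by (simp_all add: edge_obs_def pair_corr_def p_def p'_def)
		have "s * (pair_corr ?U True be e a' - pair_corr ?U False be e a) <= p' * (pair_corr ?U True be e a' - pair_corr ?U False be e a)"
		  using p Xe by (intro mult_right_mono) auto
		also have "... <= p' * pair_corr ?U True be e a' - p * pair_corr ?U False be e a"
		  using mult_right_mono[OF p(2) Xe(1)] by (simp add: right_diff_distrib)
		finally have "pair_corr ?U True be e a' - pair_corr ?U False be e a <= (1 / s) * (?e ?U True a' - ?e ?U False a)"
		  unfolding eo using s by (simp add: field_simps)
		then show ?thesis using leb 1 by (simp add: right_diff_distrib)
	  qed
	  have eo0: "0 <= ?e ?U w a" if "\<forall>x. 0 <= a x" for w a
		by (rule edge_obs_nonneg[OF fin region_bonds[OF fin] b0 that fe])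
	  have eom: "?e ?U False a <= ?e ?U True a'" if ab: "\<forall>x. 0 <= a x & a x <= a' x" for a a'
	  proof -
		have "(\<Prod>x\<in>e. a x) * pair_corr ?U False be e a <= (\<Prod>x\<in>e. a' x) * pair_corr ?U True be e a'"
		  using ab c(1)[of a e] fe by (intro mult_mono cm prod_mono prod_nonneg) (auto intro: order_trans)
		then show ?thesis by (simp add: edge_obs_def pair_corr_def)
	  qed
	  show ?case
	  proof
		show "grows (%w a. ?\<chi> a * ?Y ?U w a)"
		  unfolding grows_def
		proof (intro allI impI conjI)
		  fix a a' :: "'d site => real" assume ab: "\<forall>x. 0 <= a x & a x <= a' x"
		  then have a: "\<forall>x. 0 <= a x" by blast
		  show "0 <= ?\<chi> a * ?Y ?U False a" using c(1)[OF a fBe] strong_cases[of s F a] by auto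
		  show "?\<chi> a * ?Y ?U False a <= ?\<chi> a' * ?Y ?U True a'"
			using strong_mono[OF ab, of s F] cm[OF ab fBe] c(1)[OF a fBe] strong_cases[of s F a] strong_cases[of s F a'] by (intro mult_mono) auto
		qed
		show "grows (%w a. ?g ?U w a - ?\<chi> a * ?Y ?U w a)"
		  unfolding grows_def
		proof (intro allI impI conjI)
		  fix a a' :: "'d site => real" assume ab: "\<forall>x. 0 <= a x & a x <= a' x"
		  then have a: "\<forall>x. 0 <= a x" "\<forall>x. 0 <= a' x" by (auto intro: order_trans)
		  have n: "0 <= (1 / th) * ((1 / s) * ?e ?U w a + ?\<chi> a * ?X ?U w a)" if "\<forall>x. 0 <= a x" for w a
			using eo0[OF that] c(1)[OF that B] strong_cases[of s F a] th s by (intro mult_nonneg_nonneg add_nonneg_nonneg) auto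
		  show "0 <= ?g ?U False a - ?\<chi> a * ?Y ?U False a"
		  proof -
			have "?\<chi> a * ?Y ?U False a <= ?\<chi> a"
			  using c(2)[OF a(1) fBe, of False] c(1)[OF a(1) fBe, of False] strong_cases[of s F a] by auto
			then show ?thesis using n[OF a(1), of False] by linarith
		  qed
		  show "?g ?U False a - ?\<chi> a * ?Y ?U False a <= ?g ?U True a' - ?\<chi> a' * ?Y ?U True a'"
		  proof (cases "?\<chi> a = 1")
			case True
			then have ch: "?\<chi> a' = 1" using strong_mono[OF ab, of s F] strong_cases[of s F a'] by auto
			have "(1 / th) * ((1 / s) * ?e ?U False a + ?X ?U False a + th * (?Y ?U True a' - ?Y ?U False a))
			  <= (1 / th) * ((1 / s) * ?e ?U True a' + ?X ?U True a')"
			  using th by (intro mult_left_mono key[OF ab True ch]) auto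
			moreover have "(1 / th) * (u + th * v) = (1 / th) * u + v" for u v :: real using th by (simp add: field_simps)
			ultimately show ?thesis using True ch by simp
		  next
			case False
			then have ch: "?\<chi> a = 0" using strong_cases[of s F a] by auto
			have "(1 / th) * ((1 / s) * ?e ?U False a) <= (1 / th) * ((1 / s) * ?e ?U True a' + ?\<chi> a' * ?X ?U True a')"
			proof (rule mult_left_mono)
			  have "(1 / s) * ?e ?U False a <= (1 / s) * ?e ?U True a'" using s eom[OF ab] by (intro mult_left_mono) auto
			  moreover have "0 <= ?\<chi> a' * ?X ?U True a'" using c(1)[OF a(2) B] strong_cases[of s F a'] by auto
			  ultimately show "(1 / s) * ?e ?U False a <= (1 / s) * ?e ?U True a' + ?\<chi> a' * ?X ?U True a'" by linarith
			qed (use th in simp)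
			moreover have "0 <= ?\<chi> a' - ?\<chi> a' * ?Y ?U True a'" using c[OF a(2) fBe] strong_cases[of s F a'] by auto
			ultimately show ?thesis using ch by simp
		  qed
		qed
	  qed
	qed
  qed
qed

text \<open>The lower bound \<open>th\<close> is propagated along the induction by the second GKS inequality.\<close>
lemma strong_corr_vanishing:
  assumes F: "finite F" "F <= IE UNIV" and s: "0 < s" and S: "finite S" "S <= F"
  shows "\<exists>B. finite B & (\<forall>A. (\<Prod>e\<in>S. spins e A) = spins B A) &
	vanishing (%U w a. strong s F a * pair_corr U w be B a) &
	(\<exists>th>0. EVS n. \<forall>a. (\<forall>x. 0 <= a x) & strong s F a = 1 --> th <= pair_corr (V n) False be B a)"
  using S
proof (induction S rule: finite_induct)
  case empty
  have e: "pair_corr U w be {} a = 1" if "finite U" for U :: "'d site set" and w a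
	using ising_corr_one[OF that] by (simp add: pair_corr_def spins_def[abs_def])
  have v: "vanishing (%U w a. strong s F a * pair_corr U w be {} a)"
  proof -
	have eq: "(%w a. strong s F a * pair_corr (V n) w be {} a) = (%_. strong s F)" if "finite (V n)" for n
	  using e[OF that] by (auto simp: fun_eq_iff)
	have v0: "vanishing (%_ _. strong s F)" by (rule strong_vanishing[OF F])
	then show ?thesis by (rule vanishing_cong) (rule eq[symmetric])
  qed
  have "EVS n. \<forall>a. (\<forall>x. 0 <= a x) & strong s F a = 1 --> 1 <= pair_corr (V n) False be {} a"
	using eventually_finite by eventually_elim (simp add: e)
  then show ?case using v by (intro exI[of _ "{}"] conjI exI[of _ 1]) (auto simp: spins_def)
next
  case (insert e S)
  then obtain B th where B: "finite B" "!!A. (\<Prod>e\<in>S. spins e A) = spins B A"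
	"vanishing (%U w a. strong s F a * pair_corr U w be B a)" "0 < th"
	"EVS n. \<forall>a. (\<forall>x. 0 <= a x) & strong s F a = 1 --> th <= pair_corr (V n) False be B a" by auto
  have eF: "e : F" "e : IE UNIV" using insert.prems F by auto
  have fe: "finite e" using eF by (auto simp: inner_edges_def)
  have v: "vanishing (%U w a. strong s F a * pair_corr U w be (sym_diff B e) a)"
	by (rule strong_corr_step[OF F eF(1) s B(1,4,5,3)])
  define ta where "ta = sinh (be * s) / exp (be * s)"
  have ta: "0 < ta" unfolding ta_def using b s by (intro divide_pos_pos) auto
  have "EVS n. \<forall>a. (\<forall>x. 0 <= a x) & strong s F a = 1 --> th * ta <= pair_corr (V n) False be (sym_diff B e) a"
	using B(5) eventually_volume[OF fe]
  proof eventually_elim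
	case (elim n)
	have fin: "finite (V n)" and eV: "e : IE (V n)" using elim(2) eF(2) inner_edges_iff[of e "V n"] by auto
	show ?case
	proof (intro allI impI)
	  fix a :: "'d site => real" assume a: "(\<forall>x. 0 <= a x) & strong s F a = 1"
	  have K: "0 <= coupling (%_. be) a e' & finite e'" if "e' : IE (V n)" for e'
		using bonds_D[OF bonds_inner[OF fin] that] a b0 by (auto simp: coupling_def intro!: mult_nonneg_nonneg prod_nonneg)
	  have "s <= (\<Prod>x\<in>e. a x)" using a eF(1) by (auto simp: strong_def)
	  then have "be * s <= coupling (%_. be) a e" using b0 by (simp add: coupling_def mult_left_mono)
	  then have "ta <= pair_corr (V n) False be e a" unfolding ta_def pair_corr_def edges_of_def using b s
		by (auto intro!: ising_corr_lower[OF fin bonds_finite[OF bonds_inner[OF fin]] K eV])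
	  then have "th * ta <= pair_corr (V n) False be B a * pair_corr (V n) False be e a"
		using elim(1) a B(4) ta by (intro mult_mono) (auto intro: order_trans[OF less_imp_le])
	  also have "... <= pair_corr (V n) False be (sym_diff B e) a"
		unfolding pair_corr_def edges_of_def
		using ising_corr_mult[OF fin bonds_finite[OF bonds_inner[OF fin]] B(1) fe K] by simp
	  finally show "th * ta <= pair_corr (V n) False be (sym_diff B e) a" .
	qed
  qed
  moreover have "(\<Prod>e\<in>insert e S. spins e A) = spins (sym_diff B e) A" for A
	using insert.hyps B(2)[of A] spins_mult[OF B(1) fe, of A] by (simp add: mult.commute)
  moreover have "finite (sym_diff B e)" using B fe by simp
  moreover have "0 < th * ta" using B(4) ta by simp
  ultimately show ?case using v by blast
qed

end

section \<open>Equality of the limits\<close>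

context good_limits begin

lemma half_corr_pairs:
  assumes F: "finite F" "F <= IE UNIV" and s: "0 < s"
  obtains B where "!!S. S <= F ==> finite (B S)" "!!S A. S <= F ==> (\<Prod>e\<in>S. spins e A) = spins (B S) A"
	"!!S. S <= F ==> vanishing (%U w a. strong s F a * pair_corr U w be (B S) a)"
proof -
  have "\<forall>S. \<exists>B. S <= F --> finite B & (\<forall>A. (\<Prod>e\<in>S. spins e A) = spins B A) &
	  vanishing (%U w a. strong s F a * pair_corr U w be B a)"
  proof
	fix S show "\<exists>B. S <= F --> finite B & (\<forall>A. (\<Prod>e\<in>S. spins e A) = spins B A) &
	  vanishing (%U w a. strong s F a * pair_corr U w be B a)"
	proof (cases "S <= F")
	  case True
	  then have "finite S" using F(1) finite_subset by blast
	  from strong_corr_vanishing[OF F s this True] show ?thesis by blast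
	qed simp
  qed
  then obtain B where "\<forall>S. S <= F --> finite (B S) & (\<forall>A. (\<Prod>e\<in>S. spins e A) = spins (B S) A) &
	  vanishing (%U w a. strong s F a * pair_corr U w be (B S) a)" by (rule choice[THEN exE])
  then show ?thesis by (intro that[of B]) blast+
qed

lemma half_corr_facts:
  assumes F: "finite F" "F <= IE UNIV"
  shows "finite U ==> admits U (%w. half_corr U w be F)"
	"finite U ==> 0 <= half_corr U w be F a & half_corr U w be F a <= 1"
	"finite U ==> \<forall>x. 0 <= a x & a x <= a' x ==> half_corr U False be F a <= half_corr U True be F a'"
	"0 < s ==> vanishing (%U w a. strong s F a * half_corr U w be F a)"
proof -
  obtain B where B: "!!S. S <= F ==> finite (B S)" "!!S A. S <= F ==> (\<Prod>e\<in>S. spins e A) = spins (B S) A"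
	using half_corr_pairs[OF F zero_less_one] by metis
  have hx: "half_corr U w be F a = (1 / 2 ^ card F) * (\<Sum>S\<in>Pow F. pair_corr U w be (B S) a)" if "finite U" for U w a
	by (rule half_corr_expand[OF F(1) that]) (rule B(2))
  show bd: "0 <= half_corr U w be F a & half_corr U w be F a <= 1" if "finite U"
	using ising_corr_half[OF that] by (simp add: half_corr_def)
  show "half_corr U False be F a <= half_corr U True be F a'" if "finite U" "\<forall>x. 0 <= a x & a x <= a' x"
	unfolding hx[OF that(1)] by (intro mult_left_mono sum_mono pair_corr_mono that b0 B) auto
  show "admits U (%w. half_corr U w be F)" if fin: "finite U"
  proof -
	have "nice (region U w) (%a. (1 / 2 ^ card F) * (\<Sum>S\<in>Pow F. pair_corr U w be (B S) a))" for w
	  using pair_corr_admits[OF fin b0 B(1)] by (intro nice_cmult nice_sum) (auto simp: admits_def)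
	then show ?thesis unfolding admits_def using fin by (simp add: hx[OF fin, abs_def])
  qed
  show "vanishing (%U w a. strong s F a * half_corr U w be F a)" if s: "0 < s"
  proof (rule half_corr_pairs[OF F s])
	fix C
	assume C: "!!S. S <= F ==> finite (C S)" "!!S A. S <= F ==> (\<Prod>e\<in>S. spins e A) = spins (C S) A"
	  "!!S. S <= F ==> vanishing (%U w a. strong s F a * pair_corr U w be (C S) a)"
	have "vanishing (%U w a. (1 / 2 ^ card F) * (\<Sum>S\<in>Pow F. strong s F a * pair_corr U w be (C S) a))"
	  using F(1) C(3) by (intro vanishing_cmult vanishing_sum) auto
	then show ?thesis
	proof (rule vanishing_cong)
	  fix n assume fin: "finite (V n)"
	  have "half_corr (V n) w be F a = (1 / 2 ^ card F) * (\<Sum>S\<in>Pow F. pair_corr (V n) w be (C S) a)" for w a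
		by (rule half_corr_expand[OF F(1) fin]) (rule C(2))
	  then show "(%w a. (1 / 2 ^ card F) * (\<Sum>S\<in>Pow F. strong s F a * pair_corr (V n) w be (C S) a)) =
		  (%w a. strong s F a * half_corr (V n) w be F a)"
		by (simp add: fun_eq_iff sum_distrib_left mult.left_commute)
	qed
  qed
qed

lemma grows_mult:
  assumes "grows (%_. ph)" "grows f" shows "grows (%w a. ph a * f w (a :: 'd site => real))"
  unfolding grows_def
proof (intro allI impI conjI)
  fix a a' :: "'d site => real" assume ab: "\<forall>x. 0 <= a x & a x <= a' x"
  show "0 <= ph a * f False a" using growsD[OF assms(1) ab] growsD[OF assms(2) ab] by simp
  show "ph a * f False a <= ph a' * f True a'" using growsD[OF assms(1) ab] growsD[OF assms(2) ab] by (intro mult_mono) auto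
qed

text \<open>For \<open>u\<close> and \<open>v\<close> increasing with values in \<open>[0,1]\<close> the function \<open>u + v - u * v = 1 - (1 - u) * (1 - v)\<close> is increasing, which handles the product of edge probabilities and correlations on strong edges. Weak edges contribute at most \<open>2 * be * s\<close>, and \<open>s\<close> is arbitrary.\<close>
lemma event_probabilities_agree:
  assumes F: "finite F" "F <= IE UNIV" and S: "finite S"
  shows "measure (rc_marginal F S \<Psi>0) (PiE F (%_. {True}) \<times> up S S t) = measure (rc_marginal F S \<Psi>1) (PiE F (%_. {True}) \<times> up S S t)"
	(is "?m0 = ?m1")
proof -
  define ph :: "('d site => real) => real" where "ph a = exceeds t S a * (\<Prod>e\<in>F. edge_probability be a e)" for a
  define Q where "Q = (%U w a. ph a * half_corr U w be F a)"
  have fF: "finite (S Un \<Union>F)" using F S by (auto simp: inner_edges_def)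
  have p: "0 <= edge_probability be a e" "edge_probability be a e <= 1" if "\<forall>x. 0 <= a x" for a and e :: "'d edge"
	using edge_probability_nonneg[OF b0, of e a] edge_probability_lt_1[of be a e] that by auto
  have phi01: "0 <= ph a & ph a <= 1" if "\<forall>x. 0 <= a x" for a
  proof -
	have "0 <= (\<Prod>e\<in>F. edge_probability be a e)" "(\<Prod>e\<in>F. edge_probability be a e) <= 1"
	  using p[OF that] by (auto intro: prod_nonneg prod_le_1)
	then show ?thesis by (simp add: ph_def exceeds_def)
  qed
  have pm: "edge_probability be a e <= edge_probability be a' e" if "\<forall>x. 0 <= a x & a x <= a' x" for a a' and e :: "'d edge"
  proof -
	have "(\<Prod>x\<in>e. a x) <= (\<Prod>x\<in>e. a' x)" using that by (intro prod_mono) auto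
	then have "2 * be * (\<Prod>x\<in>e. a x) <= 2 * be * (\<Prod>x\<in>e. a' x)" using b0 by (intro mult_left_mono) auto
	then show ?thesis by (simp add: edge_probability_def)
  qed
  have phig: "grows (%_. ph)"
	unfolding grows_def
  proof (intro allI impI conjI)
	fix a a' :: "'d site => real" assume ab: "\<forall>x. 0 <= a x & a x <= a' x"
	then have a: "\<forall>x. 0 <= a x" by blast
	show "0 <= ph a" using phi01[OF a] by simp
	show "ph a <= ph a'" unfolding ph_def
	  using growsD[OF exceeds_grows[of t S] ab] p(1)[OF a] pm[OF ab] by (intro mult_mono prod_mono prod_nonneg) auto
  qed
  have phim: "ph : bm FA"
	unfolding ph_def using exceeds_measurable[OF S, of t] by measurable
  have phid: "depends_on (S Un \<Union>F) ph"
  proof (rule depends_onI)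
	fix a a' :: "'d site => real" assume eq: "!!x. x : S Un \<Union>F ==> a x = a' x"
	have "edge_probability be a e = edge_probability be a' e" if "e : F" for e
	proof -
	  have "(\<Prod>x\<in>e. a x) = (\<Prod>x\<in>e. a' x)" using eq that by (intro prod.cong) auto
	  then show ?thesis by (simp add: edge_probability_def)
	qed
	moreover have "exceeds t S a = exceeds t S a'" by (rule depends_onD[OF exceeds_depends]) (use eq in auto)
	ultimately show "ph a = ph a'" by (simp add: ph_def)
  qed
  have phiv: "vanishing (%_ _. ph)" by (rule local_vanishing[OF fF phim phid phi01])
  have pha: "EVS n. admits (V n) (%_. ph)" using phiv by (simp add: vanishing_def)
  note hc = half_corr_facts[OF F]
  have hg: "grows (%w. half_corr U w be F)" if "finite U" for U
	unfolding grows_def using hc(2,3)[OF that] by blast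
  have Qa: "EVS n. admits (V n) (Q (V n))"
	using pha eventually_finite unfolding Q_def by eventually_elim (intro admits_mult hc(1))
  have us: "up S S t : sets (PiM S (%_. nnb))" by (rule up_sets[OF S order_refl])
  have lim: "(%n. G (V n) (Q (V n))) ~~> ?m1 - ?m0"
  proof (rule Lim_transform_eventually)
	show "(%n. G (V n) (%w. rc_obs (V n) (edges_of (V n) w) be F S (up S S t))) ~~> ?m1 - ?m0"
	  unfolding gap_def edges_of_def using tendsto_diff[OF event_limit(2)[OF F S us] event_limit(1)[OF F S us]] by simp
	show "EVS n. G (V n) (%w. rc_obs (V n) (edges_of (V n) w) be F S (up S S t)) = G (V n) (Q (V n))"
	  using eventually_finite
	proof eventually_elim
	  case (elim n)
	  show ?case
	  proof (rule gap_cong[OF rg k b0 elim])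
		fix w and a :: "'d site => real" assume a: "\<forall>x. 0 <= a x"
		show "rc_obs (V n) (edges_of (V n) w) be F S (up S S t) a = Q (V n) w a"
		  using ind_up[OF order_refl a, of S t] by (simp add: rc_obs_def Q_def ph_def half_corr_def ind_def)
	  qed
	qed
  qed
  have ge: "0 <= ?m1 - ?m0"
  proof (rule tendsto_lowerbound[OF lim])
	show "EVS n. 0 <= G (V n) (Q (V n))"
	  using Qa eventually_finite
	  by eventually_elim (rule gap_nonneg[OF rg k b0], assumption, unfold Q_def, rule grows_mult[OF phig hg])
  qed simp
  have le: "?m1 - ?m0 <= 2 * be * s" if s: "0 < s" for s
  proof -
	let ?\<chi> = "strong s F"
	let ?Y = "%U w a. ?\<chi> a * half_corr U w be F a"
	have vY: "vanishing ?Y" by (rule hc(4)[OF s])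
	have Y01: "0 <= ?Y U w a & ?Y U w a <= 1" if "finite U" for U w a
	  using hc(2)[OF that, of w a] strong_cases[of s F a] by auto
	have gY: "grows (?Y U)" if "finite U" for U
	proof (rule grows_mult[OF _ hg[OF that]])
	  show "grows (%_. strong s F)" unfolding grows_def using strong_mono[of _ _ s F] by (auto simp: strong_def)
	qed
	have vphiY: "vanishing (%U w a. ph a * ?Y U w a)"
	proof (rule vanishing_dominated[OF _ vanishing_add[OF phiv vY]])
	  show "EVS n. admits (V n) (%w a. ph a * ?Y (V n) w a)"
		using pha vY[unfolded vanishing_def, THEN conjunct1] by eventually_elim (rule admits_mult)
	  show "EVS n. grows (%w a. ph a * ?Y (V n) w a) & grows (%w a. ph a + ?Y (V n) w a - ph a * ?Y (V n) w a)"
		using eventually_finite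
	  proof eventually_elim
		case (elim n)
		have "grows (%w a. ph a + ?Y (V n) w a - ph a * ?Y (V n) w a)"
		  unfolding grows_def
		proof (intro allI impI)
		  fix a a' :: "'d site => real" assume ab: "\<forall>x. 0 <= a x & a x <= a' x"
		  then have a: "\<forall>x. 0 <= a x" "\<forall>x. 0 <= a' x" by (auto intro: order_trans)
		  define u where "u = ph a" define u' where "u' = ph a'"
		  define y where "y = ?Y (V n) False a" define y' where "y' = ?Y (V n) True a'"
		  have Y1: "?Y (V n) True a' <= 1" by (rule conjunct2[OF Y01[OF elim]])
		  have *: "0 <= u" "u <= u'" "u' <= 1" "0 <= y" "y <= y'" "y' <= 1"
			using growsD[OF phig ab] growsD[OF gY[OF elim] ab] phi01[OF a(2)] Y1 by (auto simp: u_def u'_def y_def y'_def)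
		  have "(1 - u') * (1 - y') <= (1 - u) * (1 - y)" using * by (intro mult_mono) auto
		  moreover have "(1 - u) * (1 - y) <= 1 * 1" using * by (intro mult_mono) auto
		  ultimately have "0 <= u + y - u * y & u + y - u * y <= u' + y' - u' * y'" by (simp add: algebra_simps)
		  then show "0 <= ph a + ?Y (V n) False a - ph a * ?Y (V n) False a &
			ph a + ?Y (V n) False a - ph a * ?Y (V n) False a <= ph a' + ?Y (V n) True a' - ph a' * ?Y (V n) True a'"
			unfolding u_def u'_def y_def y'_def .
		qed
		then show ?case using grows_mult[OF phig gY[OF elim]] by blast
	  qed
	qed
	have small: "ph a * half_corr U w be F a <= ph a * ?Y U w a + 2 * be * s" if fin: "finite U" and a: "\<forall>x. 0 <= a x" for U w a
	proof (cases "?\<chi> a = 1")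
	  case True
	  then show ?thesis using b0 s by simp
	next
	  case False
	  then obtain e where e: "e : F" "(\<Prod>x\<in>e. a x) < s" by (auto simp: strong_def not_le)
	  have "1 + (- 2 * be * (\<Prod>x\<in>e. a x)) <= exp (- 2 * be * (\<Prod>x\<in>e. a x))" by (rule exp_ge_add_one_self)
	  moreover have "be * (\<Prod>x\<in>e. a x) <= be * s" using e b0 by (intro mult_left_mono) auto
	  ultimately have pe: "edge_probability be a e <= 2 * be * s" unfolding edge_probability_def by linarith
	  have rest: "0 <= (\<Prod>e\<in>F - {e}. edge_probability be a e)" "(\<Prod>e\<in>F - {e}. edge_probability be a e) <= 1"
		using p[OF a] by (auto intro: prod_nonneg prod_le_1)
	  have "(\<Prod>e\<in>F. edge_probability be a e) = edge_probability be a e * (\<Prod>e\<in>F - {e}. edge_probability be a e)"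
		by (rule prod.remove[OF F(1) e(1)])
	  also have "... <= edge_probability be a e" using rest p(1)[OF a, of e] by (simp add: mult_left_le)
	  finally have "ph a <= 2 * be * s" using pe b0 s by (simp add: ph_def exceeds_def)
	  then have "ph a * half_corr U w be F a <= 2 * be * s"
		using hc(2)[OF fin, of w a] phi01[OF a] mult_left_le[of "half_corr U w be F a" "ph a"] by linarith
	  moreover have "0 <= ?Y U w a" by (rule conjunct1[OF Y01[OF fin]])
	  ultimately show ?thesis using phi01[OF a] mult_nonneg_nonneg[of "ph a" "?Y U w a"] by linarith
	qed
	have "EVS n. G (V n) (Q (V n)) <= G (V n) (%w a. ph a * ?Y (V n) w a) + 2 * be * s"
	  using Qa vphiY[unfolded vanishing_def, THEN conjunct1] eventually_finite
	proof eventually_elim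
	  case (elim n)
	  show ?case
	  proof (rule gap_le[OF rg k b0 elim(1,2)])
		fix a :: "'d site => real" assume a: "\<forall>x. 0 <= a x"
		show "Q (V n) True a <= ph a * ?Y (V n) True a + 2 * be * s" unfolding Q_def by (rule small[OF elim(3) a])
		have "?Y (V n) False a <= half_corr (V n) False be F a"
		  using hc(2)[OF elim(3), of False a] strong_cases[of s F a] by auto
		then show "ph a * ?Y (V n) False a <= Q (V n) False a" unfolding Q_def using phi01[OF a] by (intro mult_left_mono) auto
	  qed
	qed
	moreover have "(%n. G (V n) (%w a. ph a * ?Y (V n) w a) + 2 * be * s) ~~> 0 + 2 * be * s"
	  using vphiY by (intro tendsto_add tendsto_const) (simp add: vanishing_def)
	ultimately show ?thesis using tendsto_le[OF sequentially_bot _ lim] by fastforce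
  qed
  have "?m1 - ?m0 <= 0"
  proof (rule field_le_epsilon)
	fix ep :: real assume "0 < ep"
	then show "?m1 - ?m0 <= 0 + ep" using le[of "ep / (2 * be)"] b by simp
  qed
  then show ?thesis using ge by simp
qed

theorem limits_agree: "\<Psi>0 = \<Psi>1"
proof -
  let ?I = "IE UNIV :: 'd edge set"
  have s: "sets \<Psi>0 = sets (rc_algebra ?I UNIV)" "sets \<Psi>1 = sets (rc_algebra ?I UNIV)"
	and p: "prob_space \<Psi>0" "prob_space \<Psi>1" using L0 L1 by (auto simp: is_local_limit_def)
  have c: "measure \<Psi> (corner ?I UNIV F S t) = measure (rc_marginal F S \<Psi>) (PiE F (%_. {True}) \<times> up S S t)"
	if F: "finite F" "F <= ?I" and S: "finite S" and sP: "sets \<Psi> = sets (rc_algebra ?I UNIV)" for F S t and \<Psi> :: "'d rc_config measure"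
  proof -
	let ?f = "%(om, a). (restrict om F, restrict a S)" and ?A = "PiE F (%_. {True}) \<times> up S S t"
	have m: "?f : measurable \<Psi> (rc_algebra F S)"
	  using marginal_measurable[OF F(2) subset_UNIV[of S]] measurable_cong_sets[OF sP refl] by blast
	have "PiE F (%_. {True}) : sets (PiM F (%_. count_space UNIV))" by (rule sets_PiM_I_finite[OF F(1)]) auto
	then have A: "?A : sets (rc_algebra F S)" using up_sets[OF S order_refl] by (intro pair_measureI) auto
	have sp: "space \<Psi> = space (rc_algebra ?I UNIV)" by (rule sets_eq_imp_space_eq[OF sP])
	have rt: "restrict om F = restrict (%_. True) F \<longleftrightarrow> (\<forall>x\<in>F. om x)" for om by (auto simp: fun_eq_iff restrict_def)
	have "?f -` ?A Int space \<Psi> = corner ?I UNIV F S t"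
	  unfolding sp corner_def
	  by (auto simp: rt up_def space_pair_measure space_PiM space_nonneg_borel PiE_iff split: if_splits)
	then show ?thesis unfolding rc_marginal_def using measure_distr[OF m A] by simp
  qed
  show ?thesis
  proof (rule measure_eqI_corners[OF p(1) s(1) p(2) s(2)])
	fix F and S :: "'d site set" and t assume F: "finite F" "F <= ?I" and S: "finite S"
	show "measure \<Psi>0 (corner ?I UNIV F S t) = measure \<Psi>1 (corner ?I UNIV F S t)"
	  unfolding c[OF F S s(1)] c[OF F S s(2)] by (rule event_probabilities_agree[OF F S])
  qed
qed

end

theorem theorem1p7:
  fixes \<rho> :: "real measure"
    and \<Psi>\<^sub>0 \<Psi>\<^sub>1 :: "real \<Rightarrow> 'd::finite rc_config measure"
  assumes dim: "CARD('d) \<ge> 2"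
    and adm: "admissible \<rho>"
    and free: "\<And>\<beta>. \<beta> \<ge> 0 \<Longrightarrow> free_rc_limit \<rho> \<beta> (\<Psi>\<^sub>0 \<beta>)"
    and wired: "\<And>\<beta>. \<beta> \<ge> 0 \<Longrightarrow> wired_rc_limit \<rho> \<beta> (\<Psi>\<^sub>1 \<beta>)"
  shows "countable {\<beta>. \<beta> \<ge> 0 \<and> \<Psi>\<^sub>0 \<beta> \<noteq> \<Psi>\<^sub>1 \<beta>}"
proof -
  have laws: "\<exists>\<beta>\<^sub>0 \<zeta>. \<beta> \<le> \<beta>\<^sub>0 \<and> wired_boundary_law TYPE('d) \<rho> \<beta>\<^sub>0 \<zeta>" if "0 \<le> \<beta>" for \<beta>
    using wired[OF that] unfolding wired_rc_limit_def by blast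
  define H where "H \<beta> = energy TYPE('d) \<rho> (max 0 \<beta>)" for \<beta>
  have "mono H" unfolding H_def by (intro monoI energy_mono[OF adm laws]) auto
  then have cd: "countable {\<beta>. \<not> isCont H \<beta>}" by (rule mono_ctble_discont)
  have agree: "\<Psi>\<^sub>0 \<beta> = \<Psi>\<^sub>1 \<beta>" if b: "0 < \<beta>" and H: "isCont H \<beta>" for \<beta>
  proof -
    have b0: "0 \<le> \<beta>" using b by simp
    obtain \<beta>\<^sub>0 \<zeta> where z: "\<beta> \<le> \<beta>\<^sub>0" "wired_boundary_law TYPE('d) \<rho> \<beta>\<^sub>0 \<zeta>" "is_local_limit (wired_rc \<rho> \<beta> \<zeta>) (\<Psi>\<^sub>1 \<beta>)"
      using wired[OF b0] unfolding wired_rc_limit_def by blast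
    have k: "good_law \<zeta>" by (rule good_law_wired_boundary[OF good_law_admissible[OF adm] z(2) b0 z(1)])
    have cont: "\<exists>\<beta>'>\<beta>. energy TYPE('d) \<rho> \<beta>' \<le> energy TYPE('d) \<rho> \<beta> + \<eta>" if "0 < \<eta>" for \<eta>
    proof -
      obtain d where d: "0 < d" "\<And>x. dist x \<beta> < d \<Longrightarrow> dist (H x) (H \<beta>) < \<eta>"
        using H \<open>0 < \<eta>\<close> unfolding continuous_at_eps_delta by blast
      have "dist (H (\<beta> + d / 2)) (H \<beta>) < \<eta>" using d by (simp add: dist_real_def)
      then have "energy TYPE('d) \<rho> (\<beta> + d / 2) \<le> energy TYPE('d) \<rho> \<beta> + \<eta>"
        using b d(1) by (simp add: H_def dist_real_def max_def)
      then show ?thesis using d(1) by (intro exI[of _ "\<beta> + d / 2"]) simp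
    qed
    obtain V :: "nat \<Rightarrow> 'd site set" where V: "filterlim V (finite_subsets_at_top UNIV) sequentially"
      "\<And>e. e \<in> inner_edges UNIV \<Longrightarrow> (\<lambda>n. energy_gap \<rho> \<zeta> \<beta> (V n) e) \<longlonglongrightarrow> 0"
      using good_volumes[OF adm laws b0 k cont] by blast
    have "good_limits \<rho> \<zeta> \<beta> V (\<Psi>\<^sub>0 \<beta>) (\<Psi>\<^sub>1 \<beta>)"
      using adm k b V free[OF b0] z(3) by (intro good_limits.intro) (auto simp: free_rc_limit_def)
    then show ?thesis by (rule good_limits.limits_agree)
  qed
  have "{\<beta>. \<beta> \<ge> 0 \<and> \<Psi>\<^sub>0 \<beta> \<noteq> \<Psi>\<^sub>1 \<beta>} \<subseteq> insert 0 {\<beta>. \<not> isCont H \<beta>}"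
    using agree by (auto simp: le_less)
  then show ?thesis using cd by (meson countable_insert countable_subset)
qed

end
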